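(* Let $T$ be a complete first-order theory, $\mathfrak{C}$ a monster model, $\bar c$ an enumeration of $\mathfrak{C}$, $\mathcal{M}$ a minimal left ideal of $\mathrm{EL}(S_{\bar c}(\mathfrak{C}))$ and $u\in\mathcal{M}$ an idempotent. Consider the conditions: (A'') $\mathrm{Gal}_{KP}(T)$ is profinite; (A') $u\mathcal{M}/H(u\mathcal{M})$ is profinite; (A) $u\mathcal{M}$ (with the $\tau$-topology) is profinite; (B) the $\mathrm{Aut}(\mathfrak{C})$-flow $S_{\bar c}(\mathfrak{C})$ is isomorphic to an inverse limit $\varprojlim_{i\in I}X_i$ of $\mathrm{Aut}(\mathfrak{C})$-flows $X_i$ (with $\mathrm{Aut}(\mathfrak{C})$-flow epimorphisms as bonding maps) each of which has finite Ellis group; (C) for every finite set of formulae $\Delta$ and finite set of types $\bar p\subseteq S(\emptyset)$, the Ellis group of the flow $(\mathrm{Aut}(\mathfrak{C}),S_{\bar c,\Delta}(\bar p))$ is finite; (D) for every finite set of formulae $\Delta$ and finite set of types $\bar p\subseteq S(\emptyset)$, there exists $\eta\in\mathrm{EL}(S_{\bar c,\Delta}(\bar p))$ with $\mathrm{Im}(\eta)$ finite. Then (D) $\Rightarrow$ (C) $\Leftrightarrow$ (B) $\Rightarrow$ (A) $\Rightarrow$ (A') $\Rightarrow$ (A'').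
   Context: $S_{\bar c}(\mathfrak{C})$ is the space of global types extending $\mathrm{tp}(\bar c/\emptyset)$, an $\mathrm{Aut}(\mathfrak{C})$-flow. For a topological group $G$ acting continuously on a compact Hausdorff space $X$ (a $G$-flow), $\mathrm{EL}(X)$ is the closure in $X^X$ (product topology) of the maps $x\mapsto gx$, a semigroup under composition. For a minimal left ideal $\mathcal{M}$ and an idempotent $u\in\mathcal{M}$, $u\mathcal{M}$ is a group; its isomorphism type (also as a semitopological group with the $\tau$-topology) is independent of the choices and is called the Ellis group of the flow. The $\tau$-topology on $u\mathcal{M}$: for $a\in\mathrm{EL}(X)$ and $B\subseteq\mathrm{EL}(X)$, $a\circ B$ is the set of limits of nets $(g_ib_i)$ with $g_i\in G$, $g_i\to a$, $b_i\in B$; the closure operator $\mathrm{cl}_\tau(B)=u\mathcal{M}\cap(u\circ B)$ for $B\subseteq u\mathcal{M}$ defines it. $H(u\mathcal{M})=\bigcap_U\mathrm{cl}_\tau(U)$ over $\tau$-open neighbourhoods $U$ of $u$; it is a normal subgroup and $u\mathcal{M}/H(u\mathcal{M})$ with the quotient topology is a compact Hausdorff group. $\mathrm{Gal}_{KP}(T)$ is the Kim–Pillay Galois group $\mathrm{Aut}(\mathfrak{C})/\mathrm{Autf}_{KP}(\mathfrak{C})$ with its standard compact Hausdorff (logic) topology. For finite $\Delta=\{\varphi_i(\bar x,\bar y)\}$ ($\bar x$ for $\bar c$, $\bar y$ finite) and finite $\bar p\subseteq S_{\bar y}(\emptyset)$, $S_{\bar c,\Delta}(\bar p)$ is the $\mathrm{Aut}(\mathfrak{C})$-flow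 of complete $\Delta$-types over $\bigcup_{p\in\bar p}p(\mathfrak{C})$ consistent with $\mathrm{tp}(\bar c)$. *)

theory Defs
  imports "HOL-Analysis.Analysis" "HOL-Algebra.Group_Action"
begin

unbundle cardinal_syntax

section \<open>Topological groups\<close>

definition topological_group :: "('g, 'b) monoid_scheme \<Rightarrow> 'g topology \<Rightarrow> bool" where
  "topological_group G \<tau> \<longleftrightarrow>
     group G \<and> topspace \<tau> = carrier G \<and>
     continuous_map (prod_topology \<tau> \<tau>) \<tau> (\<lambda>(x, y). x \<otimes>\<^bsub>G\<^esub> y) \<and>
     continuous_map \<tau> \<tau> (\<lambda>x. inv\<^bsub>G\<^esub> x)"

definition totally_disconnected :: "'a topology \<Rightarrow> bool" where
  "totally_disconnected X \<longleftrightarrow> (\<forall>x \<in> topspace X. connected_component_of_set X x = {x})"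

definition profinite_group :: "('g, 'b) monoid_scheme \<Rightarrow> 'g topology \<Rightarrow> bool" where
  "profinite_group G \<tau> \<longleftrightarrow>
     topological_group G \<tau> \<and> compact_space \<tau> \<and> Hausdorff_space \<tau> \<and> totally_disconnected \<tau>"

definition quotient_topology :: "'a topology \<Rightarrow> ('a \<Rightarrow> 'b) \<Rightarrow> 'b topology" where
  "quotient_topology X f =
     topology (\<lambda>U. U \<subseteq> f ` topspace X \<and> openin X {x \<in> topspace X. f x \<in> U})"

lemma openin_quotient_topology:
  "openin (quotient_topology X f) U \<longleftrightarrow>
     U \<subseteq> f ` topspace X \<and> openin X {x \<in> topspace X. f x \<in> U}"
proof -
  have "istopology (\<lambda>U. U \<subseteq> f ` topspace X \<and> openin X {x \<in> topspace X. f x \<in> U})"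
    unfolding istopology_def
  proof (intro conjI allI impI)
    fix S T
    assume S: "S \<subseteq> f ` topspace X \<and> openin X {x \<in> topspace X. f x \<in> S}"
      and T: "T \<subseteq> f ` topspace X \<and> openin X {x \<in> topspace X. f x \<in> T}"
    show "S \<inter> T \<subseteq> f ` topspace X" using S by blast
    have "{x \<in> topspace X. f x \<in> S \<inter> T} =
        {x \<in> topspace X. f x \<in> S} \<inter> {x \<in> topspace X. f x \<in> T}" by blast
    then show "openin X {x \<in> topspace X. f x \<in> S \<inter> T}" using S T by auto
  next
    fix K
    assume K: "\<forall>U\<in>K. U \<subseteq> f ` topspace X \<and> openin X {x \<in> topspace X. f x \<in> U}"
    show "\<Union>K \<subseteq> f ` topspace X" using K by blast
    have "{x \<in> topspace X. f x \<in> \<Union>K} = (\<Union>U\<in>K. {x \<in> topspace X. f x \<in> U})" by blast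
    then show "openin X {x \<in> topspace X. f x \<in> \<Union>K}" using K by auto
  qed
  then show ?thesis
    by (simp add: quotient_topology_def topology_inverse')
qed


section \<open>Flows and Ellis groups\<close>

definition flow ::
  "('g, 'b) monoid_scheme \<Rightarrow> 'g topology \<Rightarrow> 'x topology \<Rightarrow> ('g \<Rightarrow> 'x \<Rightarrow> 'x) \<Rightarrow> bool" where
  "flow G \<tau> X act \<longleftrightarrow>
     topological_group G \<tau> \<and> compact_space X \<and> Hausdorff_space X \<and>
     group_action G (topspace X) act \<and>
     continuous_map (prod_topology \<tau> X) X (\<lambda>(g, x). act g x)"

definition flow_epi ::
  "('g, 'b) monoid_scheme \<Rightarrow> 'x topology \<Rightarrow> ('g \<Rightarrow> 'x \<Rightarrow> 'x) \<Rightarrow>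
   'y topology \<Rightarrow> ('g \<Rightarrow> 'y \<Rightarrow> 'y) \<Rightarrow> ('x \<Rightarrow> 'y) \<Rightarrow> bool" where
  "flow_epi G X actX Y actY f \<longleftrightarrow>
     continuous_map X Y f \<and> f ` topspace X = topspace Y \<and>
     (\<forall>g \<in> carrier G. \<forall>x \<in> topspace X. f (actX g x) = actY g (f x))"

definition flow_isomorphic ::
  "('g, 'b) monoid_scheme \<Rightarrow> 'x topology \<Rightarrow> ('g \<Rightarrow> 'x \<Rightarrow> 'x) \<Rightarrow>
   'y topology \<Rightarrow> ('g \<Rightarrow> 'y \<Rightarrow> 'y) \<Rightarrow> bool" where
  "flow_isomorphic G X actX Y actY \<longleftrightarrow>
     (\<exists>h. homeomorphic_map X Y h \<and>
          (\<forall>g \<in> carrier G. \<forall>x \<in> topspace X. h (actX g x) = actY g (h x)))"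

text \<open>The map from \<open>X j\<close> to \<open>X i\<close>, for \<open>i \<leq> j\<close>, is \<open>\<pi> i j\<close>.\<close>

definition inverse_system_of_flows ::
  "('g, 'b) monoid_scheme \<Rightarrow> 'g topology \<Rightarrow> 'j set \<Rightarrow> ('j \<Rightarrow> 'j \<Rightarrow> bool) \<Rightarrow>
   ('j \<Rightarrow> 'x topology) \<Rightarrow> ('j \<Rightarrow> 'g \<Rightarrow> 'x \<Rightarrow> 'x) \<Rightarrow> ('j \<Rightarrow> 'j \<Rightarrow> 'x \<Rightarrow> 'x) \<Rightarrow> bool" where
  "inverse_system_of_flows G \<tau> I leq X act \<pi> \<longleftrightarrow>
     I \<noteq> {} \<and>
     (\<forall>i\<in>I. leq i i) \<and>
     (\<forall>i\<in>I. \<forall>j\<in>I. leq i j \<and> leq j i \<longrightarrow> i = j) \<and>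
     (\<forall>i\<in>I. \<forall>j\<in>I. \<forall>k\<in>I. leq i j \<and> leq j k \<longrightarrow> leq i k) \<and>
     (\<forall>i\<in>I. \<forall>j\<in>I. \<exists>k\<in>I. leq i k \<and> leq j k) \<and>
     (\<forall>i\<in>I. flow G \<tau> (X i) (act i)) \<and>
     (\<forall>i\<in>I. \<forall>j\<in>I. leq i j \<longrightarrow> flow_epi G (X j) (act j) (X i) (act i) (\<pi> i j)) \<and>
     (\<forall>i\<in>I. \<forall>x \<in> topspace (X i). \<pi> i i x = x) \<and>
     (\<forall>i\<in>I. \<forall>j\<in>I. \<forall>k\<in>I. leq i j \<and> leq j k \<longrightarrow>
        (\<forall>x \<in> topspace (X k). \<pi> i j (\<pi> j k x) = \<pi> i k x))"

definition inverse_limit ::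
  "'j set \<Rightarrow> ('j \<Rightarrow> 'j \<Rightarrow> bool) \<Rightarrow> ('j \<Rightarrow> 'x topology) \<Rightarrow> ('j \<Rightarrow> 'j \<Rightarrow> 'x \<Rightarrow> 'x) \<Rightarrow>
   ('j \<Rightarrow> 'x) topology" where
  "inverse_limit I leq X \<pi> =
     subtopology (product_topology X I) {x. \<forall>i\<in>I. \<forall>j\<in>I. leq i j \<longrightarrow> \<pi> i j (x j) = x i}"

definition inverse_limit_act ::
  "'j set \<Rightarrow> ('j \<Rightarrow> 'j \<Rightarrow> bool) \<Rightarrow> ('j \<Rightarrow> 'x topology) \<Rightarrow> ('j \<Rightarrow> 'g \<Rightarrow> 'x \<Rightarrow> 'x) \<Rightarrow>
   ('j \<Rightarrow> 'j \<Rightarrow> 'x \<Rightarrow> 'x) \<Rightarrow> 'g \<Rightarrow> ('j \<Rightarrow> 'x) \<Rightarrow> 'j \<Rightarrow> 'x" where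
  "inverse_limit_act I leq X act \<pi> g =
     (\<lambda>x \<in> topspace (inverse_limit I leq X \<pi>). \<lambda>i\<in>I. act i g (x i))"

text \<open>\<open>X\<^sup>X\<close> is the product topology on the extensional self-maps of \<open>topspace X\<close>; composition
  is accordingly \<^const>\<open>compose\<close> relative to \<open>topspace X\<close>.\<close>

abbreviation self_maps :: "'x topology \<Rightarrow> ('x \<Rightarrow> 'x) topology" where
  "self_maps X \<equiv> product_topology (\<lambda>_. X) (topspace X)"

definition EL :: "('g, 'b) monoid_scheme \<Rightarrow> 'x topology \<Rightarrow> ('g \<Rightarrow> 'x \<Rightarrow> 'x) \<Rightarrow> ('x \<Rightarrow> 'x) set" where
  "EL G X act = self_maps X closure_of (act ` carrier G)"

definition left_ideal ::
  "('g, 'b) monoid_scheme \<Rightarrow> 'x topology \<Rightarrow> ('g \<Rightarrow> 'x \<Rightarrow> 'x) \<Rightarrow> ('x \<Rightarrow> 'x) set \<Rightarrow> bool" where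
  "left_ideal G X act M \<longleftrightarrow>
     M \<noteq> {} \<and> M \<subseteq> EL G X act \<and>
     (\<forall>f \<in> EL G X act. \<forall>m \<in> M. compose (topspace X) f m \<in> M)"

definition minimal_left_ideal ::
  "('g, 'b) monoid_scheme \<Rightarrow> 'x topology \<Rightarrow> ('g \<Rightarrow> 'x \<Rightarrow> 'x) \<Rightarrow> ('x \<Rightarrow> 'x) set \<Rightarrow> bool" where
  "minimal_left_ideal G X act M \<longleftrightarrow>
     left_ideal G X act M \<and> (\<forall>N. left_ideal G X act N \<and> N \<subseteq> M \<longrightarrow> N = M)"

definition ellis_idempotent :: "'x topology \<Rightarrow> ('x \<Rightarrow> 'x) \<Rightarrow> bool" where
  "ellis_idempotent X u \<longleftrightarrow> compose (topspace X) u u = u"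

definition ellis_group :: "'x topology \<Rightarrow> ('x \<Rightarrow> 'x) set \<Rightarrow> ('x \<Rightarrow> 'x) \<Rightarrow> ('x \<Rightarrow> 'x) monoid" where
  "ellis_group X M u =
     \<lparr>carrier = compose (topspace X) u ` M, mult = compose (topspace X), one = u\<rparr>"

definition finite_ellis_group ::
  "('g, 'b) monoid_scheme \<Rightarrow> 'x topology \<Rightarrow> ('g \<Rightarrow> 'x \<Rightarrow> 'x) \<Rightarrow> bool" where
  "finite_ellis_group G X act \<longleftrightarrow>
     (\<forall>M u. minimal_left_ideal G X act M \<and> u \<in> M \<and> ellis_idempotent X u \<longrightarrow>
        finite (carrier (ellis_group X M u)))"

text \<open>The nets \<open>(g\<^sub>i, b\<^sub>i)\<close> are rendered by proper filters on pairs.\<close>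

definition ellis_circ ::
  "('g, 'b) monoid_scheme \<Rightarrow> 'x topology \<Rightarrow> ('g \<Rightarrow> 'x \<Rightarrow> 'x) \<Rightarrow>
   ('x \<Rightarrow> 'x) \<Rightarrow> ('x \<Rightarrow> 'x) set \<Rightarrow> ('x \<Rightarrow> 'x) set" where
  "ellis_circ G X act a B =
     {f. \<exists>F. F \<noteq> bot \<and> eventually (\<lambda>(g, b). g \<in> carrier G \<and> b \<in> B) F \<and>
             limitin (self_maps X) (\<lambda>(g, b). act g) a F \<and>
             limitin (self_maps X) (\<lambda>(g, b). compose (topspace X) (act g) b) f F}"

definition tau_closure ::
  "('g, 'b) monoid_scheme \<Rightarrow> 'x topology \<Rightarrow> ('g \<Rightarrow> 'x \<Rightarrow> 'x) \<Rightarrow>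
   ('x \<Rightarrow> 'x) set \<Rightarrow> ('x \<Rightarrow> 'x) \<Rightarrow> ('x \<Rightarrow> 'x) set \<Rightarrow> ('x \<Rightarrow> 'x) set" where
  "tau_closure G X act M u B = carrier (ellis_group X M u) \<inter> ellis_circ G X act u B"

definition tau_topology ::
  "('g, 'b) monoid_scheme \<Rightarrow> 'x topology \<Rightarrow> ('g \<Rightarrow> 'x \<Rightarrow> 'x) \<Rightarrow>
   ('x \<Rightarrow> 'x) set \<Rightarrow> ('x \<Rightarrow> 'x) \<Rightarrow> ('x \<Rightarrow> 'x) topology" where
  "tau_topology G X act M u =
     topology (\<lambda>U. U \<subseteq> carrier (ellis_group X M u) \<and>
       tau_closure G X act M u (carrier (ellis_group X M u) - U) =
         carrier (ellis_group X M u) - U)"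

definition tau_H ::
  "('g, 'b) monoid_scheme \<Rightarrow> 'x topology \<Rightarrow> ('g \<Rightarrow> 'x \<Rightarrow> 'x) \<Rightarrow>
   ('x \<Rightarrow> 'x) set \<Rightarrow> ('x \<Rightarrow> 'x) \<Rightarrow> ('x \<Rightarrow> 'x) set" where
  "tau_H G X act M u =
     \<Inter> {tau_closure G X act M u U | U. openin (tau_topology G X act M u) U \<and> u \<in> U}"

definition ellis_quotient_topology ::
  "('g, 'b) monoid_scheme \<Rightarrow> 'x topology \<Rightarrow> ('g \<Rightarrow> 'x \<Rightarrow> 'x) \<Rightarrow>
   ('x \<Rightarrow> 'x) set \<Rightarrow> ('x \<Rightarrow> 'x) \<Rightarrow> ('x \<Rightarrow> 'x) set topology" where
  "ellis_quotient_topology G X act M u =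
     quotient_topology (tau_topology G X act M u)
       (\<lambda>f. tau_H G X act M u #>\<^bsub>ellis_group X M u\<^esub> f)"


section \<open>First-order logic\<close>

text \<open>A signature lists its symbols together with their arities. A structure has the whole type
  \<open>'m\<close> as universe, and only its values on symbols of the signature (with arguments of the right
  number) matter.\<close>

record ('f, 'r) signature =
  funs :: "('f \<times> nat) set"
  rels :: "('r \<times> nat) set"

record ('f, 'r, 'm) fo_struct =
  fun_int :: "'f \<Rightarrow> 'm list \<Rightarrow> 'm"
  rel_int :: "'r \<Rightarrow> 'm list \<Rightarrow> bool"

datatype ('f, 'v) tm = Var 'v | App 'f "('f, 'v) tm list"

datatype ('f, 'r, 'v) fm =
    Equal "('f, 'v) tm" "('f, 'v) tm"
  | Rel 'r "('f, 'v) tm list"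
  | Neg "('f, 'r, 'v) fm"
  | Conj "('f, 'r, 'v) fm" "('f, 'r, 'v) fm"
  | Exi 'v "('f, 'r, 'v) fm"

fun wf_tm :: "('f, 'r) signature \<Rightarrow> ('f, 'v) tm \<Rightarrow> bool" where
  "wf_tm L (Var v) \<longleftrightarrow> True"
| "wf_tm L (App f ts) \<longleftrightarrow> (f, length ts) \<in> funs L \<and> (\<forall>t\<in>set ts. wf_tm L t)"

primrec wf_fm :: "('f, 'r) signature \<Rightarrow> ('f, 'r, 'v) fm \<Rightarrow> bool" where
  "wf_fm L (Equal s t) \<longleftrightarrow> wf_tm L s \<and> wf_tm L t"
| "wf_fm L (Rel r ts) \<longleftrightarrow> (r, length ts) \<in> rels L \<and> (\<forall>t\<in>set ts. wf_tm L t)"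
| "wf_fm L (Neg \<phi>) \<longleftrightarrow> wf_fm L \<phi>"
| "wf_fm L (Conj \<phi> \<psi>) \<longleftrightarrow> wf_fm L \<phi> \<and> wf_fm L \<psi>"
| "wf_fm L (Exi v \<phi>) \<longleftrightarrow> wf_fm L \<phi>"

fun fv_tm :: "('f, 'v) tm \<Rightarrow> 'v set" where
  "fv_tm (Var v) = {v}"
| "fv_tm (App f ts) = (\<Union>t\<in>set ts. fv_tm t)"

primrec fv :: "('f, 'r, 'v) fm \<Rightarrow> 'v set" where
  "fv (Equal s t) = fv_tm s \<union> fv_tm t"
| "fv (Rel r ts) = (\<Union>t\<in>set ts. fv_tm t)"
| "fv (Neg \<phi>) = fv \<phi>"
| "fv (Conj \<phi> \<psi>) = fv \<phi> \<union> fv \<psi>"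
| "fv (Exi v \<phi>) = fv \<phi> - {v}"

primrec eval_tm :: "('f, 'r, 'm) fo_struct \<Rightarrow> ('v \<Rightarrow> 'm) \<Rightarrow> ('f, 'v) tm \<Rightarrow> 'm" where
  "eval_tm C e (Var v) = e v"
| "eval_tm C e (App f ts) = fun_int C f (map (eval_tm C e) ts)"

text \<open>Satisfaction in the substructure of \<open>C\<close> with universe \<open>D\<close>.\<close>

primrec sat_in ::
  "('f, 'r, 'm) fo_struct \<Rightarrow> 'm set \<Rightarrow> ('v \<Rightarrow> 'm) \<Rightarrow> ('f, 'r, 'v) fm \<Rightarrow> bool" where
  "sat_in C D e (Equal s t) \<longleftrightarrow> eval_tm C e s = eval_tm C e t"
| "sat_in C D e (Rel r ts) \<longleftrightarrow> rel_int C r (map (eval_tm C e) ts)"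
| "sat_in C D e (Neg \<phi>) \<longleftrightarrow> \<not> sat_in C D e \<phi>"
| "sat_in C D e (Conj \<phi> \<psi>) \<longleftrightarrow> sat_in C D e \<phi> \<and> sat_in C D e \<psi>"
| "sat_in C D e (Exi v \<phi>) \<longleftrightarrow> (\<exists>a\<in>D. sat_in C D (e(v := a)) \<phi>)"

abbreviation sat :: "('f, 'r, 'm) fo_struct \<Rightarrow> ('v \<Rightarrow> 'm) \<Rightarrow> ('f, 'r, 'v) fm \<Rightarrow> bool" where
  "sat C \<equiv> sat_in C UNIV"

definition sentences :: "('f, 'r) signature \<Rightarrow> ('f, 'r, nat) fm set" where
  "sentences L = {\<phi>. wf_fm L \<phi> \<and> fv \<phi> = {}}"

text \<open>Theories are deductively closed; consistency follows from having a model.\<close>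

definition complete_theory :: "('f, 'r) signature \<Rightarrow> ('f, 'r, nat) fm set \<Rightarrow> bool" where
  "complete_theory L T \<longleftrightarrow>
     T \<subseteq> sentences L \<and> (\<forall>\<phi> \<in> sentences L. \<phi> \<in> T \<or> Neg \<phi> \<in> T)"

definition model_of :: "('f, 'r, 'm) fo_struct \<Rightarrow> ('f, 'r, nat) fm set \<Rightarrow> bool" where
  "model_of C T \<longleftrightarrow> (\<forall>\<phi>\<in>T. \<forall>e. sat C e \<phi>)"

definition elementary_submodel ::
  "('f, 'r) signature \<Rightarrow> ('f, 'r, 'm) fo_struct \<Rightarrow> 'm set \<Rightarrow> bool" where
  "elementary_submodel L C D \<longleftrightarrow>
     D \<noteq> {} \<and>
     (\<forall>(f, n) \<in> funs L. \<forall>xs. length xs = n \<and> set xs \<subseteq> D \<longrightarrow> fun_int C f xs \<in> D) \<and>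
     (\<forall>(\<phi> :: ('f, 'r, nat) fm) e. wf_fm L \<phi> \<and> range e \<subseteq> D \<longrightarrow>
        (sat_in C D e \<phi> \<longleftrightarrow> sat C e \<phi>))"

definition automorphisms ::
  "('f, 'r) signature \<Rightarrow> ('f, 'r, 'm) fo_struct \<Rightarrow> ('m \<Rightarrow> 'm) set" where
  "automorphisms L C =
     {\<sigma>. bij \<sigma> \<and>
         (\<forall>(f, n) \<in> funs L. \<forall>xs. length xs = n \<longrightarrow>
            \<sigma> (fun_int C f xs) = fun_int C f (map \<sigma> xs)) \<and>
         (\<forall>(r, n) \<in> rels L. \<forall>xs. length xs = n \<longrightarrow>
            (rel_int C r (map \<sigma> xs) \<longleftrightarrow> rel_int C r xs))}"

definition Aut :: "('f, 'r) signature \<Rightarrow> ('f, 'r, 'm) fo_struct \<Rightarrow> ('m \<Rightarrow> 'm) monoid" where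
  "Aut L C = \<lparr>carrier = automorphisms L C, mult = (\<circ>), one = id\<rparr>"

definition Aut_topology ::
  "('f, 'r) signature \<Rightarrow> ('f, 'r, 'm) fo_struct \<Rightarrow> ('m \<Rightarrow> 'm) topology" where
  "Aut_topology L C =
     subtopology (product_topology (\<lambda>_. discrete_topology UNIV) UNIV) (automorphisms L C)"


section \<open>Types\<close>

text \<open>A formula with parameters \<open>\<phi>(x, b)\<close> is a pair of a formula, whose variables \<open>Inl i\<close> are the
  type variables \<open>x\<^sub>i\<close> and whose variables \<open>Inr k\<close> are \<open>y\<^sub>k\<close>, and of the tuple \<open>b\<close> to be substituted
  for \<open>y\<close>.\<close>

type_synonym ('f, 'r, 'x, 'm) pfm = "('f, 'r, 'x + nat) fm \<times> 'm list"

definition psat ::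
  "('f, 'r, 'm) fo_struct \<Rightarrow> ('x \<Rightarrow> 'm) \<Rightarrow> ('f, 'r, 'x, 'm) pfm \<Rightarrow> bool" where
  "psat C x = (\<lambda>(\<phi>, b). sat C (case_sum x (nth b)) \<phi>)"

definition fms :: "('f, 'r) signature \<Rightarrow> 'x set \<Rightarrow> nat \<Rightarrow> ('f, 'r, 'x + nat) fm set" where
  "fms L V n = {\<phi>. wf_fm L \<phi> \<and> fv \<phi> \<subseteq> Inl ` V \<union> Inr ` {..<n}}"

definition pfms :: "('f, 'r) signature \<Rightarrow> 'x set \<Rightarrow> 'm set \<Rightarrow> ('f, 'r, 'x, 'm) pfm set" where
  "pfms L V A = {(\<phi>, b). set b \<subseteq> A \<and> \<phi> \<in> fms L V (length b)}"

definition pneg :: "('f, 'r, 'x, 'm) pfm \<Rightarrow> ('f, 'r, 'x, 'm) pfm" where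
  "pneg = (\<lambda>(\<phi>, b). (Neg \<phi>, b))"

text \<open>Consistency with the elementary diagram of \<open>C\<close>.\<close>

definition consistent :: "('f, 'r, 'm) fo_struct \<Rightarrow> ('f, 'r, 'x, 'm) pfm set \<Rightarrow> bool" where
  "consistent C p \<longleftrightarrow> (\<forall>p0 \<subseteq> p. finite p0 \<longrightarrow> (\<exists>x. \<forall>q\<in>p0. psat C x q))"

definition complete_types ::
  "('f, 'r, 'm) fo_struct \<Rightarrow> ('f, 'r, 'x, 'm) pfm set \<Rightarrow> ('f, 'r, 'x, 'm) pfm set set" where
  "complete_types C I =
     {p. p \<subseteq> I \<union> pneg ` I \<and> (\<forall>q\<in>I. q \<in> p \<or> pneg q \<in> p) \<and> consistent C p}"

text \<open>The type over \<open>A\<close> of the tuple \<open>a\<close> indexed by \<open>V\<close>.\<close>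

definition tp ::
  "('f, 'r) signature \<Rightarrow> ('f, 'r, 'm) fo_struct \<Rightarrow> 'x set \<Rightarrow> 'm set \<Rightarrow> ('x \<Rightarrow> 'm) \<Rightarrow>
   ('f, 'r, 'x, 'm) pfm set" where
  "tp L C V A a = {q \<in> pfms L V A. psat C a q}"

text \<open>For \<open>I\<close> not closed under negation (as for \<open>\<Delta>\<close>-types) the instances of \<open>I\<close> and of their
  negations form a subbasis of clopen sets.\<close>

definition type_topology ::
  "('f, 'r, 'x, 'm) pfm set \<Rightarrow> ('f, 'r, 'x, 'm) pfm set set \<Rightarrow>
   ('f, 'r, 'x, 'm) pfm set topology" where
  "type_topology I P =
     topology_generated_by (insert P {{p \<in> P. q \<in> p} | q. q \<in> I \<union> pneg ` I})"

definition type_act ::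
  "('f, 'r, 'x, 'm) pfm set topology \<Rightarrow> ('m \<Rightarrow> 'm) \<Rightarrow>
   ('f, 'r, 'x, 'm) pfm set \<Rightarrow> ('f, 'r, 'x, 'm) pfm set" where
  "type_act X \<sigma> = (\<lambda>p \<in> topspace X. (\<lambda>(\<phi>, b). (\<phi>, map \<sigma> b)) ` p)"

text \<open>The space \<open>S\<^sub>a(A)\<close> of complete types over \<open>A\<close> extending the type of \<open>a\<close> over the empty set.\<close>

definition type_space ::
  "('f, 'r) signature \<Rightarrow> ('f, 'r, 'm) fo_struct \<Rightarrow> 'x set \<Rightarrow> 'm set \<Rightarrow> ('x \<Rightarrow> 'm) \<Rightarrow>
   ('f, 'r, 'x, 'm) pfm set topology" where
  "type_space L C V A a =
     type_topology (pfms L V A) {p \<in> complete_types C (pfms L V A). tp L C V {} a \<subseteq> p}"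

abbreviation global_type_space ::
  "('f, 'r) signature \<Rightarrow> ('f, 'r, 'm) fo_struct \<Rightarrow> ('i \<Rightarrow> 'm) \<Rightarrow>
   ('f, 'r, 'i, 'm) pfm set topology" where
  "global_type_space L C c \<equiv> type_space L C UNIV UNIV c"

abbreviation global_type_act ::
  "('f, 'r) signature \<Rightarrow> ('f, 'r, 'm) fo_struct \<Rightarrow> ('i \<Rightarrow> 'm) \<Rightarrow> ('m \<Rightarrow> 'm) \<Rightarrow>
   ('f, 'r, 'i, 'm) pfm set \<Rightarrow> ('f, 'r, 'i, 'm) pfm set" where
  "global_type_act L C c \<equiv> type_act (global_type_space L C c)"

definition n_types ::
  "('f, 'r) signature \<Rightarrow> ('f, 'r, 'm) fo_struct \<Rightarrow> nat \<Rightarrow> ('f, 'r, nat, 'm) pfm set set" where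
  "n_types L C n = complete_types C (pfms L {..<n} {})"

definition realizations ::
  "('f, 'r, 'm) fo_struct \<Rightarrow> nat \<Rightarrow> ('f, 'r, nat, 'm) pfm set \<Rightarrow> 'm list set" where
  "realizations C n p = {b. length b = n \<and> (\<forall>q\<in>p. psat C (nth b) q)}"

definition Delta_instances ::
  "('f, 'r, 'm) fo_struct \<Rightarrow> nat \<Rightarrow> ('f, 'r, 'i + nat) fm set \<Rightarrow>
   ('f, 'r, nat, 'm) pfm set set \<Rightarrow> ('f, 'r, 'i, 'm) pfm set" where
  "Delta_instances C n \<Delta> P = \<Delta> \<times> (\<Union>p\<in>P. realizations C n p)"

definition Delta_type_space ::
  "('f, 'r) signature \<Rightarrow> ('f, 'r, 'm) fo_struct \<Rightarrow> ('i \<Rightarrow> 'm) \<Rightarrow> nat \<Rightarrow>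
   ('f, 'r, 'i + nat) fm set \<Rightarrow> ('f, 'r, nat, 'm) pfm set set \<Rightarrow>
   ('f, 'r, 'i, 'm) pfm set topology" where
  "Delta_type_space L C c n \<Delta> P =
     type_topology (Delta_instances C n \<Delta> P)
       {p \<in> complete_types C (Delta_instances C n \<Delta> P). consistent C (p \<union> tp L C UNIV {} c)}"

abbreviation Delta_type_act ::
  "('f, 'r) signature \<Rightarrow> ('f, 'r, 'm) fo_struct \<Rightarrow> ('i \<Rightarrow> 'm) \<Rightarrow> nat \<Rightarrow>
   ('f, 'r, 'i + nat) fm set \<Rightarrow> ('f, 'r, nat, 'm) pfm set set \<Rightarrow> ('m \<Rightarrow> 'm) \<Rightarrow>
   ('f, 'r, 'i, 'm) pfm set \<Rightarrow> ('f, 'r, 'i, 'm) pfm set" where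
  "Delta_type_act L C c n \<Delta> P \<equiv> type_act (Delta_type_space L C c n \<Delta> P)"

text \<open>A finite set of formulae \<open>\<phi>(x, y)\<close> and a finite set of types in \<open>y = (y\<^sub>0, \<dots>, y\<^sub>n\<^sub>-\<^sub>1)\<close>.\<close>

definition finite_Delta_data ::
  "('f, 'r) signature \<Rightarrow> ('f, 'r, 'm) fo_struct \<Rightarrow> nat \<Rightarrow>
   ('f, 'r, 'i + nat) fm set \<Rightarrow> ('f, 'r, nat, 'm) pfm set set \<Rightarrow> bool" where
  "finite_Delta_data L C n \<Delta> P \<longleftrightarrow>
     finite \<Delta> \<and> \<Delta> \<subseteq> fms L UNIV n \<and> finite P \<and> P \<subseteq> n_types L C n"


section \<open>Monster models\<close>

definition saturated ::
  "'k rel \<Rightarrow> ('f, 'r) signature \<Rightarrow> ('f, 'r, 'm) fo_struct \<Rightarrow> bool" where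
  "saturated \<kappa> L C \<longleftrightarrow>
     (\<forall>A. |A| <o \<kappa> \<longrightarrow>
        (\<forall>p \<in> complete_types C (pfms L (UNIV :: unit set) A). \<exists>x. \<forall>q\<in>p. psat C x q))"

definition partial_elementary ::
  "('f, 'r) signature \<Rightarrow> ('f, 'r, 'm) fo_struct \<Rightarrow> 'm set \<Rightarrow> ('m \<Rightarrow> 'm) \<Rightarrow> bool" where
  "partial_elementary L C A f \<longleftrightarrow>
     (\<forall>(\<phi> :: ('f, 'r, nat) fm) e. wf_fm L \<phi> \<and> e ` fv \<phi> \<subseteq> A \<longrightarrow>
        (sat C e \<phi> \<longleftrightarrow> sat C (f \<circ> e) \<phi>))"

definition strongly_homogeneous ::
  "'k rel \<Rightarrow> ('f, 'r) signature \<Rightarrow> ('f, 'r, 'm) fo_struct \<Rightarrow> bool" where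
  "strongly_homogeneous \<kappa> L C \<longleftrightarrow>
     (\<forall>A f. |A| <o \<kappa> \<and> partial_elementary L C A f \<longrightarrow>
        (\<exists>\<sigma> \<in> automorphisms L C. \<forall>a\<in>A. \<sigma> a = f a))"

definition strong_limit :: "'k rel \<Rightarrow> bool" where
  "strong_limit \<kappa> \<longleftrightarrow>
     Cinfinite \<kappa> \<and> (\<forall>A :: 'k set. |A| <o \<kappa> \<longrightarrow> |Pow A| <o \<kappa>)"

text \<open>The degree of saturation \<open>\<kappa>\<close> is a strong limit cardinal greater than \<open>|T|\<close>, the number of
  formulae of the language.\<close>

definition monster_model ::
  "'k rel \<Rightarrow> ('f, 'r) signature \<Rightarrow> ('f, 'r, nat) fm set \<Rightarrow> ('f, 'r, 'm) fo_struct \<Rightarrow> bool" where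
  "monster_model \<kappa> L T C \<longleftrightarrow>
     strong_limit \<kappa> \<and> |{\<phi> :: ('f, 'r, nat) fm. wf_fm L \<phi>}| <o \<kappa> \<and>
     model_of C T \<and> saturated \<kappa> L C \<and> strongly_homogeneous \<kappa> L C"


section \<open>The Kim--Pillay Galois group\<close>

text \<open>Tuples of length less than \<open>\<kappa>\<close> are indexed by subsets of the underlying type of \<open>\<kappa>\<close>.\<close>

definition type_definable_rel ::
  "('f, 'r, 'm) fo_struct \<Rightarrow> 'k set \<Rightarrow> ('f, 'r, 'k + 'k) fm set \<Rightarrow> ('k \<Rightarrow> 'm) rel" where
  "type_definable_rel C J \<Phi> =
     {(a, b). a \<in> J \<rightarrow>\<^sub>E UNIV \<and> b \<in> J \<rightarrow>\<^sub>E UNIV \<and> (\<forall>\<phi>\<in>\<Phi>. sat C (case_sum a b) \<phi>)}"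

definition bounded_type_definable_equivs ::
  "'k rel \<Rightarrow> ('f, 'r) signature \<Rightarrow> ('f, 'r, 'm) fo_struct \<Rightarrow> 'k set \<Rightarrow> ('k \<Rightarrow> 'm) rel set" where
  "bounded_type_definable_equivs \<kappa> L C J =
     {E. (\<exists>\<Phi>. \<Phi> \<subseteq> {\<phi>. wf_fm L \<phi> \<and> fv \<phi> \<subseteq> Inl ` J \<union> Inr ` J} \<and> E = type_definable_rel C J \<Phi>) \<and>
         equiv (J \<rightarrow>\<^sub>E UNIV) E \<and> |(J \<rightarrow>\<^sub>E UNIV) // E| <o \<kappa>}"

definition Autf_KP ::
  "'k rel \<Rightarrow> ('f, 'r) signature \<Rightarrow> ('f, 'r, 'm) fo_struct \<Rightarrow> ('m \<Rightarrow> 'm) set" where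
  "Autf_KP \<kappa> L C =
     {\<sigma> \<in> automorphisms L C.
        \<forall>J :: 'k set. |J| <o \<kappa> \<longrightarrow>
          (\<forall>E \<in> bounded_type_definable_equivs \<kappa> L C J.
             \<forall>a \<in> J \<rightarrow>\<^sub>E UNIV. (a, restrict (\<sigma> \<circ> a) J) \<in> E)}"

definition Gal_KP ::
  "'k rel \<Rightarrow> ('f, 'r) signature \<Rightarrow> ('f, 'r, 'm) fo_struct \<Rightarrow> ('m \<Rightarrow> 'm) set monoid" where
  "Gal_KP \<kappa> L C = Aut L C Mod Autf_KP \<kappa> L C"

text \<open>For a small model \<open>M\<close>, enumerated by itself as \<open>m\<close>: the map from \<open>S\<^sub>m(M)\<close> to the
  Kim--Pillay group sending \<open>tp(\<sigma>(m)/M)\<close> to the class of \<open>\<sigma>\<close>. The topology is the quotient topology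
  with respect to it, and does not depend on \<open>M\<close>.\<close>

definition KP_map ::
  "'k rel \<Rightarrow> ('f, 'r) signature \<Rightarrow> ('f, 'r, 'm) fo_struct \<Rightarrow> 'm set \<Rightarrow>
   ('f, 'r, 'm, 'm) pfm set \<Rightarrow> ('m \<Rightarrow> 'm) set" where
  "KP_map \<kappa> L C M p =
     Autf_KP \<kappa> L C #>\<^bsub>Aut L C\<^esub> (SOME \<sigma>. \<sigma> \<in> automorphisms L C \<and> tp L C M M \<sigma> = p)"

definition Gal_KP_topology ::
  "'k rel \<Rightarrow> ('f, 'r) signature \<Rightarrow> ('f, 'r, 'm) fo_struct \<Rightarrow> 'm set \<Rightarrow>
   ('m \<Rightarrow> 'm) set topology" where
  "Gal_KP_topology \<kappa> L C M = quotient_topology (type_space L C M M id) (KP_map \<kappa> L C M)"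

definition Gal_KP_profinite ::
  "'k rel \<Rightarrow> ('f, 'r) signature \<Rightarrow> ('f, 'r, 'm) fo_struct \<Rightarrow> bool" where
  "Gal_KP_profinite \<kappa> L C \<longleftrightarrow>
     (\<forall>M. elementary_submodel L C M \<and> |M| <o \<kappa> \<longrightarrow>
        profinite_group (Gal_KP \<kappa> L C) (Gal_KP_topology \<kappa> L C M))"


section \<open>Inverse limits of flows with finite Ellis groups\<close>

text \<open>The two type arguments are the types of the indices and of the points of the flows \<open>X\<^sub>i\<close>. The
  projections onto the \<open>X\<^sub>i\<close> are surjective, so each \<open>X\<^sub>i\<close> is a quotient of \<open>S\<^sub>c(C)\<close> by a closed
  equivalence relation, and the system can be indexed by these relations. Hence no generality is
  lost by taking sets of pairs of global types as indices and sets of global types as points.\<close>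

definition inverse_limit_of_finite_ellis ::
  "'j itself \<Rightarrow> 'x itself \<Rightarrow> ('g, 'b) monoid_scheme \<Rightarrow> 'g topology \<Rightarrow>
   'y topology \<Rightarrow> ('g \<Rightarrow> 'y \<Rightarrow> 'y) \<Rightarrow> bool" where
  "inverse_limit_of_finite_ellis TJ TX G \<tau> Y actY \<longleftrightarrow>
     (\<exists>(I :: 'j set) leq (X :: 'j \<Rightarrow> 'x topology) act \<pi>.
        inverse_system_of_flows G \<tau> I leq X act \<pi> \<and>
        (\<forall>i\<in>I. finite_ellis_group G (X i) (act i)) \<and>
        flow_isomorphic G Y actY (inverse_limit I leq X \<pi>) (inverse_limit_act I leq X act \<pi>))"

end

theory Submission
  imports Defs
begin

text \<open>
  \<^bold>\<open>Idea.\<close> Both (B) and (C) say that the points of \<open>S\<^sub>c(C)\<close> are separated by closed invariant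
  equivalence relations whose quotient flows have finite Ellis groups: such relations are closed under
  finite intersections, since the Ellis group of a joint quotient embeds in a product, and the
  \<open>\<Delta>\<close>-restrictions are particular such quotients. For (D) \<open>\<Rightarrow>\<close> (C), an element \<open>f\<close> of a minimal left ideal
  with finite image gives the map \<open>h \<mapsto> f h f\<close>, which is injective on \<open>uM\<close> and has finite range. For
  (B) \<open>\<Rightarrow>\<close> (A), the Ellis group maps onto the finite Ellis groups of the quotients, and the kernels
  are \<open>\<tau>\<close>-clopen and intersect trivially. If \<open>uM\<close> is \<open>\<tau>\<close>-Hausdorff then \<open>H(uM)\<close> is trivial, which gives
  (A) \<open>\<Rightarrow>\<close> (A'). Finally \<open>\<eta> \<mapsto> [\<sigma>]\<close>, where \<open>\<eta>(tp(c/C))\<close> restricts to \<open>tp(\<sigma>(m)/m)\<close> for a small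
  model \<open>m\<close>, is a semigroup homomorphism onto \<open>Gal\<^sub>K\<^sub>P\<close>, continuous on \<open>uM\<close> for \<open>\<tau>\<close>; it factors through
  \<open>uM/H(uM)\<close>, and Hausdorff images of profinite groups are profinite.
\<close>

section \<open>Compact right topological semigroups\<close>

text \<open>Composition in \<open>EL\<close> is in general continuous in the left factor only, and
  the \<tau>-topology on \<open>u M\<close> is compact but in general not Hausdorff. Both
  profiniteness arguments work around this: for (A) the images of \<open>u M\<close> are finite, so
  finitely many right factors share one neighbourhood of \<open>u\<close>; for the Galois group the
  target has a jointly continuous multiplication. Getting (C) from separation of points means
  treating infinitely many instances \<phi>(x,b) at once. Compactness settles one b. The congruences
  are invariant and p(C) is a single orbit, so the same congruence serves all b in p(C), and as
  \<Delta> and the set of types are finite, a finite intersection remains. On the Galois side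
  everything rests on automorphisms fixing a small model being Kim-Pillay strong: the class of
  \<sigma> then depends only on tp(\<sigma>(m)/m). Closedness of relations on the type space comes
  from realizing limit types by automorphisms. Formulas are mostly treated as predicates on
  assignments (\<open>definable\<close>, \<open>holds\<close>), which confines the renaming of
  variables to a few lemmas.\<close>

lemma exists_minimal_closed:
  assumes "compact_space T" "P K0"
    and closed: "\<And>K. P K \<Longrightarrow> closedin T K \<and> K \<noteq> {}"
    and Inter: "\<And>\<C>. \<lbrakk>\<C> \<noteq> {}; \<And>K. K \<in> \<C> \<Longrightarrow> P K; \<Inter>\<C> \<noteq> {}\<rbrakk> \<Longrightarrow> P (\<Inter>\<C>)"
  shows "\<exists>K\<subseteq>K0. P K \<and> (\<forall>L. P L \<and> L \<subseteq> K \<longrightarrow> L = K)"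
proof -
  let ?A = "{topspace T - K | K. P K \<and> K \<subseteq> K0}"
  \<comment> \<open>Minimal sets correspond to maximal complements, to which Zorn's lemma applies;
    the union of a chain of complements is the complement of an intersection.\<close>
  have "\<exists>W\<in>?A. \<forall>X\<in>?A. W \<subseteq> X \<longrightarrow> X = W"
  proof (rule subset_Zorn_nonempty)
    show "?A \<noteq> {}" using assms(2) by blast
    fix D assume "D \<noteq> {}" and ch: "subset.chain ?A D"
    define \<C> where "\<C> = (\<lambda>U. topspace T - U) ` D"
    have C: "P K \<and> K \<subseteq> K0 \<and> topspace T - K \<in> D" if KC: "K \<in> \<C>" for K
    proof -
      obtain U where U: "U \<in> D" "K = topspace T - U" using KC \<C>_def by blast
      then obtain K' where K': "U = topspace T - K'" "P K'" "K' \<subseteq> K0"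
        using ch by (auto simp: subset.chain_def)
      then have "K = K'" using U closed closedin_subset by blast
      then show ?thesis using U K' by auto
    qed
    have ne: "\<C> \<noteq> {}" using \<open>D \<noteq> {}\<close> \<C>_def by blast
    have "\<Inter>\<C> \<noteq> {}"
    proof -
      have "\<Inter>\<F> \<noteq> {}" if fin: "finite \<F>" "\<F> \<subseteq> \<C>" for \<F>
      proof (cases "\<F> = {}")
        case False
        \<comment> \<open>A finite nonempty part of a chain has a least member, and this member is
          its intersection.\<close>
        obtain m where m: "m \<in> \<F>" "\<And>b. b \<in> \<F> \<Longrightarrow> b \<subseteq> m \<Longrightarrow> m = b"
          using finite_has_minimal[OF fin(1) False] by blast
        have "m \<subseteq> L" if "L \<in> \<F>" for L
        proof -
          have "topspace T - m \<in> D" "topspace T - L \<in> D" "m \<subseteq> topspace T" "L \<subseteq> topspace T"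
            using m(1) that fin(2) C[of m] C[of L] closed[of m] closed[of L] by (auto dest: closedin_subset)
          moreover from this ch have "topspace T - m \<subseteq> topspace T - L \<or> topspace T - L \<subseteq> topspace T - m"
            unfolding subset_chain_def by metis
          ultimately have "m \<subseteq> L \<or> L \<subseteq> m" by (metis Diff_Diff_Int Diff_mono inf.absorb2 order_refl)
          then show ?thesis using m that by blast
        qed
        then have "m \<subseteq> \<Inter>\<F>" by blast
        moreover have "m \<noteq> {}" using m(1) fin(2) C[of m] closed[of m] by auto
        ultimately show ?thesis by blast
      qed (use fin in auto)
      moreover have "\<forall>K\<in>\<C>. closedin T K" using C closed by blast
      ultimately show ?thesis 
        using assms(1)[unfolded compact_space_fip, THEN spec[where x = \<C>]] by blast
    qed
    then have "P (\<Inter>\<C>)" using Inter ne C by blast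
    moreover have "\<Inter>\<C> \<subseteq> K0" using ne C by blast
    moreover have "\<Union>D = topspace T - \<Inter>\<C>"
    proof -
      have "\<Union>D \<subseteq> topspace T" using ch by (auto simp: subset.chain_def)
      then show ?thesis using \<C>_def by auto
    qed
    ultimately show "\<Union>D \<in> ?A" by blast
  qed
  then obtain W where W: "W \<in> ?A" and max: "\<forall>X\<in>?A. W \<subseteq> X \<longrightarrow> X = W" by (rule bexE)
  from W obtain K where K: "P K" "K \<subseteq> K0" "W = topspace T - K" by auto
  have "L = K" if L: "P L" "L \<subseteq> K" for L
  proof -
    have "topspace T - L \<in> ?A" "W \<subseteq> topspace T - L" using L K by auto
    then have "topspace T - L = topspace T - K"
      using max[THEN bspec, THEN mp, of "topspace T - L"] K(3) by simp
    moreover have "L \<subseteq> topspace T" "K \<subseteq> topspace T"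
      using L K closed[of L] closed[of K] by (auto dest: closedin_subset)
    ultimately show ?thesis by (metis double_diff order_refl)
  qed
  then show ?thesis using K by blast
qed

text \<open>Only the maps \<open>a \<mapsto> a \<cdot> b\<close> are continuous. This is the
  situation in an Ellis semigroup: precomposition with a fixed map is continuous for pointwise
  convergence, whereas postcomposition with a discontinuous limit of group elements is in general
  not.\<close>

locale compact_right_semigroup =
  fixes T :: "'a topology" and mul :: "'a \<Rightarrow> 'a \<Rightarrow> 'a" (infixl "\<cdot>" 70)
  assumes compact: "compact_space T"
    and Hausdorff: "Hausdorff_space T"
    and closed [simp]: "\<lbrakk>a \<in> topspace T; b \<in> topspace T\<rbrakk> \<Longrightarrow> a \<cdot> b \<in> topspace T"
    and assoc: "\<lbrakk>a \<in> topspace T; b \<in> topspace T; c \<in> topspace T\<rbrakk> \<Longrightarrow> a \<cdot> b \<cdot> c = a \<cdot> (b \<cdot> c)"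
    and cont: "b \<in> topspace T \<Longrightarrow> continuous_map T T (\<lambda>a. a \<cdot> b)"
begin

definition lideal :: "'a set \<Rightarrow> bool" where
  "lideal N \<longleftrightarrow> N \<noteq> {} \<and> N \<subseteq> topspace T \<and> (\<forall>e\<in>topspace T. \<forall>n\<in>N. e \<cdot> n \<in> N)"

definition min_lideal :: "'a set \<Rightarrow> bool" where
  "min_lideal N \<longleftrightarrow> lideal N \<and> (\<forall>L. lideal L \<and> L \<subseteq> N \<longrightarrow> L = N)"

lemma closedin_right_translate: "\<lbrakk>closedin T K; b \<in> topspace T\<rbrakk> \<Longrightarrow> closedin T ((\<lambda>a. a \<cdot> b) ` K)"
  by (metis Hausdorff cont closedin_compact_space compact compactin_imp_closedin image_compactin)

lemma lideal_principal: "m \<in> topspace T \<Longrightarrow> lideal ((\<lambda>e. e \<cdot> m) ` topspace T)"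
  unfolding lideal_def by (auto simp: assoc[symmetric])

lemma min_lidealD:
  assumes "min_lideal M"
  shows "M \<noteq> {}" "M \<subseteq> topspace T" "\<And>e n. \<lbrakk>e \<in> topspace T; n \<in> M\<rbrakk> \<Longrightarrow> e \<cdot> n \<in> M"
  using assms by (auto simp: min_lideal_def lideal_def)

lemma min_lideal_eq_principal:
  assumes "min_lideal M" "m \<in> M"
  shows "(\<lambda>e. e \<cdot> m) ` topspace T = M"
proof -
  have "m \<in> topspace T" using min_lidealD[OF assms(1)] assms(2) by blast
  moreover have "(\<lambda>e. e \<cdot> m) ` topspace T \<subseteq> M" using min_lidealD[OF assms(1)] assms(2) by blast
  ultimately show ?thesis using assms(1) lideal_principal unfolding min_lideal_def by blast
qed

text \<open>Closedness is not part of the definition of a minimal left ideal. It follows because the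
  ideal is principal, hence the image of the compact space under a right translation.\<close>

lemma closedin_min_lideal: "min_lideal M \<Longrightarrow> closedin T M"
  by (metis closedin_right_translate closedin_topspace ex_in_conv min_lidealD(1,2)
      min_lideal_eq_principal subset_iff)

text \<open>Compactness yields a minimal element among the closed left ideals only. It is minimal
  among all of them, since every left ideal contains a principal one and principal left ideals are
  closed.\<close>

lemma exists_min_lideal:
  assumes "lideal N"
  shows "\<exists>M\<subseteq>N. min_lideal M"
proof -
  obtain n where n: "n \<in> N" "n \<in> topspace T" using assms by (auto simp: lideal_def)
  let ?K0 = "(\<lambda>e. e \<cdot> n) ` topspace T"
  have "\<exists>K\<subseteq>?K0. (closedin T K \<and> lideal K) \<and> (\<forall>L. (closedin T L \<and> lideal L) \<and> L \<subseteq> K \<longrightarrow> L = K)"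
  proof (rule exists_minimal_closed[OF compact])
    show "closedin T ?K0 \<and> lideal ?K0"
      using n closedin_right_translate lideal_principal by blast
    show "closedin T K \<and> K \<noteq> {}" if "closedin T K \<and> lideal K" for K
      using that by (auto simp: lideal_def)
    show "closedin T (\<Inter>\<C>) \<and> lideal (\<Inter>\<C>)"
      if "\<C> \<noteq> {}" "\<And>K. K \<in> \<C> \<Longrightarrow> closedin T K \<and> lideal K" "\<Inter>\<C> \<noteq> {}" for \<C>
      using that unfolding lideal_def by (intro conjI closedin_Inter) (blast+)
  qed
  then obtain K where K: "K \<subseteq> ?K0" "closedin T K" "lideal K"
    and min: "\<And>L. closedin T L \<Longrightarrow> lideal L \<Longrightarrow> L \<subseteq> K \<Longrightarrow> L = K" by blast
  have "L = K" if L: "lideal L" "L \<subseteq> K" for L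
  proof -
    obtain m where m: "m \<in> L" "m \<in> topspace T" using L by (auto simp: lideal_def)
    have "(\<lambda>e. e \<cdot> m) ` topspace T \<subseteq> L" using that m by (auto simp: lideal_def)
    moreover from this have "(\<lambda>e. e \<cdot> m) ` topspace T = K"
      using min[of "(\<lambda>e. e \<cdot> m) ` topspace T"] that m lideal_principal closedin_right_translate by blast
    ultimately show ?thesis using that by blast
  qed
  moreover have "K \<subseteq> N" using K n assms by (auto simp: lideal_def)
  ultimately show ?thesis using K unfolding min_lideal_def by blast
qed

text \<open>The Ellis-Numakura lemma. In a minimal closed subsemigroup \<open>K\<close> with a point
  \<open>x\<close>, the set \<open>K x\<close> is again a closed subsemigroup, hence equals
  \<open>K\<close>; so \<open>{y \<in> K. y \<cdot> x = x}\<close> is nonempty, is a closed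
  subsemigroup too, and must contain \<open>x\<close>.\<close>

theorem exists_idempotent:
  assumes "closedin T S" "S \<noteq> {}" "\<And>a b. \<lbrakk>a \<in> S; b \<in> S\<rbrakk> \<Longrightarrow> a \<cdot> b \<in> S"
  shows "\<exists>e\<in>S. e \<cdot> e = e"
proof -
  define P where "P \<equiv> \<lambda>K. closedin T K \<and> K \<noteq> {} \<and> (\<forall>a\<in>K. \<forall>b\<in>K. a \<cdot> b \<in> K)"
  have "\<exists>K\<subseteq>S. P K \<and> (\<forall>L. P L \<and> L \<subseteq> K \<longrightarrow> L = K)"
  proof (rule exists_minimal_closed[OF compact])
    show "P S" using assms unfolding P_def by blast
    show "P (\<Inter>\<C>)" if "\<C> \<noteq> {}" "\<And>K. K \<in> \<C> \<Longrightarrow> P K" "\<Inter>\<C> \<noteq> {}" for \<C>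
      unfolding P_def
    proof (intro conjI closedin_Inter)
      show "\<forall>a\<in>\<Inter>\<C>. \<forall>b\<in>\<Inter>\<C>. a \<cdot> b \<in> \<Inter>\<C>" using that(2) unfolding P_def by blast
    qed (use that in \<open>auto simp: P_def\<close>)
  qed (auto simp: P_def)
  then obtain K where K: "K \<subseteq> S" "P K" and min: "\<And>L. P L \<Longrightarrow> L \<subseteq> K \<Longrightarrow> L = K" by blast
  then obtain x where x: "x \<in> K" by (auto simp: P_def)
  have KP: "closedin T K" "\<And>a b. \<lbrakk>a \<in> K; b \<in> K\<rbrakk> \<Longrightarrow> a \<cdot> b \<in> K" using K by (auto simp: P_def)
  have KE: "K \<subseteq> topspace T" using KP closedin_subset by blast
  have "(\<lambda>a. a \<cdot> x) ` K = K"
  proof (rule min)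
    have "a \<cdot> x \<cdot> (b \<cdot> x) \<in> (\<lambda>a. a \<cdot> x) ` K" if "a \<in> K" "b \<in> K" for a b
      using that x KP KE by (intro image_eqI[where x = "a \<cdot> x \<cdot> b"]) (auto simp: assoc subset_iff)
    then show "P ((\<lambda>a. a \<cdot> x) ` K)" using closedin_right_translate KP x KE by (auto simp: P_def)
    show "(\<lambda>a. a \<cdot> x) ` K \<subseteq> K" using KP x by blast
  qed
  then have "x \<in> (\<lambda>a. a \<cdot> x) ` K" using x by simp
  then have ne: "{y\<in>K. y \<cdot> x = x} \<noteq> {}" by (auto simp: image_iff)
  have "{y\<in>K. y \<cdot> x = x} = K"
  proof (rule min)
    have "closedin T {y\<in>topspace T. y \<cdot> x \<in> {x}}"
      using closedin_continuous_map_preimage[OF cont[of x]] x KE closedin_Hausdorff_singleton[OF Hausdorff]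
      by blast
    then have "closedin T (K \<inter> {y\<in>topspace T. y \<cdot> x \<in> {x}})" using KP by blast
    moreover have "K \<inter> {y\<in>topspace T. y \<cdot> x \<in> {x}} = {y\<in>K. y \<cdot> x = x}" using KE by auto
    ultimately have "closedin T {y\<in>K. y \<cdot> x = x}" by simp
    moreover have "a \<cdot> b \<cdot> x = x" if "a \<in> K" "b \<in> K" "a \<cdot> x = x" "b \<cdot> x = x" for a b
      using that x KE by (simp add: assoc subset_iff)
    ultimately show "P {y\<in>K. y \<cdot> x = x}" using ne KP by (auto simp: P_def)
  qed blast
  then show ?thesis using x K by blast
qed

context
  fixes M u assumes M: "min_lideal M" and u: "u \<in> M" "u \<cdot> u = u"
begin

lemma min_lideal_in_space: "m \<in> M \<Longrightarrow> m \<in> topspace T" "u \<in> topspace T"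
  using min_lidealD[OF M] u by auto

text \<open>By minimality \<open>M\<close> is the left ideal generated by \<open>u\<close>, so every
  element has the form \<open>e \<cdot> u\<close>. On the left, \<open>u\<close> acts as an identity
  only on \<open>u M\<close>.\<close>

lemma right_identity: "m \<in> M \<Longrightarrow> m \<cdot> u = m"
  using min_lideal_eq_principal[OF M u(1)] u min_lideal_in_space by (auto simp: assoc)

lemma ellis_subset: "a \<in> (\<cdot>) u ` M \<Longrightarrow> a \<in> M"
  using min_lidealD[OF M] min_lideal_in_space by blast

lemma ellis_left_identity: "a \<in> (\<cdot>) u ` M \<Longrightarrow> u \<cdot> a = a"
  using min_lideal_in_space u by (auto simp: assoc[symmetric])

lemma ellis_memI: "\<lbrakk>a \<in> M; u \<cdot> a = a\<rbrakk> \<Longrightarrow> a \<in> (\<cdot>) u ` M"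
  by force

text \<open>The element \<open>u \<cdot> a\<close> generates \<open>M\<close>, so some
  \<open>e'\<close> satisfies \<open>e' \<cdot> (u \<cdot> a) = u\<close>. Multiplying
  \<open>e'\<close> by \<open>u\<close> on both sides moves it into \<open>u M\<close> and keeps it
  a left inverse of \<open>a\<close>.\<close>

lemma ellis_left_inverse:
  assumes "a \<in> M"
  shows "\<exists>b \<in> (\<cdot>) u ` M. b \<cdot> a = u"
proof -
  obtain e where e: "e \<in> topspace T" "e \<cdot> a = u"
    using min_lideal_eq_principal[OF M assms] u by auto
  have "u \<cdot> (e \<cdot> u) \<in> (\<cdot>) u ` M" using e u min_lidealD[OF M] by blast
  moreover have "\<exists>e'\<in>topspace T. e' \<cdot> (u \<cdot> a) = u"
    using min_lideal_eq_principal[OF M, of "u \<cdot> a"] u assms min_lideal_in_space min_lidealD[OF M] by force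
  then obtain e' where e': "e' \<in> topspace T" "e' \<cdot> (u \<cdot> a) = u" by blast
  have "u \<cdot> (e' \<cdot> u) \<cdot> a = u"
    using e' u assms min_lideal_in_space by (simp add: assoc)
  moreover have "u \<cdot> (e' \<cdot> u) \<in> (\<cdot>) u ` M" using e' u min_lidealD[OF M] by blast
  ultimately show ?thesis by blast
qed

lemma group_ellis: "group \<lparr>carrier = (\<cdot>) u ` M, mult = (\<cdot>), one = u\<rparr>"
proof (rule groupI, simp_all only: partial_object.simps monoid.simps)
  fix x y assume xy: "x \<in> (\<cdot>) u ` M" "y \<in> (\<cdot>) u ` M"
  then have "x \<cdot> y \<in> M" using ellis_subset min_lideal_in_space min_lidealD[OF M] by blast
  moreover have "u \<cdot> (x \<cdot> y) = x \<cdot> y"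
    using xy ellis_subset min_lideal_in_space ellis_left_identity by (metis assoc)
  ultimately show "x \<cdot> y \<in> (\<cdot>) u ` M" using ellis_memI by simp
  show "x \<cdot> y \<cdot> z = x \<cdot> (y \<cdot> z)" if "z \<in> (\<cdot>) u ` M" for z
    using xy that ellis_subset min_lideal_in_space by (simp add: assoc)
next
  show "u \<in> (\<cdot>) u ` M" using u ellis_memI by blast
  fix x assume x: "x \<in> (\<cdot>) u ` M"
  show "u \<cdot> x = x" using x ellis_left_identity by blast
  show "\<exists>y\<in>(\<cdot>) u ` M. y \<cdot> x = u" using x ellis_left_inverse ellis_subset by blast
qed

end

end

section \<open>Epimorphisms of compact right topological semigroups\<close>

locale crs_hom = A: compact_right_semigroup T mul + B: compact_right_semigroup T' mul'
  for T :: "'a topology" and mul (infixl "\<cdot>" 70) and T' :: "'b topology" and mul' (infixl "\<star>" 70) +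
  fixes \<theta> :: "'a \<Rightarrow> 'b"
  assumes contmap: "continuous_map T T' \<theta>"
    and surj: "\<theta> ` topspace T = topspace T'"
    and hom: "\<lbrakk>a \<in> topspace T; b \<in> topspace T\<rbrakk> \<Longrightarrow> \<theta> (a \<cdot> b) = \<theta> a \<star> \<theta> b"
begin

lemma image_lideal: "A.lideal N \<Longrightarrow> B.lideal (\<theta> ` N)"
proof -
  assume N: "A.lideal N"
  have "e' \<star> \<theta> n \<in> \<theta> ` N" if e': "e' \<in> topspace T'" and n: "n \<in> N" for e' n
  proof -
    obtain e where e: "e \<in> topspace T" "e' = \<theta> e" using e' surj by blast
    have "e' \<star> \<theta> n = \<theta> (e \<cdot> n)" using e n N hom by (auto simp: A.lideal_def)
    then show ?thesis using e n N by (auto simp: A.lideal_def)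
  qed
  moreover have "\<theta> ` N \<subseteq> topspace T'" "N \<noteq> {}" using N surj by (auto simp: A.lideal_def)
  ultimately show ?thesis unfolding B.lideal_def by blast
qed

lemma image_min_lideal:
  assumes "A.min_lideal M"
  shows "B.min_lideal (\<theta> ` M)"
proof -
  have M: "A.lideal M" using assms by (simp add: A.min_lideal_def)
  have "L = \<theta> ` M" if L: "B.lideal L" "L \<subseteq> \<theta> ` M" for L
  proof -
    have "A.lideal {m\<in>M. \<theta> m \<in> L}"
      unfolding A.lideal_def
    proof (intro conjI ballI)
      show "{m\<in>M. \<theta> m \<in> L} \<noteq> {}" using L unfolding B.lideal_def by blast
      show "{m\<in>M. \<theta> m \<in> L} \<subseteq> topspace T" using M unfolding A.lideal_def by blast
      show "e \<cdot> n \<in> {m\<in>M. \<theta> m \<in> L}" if "e \<in> topspace T" "n \<in> {m\<in>M. \<theta> m \<in> L}" for e n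
      proof -
        have "n \<in> topspace T" "\<theta> e \<in> topspace T'" using that M surj by (auto simp: A.lideal_def)
        then show ?thesis using that M L hom[of e n] by (auto simp: A.lideal_def B.lideal_def)
      qed
    qed
    then have "{m\<in>M. \<theta> m \<in> L} = M" using assms unfolding A.min_lideal_def by blast
    then show ?thesis using L by blast
  qed
  then show ?thesis using image_lideal[OF M] unfolding B.min_lideal_def by blast
qed

lemma image_ellis:
  assumes "A.min_lideal M" "u \<in> M"
  shows "\<theta> ` (\<cdot>) u ` M = (\<star>) (\<theta> u) ` \<theta> ` M"
proof -
  have "\<theta> (u \<cdot> m) = \<theta> u \<star> \<theta> m" if "m \<in> M" for m
    using hom A.min_lidealD(2)[OF assms(1)] assms(2) that by blast
  then show ?thesis by (simp add: image_image)
qed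

text \<open>Finiteness of an Ellis group is a statement about all pairs of a minimal left ideal and
  an idempotent, so passing it to a quotient requires lifting such pairs. \<open>M\<close> is chosen
  inside the preimage of \<open>N\<close>, and \<open>u\<close> is an idempotent of the closed
  subsemigroup formed by the fibre of \<open>M\<close> over \<open>v\<close>.\<close>

lemma lift_min_lideal_idempotent:
  assumes N: "B.min_lideal N" "v \<in> N" "v \<star> v = v"
  shows "\<exists>M u. A.min_lideal M \<and> u \<in> M \<and> u \<cdot> u = u \<and> (\<star>) v ` N = \<theta> ` (\<cdot>) u ` M"
proof -
  have "A.lideal {a\<in>topspace T. \<theta> a \<in> N}"
    unfolding A.lideal_def
  proof (intro conjI ballI)
    show "{a\<in>topspace T. \<theta> a \<in> N} \<noteq> {}"
      using B.min_lidealD(2)[OF N(1)] N(2) surj by (smt (verit) Collect_empty_eq image_iff subset_iff)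
    show "e \<cdot> n \<in> {a\<in>topspace T. \<theta> a \<in> N}" if "e \<in> topspace T" "n \<in> {a\<in>topspace T. \<theta> a \<in> N}" for e n
      using that hom[of e n] B.min_lidealD(3)[OF N(1), of "\<theta> e" "\<theta> n"] surj by auto
  qed blast
  then obtain M where M: "M \<subseteq> {a\<in>topspace T. \<theta> a \<in> N}" "A.min_lideal M"
    using A.exists_min_lideal by blast
  have "B.lideal (\<theta> ` M)" "\<theta> ` M \<subseteq> N" using M image_lideal by (auto simp: A.min_lideal_def)
  then have MN: "\<theta> ` M = N" using N unfolding B.min_lideal_def by blast
  have vE: "v \<in> topspace T'" using B.min_lidealD(2)[OF N(1)] N(2) by blast
  have "\<exists>e\<in>{a\<in>M. \<theta> a = v}. e \<cdot> e = e"
  proof (rule A.exists_idempotent)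
    have "closedin T {a\<in>topspace T. \<theta> a \<in> {v}}"
      using closedin_continuous_map_preimage[OF contmap] closedin_Hausdorff_singleton[OF B.Hausdorff] vE by blast
    then have "closedin T (M \<inter> {a\<in>topspace T. \<theta> a \<in> {v}})"
      using A.closedin_min_lideal[OF M(2)] by blast
    moreover have "M \<inter> {a\<in>topspace T. \<theta> a \<in> {v}} = {a\<in>M. \<theta> a = v}" using M by auto
    ultimately show "closedin T {a\<in>M. \<theta> a = v}" by simp
    show "{a\<in>M. \<theta> a = v} \<noteq> {}" using MN N by auto
    show "a \<cdot> b \<in> {a\<in>M. \<theta> a = v}" if "a \<in> {a\<in>M. \<theta> a = v}" "b \<in> {a\<in>M. \<theta> a = v}" for a b
      using that A.min_lidealD(2,3)[OF M(2)] hom[of a b] N(3) by (auto simp: subset_iff)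
  qed
  then obtain u where u: "u \<in> M" "\<theta> u = v" "u \<cdot> u = u" by blast
  then show ?thesis using M MN image_ellis by blast
qed

end

section \<open>Ellis semigroups of flows\<close>

lemma flowD:
  assumes "flow G \<tau> X act"
  shows "topological_group G \<tau>" "compact_space X" "Hausdorff_space X"
    "group_action G (topspace X) act" "group G" "topspace \<tau> = carrier G"
    "continuous_map (prod_topology \<tau> X) X (\<lambda>(g, x). act g x)"
  using assms by (auto simp: flow_def topological_group_def)

lemma flow_act:
  assumes "flow G \<tau> X act" "g \<in> carrier G"
  shows "act g \<in> topspace X \<rightarrow>\<^sub>E topspace X" "bij_betw (act g) (topspace X) (topspace X)"
    "\<And>x. x \<in> topspace X \<Longrightarrow> act g x \<in> topspace X"
proof -
  interpret group_action G "topspace X" act using flowD[OF assms(1)] by simp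
  have "act g \<in> Bij (topspace X)" using bij_prop0[OF assms(2)] by (simp add: BijGroup_def)
  then show "act g \<in> topspace X \<rightarrow>\<^sub>E topspace X" "bij_betw (act g) (topspace X) (topspace X)"
    by (auto simp: Bij_def PiE_iff bij_betw_def)
  then show "\<And>x. x \<in> topspace X \<Longrightarrow> act g x \<in> topspace X" by auto
qed

lemma flow_act_mult:
  assumes "flow G \<tau> X act" "g \<in> carrier G" "h \<in> carrier G"
  shows "act (g \<otimes>\<^bsub>G\<^esub> h) = compose (topspace X) (act g) (act h)"
proof -
  interpret group_action G "topspace X" act using flowD[OF assms(1)] by simp
  show ?thesis
    using assms composition_rule flow_act[OF assms(1)] group.is_monoid[OF flowD(5)[OF assms(1)]]
    by (intro extensionalityI[where A = "topspace X"]) (auto simp: compose_def PiE_iff monoid.m_closed)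
qed

lemma flow_act_one:
  assumes "flow G \<tau> X act" "x \<in> topspace X"
  shows "act \<one>\<^bsub>G\<^esub> x = x"
proof -
  interpret group_action G "topspace X" act using flowD[OF assms(1)] by simp
  show ?thesis using id_eq_one assms(2) by (metis restrict_apply')
qed

lemma flow_act_continuous:
  assumes "flow G \<tau> X act" "g \<in> carrier G"
  shows "continuous_map X X (act g)"
proof -
  have "continuous_map X (prod_topology \<tau> X) (\<lambda>x. (g, x))"
    using assms(2) flowD(6)[OF assms(1)] by (simp add: continuous_map_pairwise o_def)
  from continuous_map_compose[OF this flowD(7)[OF assms(1)]] show ?thesis by (simp add: o_def)
qed

lemma compact_Hausdorff_self_maps:
  assumes "compact_space X" "Hausdorff_space X"
  shows "compact_space (self_maps X)" "Hausdorff_space (self_maps X)"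
  using assms by (auto simp: compact_space_product_topology Hausdorff_space_product_topology)

lemma continuous_map_compose_right:
  assumes "b \<in> topspace (self_maps X)"
  shows "continuous_map (self_maps X) (self_maps X) (\<lambda>f. compose (topspace X) f b)"
  unfolding continuous_map_componentwise
proof (intro conjI ballI)
  fix k assume k: "k \<in> topspace X"
  then have "b k \<in> topspace X" using assms by auto
  then show "continuous_map (self_maps X) X (\<lambda>f. compose (topspace X) f b k)"
    using k continuous_map_product_projection[of "b k" "topspace X" "\<lambda>_. X"] by (simp add: compose_def)
qed auto

lemma continuous_map_compose_left:
  assumes "continuous_map X X h"
  shows "continuous_map (self_maps X) (self_maps X) (\<lambda>f. compose (topspace X) h f)"
  unfolding continuous_map_componentwise
proof (intro conjI ballI)
  fix k assume k: "k \<in> topspace X"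
  then show "continuous_map (self_maps X) X (\<lambda>f. compose (topspace X) h f k)"
    using continuous_map_compose[OF continuous_map_product_projection[OF k] assms]
    by (simp add: compose_def o_def)
qed auto

definition EL_topology where
  "EL_topology G X act = subtopology (self_maps X) (EL G X act)"

context
  fixes G \<tau> X act assumes flow: "flow G \<tau> X act"
begin

lemma act_image_subset: "act ` carrier G \<subseteq> topspace (self_maps X)"
  using flow_act(1)[OF flow] by auto

lemma EL_subset: "EL G X act \<subseteq> topspace (self_maps X)"
  unfolding EL_def by (rule closure_of_subset_topspace)

lemma EL_in_PiE: "f \<in> EL G X act \<Longrightarrow> f \<in> topspace X \<rightarrow>\<^sub>E topspace X"
  using EL_subset by auto

lemma act_in_EL: "g \<in> carrier G \<Longrightarrow> act g \<in> EL G X act"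
  unfolding EL_def using closure_of_subset[OF act_image_subset] by auto

lemma topspace_EL_topology: "topspace (EL_topology G X act) = EL G X act"
  unfolding EL_topology_def using EL_subset by auto

lemma closedin_EL: "closedin (self_maps X) (EL G X act)"
  by (simp add: EL_def)

text \<open>Two closure arguments, one for each factor. With \<open>act g\<close> on the left,
  continuity of \<open>act g\<close> allows a limit in the right factor; for a fixed right factor, a
  limit in the left factor is always allowed.\<close>

lemma EL_compose:
  assumes "f \<in> EL G X act" "h \<in> EL G X act"
  shows "compose (topspace X) f h \<in> EL G X act"
proof -
  have 1: "compose (topspace X) (act g) h \<in> EL G X act" if g: "g \<in> carrier G" for g
  proof -
    have "(\<lambda>f. compose (topspace X) (act g) f) ` (self_maps X closure_of (act ` carrier G))
        \<subseteq> self_maps X closure_of ((\<lambda>f. compose (topspace X) (act g) f) ` act ` carrier G)"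
      using continuous_map_image_closure_subset
        [OF continuous_map_compose_left[OF flow_act_continuous[OF flow g]]] .
    also have "\<dots> \<subseteq> EL G X act" unfolding EL_def
      using g flow_act_mult[OF flow g] group.is_monoid[OF flowD(5)[OF flow]]
      by (intro closure_of_mono) (auto simp: image_iff monoid.m_closed dest!: sym[of "act _"]; metis monoid.m_closed)
    finally show ?thesis using assms(2) unfolding EL_def by blast
  qed
  have "(\<lambda>f. compose (topspace X) f h) ` (self_maps X closure_of (act ` carrier G))
        \<subseteq> self_maps X closure_of ((\<lambda>f. compose (topspace X) f h) ` act ` carrier G)"
    using continuous_map_image_closure_subset[OF continuous_map_compose_right, of h] assms(2) EL_subset by blast
  also have "\<dots> \<subseteq> EL G X act"
    using 1 by (intro closure_of_minimal closedin_EL) auto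
  finally show ?thesis using assms(1) unfolding EL_def by blast
qed

lemma EL_semigroup: "compact_right_semigroup (EL_topology G X act) (compose (topspace X))"
proof
  note cH = compact_Hausdorff_self_maps[OF flowD(2,3)[OF flow]]
  show "compact_space (EL_topology G X act)"
    unfolding EL_topology_def using cH closedin_EL closedin_compact_space compactin_subspace by blast
  show "Hausdorff_space (EL_topology G X act)"
    unfolding EL_topology_def using cH Hausdorff_space_subtopology by blast
  fix a b assume "a \<in> topspace (EL_topology G X act)" "b \<in> topspace (EL_topology G X act)"
  then have ab: "a \<in> EL G X act" "b \<in> EL G X act" by (auto simp: topspace_EL_topology)
  then show "compose (topspace X) a b \<in> topspace (EL_topology G X act)"
    by (simp add: topspace_EL_topology EL_compose)
  show "compose (topspace X) (compose (topspace X) a b) c = compose (topspace X) a (compose (topspace X) b c)"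
    if "c \<in> topspace (EL_topology G X act)" for c
  proof -
    have "c \<in> topspace X \<rightarrow> topspace X" using that EL_in_PiE by (auto simp: topspace_EL_topology)
    then show ?thesis unfolding compose_def by (intro restrict_ext) auto
  qed
  show "continuous_map (EL_topology G X act) (EL_topology G X act) (\<lambda>a. compose (topspace X) a b)"
    unfolding EL_topology_def continuous_map_in_subtopology
    using continuous_map_compose_right[of b X] ab EL_subset EL_compose
    by (auto intro: continuous_map_from_subtopology)
qed

interpretation S: compact_right_semigroup "EL_topology G X act" "compose (topspace X)"
  by (rule EL_semigroup)

lemma left_ideal_iff: "left_ideal G X act N \<longleftrightarrow> S.lideal N"
  unfolding left_ideal_def S.lideal_def by (simp add: topspace_EL_topology)

lemma minimal_left_ideal_iff: "minimal_left_ideal G X act N \<longleftrightarrow> S.min_lideal N"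
  unfolding minimal_left_ideal_def S.min_lideal_def by (simp add: left_ideal_iff)

lemma finite_ellis_group_iff:
  "finite_ellis_group G X act \<longleftrightarrow>
    (\<forall>M u. S.min_lideal M \<and> u \<in> M \<and> compose (topspace X) u u = u \<longrightarrow> finite (compose (topspace X) u ` M))"
  unfolding finite_ellis_group_def by (simp add: minimal_left_ideal_iff ellis_idempotent_def ellis_group_def)

lemma group_ellis_group:
  assumes "minimal_left_ideal G X act M" "u \<in> M" "ellis_idempotent X u"
  shows "group (ellis_group X M u)"
  unfolding ellis_group_def
  using S.group_ellis assms by (simp add: minimal_left_ideal_iff ellis_idempotent_def)

text \<open>For \<open>f = \<eta>u\<close> of finite image, \<open>h \<mapsto> fhf\<close> is injective on \<open>uM\<close>, and \<open>fhf\<close> is determined by a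
  self-map of the image of \<open>f\<close>.\<close>

lemma finite_ellis_group_if_finite_image:
  assumes "\<eta> \<in> EL G X act" "finite (\<eta> ` topspace X)"
  shows "finite_ellis_group G X act"
  unfolding finite_ellis_group_iff
proof (intro allI impI, elim conjE)
  let ?A = "topspace X"
  let ?c = "compose ?A"
  fix M u assume M: "S.min_lideal M" and u: "u \<in> M" "?c u u = u"
  define f where "f = ?c \<eta> u"
  have ME: "m \<in> EL G X act" if "m \<in> M" for m
    using S.min_lideal_in_space[OF M u] that by (simp add: topspace_EL_topology)
  have fM: "f \<in> M" unfolding f_def using S.min_lidealD(3)[OF M] assms u by (simp add: topspace_EL_topology)
  have uE: "u \<in> EL G X act" "f \<in> EL G X act" using u fM ME by auto
  have fF: "f \<in> ?A \<rightarrow>\<^sub>E ?A" "u \<in> ?A \<rightarrow>\<^sub>E ?A" using uE EL_in_PiE by auto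
  have "finite (f ` ?A)"
    using fF(2) by (intro finite_subset[OF _ assms(2)]) (auto simp: f_def compose_def)
  then have fin: "finite (f ` ?A \<rightarrow>\<^sub>E f ` ?A)" by (simp add: finite_PiE)
  note as = S.assoc[unfolded topspace_EL_topology]
  have inj: "inj_on (\<lambda>h. ?c f (?c h f)) (?c u ` M)"
  proof (rule inj_onI)
    fix h k assume h: "h \<in> ?c u ` M" and k: "k \<in> ?c u ` M" and eq: "?c f (?c h f) = ?c f (?c k f)"
    obtain b where b: "b \<in> ?c u ` M" "?c b f = u" using S.ellis_left_inverse[OF M u fM] by blast
    have bE: "b \<in> EL G X act" using b S.ellis_subset[OF M u] ME by blast
    have "?c b f \<in> M" using b u by simp
    \<comment> \<open>\<open>f b\<close> need not be \<open>u\<close>, but \<open>u f b = u\<close>.\<close>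
    have key: "x = ?c (?c b (?c f (?c x f))) b" if x: "x \<in> ?c u ` M" for x
    proof -
      have xE: "x \<in> EL G X act" and xM: "x \<in> M" using x S.ellis_subset[OF M u] ME by auto
      have uf: "?c u f \<in> ?c u ` M" using fM by blast
      interpret Gr: group "\<lparr>carrier = ?c u ` M, mult = ?c, one = u\<rparr>" using S.group_ellis[OF M u] .
      have bu: "?c b u = b" using S.right_identity[OF M u] S.ellis_subset[OF M u] b by blast
      have "?c b (?c u f) = u" using b bu as bE uE by metis
      \<comment> \<open>The product \<open>u f\<close> lies in the group \<open>u M\<close>,
        although \<open>f\<close> itself need not; there the left inverse \<open>b\<close> is also a
        right inverse.\<close>
      then have "?c (?c u f) b = u" using Gr.inv_comm[of b "?c u f"] b(1) uf by simp
      moreover have "?c x u = x" using S.right_identity[OF M u] xM by blast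
      ultimately have "?c (?c x f) b = x"
        using as xE uE bE by (metis EL_compose)
      moreover have "?c b (?c f (?c x f)) = ?c x f"
        using as xE uE bE b S.ellis_left_identity[OF M u x] by (metis EL_compose)
      ultimately show ?thesis by simp
    qed
    show "h = k" using key[OF h] key[OF k] eq by metis
  qed
  have "finite ((\<lambda>h. ?c f (?c h f)) ` (?c u ` M))"
  proof (rule finite_subset)
    show "(\<lambda>h. ?c f (?c h f)) ` (?c u ` M) \<subseteq> (\<lambda>r. \<lambda>x\<in>?A. r (f x)) ` (f ` ?A \<rightarrow>\<^sub>E f ` ?A)"
    proof (rule image_subsetI)
      fix h assume h: "h \<in> ?c u ` M"
      then have hF: "h \<in> ?A \<rightarrow>\<^sub>E ?A" using S.ellis_subset[OF M u] ME EL_in_PiE by blast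
      show "?c f (?c h f) \<in> (\<lambda>r. \<lambda>x\<in>?A. r (f x)) ` (f ` ?A \<rightarrow>\<^sub>E f ` ?A)"
      proof (rule image_eqI[where x = "\<lambda>y\<in>f ` ?A. f (h y)"])
        show "?c f (?c h f) = (\<lambda>x\<in>?A. (\<lambda>y\<in>f ` ?A. f (h y)) (f x))"
          by (auto simp: compose_def)
        show "(\<lambda>y\<in>f ` ?A. f (h y)) \<in> f ` ?A \<rightarrow>\<^sub>E f ` ?A" using hF fF by auto
      qed
    qed
  qed (use fin in simp)
  then show "finite (?c u ` M)" using inj finite_imageD by blast
qed

end

text \<open>The choice of the preimage of \<open>y\<close> does not matter for \<open>\<eta>\<close> in the Ellis semigroup.\<close>

definition EL_map :: "'x topology \<Rightarrow> 'y topology \<Rightarrow> ('x \<Rightarrow> 'y) \<Rightarrow> ('x \<Rightarrow> 'x) \<Rightarrow> 'y \<Rightarrow> 'y" where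
  "EL_map X Y f \<eta> = (\<lambda>y\<in>topspace Y. f (\<eta> (inv_into (topspace X) f y)))"

section \<open>Homomorphisms of Ellis semigroups induced by flow epimorphisms\<close>

context
  fixes G :: "('g, 'b) monoid_scheme" and \<tau> X act Y actY f
  assumes flX: "flow G \<tau> X act" and flY: "flow G \<tau> Y actY" and epi: "flow_epi G X act Y actY f"
begin

lemma flow_epiD:
  "continuous_map X Y f" "f ` topspace X = topspace Y"
  "\<And>g x. \<lbrakk>g \<in> carrier G; x \<in> topspace X\<rbrakk> \<Longrightarrow> f (act g x) = actY g (f x)"
  using epi by (auto simp: flow_epi_def)

text \<open>The equation is a closed condition on \<open>\<eta>\<close>, because \<open>Y\<close> is
  Hausdorff and evaluation is continuous. It holds for the maps \<open>act g\<close> by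
  equivariance, hence on their closure.\<close>

lemma EL_respects_fibres:
  assumes "\<eta> \<in> EL G X act" "x \<in> topspace X" "y \<in> topspace X" "f x = f y"
  shows "f (\<eta> x) = f (\<eta> y)"
proof -
  have "continuous_map (self_maps X) Y (\<lambda>\<eta>. f (\<eta> z))" if "z \<in> topspace X" for z
    using continuous_map_compose[OF continuous_map_product_projection[OF that] flow_epiD(1)] by (simp add: o_def)
  moreover have "f (h x) = f (h y)" if "h \<in> act ` carrier G" for h
    using that flow_epiD(3) assms by auto
  ultimately show ?thesis
    using forall_in_closure_of_eq[of \<eta> "self_maps X" "act ` carrier G" Y "\<lambda>\<eta>. f (\<eta> x)" "\<lambda>\<eta>. f (\<eta> y)"]
      assms flowD(3)[OF flY] unfolding EL_def by blast
qed

lemma EL_map_apply: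
  assumes "\<eta> \<in> EL G X act" "x \<in> topspace X"
  shows "EL_map X Y f \<eta> (f x) = f (\<eta> x)"
proof -
  have "f x \<in> topspace Y" using flow_epiD(2) assms(2) by auto
  moreover have "f (inv_into (topspace X) f (f x)) = f x" "inv_into (topspace X) f (f x) \<in> topspace X"
    using assms(2) by (simp_all add: f_inv_into_f inv_into_into)
  ultimately show ?thesis
    unfolding EL_map_def using EL_respects_fibres[OF assms(1) _ assms(2)] by (metis restrict_apply')
qed

lemma EL_map_act: "g \<in> carrier G \<Longrightarrow> EL_map X Y f (act g) = actY g"
proof (rule extensionalityI[where A = "topspace Y"])
  assume g: "g \<in> carrier G"
  show "actY g \<in> extensional (topspace Y)" using flow_act(1)[OF flY g] by (auto simp: PiE_iff)
  fix y assume "y \<in> topspace Y"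
  then obtain x where "x \<in> topspace X" "y = f x" using flow_epiD(2) by blast
  then show "EL_map X Y f (act g) y = actY g y"
    using EL_map_apply[OF act_in_EL[OF flX g]] flow_epiD(3) g by simp
qed (auto simp: EL_map_def)

lemma continuous_map_EL_map: "continuous_map (EL_topology G X act) (self_maps Y) (EL_map X Y f)"
  unfolding continuous_map_componentwise
proof (intro conjI ballI)
  fix y assume y: "y \<in> topspace Y"
  then have i: "inv_into (topspace X) f y \<in> topspace X" by (simp add: flow_epiD(2) inv_into_into)
  have "continuous_map (self_maps X) Y (\<lambda>\<eta>. f (\<eta> (inv_into (topspace X) f y)))"
    using continuous_map_compose[OF continuous_map_product_projection[OF i] flow_epiD(1)] by (simp add: o_def)
  then show "continuous_map (EL_topology G X act) Y (\<lambda>\<eta>. EL_map X Y f \<eta> y)"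
    unfolding EL_topology_def EL_map_def using y by (simp add: continuous_map_from_subtopology)
qed (auto simp: EL_map_def)

text \<open>Continuity sends the closure of the acting group into the closure of its image.
  Conversely the image of \<open>EL\<close> is compact, hence closed, and contains the maps
  \<open>actY g\<close>; this gives surjectivity.\<close>

lemma EL_map_crs_hom:
  "crs_hom (EL_topology G X act) (compose (topspace X)) (EL_topology G Y actY) (compose (topspace Y)) (EL_map X Y f)"
proof -
  interpret A: compact_right_semigroup "EL_topology G X act" "compose (topspace X)"
    by (rule EL_semigroup[OF flX])
  interpret B: compact_right_semigroup "EL_topology G Y actY" "compose (topspace Y)"
    by (rule EL_semigroup[OF flY])
  have im: "EL_map X Y f ` act ` carrier G = actY ` carrier G"
    using EL_map_act by (force simp: image_image)
  have "EL_topology G X act closure_of (act ` carrier G) = EL G X act"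
    unfolding EL_topology_def EL_def
    using closure_of_subset[OF act_image_subset[OF flX]] by (simp add: closure_of_subtopology Int_absorb1)
  then have "EL_map X Y f ` EL G X act \<subseteq> EL G Y actY"
    using continuous_map_image_closure_subset[OF continuous_map_EL_map, of "act ` carrier G"] im
    by (simp add: EL_def)
  moreover have "EL G Y actY \<subseteq> EL_map X Y f ` EL G X act"
    unfolding EL_def[of G Y]
  proof (rule closure_of_minimal)
    show "actY ` carrier G \<subseteq> EL_map X Y f ` EL G X act"
      using im act_in_EL[OF flX] by blast
    have "compactin (self_maps Y) (EL_map X Y f ` topspace (EL_topology G X act))"
      using A.compact continuous_map_EL_map image_compactin compact_space_def by blast
    then show "closedin (self_maps Y) (EL_map X Y f ` EL G X act)"
      using compact_Hausdorff_self_maps(2)[OF flowD(2,3)[OF flY]] compactin_imp_closedin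
      by (simp add: topspace_EL_topology[OF flX])
  qed
  ultimately have sur: "EL_map X Y f ` EL G X act = EL G Y actY" by blast
  show ?thesis
  proof
    show "continuous_map (EL_topology G X act) (EL_topology G Y actY) (EL_map X Y f)"
      using continuous_map_EL_map sur topspace_EL_topology[OF flX]
      unfolding EL_topology_def[of G Y] continuous_map_in_subtopology by auto
    show "EL_map X Y f ` topspace (EL_topology G X act) = topspace (EL_topology G Y actY)"
      using sur by (simp add: topspace_EL_topology[OF flX] topspace_EL_topology[OF flY])
    fix a b assume "a \<in> topspace (EL_topology G X act)" "b \<in> topspace (EL_topology G X act)"
    then have ab: "a \<in> EL G X act" "b \<in> EL G X act" by (auto simp: topspace_EL_topology[OF flX])
    show "EL_map X Y f (compose (topspace X) a b) = compose (topspace Y) (EL_map X Y f a) (EL_map X Y f b)"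
    proof (rule extensionalityI[where A = "topspace Y"])
      fix y assume "y \<in> topspace Y"
      then obtain x where x: "x \<in> topspace X" "y = f x" using flow_epiD(2) by blast
      have "b x \<in> topspace X" using EL_in_PiE[OF flX ab(2)] x by auto
      then show "EL_map X Y f (compose (topspace X) a b) y = compose (topspace Y) (EL_map X Y f a) (EL_map X Y f b) y"
        using x ab EL_compose[OF flX ab] EL_map_apply \<open>y \<in> topspace Y\<close> by (simp add: compose_def)
    qed (auto simp: EL_map_def)
  qed
qed

lemma finite_ellis_group_epi:
  assumes "finite_ellis_group G X act"
  shows "finite_ellis_group G Y actY"
proof -
  interpret crs_hom "EL_topology G X act" "compose (topspace X)" "EL_topology G Y actY" "compose (topspace Y)" "EL_map X Y f"
    by (rule EL_map_crs_hom)
  show ?thesis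
    unfolding finite_ellis_group_iff[OF flY]
  proof (intro allI impI, elim conjE)
    fix N v assume "B.min_lideal N" "v \<in> N" "compose (topspace Y) v v = v"
    then obtain M u where "A.min_lideal M" "u \<in> M" "compose (topspace X) u u = u"
      and eq: "compose (topspace Y) v ` N = EL_map X Y f ` compose (topspace X) u ` M"
      using lift_min_lideal_idempotent by meson
    then have "finite (compose (topspace X) u ` M)"
      using assms unfolding finite_ellis_group_iff[OF flX] by blast
    then show "finite (compose (topspace Y) v ` N)" using eq by simp
  qed
qed

text \<open>The image is itself an Ellis group of \<open>Y\<close>, namely the one belonging to the
  images of \<open>M\<close> and \<open>u\<close>.\<close>

lemma finite_image_ellis_group:
  assumes "finite_ellis_group G Y actY" "minimal_left_ideal G X act M" "u \<in> M" "ellis_idempotent X u"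
  shows "finite (EL_map X Y f ` carrier (ellis_group X M u))"
proof -
  interpret crs_hom "EL_topology G X act" "compose (topspace X)" "EL_topology G Y actY" "compose (topspace Y)" "EL_map X Y f"
    by (rule EL_map_crs_hom)
  have M: "A.min_lideal M" using assms(2) minimal_left_ideal_iff[OF flX] by blast
  have uE: "u \<in> topspace (EL_topology G X act)" using A.min_lidealD(2)[OF M] assms(3) by blast
  have "B.min_lideal (EL_map X Y f ` M)" using M image_min_lideal by blast
  moreover have "compose (topspace Y) (EL_map X Y f u) (EL_map X Y f u) = EL_map X Y f u"
    using hom[OF uE uE] assms(4) by (simp add: ellis_idempotent_def)
  ultimately have "finite (compose (topspace Y) (EL_map X Y f u) ` EL_map X Y f ` M)"
    using assms(1,3) unfolding finite_ellis_group_iff[OF flY] by blast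
  then show ?thesis using image_ellis[OF M assms(3)] by (simp add: ellis_group_def)
qed

end

lemma finite_ellis_group_joint:
  assumes flX: "flow G \<tau> X act"
    and Y: "flow G \<tau> Y actY" "flow_epi G X act Y actY f" "finite_ellis_group G Y actY"
    and Z: "flow G \<tau> Z actZ" "flow_epi G X act Z actZ h" "finite_ellis_group G Z actZ"
    and joint: "\<And>x y. \<lbrakk>x \<in> topspace X; y \<in> topspace X; f x = f y; h x = h y\<rbrakk> \<Longrightarrow> x = y"
  shows "finite_ellis_group G X act"
  unfolding finite_ellis_group_def
proof (intro allI impI, elim conjE)
  fix M u assume Mu: "minimal_left_ideal G X act M" "u \<in> M" "ellis_idempotent X u"
  let ?c = "carrier (ellis_group X M u)"
  have EL: "a \<in> EL G X act" if "a \<in> ?c" for a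
  proof -
    interpret S: compact_right_semigroup "EL_topology G X act" "compose (topspace X)"
      by (rule EL_semigroup[OF flX])
    have M: "S.min_lideal M" and u: "compose (topspace X) u u = u"
      using Mu minimal_left_ideal_iff[OF flX] by (auto simp: ellis_idempotent_def)
    show ?thesis
      using S.min_lideal_in_space(1)[OF M Mu(2) u S.ellis_subset[OF M Mu(2) u]] that
      by (simp add: ellis_group_def topspace_EL_topology[OF flX])
  qed
  have "inj_on (\<lambda>a. (EL_map X Y f a, EL_map X Z h a)) ?c"
  proof (rule inj_onI)
    fix a b assume ab: "a \<in> ?c" "b \<in> ?c"
      "(EL_map X Y f a, EL_map X Z h a) = (EL_map X Y f b, EL_map X Z h b)"
    have F: "a \<in> topspace X \<rightarrow>\<^sub>E topspace X" "b \<in> topspace X \<rightarrow>\<^sub>E topspace X"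
      using EL ab EL_in_PiE[OF flX] by auto
    show "a = b"
    proof (rule PiE_ext[OF F])
      fix x assume x: "x \<in> topspace X"
      have "f (a x) = f (b x)" 
        using EL_map_apply[OF flX Y(1,2) EL[OF ab(1)] x] EL_map_apply[OF flX Y(1,2) EL[OF ab(2)] x] ab(3) by simp
      moreover have "h (a x) = h (b x)" 
        using EL_map_apply[OF flX Z(1,2) EL[OF ab(1)] x] EL_map_apply[OF flX Z(1,2) EL[OF ab(2)] x] ab(3) by simp
      ultimately show "a x = b x" using joint F x by (auto simp: PiE_iff)
    qed
  qed
  moreover have "(\<lambda>a. (EL_map X Y f a, EL_map X Z h a)) ` ?c \<subseteq> EL_map X Y f ` ?c \<times> EL_map X Z h ` ?c"
    by auto
  moreover have "finite (EL_map X Y f ` ?c \<times> EL_map X Z h ` ?c)"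
    using finite_image_ellis_group[OF flX Y(1,2,3) Mu] finite_image_ellis_group[OF flX Z(1,2,3) Mu] by simp
  ultimately show "finite ?c" by (metis (no_types, lifting) finite_imageD finite_subset)
qed

section \<open>The \<open>\<tau>\<close>-topology\<close>

lemma closure_of_meets:
  "\<lbrakk>x \<in> X closure_of S; openin X U; x \<in> U\<rbrakk> \<Longrightarrow> \<exists>y\<in>S. y \<in> U"
  by (auto simp: in_closure_of)

text \<open>All later arguments about the \<tau>-topology use this neighbourhood form. From right to
  left, the sets of pairs \<open>(g, b)\<close> with \<open>act g \<in> U\<close> and
  \<open>compose (topspace X) (act g) b \<in> W\<close> form a filter base, since pairs of
  neighbourhoods can be intersected; its filter has the two required limits.\<close>

lemma in_ellis_circ_iff:
  "f \<in> ellis_circ G X act a B \<longleftrightarrow>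
     a \<in> topspace (self_maps X) \<and> f \<in> topspace (self_maps X) \<and>
     (\<forall>U W. openin (self_maps X) U \<and> a \<in> U \<and> openin (self_maps X) W \<and> f \<in> W \<longrightarrow>
        (\<exists>g\<in>carrier G. \<exists>b\<in>B. act g \<in> U \<and> compose (topspace X) (act g) b \<in> W))"
  (is "?L \<longleftrightarrow> ?R")
proof
  assume ?L
  then obtain F where F: "F \<noteq> bot" "eventually (\<lambda>(g, b). g \<in> carrier G \<and> b \<in> B) F"
      "limitin (self_maps X) (\<lambda>(g, b). act g) a F"
      "limitin (self_maps X) (\<lambda>(g, b). compose (topspace X) (act g) b) f F"
    unfolding ellis_circ_def by blast
  show ?R
  proof (intro conjI allI impI)
    show "a \<in> topspace (self_maps X)" "f \<in> topspace (self_maps X)"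
      by (rule limitin_topspace[OF F(3)], rule limitin_topspace[OF F(4)])
    fix U W assume UW: "openin (self_maps X) U \<and> a \<in> U \<and> openin (self_maps X) W \<and> f \<in> W"
    have "eventually (\<lambda>p. (case p of (g, b) \<Rightarrow> act g) \<in> U) F"
      using F(3) UW unfolding limitin_def by blast
    moreover have "eventually (\<lambda>p. (case p of (g, b) \<Rightarrow> compose (topspace X) (act g) b) \<in> W) F"
      using F(4) UW unfolding limitin_def by blast
    ultimately have "eventually (\<lambda>(g, b). g \<in> carrier G \<and> b \<in> B \<and> act g \<in> U \<and>
        compose (topspace X) (act g) b \<in> W) F"
      using F(2) by eventually_elim auto
    then show "\<exists>g\<in>carrier G. \<exists>b\<in>B. act g \<in> U \<and> compose (topspace X) (act g) b \<in> W"
      using eventually_happens'[OF F(1)] by fastforce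
  qed
next
  assume R: ?R
  define N where "N = {(U, W). openin (self_maps X) U \<and> a \<in> U \<and> openin (self_maps X) W \<and> f \<in> W}"
  define P where "P = (\<lambda>(U, W). principal {(g, b). g \<in> carrier G \<and> b \<in> B \<and> act g \<in> U \<and>
        compose (topspace X) (act g) b \<in> W})"
  define F where "F = (INF p\<in>N. P p)"
  have top: "(topspace (self_maps X), topspace (self_maps X)) \<in> N"
    using R by (simp only: N_def mem_Collect_eq case_prod_conv openin_topspace simp_thms)
  then have N: "N \<noteq> {}" by blast
  have ev: "eventually Q F \<longleftrightarrow> (\<exists>p\<in>N. eventually Q (P p))" for Q
    unfolding F_def
  proof (rule eventually_INF_base[OF N])
    fix p q assume pq: "p \<in> N" "q \<in> N"
    obtain U W U' W' where p: "p = (U, W)" "q = (U', W')" by fastforce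
    have "(U \<inter> U', W \<inter> W') \<in> N" using pq p by (auto simp: N_def)
    moreover have "P (U \<inter> U', W \<inter> W') \<le> inf (P p) (P q)" using p by (auto simp: P_def)
    ultimately show "\<exists>x\<in>N. P x \<le> inf (P p) (P q)" by blast
  qed
  have "F \<noteq> bot"
  proof
    assume "F = bot"
    then have "eventually (\<lambda>_. False) F" by simp
    then obtain U W where "(U, W) \<in> N" "eventually (\<lambda>_. False) (P (U, W))" using ev by auto
    then have UW: "openin (self_maps X) U \<and> a \<in> U \<and> openin (self_maps X) W \<and> f \<in> W"
      and "\<And>g b. \<lbrakk>g \<in> carrier G; b \<in> B; act g \<in> U\<rbrakk> \<Longrightarrow> compose (topspace X) (act g) b \<notin> W"
      by (auto simp: P_def eventually_principal N_def)
    moreover have "\<exists>g\<in>carrier G. \<exists>b\<in>B. act g \<in> U \<and> compose (topspace X) (act g) b \<in> W"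
      using R UW by meson
    ultimately show False by blast
  qed
  moreover have "eventually (\<lambda>(g, b). g \<in> carrier G \<and> b \<in> B) F"
    unfolding ev using top by (intro bexI[OF _ top]) (auto simp: P_def eventually_principal)
  moreover have "limitin (self_maps X) (\<lambda>(g, b). act g) a F"
    unfolding limitin_def
  proof (intro conjI allI impI)
    show "a \<in> topspace (self_maps X)" using R by blast
    fix U assume "openin (self_maps X) U \<and> a \<in> U"
    then have "(U, topspace (self_maps X)) \<in> N"
      using R by (simp only: N_def mem_Collect_eq case_prod_conv openin_topspace simp_thms)
    then show "\<forall>\<^sub>F x in F. (case x of (g, b) \<Rightarrow> act g) \<in> U"
      unfolding ev by (rule bexI[rotated]) (auto simp: P_def eventually_principal)
  qed
  moreover have "limitin (self_maps X) (\<lambda>(g, b). compose (topspace X) (act g) b) f F"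
    unfolding limitin_def
  proof (intro conjI allI impI)
    show "f \<in> topspace (self_maps X)" using R by blast
    fix W assume "openin (self_maps X) W \<and> f \<in> W"
    then have "(topspace (self_maps X), W) \<in> N"
      using R by (simp only: N_def mem_Collect_eq case_prod_conv openin_topspace simp_thms)
    then show "\<forall>\<^sub>F x in F. (case x of (g, b) \<Rightarrow> compose (topspace X) (act g) b) \<in> W"
      unfolding ev by (rule bexI[rotated]) (auto simp: P_def eventually_principal)
  qed
  ultimately show ?L unfolding ellis_circ_def by blast
qed

text \<open>Continuity of the group operations is a conclusion here, not an assumption. Compactness
  makes finite intersections of fibres a neighbourhood base, and on such a base the operations are
  continuous because each \<open>\<theta> i\<close> respects products. Only the partition given by
  \<open>\<theta> i\<close> matters, so its target carries no group structure; by compactness this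
  partition is finite.\<close>

lemma profinite_groupI_finite_quotients:
  fixes \<theta> :: "'i \<Rightarrow> 'g \<Rightarrow> 'q" and \<Gamma> :: "('g, 'z) monoid_scheme" (structure)
  assumes grp: "group \<Gamma>" and top: "topspace \<tau> = carrier \<Gamma>" and comp: "compact_space \<tau>"
    and opn: "\<And>i t. i \<in> I \<Longrightarrow> openin \<tau> {x \<in> carrier \<Gamma>. \<theta> i x = t}"
    and cong: "\<And>i x x' y y'. \<lbrakk>i \<in> I; x \<in> carrier \<Gamma>; x' \<in> carrier \<Gamma>; y \<in> carrier \<Gamma>; y' \<in> carrier \<Gamma>;
        \<theta> i x = \<theta> i x'; \<theta> i y = \<theta> i y'\<rbrakk> \<Longrightarrow> \<theta> i (x \<otimes>\<^bsub>\<Gamma>\<^esub> y) = \<theta> i (x' \<otimes>\<^bsub>\<Gamma>\<^esub> y')"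
    and sep: "\<And>x y. \<lbrakk>x \<in> carrier \<Gamma>; y \<in> carrier \<Gamma>; x \<noteq> y\<rbrakk> \<Longrightarrow> \<exists>i\<in>I. \<theta> i x \<noteq> \<theta> i y"
  shows "profinite_group \<Gamma> \<tau>"
proof -
  interpret group \<Gamma> by fact
  define fib where "fib i x = {z \<in> carrier \<Gamma>. \<theta> i z = \<theta> i x}" for i x
  have fib_open: "openin \<tau> (fib i x)" if "i \<in> I" for i x
    using opn[OF that] by (simp add: fib_def)
  have fib_closed: "closedin \<tau> (fib i x)" if "i \<in> I" for i x
  proof -
    have "carrier \<Gamma> - fib i x = (\<Union>y \<in> carrier \<Gamma> - fib i x. fib i y)"
      by (auto simp: fib_def)
    moreover have "openin \<tau> (\<Union>y \<in> carrier \<Gamma> - fib i x. fib i y)"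
      using fib_open[OF that] by blast
    moreover have "fib i x \<subseteq> topspace \<tau>" by (auto simp: fib_def top)
    ultimately show ?thesis by (simp add: closedin_def top)
  qed
  \<comment> \<open>The complement of \<open>U\<close> is compact and, since points are separated,
    covered by the open complements of the fibres through \<open>x\<close>; finitely many indices
    suffice.\<close>
  have nbhd: "\<exists>I0. finite I0 \<and> I0 \<subseteq> I \<and> carrier \<Gamma> \<inter> \<Inter>((\<lambda>i. fib i x) ` I0) \<subseteq> U"
    if U: "openin \<tau> U" and x: "x \<in> U" for U x
  proof -
    have xc: "x \<in> carrier \<Gamma>" using x U openin_subset top by blast
    have K: "compactin \<tau> (carrier \<Gamma> - U)"
      using U comp top closedin_compact_space by (metis closedin_def closedin_topspace openin_closedin_eq openin_diff)
    have cov: "carrier \<Gamma> - U \<subseteq> \<Union>((\<lambda>i. carrier \<Gamma> - fib i x) ` I)"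
    proof
      fix z assume z: "z \<in> carrier \<Gamma> - U"
      then obtain i where "i \<in> I" "\<theta> i z \<noteq> \<theta> i x" using sep[of z x] x xc by auto
      then show "z \<in> \<Union>((\<lambda>i. carrier \<Gamma> - fib i x) ` I)" using z by (auto simp: fib_def)
    qed
    have "\<exists>\<F>. finite \<F> \<and> \<F> \<subseteq> (\<lambda>i. carrier \<Gamma> - fib i x) ` I \<and> carrier \<Gamma> - U \<subseteq> \<Union>\<F>"
      using K cov fib_closed top unfolding compactin_def by (smt (verit) closedin_def image_iff)
    then obtain I0 where "finite I0" "I0 \<subseteq> I" "carrier \<Gamma> - U \<subseteq> \<Union>((\<lambda>i. carrier \<Gamma> - fib i x) ` I0)"
      by (metis finite_subset_image)
    then show ?thesis by (intro exI[where x = I0]) auto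
  qed
  have fin_open: "openin \<tau> (carrier \<Gamma> \<inter> \<Inter>((\<lambda>i. fib i x) ` I0))" if "finite I0" "I0 \<subseteq> I" for I0 x
  proof -
    have "openin \<tau> (\<Inter>((\<lambda>i. fib i x) ` I0) \<inter> topspace \<tau>)"
      using that fib_open by (intro openin_INT) auto
    then show ?thesis by (simp add: top Int_commute)
  qed
  have haus: "Hausdorff_space \<tau>"
    unfolding Hausdorff_space_def
  proof (intro allI impI)
    fix x y assume xy: "x \<in> topspace \<tau> \<and> y \<in> topspace \<tau> \<and> x \<noteq> y"
    then obtain i where "i \<in> I" "\<theta> i x \<noteq> \<theta> i y" using sep[of x y] top by auto
    then show "\<exists>U V. openin \<tau> U \<and> openin \<tau> V \<and> x \<in> U \<and> y \<in> V \<and> disjnt U V"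
      using xy top fib_open[of i x] fib_open[of i y]
      by (intro exI[where x = "fib i x"] exI[where x = "fib i y"]) (auto simp: fib_def disjnt_iff)
  qed
  have cong_inv: "\<theta> i (inv x) = \<theta> i (inv y)"
    if "i \<in> I" "x \<in> carrier \<Gamma>" "y \<in> carrier \<Gamma>" "\<theta> i x = \<theta> i y" for i x y
  proof -
    \<comment> \<open>The left product is \<open>inv x\<close> and the right one is
      \<open>inv y\<close>. They differ only in the middle factor, so compatibility with inverses
      follows from compatibility with products.\<close>
    have "\<theta> i (inv x \<otimes> y \<otimes> inv y) = \<theta> i (inv x \<otimes> x \<otimes> inv y)"
      using that by (intro cong) auto
    then show ?thesis using that by (simp add: m_assoc)
  qed
  have "continuous_map (prod_topology \<tau> \<tau>) \<tau> (\<lambda>(x, y). x \<otimes> y)"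
    unfolding continuous_map_def
  proof (intro conjI allI impI)
    show "(\<lambda>(x, y). x \<otimes> y) \<in> topspace (prod_topology \<tau> \<tau>) \<rightarrow> topspace \<tau>" by (auto simp: top)
    fix U assume U: "openin \<tau> U"
    show "openin (prod_topology \<tau> \<tau>) {p \<in> topspace (prod_topology \<tau> \<tau>). (case p of (x, y) \<Rightarrow> x \<otimes> y) \<in> U}"
    proof (subst openin_subopen, intro ballI)
      fix p assume p: "p \<in> {p \<in> topspace (prod_topology \<tau> \<tau>). (case p of (x, y) \<Rightarrow> x \<otimes> y) \<in> U}"
      obtain x y where xy: "p = (x, y)" by fastforce
      have xyc: "x \<in> carrier \<Gamma>" "y \<in> carrier \<Gamma>" "x \<otimes> y \<in> U" using p xy by (auto simp: top)
      obtain I0 where I0: "finite I0" "I0 \<subseteq> I" and sub: "carrier \<Gamma> \<inter> \<Inter>((\<lambda>i. fib i (x \<otimes> y)) ` I0) \<subseteq> U"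
        using nbhd[OF U xyc(3)] by blast
      let ?A = "\<lambda>x. carrier \<Gamma> \<inter> \<Inter>((\<lambda>i. fib i x) ` I0)"
      have "(a, b) \<in> {p \<in> topspace (prod_topology \<tau> \<tau>). (case p of (x, y) \<Rightarrow> x \<otimes> y) \<in> U}"
        if "a \<in> ?A x" "b \<in> ?A y" for a b
      proof -
        have a: "a \<in> carrier \<Gamma>" "a \<in> \<Inter>((\<lambda>i. fib i x) ` I0)"
          and b: "b \<in> carrier \<Gamma>" "b \<in> \<Inter>((\<lambda>i. fib i y) ` I0)" using that by auto
        have "\<theta> i (a \<otimes> b) = \<theta> i (x \<otimes> y)" if "i \<in> I0" for i
          using a b that xyc I0 by (intro cong) (auto simp: fib_def)
        then have "a \<otimes> b \<in> ?A (x \<otimes> y)" using a b by (auto simp: fib_def)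
        then show ?thesis using sub a b by (auto simp: top)
      qed
      then have "?A x \<times> ?A y \<subseteq> {p \<in> topspace (prod_topology \<tau> \<tau>). (case p of (x, y) \<Rightarrow> x \<otimes> y) \<in> U}"
        by (simp only: subset_iff split_paired_All mem_Times_iff fst_conv snd_conv) blast
      moreover have "openin (prod_topology \<tau> \<tau>) (?A x \<times> ?A y)"
        using fin_open[OF I0] by (simp add: openin_prod_Times_iff)
      moreover have "p \<in> ?A x \<times> ?A y" using xy xyc by (auto simp: fib_def)
      ultimately show "\<exists>T. openin (prod_topology \<tau> \<tau>) T \<and> p \<in> T \<and>
          T \<subseteq> {p \<in> topspace (prod_topology \<tau> \<tau>). (case p of (x, y) \<Rightarrow> x \<otimes> y) \<in> U}" by blast
    qed
  qed
  moreover have "continuous_map \<tau> \<tau> (\<lambda>x. inv x)"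
    unfolding continuous_map_def
  proof (intro conjI allI impI)
    show "(\<lambda>x. inv x) \<in> topspace \<tau> \<rightarrow> topspace \<tau>" by (auto simp: top)
    fix U assume U: "openin \<tau> U"
    show "openin \<tau> {x \<in> topspace \<tau>. inv x \<in> U}"
    proof (subst openin_subopen, intro ballI)
      fix x assume x: "x \<in> {x \<in> topspace \<tau>. inv x \<in> U}"
      then have xc: "x \<in> carrier \<Gamma>" "inv x \<in> U" by (auto simp: top)
      obtain I0 where I0: "finite I0" "I0 \<subseteq> I" and sub: "carrier \<Gamma> \<inter> \<Inter>((\<lambda>i. fib i (inv x)) ` I0) \<subseteq> U"
        using nbhd[OF U xc(2)] by blast
      have "carrier \<Gamma> \<inter> \<Inter>((\<lambda>i. fib i x) ` I0) \<subseteq> {x \<in> topspace \<tau>. inv x \<in> U}"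
      proof
        fix a assume "a \<in> carrier \<Gamma> \<inter> \<Inter>((\<lambda>i. fib i x) ` I0)"
        then have a: "a \<in> carrier \<Gamma>" "a \<in> \<Inter>((\<lambda>i. fib i x) ` I0)" by auto
        have "\<theta> i (inv a) = \<theta> i (inv x)" if "i \<in> I0" for i
          using a that xc I0 by (intro cong_inv) (auto simp: fib_def)
        then have "inv a \<in> carrier \<Gamma> \<inter> \<Inter>((\<lambda>i. fib i (inv x)) ` I0)" using a by (auto simp: fib_def)
        then show "a \<in> {x \<in> topspace \<tau>. inv x \<in> U}" using sub a by (auto simp: top)
      qed
      moreover have "x \<in> carrier \<Gamma> \<inter> \<Inter>((\<lambda>i. fib i x) ` I0)" using xc by (auto simp: fib_def)
      ultimately show "\<exists>T. openin \<tau> T \<and> x \<in> T \<and> T \<subseteq> {x \<in> topspace \<tau>. inv x \<in> U}"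
        using fin_open[OF I0, of x] by blast
    qed
  qed
  moreover have "totally_disconnected \<tau>"
    unfolding totally_disconnected_def
  proof (intro ballI equalityI subsetI)
    fix x y assume x: "x \<in> topspace \<tau>" and y: "y \<in> connected_component_of_set \<tau> x"
    have "quasi_component_of \<tau> x y"
      using y connected_component_subset_quasi_component_of[of \<tau> x] by auto
    then have q: "y \<in> T" if "x \<in> T" "closedin \<tau> T" "openin \<tau> T" for T
      using that by (auto simp: quasi_component_of)
    have "y \<in> fib i x" if "i \<in> I" for i
      using q[OF _ fib_closed[OF that] fib_open[OF that]] x top by (simp add: fib_def)
    moreover have "y \<in> carrier \<Gamma>" using y top connected_component_in_topspace by fastforce
    ultimately show "y \<in> {x}" using sep[of x y] x top by (auto simp: fib_def)
  qed (auto simp: connected_component_of_refl)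
  ultimately show ?thesis
    using haus comp top grp unfolding profinite_group_def topological_group_def by blast
qed

section \<open>The closure operator on \<open>u M\<close>, compactness, and profiniteness from
  finite images\<close>

context
  fixes G \<tau> X act M u
  assumes flow: "flow G \<tau> X act" and min: "minimal_left_ideal G X act M" and u: "u \<in> M"
    and idem: "ellis_idempotent X u"
begin

interpretation S: compact_right_semigroup "EL_topology G X act" "compose (topspace X)"
  by (rule EL_semigroup[OF flow])

abbreviation uM where "uM \<equiv> carrier (ellis_group X M u)"

lemma S_min: "S.min_lideal M" and S_idem: "compose (topspace X) u u = u"
  using min idem minimal_left_ideal_iff[OF flow] by (auto simp: ellis_idempotent_def)

lemma uM_in_M: "a \<in> uM \<Longrightarrow> a \<in> M"
  using S.ellis_subset[OF S_min u S_idem] by (simp add: ellis_group_def)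

lemma M_in_EL: "a \<in> M \<Longrightarrow> a \<in> EL G X act"
  using S.min_lideal_in_space(1)[OF S_min u S_idem] by (simp add: topspace_EL_topology[OF flow])

lemma uM_in_EL: "a \<in> uM \<Longrightarrow> a \<in> EL G X act"
  using M_in_EL uM_in_M by blast

lemma u_compose_uM: "a \<in> uM \<Longrightarrow> compose (topspace X) u a = a"
  using S.ellis_left_identity[OF S_min u S_idem, of a] by (simp only: ellis_group_def partial_object.simps)

lemma u_in_uM: "u \<in> uM"
  using S.ellis_memI[OF S_min u S_idem] u S_idem by (simp add: ellis_group_def)

lemma u_compose_M: "a \<in> M \<Longrightarrow> compose (topspace X) u a \<in> uM"
  by (simp add: ellis_group_def)

lemma tau_closure_mono: "B \<subseteq> B' \<Longrightarrow> tau_closure G X act M u B \<subseteq> tau_closure G X act M u B'"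
  unfolding tau_closure_def in_ellis_circ_iff subset_iff Int_iff by blast

text \<open>Approximating \<open>u\<close> and then \<open>ga\<close>, for \<open>g\<close> close to \<open>u\<close>, shows that \<open>ua\<close> is a \<open>\<tau>\<close>-limit of \<open>B\<close>.\<close>

lemma u_compose_closure_in_ellis_circ:
  assumes "B \<subseteq> EL G X act" "a \<in> self_maps X closure_of B"
  shows "compose (topspace X) u a \<in> ellis_circ G X act u B"
  unfolding in_ellis_circ_iff
proof (intro conjI allI impI)
  have uE: "u \<in> EL G X act" using u M_in_EL by blast
  have aE: "a \<in> EL G X act"
    using assms closure_of_minimal[OF assms(1) closedin_EL[OF flow]] by blast
  show "u \<in> topspace (self_maps X)" "compose (topspace X) u a \<in> topspace (self_maps X)"
    using uE aE EL_subset[OF flow] EL_compose[OF flow] by blast+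
  fix U W assume UW: "openin (self_maps X) U \<and> u \<in> U \<and> openin (self_maps X) W \<and> compose (topspace X) u a \<in> W"
  have "openin (self_maps X) {h \<in> topspace (self_maps X). compose (topspace X) h a \<in> W}"
    using aE EL_subset[OF flow] UW
    by (intro openin_continuous_map_preimage[OF continuous_map_compose_right]) blast+
  then have "openin (self_maps X) (U \<inter> {h \<in> topspace (self_maps X). compose (topspace X) h a \<in> W})"
    using UW by blast
  moreover have "u \<in> U \<inter> {h \<in> topspace (self_maps X). compose (topspace X) h a \<in> W}"
    using UW uE EL_subset[OF flow] by blast
  ultimately have "\<exists>h\<in>act ` carrier G. h \<in> U \<inter> {h \<in> topspace (self_maps X). compose (topspace X) h a \<in> W}"
    using closure_of_meets[OF uE[unfolded EL_def]] by blast
  then obtain g where g: "g \<in> carrier G" "act g \<in> U" "compose (topspace X) (act g) a \<in> W" by blast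
  have "openin (self_maps X) {b \<in> topspace (self_maps X). compose (topspace X) (act g) b \<in> W}"
    using UW
    by (intro openin_continuous_map_preimage[OF continuous_map_compose_left[OF flow_act_continuous[OF flow g(1)]]]) blast
  moreover have "a \<in> {b \<in> topspace (self_maps X). compose (topspace X) (act g) b \<in> W}"
    using g aE EL_subset[OF flow] by blast
  ultimately obtain b where "b \<in> B" "compose (topspace X) (act g) b \<in> W"
    using closure_of_meets[OF assms(2)] by blast
  then show "\<exists>g\<in>carrier G. \<exists>b\<in>B. act g \<in> U \<and> compose (topspace X) (act g) b \<in> W" using g by blast
qed

lemma tau_closure_extensive:
  assumes "B \<subseteq> uM"
  shows "B \<subseteq> tau_closure G X act M u B"
proof
  fix b assume b: "b \<in> B"
  have BE: "B \<subseteq> EL G X act" using assms uM_in_EL by blast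
  then have "b \<in> self_maps X closure_of B"
    using b EL_subset[OF flow] closure_of_subset[of B "self_maps X"] by blast
  from u_compose_closure_in_ellis_circ[OF BE this] show "b \<in> tau_closure G X act M u B"
    using u_compose_uM b assms by (auto simp: tau_closure_def)
qed

lemma tau_closureD:
  assumes "f \<in> tau_closure G X act M u B" "openin (self_maps X) U" "u \<in> U" "openin (self_maps X) W" "f \<in> W"
  shows "\<exists>g\<in>carrier G. \<exists>b\<in>B. act g \<in> U \<and> compose (topspace X) (act g) b \<in> W"
  using assms unfolding tau_closure_def by (simp add: in_ellis_circ_iff)

lemma not_in_tau_closureD:
  assumes "f \<in> uM" "f \<notin> tau_closure G X act M u B"
  shows "\<exists>U W. openin (self_maps X) U \<and> u \<in> U \<and> openin (self_maps X) W \<and> f \<in> W \<and>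
     (\<forall>g\<in>carrier G. \<forall>b\<in>B. act g \<in> U \<longrightarrow> compose (topspace X) (act g) b \<notin> W)"
proof -
  have "u \<in> topspace (self_maps X)" "f \<in> topspace (self_maps X)"
    using uM_in_EL[OF assms(1)] uM_in_EL[OF u_in_uM] EL_subset[OF flow] by (auto simp only: subset_iff)
  then show ?thesis using assms unfolding tau_closure_def Int_iff in_ellis_circ_iff by meson
qed

text \<open>Neighbourhoods that keep \<open>f\<close> away from \<open>A\<close> and from
  \<open>B\<close> can be intersected, and the intersections keep it away from the union.\<close>

lemma tau_closure_Un:
  "tau_closure G X act M u (A \<union> B) = tau_closure G X act M u A \<union> tau_closure G X act M u B" (is "?L = ?R")
proof (rule equalityI)
  show "?L \<subseteq> ?R"
  proof
    fix f assume f: "f \<in> ?L"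
    show "f \<in> ?R"
    proof (rule ccontr)
      assume "f \<notin> ?R"
      then have nA: "f \<notin> tau_closure G X act M u A" and nB: "f \<notin> tau_closure G X act M u B" by blast+
      have fM: "f \<in> uM" using f by (simp add: tau_closure_def)
      obtain U W where
        1: "openin (self_maps X) U" "u \<in> U" "openin (self_maps X) W" "f \<in> W"
          "\<forall>g\<in>carrier G. \<forall>b\<in>A. act g \<in> U \<longrightarrow> compose (topspace X) (act g) b \<notin> W"
        using not_in_tau_closureD[OF fM nA] by (elim exE conjE) (rule that)
      obtain U' W' where
        2: "openin (self_maps X) U'" "u \<in> U'" "openin (self_maps X) W'" "f \<in> W'"
          "\<forall>g\<in>carrier G. \<forall>b\<in>B. act g \<in> U' \<longrightarrow> compose (topspace X) (act g) b \<notin> W'"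
        using not_in_tau_closureD[OF fM nB] by (elim exE conjE) (rule that)
      have "openin (self_maps X) (U \<inter> U')" "openin (self_maps X) (W \<inter> W')" "u \<in> U \<inter> U'" "f \<in> W \<inter> W'"
        using 1 2 by auto
      then have "\<exists>g\<in>carrier G. \<exists>b\<in>A \<union> B. act g \<in> U \<inter> U' \<and> compose (topspace X) (act g) b \<in> W \<inter> W'"
        using tau_closureD[OF f] by meson
      then show False using 1(5) 2(5) by blast
    qed
  qed
  show "?R \<subseteq> ?L" using tau_closure_mono by (meson Un_least Un_upper1 Un_upper2)
qed

text \<open>The axioms for the complements of the fixed points of \<open>tau_closure\<close> come
  from its additivity (finite intersections of open sets) and from its being monotone and extensive
  (arbitrary unions).\<close>

lemma istopology_tau:
  "istopology (\<lambda>U. U \<subseteq> uM \<and> tau_closure G X act M u (uM - U) = uM - U)"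
  unfolding istopology_def
proof (intro conjI allI impI)
  fix S T assume S: "S \<subseteq> uM \<and> tau_closure G X act M u (uM - S) = uM - S"
    and T: "T \<subseteq> uM \<and> tau_closure G X act M u (uM - T) = uM - T"
  show "S \<inter> T \<subseteq> uM" using S by blast
  have "uM - S \<inter> T = (uM - S) \<union> (uM - T)" by blast
  then show "tau_closure G X act M u (uM - S \<inter> T) = uM - S \<inter> T" using S T by (simp add: tau_closure_Un)
next
  fix K assume K: "\<forall>U\<in>K. U \<subseteq> uM \<and> tau_closure G X act M u (uM - U) = uM - U"
  show "\<Union>K \<subseteq> uM" using K by blast
  show "tau_closure G X act M u (uM - \<Union>K) = uM - \<Union>K"
  proof (rule equalityI)
    have "tau_closure G X act M u (uM - \<Union>K) \<subseteq> uM - U" if "U \<in> K" for U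
      using K that tau_closure_mono[of "uM - \<Union>K" "uM - U"] by blast
    moreover have "tau_closure G X act M u (uM - \<Union>K) \<subseteq> uM" by (simp add: tau_closure_def)
    ultimately show "tau_closure G X act M u (uM - \<Union>K) \<subseteq> uM - \<Union>K" by blast
    show "uM - \<Union>K \<subseteq> tau_closure G X act M u (uM - \<Union>K)" by (rule tau_closure_extensive) blast
  qed
qed

lemma openin_tau:
  "openin (tau_topology G X act M u) U \<longleftrightarrow> U \<subseteq> uM \<and> tau_closure G X act M u (uM - U) = uM - U"
  unfolding tau_topology_def using topology_inverse'[OF istopology_tau] by simp

lemma tau_closure_empty: "tau_closure G X act M u {} = {}"
proof -
  have "f \<notin> ellis_circ G X act u {}" for f
    unfolding in_ellis_circ_iff using openin_topspace by blast
  then show ?thesis by (auto simp: tau_closure_def)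
qed

lemma topspace_tau: "topspace (tau_topology G X act M u) = uM"
proof -
  have "openin (tau_topology G X act M u) uM" using openin_tau tau_closure_empty by simp
  moreover have "topspace (tau_topology G X act M u) \<subseteq> uM" using openin_tau openin_topspace by blast
  ultimately show ?thesis using openin_subset by blast
qed

lemma closedin_tau: "closedin (tau_topology G X act M u) K \<longleftrightarrow> K \<subseteq> uM \<and> tau_closure G X act M u K = K"
  unfolding closedin_def topspace_tau openin_tau by (auto simp: double_diff)

text \<open>A \<tau>-closed set need not be closed under pointwise convergence. The finite
  intersection property is therefore applied to pointwise closures, which yields a common point
  \<open>a\<close> of \<open>M\<close>; then \<open>u a\<close> is a \<tau>-limit of each of the
  sets and so belongs to all of them.\<close>

lemma compact_tau: "compact_space (tau_topology G X act M u)"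
  unfolding compact_space_fip
proof (intro allI impI, elim conjE)
  fix \<U> assume cl: "\<forall>C\<in>\<U>. closedin (tau_topology G X act M u) C"
    and fip: "\<forall>\<F>. finite \<F> \<and> \<F> \<subseteq> \<U> \<longrightarrow> \<Inter> \<F> \<noteq> {}"
  let ?cl = "\<lambda>C. self_maps X closure_of C"
  have sub: "C \<subseteq> EL G X act" "C \<subseteq> M" "C \<subseteq> uM" "C \<subseteq> topspace (self_maps X)" if "C \<in> \<U>" for C
    using that cl closedin_tau uM_in_EL uM_in_M EL_subset[OF flow] by blast+
  show "\<Inter>\<U> \<noteq> {}"
  proof (cases "\<U> = {}")
    case False
    have "\<Inter>(?cl ` \<U>) \<noteq> {}"
    proof -
      have fin: "\<Inter>\<F> \<noteq> {}" if F: "finite \<F>" "\<F> \<subseteq> ?cl ` \<U>" for \<F>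
      proof -
        obtain \<G> where "finite \<G>" "\<G> \<subseteq> \<U>" "\<F> = ?cl ` \<G>" using F by (meson finite_subset_image)
        moreover from this obtain x where "x \<in> \<Inter>\<G>" using fip by blast
        moreover have "C \<subseteq> ?cl C" if "C \<in> \<G>" for C
          using sub(4)[of C] that \<open>\<G> \<subseteq> \<U>\<close> closure_of_subset by blast
        ultimately have "x \<in> \<Inter>\<F>" by blast
        then show ?thesis by blast
      qed
      have "compact_space (self_maps X)" using compact_Hausdorff_self_maps flowD(2,3)[OF flow] by blast
      then have *: "(\<forall>C\<in>?cl ` \<U>. closedin (self_maps X) C) \<and> (\<forall>\<F>. finite \<F> \<and> \<F> \<subseteq> ?cl ` \<U> \<longrightarrow> \<Inter> \<F> \<noteq> {})
         \<longrightarrow> \<Inter> (?cl ` \<U>) \<noteq> {}"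
        unfolding compact_space_fip by (rule spec)
      show ?thesis by (rule *[THEN mp]) (use fin in \<open>simp add: fin\<close>)
    qed
    then obtain a where a: "\<And>C. C \<in> \<U> \<Longrightarrow> a \<in> ?cl C" by blast
    obtain C0 where C0: "C0 \<in> \<U>" using False by blast
    have "closedin (self_maps X) M"
      using S.closedin_min_lideal[OF S_min] closedin_EL[OF flow] closedin_closed_subtopology
      unfolding EL_topology_def by blast
    then have "a \<in> M" using a[OF C0] closure_of_minimal[OF sub(2)[OF C0]] by blast
    then have ua: "compose (topspace X) u a \<in> uM" by (rule u_compose_M)
    have "compose (topspace X) u a \<in> C" if C: "C \<in> \<U>" for C
    proof -
      have "compose (topspace X) u a \<in> tau_closure G X act M u C"
        using u_compose_closure_in_ellis_circ[OF sub(1)[OF C] a[OF C]] ua by (simp add: tau_closure_def)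
      then show ?thesis using cl C closedin_tau by simp
    qed
    then show ?thesis by blast
  qed simp
qed

text \<open>What has to be shown is that the fibres of the induced maps on \<open>u M\<close> are
  \<tau>-open. Multiplication in the Ellis semigroup of \<open>Y i\<close> is continuous only in the
  left factor; finiteness of the image of \<open>u M\<close> makes up for this, because one
  neighbourhood of \<open>u\<close> can be chosen for all right factors that occur.\<close>

lemma profinite_ellis_group:
  fixes Y :: "'j \<Rightarrow> 'y topology"
  assumes Y: "\<And>i. i \<in> I \<Longrightarrow> flow G \<tau> (Y i) (actY i)"
    and epi: "\<And>i. i \<in> I \<Longrightarrow> flow_epi G X act (Y i) (actY i) (f i)"
    and fin: "\<And>i. i \<in> I \<Longrightarrow> finite_ellis_group G (Y i) (actY i)"
    and sep: "\<And>x y. \<lbrakk>x \<in> topspace X; y \<in> topspace X; x \<noteq> y\<rbrakk> \<Longrightarrow> \<exists>i\<in>I. f i x \<noteq> f i y"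
  shows "profinite_group (ellis_group X M u) (tau_topology G X act M u)"
proof (rule profinite_groupI_finite_quotients)
  let ?\<theta> = "\<lambda>i. EL_map X (Y i) (f i)"
  show "group (ellis_group X M u)" using group_ellis_group[OF flow min u idem] .
  show "topspace (tau_topology G X act M u) = uM" by (rule topspace_tau)
  show "compact_space (tau_topology G X act M u)" by (rule compact_tau)
  show "\<exists>i\<in>I. ?\<theta> i a \<noteq> ?\<theta> i b" if ab: "a \<in> uM" "b \<in> uM" "a \<noteq> b" for a b
  proof -
    have F: "a \<in> topspace X \<rightarrow>\<^sub>E topspace X" "b \<in> topspace X \<rightarrow>\<^sub>E topspace X"
      using ab uM_in_EL EL_in_PiE[OF flow] by auto
    then obtain x where x: "x \<in> topspace X" "a x \<noteq> b x" using ab(3) by (metis PiE_ext)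
    then obtain i where i: "i \<in> I" "f i (a x) \<noteq> f i (b x)" using sep[of "a x" "b x"] F by (auto simp: PiE_iff)
    then show ?thesis
      using EL_map_apply[OF flow Y[OF i(1)] epi[OF i(1)] uM_in_EL x(1)] ab by metis
  qed
  fix i assume i: "i \<in> I"
  interpret h: crs_hom "EL_topology G X act" "compose (topspace X)" "EL_topology G (Y i) (actY i)"
    "compose (topspace (Y i))" "?\<theta> i"
    using EL_map_crs_hom[OF flow Y[OF i] epi[OF i]] .
  have inE: "a \<in> topspace (EL_topology G X act)" if "a \<in> uM" for a
    using that uM_in_EL topspace_EL_topology[OF flow] by blast
  show "?\<theta> i (a \<otimes>\<^bsub>ellis_group X M u\<^esub> b) = ?\<theta> i (a' \<otimes>\<^bsub>ellis_group X M u\<^esub> b')"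
    if "a \<in> uM" "a' \<in> uM" "b \<in> uM" "b' \<in> uM" "?\<theta> i a = ?\<theta> i a'" "?\<theta> i b = ?\<theta> i b'" for a a' b b'
    using h.hom[OF inE inE] that by (simp add: ellis_group_def)
  have finim: "finite (?\<theta> i ` uM)"
    using finite_image_ellis_group[OF flow Y[OF i] epi[OF i] fin[OF i] min u idem] .
  fix t
  let ?B = "uM - {x \<in> uM. ?\<theta> i x = t}"
  have "tau_closure G X act M u ?B \<subseteq> ?B"
  proof
    fix a assume a: "a \<in> tau_closure G X act M u ?B"
    then have aM: "a \<in> uM" and ac: "a \<in> ellis_circ G X act u ?B" by (auto simp: tau_closure_def)
    let ?T = "?\<theta> i ` ?B"
    \<comment> \<open>Otherwise separate the image of \<open>a\<close> from each point
      \<open>s\<close> of the finite set \<open>?T\<close>. For \<open>g\<close> close to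
      \<open>u\<close>, the product of the image of \<open>g\<close> with \<open>s\<close> stays
      near \<open>s\<close>, as \<open>u\<close> acts trivially on \<open>u M\<close>. For
      \<open>g b\<close> close to \<open>a\<close>, the image of \<open>g b\<close> is near that of
      \<open>a\<close>. With \<open>s\<close> the image of \<open>b\<close> these two statements
      collide.\<close>
    have "?\<theta> i a \<in> ?T"
    proof (rule ccontr)
      assume no: "?\<theta> i a \<notin> ?T"
      have aE: "?\<theta> i a \<in> topspace (EL_topology G (Y i) (actY i))" using h.surj inE[OF aM] by blast
      define P where "P s V V' \<longleftrightarrow> openin (EL_topology G (Y i) (actY i)) V \<and>
          openin (EL_topology G (Y i) (actY i)) V' \<and> s \<in> V \<and> ?\<theta> i a \<in> V' \<and> disjnt V V'" for s V V'
      have "\<forall>s\<in>?T. \<exists>V V'. P s V V'"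
      proof
        fix s assume s: "s \<in> ?T"
        then have "s \<in> topspace (EL_topology G (Y i) (actY i))" using h.surj inE by blast
        moreover have "s \<noteq> ?\<theta> i a" using s no by blast
        ultimately show "\<exists>V V'. P s V V'"
          using h.B.Hausdorff aE unfolding P_def Hausdorff_space_def by meson
      qed
      from bchoice[OF this] obtain V where "\<forall>s\<in>?T. \<exists>V'. P s (V s) V'" by (rule exE)
      from bchoice[OF this] obtain V' where VV': "\<forall>s\<in>?T. P s (V s) (V' s)" by (rule exE)
      have V: "openin (EL_topology G (Y i) (actY i)) (V s)" "openin (EL_topology G (Y i) (actY i)) (V' s)"
         "s \<in> V s" "?\<theta> i a \<in> V' s" "disjnt (V s) (V' s)" if s: "s \<in> ?T" for s
        using bspec[OF VV' s] unfolding P_def by simp_all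
      let ?E = "EL_topology G X act"
      let ?U = "\<lambda>s. {x \<in> topspace ?E. compose (topspace (Y i)) (?\<theta> i x) s \<in> V s}"
      let ?W = "\<lambda>s. {x \<in> topspace ?E. ?\<theta> i x \<in> V' s}"
      define UU where "UU = \<Inter>(?U ` ?T) \<inter> topspace ?E"
      define WW where "WW = \<Inter>(?W ` ?T) \<inter> topspace ?E"
      have finT: "finite ?T" using finim by (rule finite_subset[rotated]) blast
      have sE: "s \<in> topspace (EL_topology G (Y i) (actY i))" if "s \<in> ?T" for s
        using that h.surj inE by blast
      have "openin ?E (?U s)" if s: "s \<in> ?T" for s
        using continuous_map_compose[OF h.contmap h.B.cont[OF sE[OF s]]] V(1)[OF s]
        by (intro openin_continuous_map_preimage) (auto simp: o_def)
      moreover have "openin ?E (?W s)" if s: "s \<in> ?T" for s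
        using h.contmap V(2)[OF s] by (rule openin_continuous_map_preimage)
      ultimately have op: "openin ?E UU" "openin ?E WW"
        using finT unfolding UU_def WW_def by (simp_all only: openin_INT)
      have "u \<in> ?U s" if s: "s \<in> ?T" for s
      proof -
        obtain b where b: "b \<in> uM" "s = ?\<theta> i b" using s by blast
        have "compose (topspace (Y i)) (?\<theta> i u) s = ?\<theta> i (compose (topspace X) u b)"
          using h.hom[OF inE[OF u_in_uM] inE[OF b(1)]] b by simp
        then show ?thesis using V(3)[OF s] u_compose_uM[OF b(1)] b inE[OF u_in_uM] by simp
      qed
      then have uU: "u \<in> UU" using inE[OF u_in_uM] unfolding UU_def by blast
      have aW: "a \<in> WW" using inE[OF aM] V(4) unfolding WW_def by blast
      obtain U' W' where U': "openin (self_maps X) U'" "UU = U' \<inter> EL G X act"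
         and W': "openin (self_maps X) W'" "WW = W' \<inter> EL G X act"
        using op unfolding EL_topology_def[of G X act] openin_subtopology by (elim exE conjE) (rule that)
      have "u \<in> U'" "a \<in> W'" using uU aW U'(2) W'(2) by blast+
      then obtain g b where gb: "g \<in> carrier G" "b \<in> ?B" "act g \<in> U'" "compose (topspace X) (act g) b \<in> W'"
        using tau_closureD[OF a U'(1) _ W'(1)] by blast
      have gE: "act g \<in> EL G X act" "compose (topspace X) (act g) b \<in> EL G X act"
        using act_in_EL[OF flow gb(1)] EL_compose[OF flow] gb uM_in_EL by auto
      have "?\<theta> i b \<in> ?T" using gb by blast
      moreover have "act g \<in> UU" using U'(2) gb gE by blast
      ultimately have "act g \<in> ?U (?\<theta> i b)" unfolding UU_def by blast
      moreover have "compose (topspace X) (act g) b \<in> WW" using W'(2) gb gE by blast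
      then have "compose (topspace X) (act g) b \<in> ?W (?\<theta> i b)" using \<open>?\<theta> i b \<in> ?T\<close> unfolding WW_def by blast
      moreover have "?\<theta> i (compose (topspace X) (act g) b) = compose (topspace (Y i)) (?\<theta> i (act g)) (?\<theta> i b)"
        using h.hom[of "act g" b] gE gb inE by (simp add: topspace_EL_topology[OF flow])
      ultimately show False using V(5)[OF \<open>?\<theta> i b \<in> ?T\<close>] by (simp add: disjnt_iff)
    qed
    \<comment> \<open>\<open>?B\<close> is a union of fibres, so membership can be read off from the
      image.\<close>
    then show "a \<in> ?B" using aM by auto
  qed
  moreover have "?B \<subseteq> tau_closure G X act M u ?B" by (rule tau_closure_extensive) blast
  ultimately show "openin (tau_topology G X act M u) {x \<in> uM. ?\<theta> i x = t}"
    unfolding openin_tau by blast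
qed

lemma tau_H_trivial:
  assumes "Hausdorff_space (tau_topology G X act M u)"
  shows "tau_H G X act M u = {u}"
proof (rule equalityI)
  show "{u} \<subseteq> tau_H G X act M u"
    unfolding tau_H_def using tau_closure_extensive openin_tau by blast
  show "tau_H G X act M u \<subseteq> {u}"
  proof
    fix v assume v: "v \<in> tau_H G X act M u"
    have op: "openin (tau_topology G X act M u) uM" using openin_topspace[of "tau_topology G X act M u"] topspace_tau by simp
    then have vM: "v \<in> uM" using v u_in_uM unfolding tau_H_def tau_closure_def by blast
    show "v \<in> {u}"
    proof (rule ccontr)
      assume "v \<notin> {u}"
      then obtain U V where UV: "openin (tau_topology G X act M u) U" "openin (tau_topology G X act M u) V"
        "u \<in> U" "v \<in> V" "disjnt U V"
        using assms u_in_uM vM topspace_tau unfolding Hausdorff_space_def by (metis singletonI)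
      have "tau_closure G X act M u U \<subseteq> tau_closure G X act M u (uM - V)"
        using UV openin_tau by (intro tau_closure_mono) (auto simp: disjnt_iff)
      also have "\<dots> = uM - V" using UV openin_tau by blast
      finally show False using v UV unfolding tau_H_def by blast
    qed
  qed
qed

end

section \<open>Quotient flows\<close>

lemma topspace_quotient_topology: "topspace (quotient_topology X f) = f ` topspace X"
proof -
  have "openin (quotient_topology X f) (f ` topspace X)"
  proof -
    have "{x \<in> topspace X. f x \<in> f ` topspace X} = topspace X" by blast
    then show ?thesis unfolding openin_quotient_topology by simp
  qed
  moreover have "topspace (quotient_topology X f) \<subseteq> f ` topspace X"
    using openin_quotient_topology[of X f "topspace (quotient_topology X f)"] by simp
  ultimately show ?thesis by (intro equalityI openin_subset)
qed

lemma quotient_map_quotient_topology: "quotient_map X (quotient_topology X f) f"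
  unfolding quotient_map_def by (auto simp: topspace_quotient_topology openin_quotient_topology)

text \<open>The saturation of a closed set \<open>F\<close> is the projection of the closed set
  \<open>?R \<inter> F \<times> topspace X\<close> along a compact factor, hence closed.\<close>

lemma closed_map_quotient_topology:
  assumes X: "compact_space X" and ker: "closedin (prod_topology X X) {(x, y). x \<in> topspace X \<and> y \<in> topspace X \<and> f x = f y}"
  shows "closed_map X (quotient_topology X f) f"
  unfolding closed_map_def
proof (intro allI impI)
  let ?R = "{(x, y). x \<in> topspace X \<and> y \<in> topspace X \<and> f x = f y}"
  fix F assume F: "closedin X F"
  then have FX: "F \<subseteq> topspace X" by (rule closedin_subset)
  have "closedin (prod_topology X X) (?R \<inter> F \<times> topspace X)"
    using ker F by (intro closedin_Int) (simp_all add: closedin_prod_Times_iff)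
  then have "closedin X (snd ` (?R \<inter> F \<times> topspace X))"
    using closed_map_snd[OF X, of X] unfolding closed_map_def by blast
  moreover have "snd ` (?R \<inter> F \<times> topspace X) = {x \<in> topspace X. f x \<in> f ` F}"
  proof (intro equalityI subsetI)
    fix y assume "y \<in> snd ` (?R \<inter> F \<times> topspace X)"
    then obtain a where a: "a \<in> F" "y \<in> topspace X" "f a = f y" by auto
    then have "f y \<in> f ` F" by (metis imageI)
    then show "y \<in> {x \<in> topspace X. f x \<in> f ` F}" using a by simp
  next
    fix y assume "y \<in> {x \<in> topspace X. f x \<in> f ` F}"
    then obtain a where a: "a \<in> F" "y \<in> topspace X" "f y = f a" by auto
    then have "(a, y) \<in> ?R \<inter> F \<times> topspace X" using FX by auto
    then show "y \<in> snd ` (?R \<inter> F \<times> topspace X)" by (rule image_eqI[rotated]) simp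
  qed
  ultimately have "closedin X {x \<in> topspace X. f x \<in> f ` F}" by simp
  moreover have "f ` F \<subseteq> topspace (quotient_topology X f)" using FX by (auto simp: topspace_quotient_topology)
  ultimately show "closedin (quotient_topology X f) (f ` F)"
    using quotient_map_quotient_topology[of X f] unfolding quotient_map_closedin by simp
qed

text \<open>The quotient map is closed. This makes points of the quotient closed and carries
  normality over from the compact Hausdorff space \<open>X\<close>.\<close>

lemma Hausdorff_quotient_topology:
  assumes X: "compact_space X" "Hausdorff_space X"
    and ker: "closedin (prod_topology X X) {(x, y). x \<in> topspace X \<and> y \<in> topspace X \<and> f x = f y}"
  shows "Hausdorff_space (quotient_topology X f)"
proof (rule Hausdorff_normal_space_closed_continuous_map_image)
  show "normal_space X" using X compact_Hausdorff_or_regular_imp_normal_space by blast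
  show cl: "closed_map X (quotient_topology X f) f" by (rule closed_map_quotient_topology[OF X(1) ker])
  show "continuous_map X (quotient_topology X f) f"
    by (rule quotient_imp_continuous_map[OF quotient_map_quotient_topology])
  show "f ` topspace X = topspace (quotient_topology X f)" by (simp add: topspace_quotient_topology)
  show "t1_space (quotient_topology X f)"
    unfolding t1_space_closedin_singleton
  proof
    fix c assume "c \<in> topspace (quotient_topology X f)"
    then obtain x where x: "x \<in> topspace X" "c = f x" by (auto simp: topspace_quotient_topology)
    have "closedin X {x}" by (rule closedin_Hausdorff_singleton[OF X(2) x(1)])
    then have "closedin (quotient_topology X f) (f ` {x})" using cl unfolding closed_map_def by blast
    then show "closedin (quotient_topology X f) {c}" using x by simp
  qed
qed

text \<open>Replaces the homomorphism into \<open>BijGroup\<close> that \<open>group_action\<close>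
  asks for by the two laws of an action; \<open>act g\<close> is a bijection because the inverse of
  \<open>g\<close> acts as its inverse.\<close>

lemma flowI:
  assumes top: "topological_group G \<tau>" and "compact_space X" "Hausdorff_space X"
    and ext: "\<And>g. g \<in> carrier G \<Longrightarrow> act g \<in> topspace X \<rightarrow>\<^sub>E topspace X"
    and one: "\<And>x. x \<in> topspace X \<Longrightarrow> act \<one>\<^bsub>G\<^esub> x = x"
    and mult: "\<And>g h x. \<lbrakk>g \<in> carrier G; h \<in> carrier G; x \<in> topspace X\<rbrakk> \<Longrightarrow> act (g \<otimes>\<^bsub>G\<^esub> h) x = act g (act h x)"
    and cont: "continuous_map (prod_topology \<tau> X) X (\<lambda>(g, x). act g x)"
  shows "flow G \<tau> X act"
proof -
  interpret group G using top by (simp add: topological_group_def)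
  have bij: "act g \<in> Bij (topspace X)" if g: "g \<in> carrier G" for g
  proof -
    have "bij_betw (act g) (topspace X) (topspace X)"
    proof (rule bij_betw_byWitness[where f' = "act (inv\<^bsub>G\<^esub> g)"])
      show "\<forall>a\<in>topspace X. act (inv\<^bsub>G\<^esub> g) (act g a) = a" "\<forall>a\<in>topspace X. act g (act (inv\<^bsub>G\<^esub> g) a) = a"
        using g one by (auto simp flip: mult)
    qed (use ext g in auto)
    then show ?thesis using ext[OF g] by (auto simp: Bij_def PiE_iff)
  qed
  have "act \<in> hom G (BijGroup (topspace X))"
  proof (rule homI)
    show "act g \<in> carrier (BijGroup (topspace X))" if "g \<in> carrier G" for g
      using bij that by (simp add: BijGroup_def)
    show "act (g \<otimes>\<^bsub>G\<^esub> h) = act g \<otimes>\<^bsub>BijGroup (topspace X)\<^esub> act h" if "g \<in> carrier G" "h \<in> carrier G" for g h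
      using that bij ext[of "g \<otimes>\<^bsub>G\<^esub> h"] mult
      by (intro extensionalityI[where A = "topspace X"]) (auto simp: BijGroup_def compose_def PiE_iff)
  qed
  then have "group_action G (topspace X) act"
    by (simp add: group_action_def group_hom_def group_hom_axioms_def is_group group_BijGroup)
  then show ?thesis using assms by (simp add: flow_def)
qed

definition flow_congruence ::
  "('g, 'b) monoid_scheme \<Rightarrow> 'x topology \<Rightarrow> ('g \<Rightarrow> 'x \<Rightarrow> 'x) \<Rightarrow> ('x \<times> 'x) set \<Rightarrow> bool" where
  "flow_congruence G X act R \<longleftrightarrow> equiv (topspace X) R \<and> closedin (prod_topology X X) R \<and>
     (\<forall>g\<in>carrier G. \<forall>x y. (x, y) \<in> R \<longrightarrow> (act g x, act g y) \<in> R)"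

abbreviation quot_space :: "'x topology \<Rightarrow> ('x \<times> 'x) set \<Rightarrow> 'x set topology" where
  "quot_space X R \<equiv> quotient_topology X (\<lambda>x. R `` {x})"

definition quot_act :: "'x topology \<Rightarrow> ('x \<times> 'x) set \<Rightarrow> ('g \<Rightarrow> 'x \<Rightarrow> 'x) \<Rightarrow> 'g \<Rightarrow> 'x set \<Rightarrow> 'x set" where
  "quot_act X R act g = (\<lambda>c\<in>topspace X // R. act g ` c)"

lemma topspace_quot_space: "topspace (quot_space X R) = topspace X // R"
  by (auto simp: topspace_quotient_topology quotient_def)

context
  fixes G \<tau> X act R
  assumes flow: "flow G \<tau> X act" and cong: "flow_congruence G X act R"
begin

lemma congruence_equiv: "equiv (topspace X) R"
  using cong by (simp add: flow_congruence_def)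

lemma congruence_class_eq:
  "\<lbrakk>x \<in> topspace X; y \<in> topspace X\<rbrakk> \<Longrightarrow> R `` {x} = R `` {y} \<longleftrightarrow> (x, y) \<in> R"
  using eq_equiv_class_iff[OF congruence_equiv] .

lemma congruence_subset: "(x, y) \<in> R \<Longrightarrow> x \<in> topspace X" "(x, y) \<in> R \<Longrightarrow> y \<in> topspace X"
  using congruence_equiv by (auto simp: equiv_def refl_on_def dest: closedin_subset)

text \<open>Invariance of \<open>R\<close> under \<open>g\<close> gives one inclusion between the
  classes, invariance under the inverse of \<open>g\<close> the other. Hence the plain image of a
  class is again a class.\<close>

lemma quot_act_class:
  assumes g: "g \<in> carrier G" and x: "x \<in> topspace X"
  shows "quot_act X R act g (R `` {x}) = R `` {act g x}"
proof -
  interpret group G using flowD(5)[OF flow] .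
  have inv: "(act h a, act h b) \<in> R" if "h \<in> carrier G" "(a, b) \<in> R" for h a b
    using cong that by (auto simp: flow_congruence_def)
  have "act g ` (R `` {x}) = R `` {act g x}"
  proof (rule equalityI)
    show "act g ` (R `` {x}) \<subseteq> R `` {act g x}" using inv g by blast
    show "R `` {act g x} \<subseteq> act g ` (R `` {x})"
    proof
      fix y assume y: "y \<in> R `` {act g x}"
      then have yX: "y \<in> topspace X" using congruence_subset by blast
      have "(act (inv\<^bsub>G\<^esub> g) (act g x), act (inv\<^bsub>G\<^esub> g) y) \<in> R" using inv y g by blast
      moreover have "act (inv\<^bsub>G\<^esub> g) (act g x) = x"
        using fun_cong[OF flow_act_mult[OF flow, of "inv\<^bsub>G\<^esub> g" g], of x] flow_act_one[OF flow x] g x by (simp add: compose_def)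
      moreover have "act g (act (inv\<^bsub>G\<^esub> g) y) = y"
        using fun_cong[OF flow_act_mult[OF flow, of g "inv\<^bsub>G\<^esub> g"], of y] flow_act_one[OF flow yX] g yX by (simp add: compose_def)
      ultimately show "y \<in> act g ` (R `` {x})" by (metis Image_singleton_iff image_eqI)
    qed
  qed
  then show ?thesis using x by (simp add: quot_act_def quotientI)
qed

lemma closedin_congruence:
  "closedin (prod_topology X X) {(x, y). x \<in> topspace X \<and> y \<in> topspace X \<and> R `` {x} = R `` {y}}"
proof -
  have "x \<in> topspace X \<and> y \<in> topspace X \<and> R `` {x} = R `` {y} \<longleftrightarrow> (x, y) \<in> R" for x y
    using congruence_class_eq[of x y] congruence_subset[of x y] by iprover
  then have "{(x, y). x \<in> topspace X \<and> y \<in> topspace X \<and> R `` {x} = R `` {y}} = R"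
    by (simp only:) auto
  then show ?thesis using cong by (simp add: flow_congruence_def)
qed

lemma closed_map_quot: "closed_map X (quot_space X R) (\<lambda>x. R `` {x})"
  by (rule closed_map_quotient_topology[OF flowD(2)[OF flow] closedin_congruence])

lemma Hausdorff_quot: "Hausdorff_space (quot_space X R)"
  by (rule Hausdorff_quotient_topology[OF flowD(2,3)[OF flow] closedin_congruence])

lemma flow_epi_quot: "flow_epi G X act (quot_space X R) (quot_act X R act) (\<lambda>x. R `` {x})"
  unfolding flow_epi_def
  using quot_act_class quotient_imp_continuous_map[OF quotient_map_quotient_topology, of X "\<lambda>x. R `` {x}"]
  by (simp add: topspace_quotient_topology)

lemma flow_quot: "flow G \<tau> (quot_space X R) (quot_act X R act)"
proof (rule flowI)
  let ?q = "\<lambda>x. R `` {x}"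
  interpret group G using flowD(5)[OF flow] .
  note aX = flow_act(3)[OF flow]
  show "topological_group G \<tau>" using flowD(1)[OF flow] .
  show "compact_space (quot_space X R)"
    unfolding compact_space_def topspace_quotient_topology
    by (rule image_compactin[OF _ quotient_imp_continuous_map[OF quotient_map_quotient_topology]])
      (use flowD(2)[OF flow] in \<open>simp add: compact_space_def\<close>)
  show "Hausdorff_space (quot_space X R)" by (rule Hausdorff_quot)
  show "quot_act X R act g \<in> topspace (quot_space X R) \<rightarrow>\<^sub>E topspace (quot_space X R)" if g: "g \<in> carrier G" for g
  proof (rule PiE_I)
    fix c assume "c \<in> topspace (quot_space X R)"
    then obtain x where "x \<in> topspace X" "c = R `` {x}" by (auto simp: topspace_quotient_topology)
    then show "quot_act X R act g c \<in> topspace (quot_space X R)"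
      using quot_act_class[OF g] aX[OF g] by (simp add: topspace_quotient_topology)
  next
    fix c assume "c \<notin> topspace (quot_space X R)"
    then show "quot_act X R act g c = undefined" by (simp add: quot_act_def topspace_quot_space)
  qed
  show "quot_act X R act \<one>\<^bsub>G\<^esub> c = c" if c: "c \<in> topspace (quot_space X R)" for c
  proof -
    obtain x where "x \<in> topspace X" "c = R `` {x}" using c by (auto simp: topspace_quotient_topology)
    then show ?thesis using quot_act_class[OF one_closed] flow_act_one[OF flow] by simp
  qed
  show "quot_act X R act (g \<otimes>\<^bsub>G\<^esub> h) c = quot_act X R act g (quot_act X R act h c)"
    if gh: "g \<in> carrier G" "h \<in> carrier G" and c: "c \<in> topspace (quot_space X R)" for g h c
  proof -
    obtain x where x: "x \<in> topspace X" "c = R `` {x}" using c by (auto simp: topspace_quotient_topology)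
    have "act (g \<otimes>\<^bsub>G\<^esub> h) x = act g (act h x)" using flow_act_mult[OF flow gh] x by (simp add: compose_def)
    then show ?thesis using quot_act_class x gh aX by simp
  qed
  \<comment> \<open>Joint continuity descends along \<open>id \<times> ?q\<close> once this is a
    quotient map. Products of quotient maps can fail to be quotient maps, but \<open>?q\<close> is
    closed with compact fibres, that is proper, and a product of proper maps is proper and so
    closed.\<close>
  show "continuous_map (prod_topology \<tau> (quot_space X R)) (quot_space X R) (\<lambda>(g, c). quot_act X R act g c)"
  proof (rule continuous_compose_quotient_map)
    let ?p = "\<lambda>(g, x). (id g, ?q x)"
    have "proper_map X (quot_space X R) ?q"
      unfolding proper_map_def
    proof (intro conjI ballI)
      show "closed_map X (quot_space X R) ?q" by (rule closed_map_quot)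
      fix c assume c: "c \<in> topspace (quot_space X R)"
      have "closedin (quot_space X R) {c}" by (rule closedin_Hausdorff_singleton[OF Hausdorff_quot c])
      then have "closedin X {x \<in> topspace X. ?q x \<in> {c}}"
        using closedin_continuous_map_preimage[OF quotient_imp_continuous_map[OF quotient_map_quotient_topology]] by blast
      then show "compactin X {x \<in> topspace X. ?q x = c}"
        using closedin_compact_space[OF flowD(2)[OF flow]] by simp
    qed
    moreover have "proper_map \<tau> \<tau> id" by (simp add: homeomorphic_imp_proper_map)
    ultimately have pr: "proper_map (prod_topology \<tau> X) (prod_topology \<tau> (quot_space X R)) ?p"
      by (intro proper_map_prod[THEN iffD2] disjI2 conjI)
    show "quotient_map (prod_topology \<tau> X) (prod_topology \<tau> (quot_space X R)) ?p"
    proof (rule continuous_closed_imp_quotient_map)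
      show "closed_map (prod_topology \<tau> X) (prod_topology \<tau> (quot_space X R)) ?p"
        using pr by (rule proper_imp_closed_map)
      show "continuous_map (prod_topology \<tau> X) (prod_topology \<tau> (quot_space X R)) ?p"
        using quotient_imp_continuous_map[OF quotient_map_quotient_topology, of X ?q]
        by (intro continuous_map_prod_top[THEN iffD2] disjI2 conjI) (simp_all add: id_def)
      show "?p ` topspace (prod_topology \<tau> X) = topspace (prod_topology \<tau> (quot_space X R))"
        by (auto simp: topspace_quotient_topology image_iff)
    qed
    have eq: "((\<lambda>(g, c). quot_act X R act g c) \<circ> ?p) z = ?q ((\<lambda>(g, x). act g x) z)"
      if "z \<in> topspace (prod_topology \<tau> X)" for z
      using that quot_act_class flowD(6)[OF flow] by auto
    have "continuous_map (prod_topology \<tau> X) (quot_space X R) (?q \<circ> (\<lambda>(g, x). act g x))"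
      using continuous_map_compose[OF flowD(7)[OF flow]] flow_epi_quot by (auto simp: flow_epi_def)
    then show "continuous_map (prod_topology \<tau> X) (quot_space X R) ((\<lambda>(g, c). quot_act X R act g c) \<circ> ?p)"
      by (rule continuous_map_eq) (use eq in \<open>auto simp: o_def\<close>)
  qed
qed

lemma flow_epi_factor:
  assumes epi: "flow_epi G X act Z actZ f" and h: "\<And>x. x \<in> topspace X \<Longrightarrow> h (R `` {x}) = f x"
  shows "flow_epi G (quot_space X R) (quot_act X R act) Z actZ h"
  unfolding flow_epi_def
proof (intro conjI ballI)
  have "continuous_map X Z (h \<circ> (\<lambda>x. R `` {x}))"
  proof (rule continuous_map_eq)
    show "continuous_map X Z f" using epi by (simp add: flow_epi_def)
  qed (simp add: h)
  then show "continuous_map (quot_space X R) Z h"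
    by (rule continuous_compose_quotient_map[OF quotient_map_quotient_topology])
  have "h ` (\<lambda>x. R `` {x}) ` topspace X = f ` topspace X" using h by (simp add: image_image)
  then show "h ` topspace (quot_space X R) = topspace Z"
    using epi by (simp add: topspace_quotient_topology flow_epi_def)
  fix g c assume g: "g \<in> carrier G" and c: "c \<in> topspace (quot_space X R)"
  obtain x where x: "x \<in> topspace X" "c = R `` {x}" using c by (auto simp: topspace_quotient_topology)
  then show "h (quot_act X R act g c) = actZ g (h c)"
    using quot_act_class[OF g] h flow_act(3)[OF flow g] epi g by (simp add: flow_epi_def)
qed

end

section \<open>Closed invariant equivalence relations with finite Ellis group\<close>

definition finite_ellis_congruences ::
  "('g, 'b) monoid_scheme \<Rightarrow> 'x topology \<Rightarrow> ('g \<Rightarrow> 'x \<Rightarrow> 'x) \<Rightarrow> ('x \<times> 'x) set set" where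
  "finite_ellis_congruences G X act =
     {R. flow_congruence G X act R \<and> finite_ellis_group G (quot_space X R) (quot_act X R act)}"

definition finite_ellis_separated ::
  "('g, 'b) monoid_scheme \<Rightarrow> 'x topology \<Rightarrow> ('g \<Rightarrow> 'x \<Rightarrow> 'x) \<Rightarrow> bool" where
  "finite_ellis_separated G X act \<longleftrightarrow>
     (\<forall>x\<in>topspace X. \<forall>y\<in>topspace X. x \<noteq> y \<longrightarrow> (\<exists>R\<in>finite_ellis_congruences G X act. (x, y) \<notin> R))"

context
  fixes G \<tau> X act assumes flow: "flow G \<tau> X act"
begin

text \<open>The quotient by the kernel of \<open>f\<close> is a copy of \<open>Z\<close>. To inherit
  finiteness it is enough that \<open>Z\<close> maps onto it, by sending a point to its fibre; this
  map is continuous because \<open>f\<close>, being closed, is a quotient map.\<close>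

lemma kernel_in_finite_ellis_congruences:
  assumes Z: "flow G \<tau> Z actZ" and epi: "flow_epi G X act Z actZ f" and fin: "finite_ellis_group G Z actZ"
  shows "{(x, y). x \<in> topspace X \<and> y \<in> topspace X \<and> f x = f y} \<in> finite_ellis_congruences G X act" (is "?R \<in> _")
proof -
  note fD = flow_epiD[OF flow Z epi]
  have cong: "flow_congruence G X act ?R"
    unfolding flow_congruence_def
  proof (intro conjI ballI allI impI)
    show "equiv (topspace X) ?R" by (auto intro!: equivI refl_onI symI transI)
    have "closedin (prod_topology X X) {p \<in> topspace (prod_topology X X). (f \<circ> fst) p = (f \<circ> snd) p}"
    proof (rule closedin_continuous_maps_eq[OF flowD(3)[OF Z]])
      show "continuous_map (prod_topology X X) Z (f \<circ> fst)" "continuous_map (prod_topology X X) Z (f \<circ> snd)"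
        using fD(1) by (auto intro: continuous_map_compose continuous_map_fst continuous_map_snd)
    qed
    moreover have "{p \<in> topspace (prod_topology X X). (f \<circ> fst) p = (f \<circ> snd) p} = ?R" by auto
    ultimately show "closedin (prod_topology X X) ?R" by simp
    fix g x y assume "g \<in> carrier G" "(x, y) \<in> ?R"
    then show "(act g x, act g y) \<in> ?R" using fD(3) flow_act(3)[OF flow] by auto
  qed
  let ?h = "\<lambda>z. {x \<in> topspace X. f x = z}"
  have h: "?h (f x) = ?R `` {x}" if "x \<in> topspace X" for x using that by auto
  have "flow_epi G Z actZ (quot_space X ?R) (quot_act X ?R act) ?h"
    unfolding flow_epi_def
  proof (intro conjI ballI)
    have "quotient_map X Z f"
      by (rule continuous_closed_imp_quotient_map[OF fD(1) continuous_imp_closed_map[OF fD(1) flowD(2)[OF flow] flowD(3)[OF Z]] fD(2)])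
    moreover have "continuous_map X (quot_space X ?R) (?h \<circ> f)"
    proof (rule continuous_map_eq)
      show "continuous_map X (quot_space X ?R) (\<lambda>x. ?R `` {x})"
        using flow_epi_quot[OF flow cong] unfolding flow_epi_def by (rule conjunct1)
    qed (simp add: h)
    ultimately show "continuous_map Z (quot_space X ?R) ?h" by (rule continuous_compose_quotient_map)
    have "?h ` f ` topspace X = (\<lambda>x. ?R `` {x}) ` topspace X" using h by (simp add: image_image)
    then show "?h ` topspace Z = topspace (quot_space X ?R)" by (simp add: topspace_quotient_topology fD(2))
    fix g z assume g: "g \<in> carrier G" and z: "z \<in> topspace Z"
    obtain x where x: "x \<in> topspace X" "z = f x" using z fD(2) by blast
    have "?h (actZ g z) = ?h (f (act g x))" using x fD(3) g by simp
    also have "\<dots> = ?R `` {act g x}" using h flow_act(3)[OF flow g] x by blast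
    also have "\<dots> = quot_act X ?R act g (?R `` {x})" using quot_act_class[OF flow cong g x(1)] by simp
    finally show "?h (actZ g z) = quot_act X ?R act g (?h z)" using x h by simp
  qed
  then show ?thesis
    using finite_ellis_group_epi[OF Z flow_quot[OF flow cong]] fin cong by (simp add: finite_ellis_congruences_def)
qed

text \<open>The quotient has at most one point. This relation starts the induction over finite
  intersections and makes the index set of the inverse system below nonempty.\<close>

lemma total_in_finite_ellis_congruences:
  "topspace X \<times> topspace X \<in> finite_ellis_congruences G X act" (is "?R \<in> _")
proof -
  have cong: "flow_congruence G X act ?R"
    using flow_act(3)[OF flow] by (auto simp: flow_congruence_def equiv_def refl_on_def sym_def trans_def closedin_prod_Times_iff)
  have "topspace X // ?R \<subseteq> {topspace X}" by (auto simp: quotient_def)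
  then have "finite (topspace (quot_space X ?R))"
    unfolding topspace_quot_space using finite_subset by blast
  moreover from this have "act_e ` topspace (quot_space X ?R) \<subseteq> topspace (quot_space X ?R)"
    if "act_e \<in> EL G (quot_space X ?R) (quot_act X ?R act)" for act_e
    using EL_in_PiE[OF flow_quot[OF flow cong] that] by auto
  moreover have "group G" using flowD(5)[OF flow] .
  then have "quot_act X ?R act \<one>\<^bsub>G\<^esub> \<in> EL G (quot_space X ?R) (quot_act X ?R act)"
    using act_in_EL[OF flow_quot[OF flow cong]] by (meson group.is_monoid monoid.one_closed)
  ultimately have "finite_ellis_group G (quot_space X ?R) (quot_act X ?R act)"
    using finite_ellis_group_if_finite_image[OF flow_quot[OF flow cong]] by blast
  then show ?thesis using cong by (simp add: finite_ellis_congruences_def)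
qed

lemma Int_in_finite_ellis_congruences:
  assumes "R \<in> finite_ellis_congruences G X act" "S \<in> finite_ellis_congruences G X act"
  shows "R \<inter> S \<in> finite_ellis_congruences G X act"
proof -
  have R: "flow_congruence G X act R" "finite_ellis_group G (quot_space X R) (quot_act X R act)"
    and S: "flow_congruence G X act S" "finite_ellis_group G (quot_space X S) (quot_act X S act)"
    using assms by (auto simp: finite_ellis_congruences_def)
  have eqv: "equiv (topspace X) R" "equiv (topspace X) S"
    using R S by (auto simp: flow_congruence_def)
  have cong: "flow_congruence G X act (R \<inter> S)"
    using R(1) S(1) unfolding flow_congruence_def
    by (intro conjI) (auto simp: equiv_def refl_on_def sym_def intro: trans_Int)
  note eq = congruence_class_eq[OF flow R(1)] congruence_class_eq[OF flow S(1)] congruence_class_eq[OF flow cong]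
  \<comment> \<open>Taking the image under \<open>Q\<close> is the projection from the finer
    quotient to the coarser one.\<close>
  have cl: "Q `` ((R \<inter> S) `` {x}) = Q `` {x}" if "Q = R \<or> Q = S" and x: "x \<in> topspace X" for Q x
  proof -
    have Q: "equiv (topspace X) Q" using that eqv by blast
    have "(x, x) \<in> R \<inter> S" using eqv x by (auto simp: equiv_def refl_on_def)
    moreover have "Q `` ((R \<inter> S) `` {x}) \<subseteq> Q `` (Q `` {x})" using that by blast
    moreover have "Q `` (Q `` {x}) \<subseteq> Q `` {x}" using Q by (auto simp: equiv_def dest: transD)
    ultimately show ?thesis by blast
  qed
  have "finite_ellis_group G (quot_space X (R \<inter> S)) (quot_act X (R \<inter> S) act)"
  proof (rule finite_ellis_group_joint[OF flow_quot[OF flow cong]])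
    show "flow G \<tau> (quot_space X R) (quot_act X R act)" "flow G \<tau> (quot_space X S) (quot_act X S act)"
      using flow_quot[OF flow] R S by auto
    show "flow_epi G (quot_space X (R \<inter> S)) (quot_act X (R \<inter> S) act) (quot_space X R) (quot_act X R act) (\<lambda>c. R `` c)"
      by (rule flow_epi_factor[OF flow cong flow_epi_quot[OF flow R(1)]]) (use cl in blast)
    show "flow_epi G (quot_space X (R \<inter> S)) (quot_act X (R \<inter> S) act) (quot_space X S) (quot_act X S act) (\<lambda>c. S `` c)"
      by (rule flow_epi_factor[OF flow cong flow_epi_quot[OF flow S(1)]]) (use cl in blast)
    fix c d assume "c \<in> topspace (quot_space X (R \<inter> S))" "d \<in> topspace (quot_space X (R \<inter> S))"
      and cd: "R `` c = R `` d" "S `` c = S `` d"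
    then obtain x y where x: "x \<in> topspace X" "c = (R \<inter> S) `` {x}" and y: "y \<in> topspace X" "d = (R \<inter> S) `` {y}"
      by (auto simp: topspace_quotient_topology)
    then have "R `` {x} = R `` {y}" "S `` {x} = S `` {y}" using cd cl by simp_all
    then have "(x, y) \<in> R \<inter> S" using eq x y by blast
    then show "c = d" using eq(3) x y by blast
  qed (use R S in auto)
  then show ?thesis using cong by (simp add: finite_ellis_congruences_def)
qed

text \<open>The factor \<open>topspace X \<times> topspace X\<close> supplies the right value for
  the empty family, whose plain intersection would be everything.\<close>

lemma Inter_in_finite_ellis_congruences:
  assumes "finite \<F>" "\<F> \<subseteq> finite_ellis_congruences G X act"
  shows "topspace X \<times> topspace X \<inter> \<Inter>\<F> \<in> finite_ellis_congruences G X act"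
  using assms
proof (induction \<F> rule: finite_induct)
  case empty
  then show ?case using total_in_finite_ellis_congruences by simp
next
  case (insert R \<F>)
  have "topspace X \<times> topspace X \<inter> \<Inter>(insert R \<F>) = R \<inter> (topspace X \<times> topspace X \<inter> \<Inter>\<F>)" by auto
  then show ?case using insert Int_in_finite_ellis_congruences by simp
qed

text \<open>Separation provides one congruence for each pair in
  \<open>K \<times> (topspace X - K)\<close>. This product is compact and the complements of the
  congruences are open, so the intersection of finitely many congruences separates all these
  pairs.\<close>

lemma clopen_saturated:
  assumes sep: "finite_ellis_separated G X act" and K: "closedin X K" "openin X K"
  shows "\<exists>R\<in>finite_ellis_congruences G X act. \<forall>x y. (x, y) \<in> R \<longrightarrow> (x \<in> K \<longleftrightarrow> y \<in> K)"
proof -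
  let ?D = "K \<times> (topspace X - K)"
  have "compactin (prod_topology X X) ?D"
    using K closedin_compact_space[OF flowD(2)[OF flow]] by (simp add: compactin_Times closedin_diff)
  moreover have "?D \<subseteq> \<Union>((\<lambda>R. topspace X \<times> topspace X - R) ` finite_ellis_congruences G X act)"
  proof clarify
    fix x y assume xy: "x \<in> K" "y \<in> topspace X" "y \<notin> K"
    then have "x \<in> topspace X" "x \<noteq> y" using K closedin_subset by blast+
    then obtain R where "R \<in> finite_ellis_congruences G X act" "(x, y) \<notin> R"
      using sep xy unfolding finite_ellis_separated_def by blast
    then show "(x, y) \<in> \<Union>((\<lambda>R. topspace X \<times> topspace X - R) ` finite_ellis_congruences G X act)"
      using xy \<open>x \<in> topspace X\<close> by blast
  qed
  moreover have "openin (prod_topology X X) U"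
    if "U \<in> (\<lambda>R. topspace X \<times> topspace X - R) ` finite_ellis_congruences G X act" for U
    using that by (auto simp: finite_ellis_congruences_def flow_congruence_def closedin_def)
  ultimately obtain \<F> where \<F>: "finite \<F>" "\<F> \<subseteq> (\<lambda>R. topspace X \<times> topspace X - R) ` finite_ellis_congruences G X act"
     "?D \<subseteq> \<Union>\<F>" unfolding compactin_def by meson
  from finite_subset_image[OF \<F>(1,2)] \<F>(3) obtain \<G> where \<G>: "finite \<G>" "\<G> \<subseteq> finite_ellis_congruences G X act"
      and cov: "?D \<subseteq> \<Union>((\<lambda>R. topspace X \<times> topspace X - R) ` \<G>)"
    by blast
  define R where "R = topspace X \<times> topspace X \<inter> \<Inter>\<G>"
  have R: "R \<in> finite_ellis_congruences G X act" unfolding R_def by (rule Inter_in_finite_ellis_congruences[OF \<G>])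
  have disj: "R \<inter> ?D = {}" using cov unfolding R_def by blast
  have sub: "R \<subseteq> topspace X \<times> topspace X" unfolding R_def by blast
  have "sym R" using R by (auto simp: finite_ellis_congruences_def flow_congruence_def equiv_def)
  then have "x \<in> K \<longleftrightarrow> y \<in> K" if "(x, y) \<in> R" for x y
    using that disj sub by (auto dest: symD)
  then show ?thesis using R by blast
qed

end

section \<open>Inverse limits of flows\<close>

lemma topspace_inverse_limit:
  "topspace (inverse_limit I leq X \<pi>) =
     {x \<in> \<Pi>\<^sub>E i\<in>I. topspace (X i). \<forall>i\<in>I. \<forall>j\<in>I. leq i j \<longrightarrow> \<pi> i j (x j) = x i}"
  by (auto simp: inverse_limit_def)

text \<open>The usual compactness argument: the points of the full product that are coherent below
  \<open>j\<close> and have coordinate \<open>x0\<close> at \<open>i0\<close> form nonempty closed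
  sets which decrease along the directed index set.\<close>

lemma inverse_limit_projection_surj:
  assumes sys: "inverse_system_of_flows G \<tau> I leq X act \<pi>" and i0: "i0 \<in> I" and x0: "x0 \<in> topspace (X i0)"
  shows "\<exists>x\<in>topspace (inverse_limit I leq X \<pi>). x i0 = x0"
proof -
  have refl: "\<And>i. i \<in> I \<Longrightarrow> leq i i"
    and trans: "\<And>i j k. \<lbrakk>i \<in> I; j \<in> I; k \<in> I; leq i j; leq j k\<rbrakk> \<Longrightarrow> leq i k"
    and dir: "\<And>i j. \<lbrakk>i \<in> I; j \<in> I\<rbrakk> \<Longrightarrow> \<exists>k\<in>I. leq i k \<and> leq j k"
    and flow: "\<And>i. i \<in> I \<Longrightarrow> flow G \<tau> (X i) (act i)"
    and epi: "\<And>i j. \<lbrakk>i \<in> I; j \<in> I; leq i j\<rbrakk> \<Longrightarrow> flow_epi G (X j) (act j) (X i) (act i) (\<pi> i j)"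
    and comp: "\<And>i j k x. \<lbrakk>i \<in> I; j \<in> I; k \<in> I; leq i j; leq j k; x \<in> topspace (X k)\<rbrakk> \<Longrightarrow> \<pi> i j (\<pi> j k x) = \<pi> i k x"
    using sys unfolding inverse_system_of_flows_def by meson+
  have surj: "\<pi> i j ` topspace (X j) = topspace (X i)" and cont: "continuous_map (X j) (X i) (\<pi> i j)"
    if "i \<in> I" "j \<in> I" "leq i j" for i j
    using epi[OF that] by (auto simp: flow_epi_def)
  let ?P = "product_topology X I"
  define C where "C i j = {x \<in> topspace ?P. \<pi> i j (x j) = x i}" for i j
  \<comment> \<open>Coherence is demanded only between \<open>j\<close> and the indices below it.
    The remaining coordinates stay free, which is what makes \<open>K j\<close> easy to
    inhabit.\<close>
  define K where "K j = {x \<in> topspace ?P. x i0 = x0 \<and> (\<forall>i\<in>I. leq i j \<longrightarrow> \<pi> i j (x j) = x i)}" for j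
  have proj: "continuous_map ?P (X i) (\<lambda>x. x i)" if "i \<in> I" for i
    using continuous_map_product_projection[OF that] .
  have clK: "closedin ?P (K j)" if j: "j \<in> I" for j
  proof -
    have C: "closedin ?P (C i j)" if "i \<in> I" "leq i j" for i
      unfolding C_def
      using closedin_continuous_maps_eq[OF flowD(3)[OF flow[OF that(1)]] continuous_map_compose[OF proj[OF j] cont[OF that(1) j that(2)]] proj[OF that(1)]]
      by (simp add: o_def)
    have "closedin (X i0) {x0}" by (rule closedin_Hausdorff_singleton[OF flowD(3)[OF flow[OF i0]] x0])
    then have "closedin ?P {x \<in> topspace ?P. x i0 \<in> {x0}}"
      by (rule closedin_continuous_map_preimage[OF proj[OF i0]])
    then have "closedin ?P (\<Inter>(insert {x \<in> topspace ?P. x i0 \<in> {x0}} ((\<lambda>i. C i j) ` {i\<in>I. leq i j})))"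
      using C by (intro closedin_Inter) auto
    moreover have "\<Inter>(insert {x \<in> topspace ?P. x i0 \<in> {x0}} ((\<lambda>i. C i j) ` {i\<in>I. leq i j})) = K j"
      unfolding K_def C_def by (auto simp del: topspace_product_topology)
    ultimately show ?thesis by simp
  qed
  have neK: "K j \<noteq> {}" if j: "j \<in> I" "leq i0 j" for j
  proof -
    have "x0 \<in> \<pi> i0 j ` topspace (X j)" using surj[OF i0 j] x0 by simp
    then obtain y where y: "y \<in> topspace (X j)" "\<pi> i0 j y = x0" by blast
    have ne: "topspace (X i) \<noteq> {}" if i: "i \<in> I" for i
    proof -
      obtain k where k: "k \<in> I" "leq i k" "leq i0 k" using dir[OF i i0] by blast
      have "topspace (X k) \<noteq> {}" using surj[OF i0 k(1,3)] x0 by auto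
      then show ?thesis using surj[OF i k(1,2)] by auto
    qed
    \<comment> \<open>Below \<open>j\<close> the coordinates are the images of a preimage
      \<open>y\<close> of \<open>x0\<close>; elsewhere any point will do, and there is one because
      \<open>i\<close> and \<open>i0\<close> have a common upper bound.\<close>
    define x where "x = (\<lambda>i\<in>I. if leq i j then \<pi> i j y else (SOME z. z \<in> topspace (X i)))"
    have "x i \<in> topspace (X i)" if i: "i \<in> I" for i
    proof (cases "leq i j")
      case True
      then show ?thesis using surj[OF i j(1) True] y i by (auto simp: x_def)
    next
      case False
      then show ?thesis using ne[OF i] i by (simp add: x_def some_in_eq)
    qed
    then have "x \<in> topspace ?P" by (auto simp: x_def)
    moreover have "\<pi> i j (x j) = x i" if "i \<in> I" "leq i j" for i
      using comp[of i j j y] that j y refl by (simp add: x_def)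
    moreover have "x i0 = x0" using i0 j y by (simp add: x_def)
    ultimately show ?thesis unfolding K_def by blast
  qed
  have decK: "K k \<subseteq> K j" if jk: "j \<in> I" "k \<in> I" "leq j k" for j k
  proof
    fix x assume x: "x \<in> K k"
    have xk: "x k \<in> topspace (X k)" using x jk by (auto simp: K_def)
    have "\<pi> i j (x j) = x i" if i: "i \<in> I" "leq i j" for i
    proof -
      have "x j = \<pi> j k (x k)" "x i = \<pi> i k (x k)" using x jk i trans[OF i(1) jk(1,2) i(2) jk(3)] by (auto simp: K_def)
      then show ?thesis using comp[OF i(1) jk(1,2) i(2) jk(3) xk] by simp
    qed
    then show "x \<in> K j" using x by (auto simp: K_def)
  qed
  \<comment> \<open>Only indices above \<open>i0\<close> are considered, where a bonding map onto
    \<open>X i0\<close> exists; by directedness they are cofinal.\<close>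
  define J where "J = {j\<in>I. leq i0 j}"
  have "compact_space ?P" using flowD(2)[OF flow] by (simp add: compact_space_product_topology)
  then have *: "(\<forall>D\<in>K ` J. closedin ?P D) \<and> (\<forall>\<F>. finite \<F> \<and> \<F> \<subseteq> K ` J \<longrightarrow> \<Inter> \<F> \<noteq> {}) \<longrightarrow> \<Inter> (K ` J) \<noteq> {}"
    unfolding compact_space_fip by (rule spec)
  have dirK: "\<exists>k\<in>J. K k \<subseteq> \<Inter>(K ` F)" if "finite F" "F \<subseteq> J" for F
    using that
  proof (induction F rule: finite_induct)
    case empty
    then show ?case using i0 refl by (auto simp: J_def)
  next
    case (insert j F)
    then obtain k where k: "k \<in> J" "K k \<subseteq> \<Inter>(K ` F)" by blast
    have j: "j \<in> J" using insert by blast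
    obtain l where l: "l \<in> I" "leq j l" "leq k l" using dir[of j k] k j by (auto simp: J_def)
    have "l \<in> J" using l k trans[OF i0 _ l(1) _ l(3)] by (auto simp: J_def)
    moreover have "K l \<subseteq> K j" "K l \<subseteq> K k" using decK[of j l] decK[of k l] l k j by (auto simp: J_def)
    ultimately show ?case using k by blast
  qed
  have "\<Inter>\<F> \<noteq> {}" if F: "finite \<F>" "\<F> \<subseteq> K ` J" for \<F>
  proof -
    from finite_subset_image[OF F] obtain F where F': "F \<subseteq> J" "finite F" "\<F> = K ` F" by blast
    obtain k where "k \<in> J" "K k \<subseteq> \<Inter>(K ` F)" using dirK[OF F'(2,1)] by blast
    moreover have "K k \<noteq> {}" using neK[of k] \<open>k \<in> J\<close> by (simp add: J_def)
    ultimately show ?thesis unfolding F'(3) by blast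
  qed
  then have "\<Inter>(K ` J) \<noteq> {}" using clK by (intro *[THEN mp]) (auto simp: J_def)
  then obtain x where x: "\<And>j. j \<in> J \<Longrightarrow> x \<in> K j" by blast
  have "i0 \<in> J" using i0 refl by (auto simp: J_def)
  then have x': "x \<in> topspace ?P" "x i0 = x0" using x[of i0] by (auto simp: K_def)
  have "\<pi> i j (x j) = x i" if ij: "i \<in> I" "j \<in> I" "leq i j" for i j
  proof -
    obtain k where k: "k \<in> I" "leq j k" "leq i0 k" using dir[OF ij(2) i0] by blast
    then have "x \<in> K k" using x by (auto simp: J_def)
    then have "x \<in> K j" using decK[OF ij(2) k(1,2)] by blast
    then show ?thesis using ij by (auto simp: K_def)
  qed
  then have "x \<in> topspace (inverse_limit I leq X \<pi>)" using x' by (auto simp: topspace_inverse_limit)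
  then show ?thesis using x' by blast
qed

text \<open>The coordinate maps are flow epimorphisms by
  \<open>inverse_limit_projection_surj\<close>, and their kernels separate points. Index and point
  types are arbitrary here, so the lemma covers both \<open>cond_B\<close> and
  \<open>cond_B_any\<close>.\<close>

lemma finite_ellis_separated_if_inverse_limit:
  assumes flow: "flow G \<tau> Y actY"
    and lim: "inverse_limit_of_finite_ellis TYPE('j) TYPE('x) G \<tau> Y actY"
  shows "finite_ellis_separated G Y actY"
proof -
  obtain I :: "'j set" and leq and X :: "'j \<Rightarrow> 'x topology" and act \<pi>
    where sys: "inverse_system_of_flows G \<tau> I leq X act \<pi>"
      and fin: "\<forall>i\<in>I. finite_ellis_group G (X i) (act i)"
      and iso: "flow_isomorphic G Y actY (inverse_limit I leq X \<pi>) (inverse_limit_act I leq X act \<pi>)"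
    using lim unfolding inverse_limit_of_finite_ellis_def by blast
  let ?L = "inverse_limit I leq X \<pi>"
  obtain h where h: "homeomorphic_map Y ?L h"
    and heq: "\<And>g y. g \<in> carrier G \<Longrightarrow> y \<in> topspace Y \<Longrightarrow> h (actY g y) = inverse_limit_act I leq X act \<pi> g (h y)"
    using iso unfolding flow_isomorphic_def by blast
  have him: "h ` topspace Y = topspace ?L" using h homeomorphic_imp_surjective_map by blast
  have hinj: "inj_on h (topspace Y)" using h homeomorphic_imp_injective_map by blast
  have hcont: "continuous_map Y ?L h" using h homeomorphic_imp_continuous_map by blast
  have flX: "flow G \<tau> (X i) (act i)" if "i \<in> I" for i
    using sys that unfolding inverse_system_of_flows_def by blast
  have epi: "flow_epi G Y actY (X i) (act i) (\<lambda>y. h y i)" if i: "i \<in> I" for i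
    unfolding flow_epi_def
  proof (intro conjI ballI)
    have "continuous_map ?L (X i) (\<lambda>x. x i)"
      unfolding inverse_limit_def using i by (intro continuous_map_from_subtopology continuous_map_product_projection)
    from continuous_map_compose[OF hcont this] show "continuous_map Y (X i) (\<lambda>y. h y i)" by (simp add: o_def)
    show "(\<lambda>y. h y i) ` topspace Y = topspace (X i)"
    proof (rule equalityI)
      show "(\<lambda>y. h y i) ` topspace Y \<subseteq> topspace (X i)"
        using him i by (auto simp: topspace_inverse_limit PiE_iff dest!: equalityD1)
      show "topspace (X i) \<subseteq> (\<lambda>y. h y i) ` topspace Y"
      proof
        fix x0 assume "x0 \<in> topspace (X i)"
        then obtain x where "x \<in> topspace ?L" "x i = x0" using inverse_limit_projection_surj[OF sys i] by blast
        then show "x0 \<in> (\<lambda>y. h y i) ` topspace Y" using him by (metis (no_types, lifting) image_iff)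
      qed
    qed
    fix g y assume g: "g \<in> carrier G" and y: "y \<in> topspace Y"
    then have "h y \<in> topspace ?L" using him by blast
    then show "h (actY g y) i = act i g (h y i)" using heq[OF g y] i by (simp add: inverse_limit_act_def)
  qed
  show ?thesis
    unfolding finite_ellis_separated_def
  proof (intro ballI impI)
    fix x y assume xy: "x \<in> topspace Y" "y \<in> topspace Y" "x \<noteq> y"
    then have ne: "h x \<noteq> h y" using hinj by (meson inj_onD)
    have "h x \<in> topspace ?L" "h y \<in> topspace ?L" using xy him by blast+
    then have "h x \<in> (\<Pi>\<^sub>E i\<in>I. topspace (X i))" "h y \<in> (\<Pi>\<^sub>E i\<in>I. topspace (X i))"
      by (simp_all add: topspace_inverse_limit)
    then obtain i where i: "i \<in> I" "h x i \<noteq> h y i" using ne by (metis PiE_ext)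
    have "{(x, y). x \<in> topspace Y \<and> y \<in> topspace Y \<and> h x i = h y i} \<in> finite_ellis_congruences G Y actY"
      using kernel_in_finite_ellis_congruences[OF flow flX[OF i(1)] epi[OF i(1)]] fin i by blast
    then show "\<exists>R\<in>finite_ellis_congruences G Y actY. (x, y) \<notin> R" using i(2) by (intro bexI[rotated]) auto
  qed
qed

text \<open>The system consists of all quotients by congruences with finite Ellis group, ordered by
  reverse inclusion and directed by intersections. The canonical map into the limit is injective by
  separation; compactness gives surjectivity and makes it a homeomorphism.\<close>

lemma inverse_limit_if_finite_ellis_separated:
  fixes X :: "'x topology"
  assumes flow: "flow G \<tau> X act" and sep: "finite_ellis_separated G X act"
  shows "inverse_limit_of_finite_ellis TYPE(('x \<times> 'x) set) TYPE('x set) G \<tau> X act"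
proof -
  define I where "I = finite_ellis_congruences G X act"
  define leq where "leq R S \<longleftrightarrow> S \<subseteq> R" for R S :: "('x \<times> 'x) set"
  let ?X = "\<lambda>R. quot_space X R"
  let ?act = "\<lambda>R. quot_act X R act"
  let ?\<pi> = "\<lambda>R S :: ('x \<times> 'x) set. \<lambda>c. R `` c"
  have cong: "flow_congruence G X act R" and fin: "finite_ellis_group G (?X R) (?act R)" if "R \<in> I" for R
    using that by (auto simp: I_def finite_ellis_congruences_def)
  have eqv: "equiv (topspace X) R" if "R \<in> I" for R using cong[OF that] by (simp add: flow_congruence_def)
  have cl: "R `` (S `` {x}) = R `` {x}" if RS: "R \<in> I" "S \<in> I" "S \<subseteq> R" and x: "x \<in> topspace X" for R S x
  proof -
    have "(x, x) \<in> S" using eqv[OF RS(2)] x by (auto simp: equiv_def refl_on_def)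
    moreover have "R `` (S `` {x}) \<subseteq> R `` (R `` {x})" using RS by blast
    moreover have "R `` (R `` {x}) \<subseteq> R `` {x}" using eqv[OF RS(1)] by (auto simp: equiv_def dest: transD)
    ultimately show ?thesis by blast
  qed
  have pt: "\<exists>x\<in>topspace X. c = R `` {x}" if "c \<in> topspace (?X R)" for c R
    using that by (auto simp: topspace_quotient_topology)
  have sys: "inverse_system_of_flows G \<tau> I leq ?X ?act ?\<pi>"
    unfolding inverse_system_of_flows_def
  proof (intro conjI ballI impI)
    show "I \<noteq> {}" using total_in_finite_ellis_congruences[OF flow] by (auto simp: I_def)
    show "\<exists>k\<in>I. leq i k \<and> leq j k" if "i \<in> I" "j \<in> I" for i j
      using Int_in_finite_ellis_congruences[OF flow] that unfolding I_def leq_def by blast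
    show "flow G \<tau> (?X R) (?act R)" if "R \<in> I" for R using flow_quot[OF flow cong[OF that]] .
    show "flow_epi G (?X S) (?act S) (?X R) (?act R) (?\<pi> R S)" if RS: "R \<in> I" "S \<in> I" "leq R S" for R S
      using flow_epi_factor[OF flow cong[OF RS(2)] flow_epi_quot[OF flow cong[OF RS(1)]]] cl[OF RS(1,2)] RS(3)
      unfolding leq_def by blast
    show "R `` c = c" if R: "R \<in> I" and c: "c \<in> topspace (?X R)" for R c
      using pt[OF c] cl[OF R R subset_refl] by auto
    show "R `` (S `` c) = R `` c" if RSK: "R \<in> I" "S \<in> I" "K \<in> I" "leq R S \<and> leq S K" and c: "c \<in> topspace (?X K)" for R S K c
    proof -
      obtain x where x: "x \<in> topspace X" "c = K `` {x}" using pt[OF c] by blast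
      have "S `` c = S `` {x}" "R `` c = R `` {x}" "R `` (S `` {x}) = R `` {x}"
        using cl[of S K x] cl[of R K x] cl[of R S x] RSK x unfolding leq_def by (metis subset_trans)+
      then show ?thesis by simp
    qed
  qed (auto simp: leq_def)
  let ?L = "inverse_limit I leq ?X ?\<pi>"
  define h where "h x = (\<lambda>R\<in>I. R `` {x})" for x
  have hL: "h x \<in> topspace ?L" if x: "x \<in> topspace X" for x
    using x cl by (auto simp: topspace_inverse_limit h_def leq_def topspace_quotient_topology)
  have "homeomorphic_map X ?L h"
  proof (rule continuous_imp_homeomorphic_map)
    show "compact_space X" using flowD(2)[OF flow] .
    have "Hausdorff_space (?X R)" if "R \<in> I" for R using Hausdorff_quot[OF flow cong[OF that]] .
    then show "Hausdorff_space ?L"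
      unfolding inverse_limit_def by (intro Hausdorff_space_subtopology) (simp add: Hausdorff_space_product_topology)
    have "continuous_map X (product_topology ?X I) h"
      unfolding continuous_map_componentwise
    proof (intro conjI ballI)
      fix R assume R: "R \<in> I"
      show "continuous_map X (?X R) (\<lambda>x. h x R)"
        using quotient_imp_continuous_map[OF quotient_map_quotient_topology, of X "\<lambda>x. R `` {x}"] R by (simp add: h_def)
    qed (auto simp: h_def)
    then show "continuous_map X ?L h"
      using hL unfolding inverse_limit_def continuous_map_in_subtopology by (auto simp: topspace_inverse_limit)
    show "inj_on h (topspace X)"
    proof (rule inj_onI, rule ccontr)
      fix x y assume xy: "x \<in> topspace X" "y \<in> topspace X" "h x = h y" "x \<noteq> y"
      then obtain R where R: "R \<in> I" "(x, y) \<notin> R" using sep unfolding finite_ellis_separated_def I_def by blast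
      have "R `` {x} = R `` {y}" using fun_cong[OF xy(3), of R] R by (simp add: h_def)
      then show False using congruence_class_eq[OF flow cong[OF R(1)] xy(1,2)] R by blast
    qed
    show "h ` topspace X = topspace ?L"
    proof (rule equalityI)
      show "h ` topspace X \<subseteq> topspace ?L" using hL by blast
      show "topspace ?L \<subseteq> h ` topspace X"
      proof
        \<comment> \<open>A point of the limit picks one class, a nonempty closed subset of
          \<open>X\<close>, for each congruence. Compatibility and closure under intersections make
          these classes directed downwards, and any common element is a preimage of
          \<open>z\<close>.\<close>
        fix z assume z: "z \<in> topspace ?L"
        then have zt: "z R \<in> topspace (?X R)" if "R \<in> I" for R using that by (auto simp: topspace_inverse_limit)
        have zc: "R `` (z S) = z R" if "R \<in> I" "S \<in> I" "S \<subseteq> R" for R S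
          using z that by (auto simp: topspace_inverse_limit leq_def)
        have zne: "z R \<noteq> {}" and zclosed: "closedin X (z R)" and zsub: "z R \<subseteq> topspace X" if R: "R \<in> I" for R
        proof -
          obtain x where x: "x \<in> topspace X" "z R = R `` {x}" using pt[OF zt[OF R]] by blast
          show "z R \<noteq> {}" using x eqv[OF R] by (auto simp: equiv_def refl_on_def)
          have "closedin (?X R) {z R}"
            by (rule closedin_Hausdorff_singleton[OF Hausdorff_quot[OF flow cong[OF R]] zt[OF R]])
          then have "closedin X {y \<in> topspace X. R `` {y} \<in> {z R}}"
            by (rule closedin_continuous_map_preimage[OF quotient_imp_continuous_map[OF quotient_map_quotient_topology]])
          moreover have "{y \<in> topspace X. R `` {y} \<in> {z R}} = z R"
          proof (intro equalityI subsetI)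
            fix y assume "y \<in> {y \<in> topspace X. R `` {y} \<in> {z R}}"
            then have "y \<in> topspace X" "R `` {x} = R `` {y}" using x by auto
            then show "y \<in> z R" using congruence_class_eq[OF flow cong[OF R] x(1)] x by simp
          next
            fix y assume "y \<in> z R"
            then have xy: "(x, y) \<in> R" using x by simp
            then have "y \<in> topspace X" using congruence_subset(2)[OF flow cong[OF R]] by blast
            moreover from this have "R `` {x} = R `` {y}"
              using congruence_class_eq[OF flow cong[OF R] x(1)] xy by simp
            ultimately show "y \<in> {y \<in> topspace X. R `` {y} \<in> {z R}}" using x by simp
          qed
          ultimately show "closedin X (z R)" by simp
          then show "z R \<subseteq> topspace X" by (rule closedin_subset)
        qed
        have "\<exists>R\<in>I. z R \<subseteq> \<Inter>(z ` F)" if "finite F" "F \<subseteq> I" for F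
          using that
        proof (induction F rule: finite_induct)
          case empty
          then show ?case using total_in_finite_ellis_congruences[OF flow] by (auto simp: I_def)
        next
          case (insert S F)
          then obtain R where R: "R \<in> I" "z R \<subseteq> \<Inter>(z ` F)" by blast
          have S: "S \<in> I" using insert by blast
          have RS: "R \<inter> S \<in> I" using Int_in_finite_ellis_congruences[OF flow] R S unfolding I_def by blast
          have refl: "z (R \<inter> S) \<subseteq> Q `` z (R \<inter> S)" if "Q \<in> I" for Q
            using zsub[OF RS] eqv[OF that] by (auto simp: equiv_def refl_on_def)
          have "z (R \<inter> S) \<subseteq> z R" "z (R \<inter> S) \<subseteq> z S"
            using refl[OF R(1)] refl[OF S] zc[OF R(1) RS] zc[OF S RS] by auto
          then show ?case using RS R by blast
        qed
        note dir = this
        have *: "(\<forall>D\<in>z ` I. closedin X D) \<and> (\<forall>\<F>. finite \<F> \<and> \<F> \<subseteq> z ` I \<longrightarrow> \<Inter> \<F> \<noteq> {}) \<longrightarrow> \<Inter> (z ` I) \<noteq> {}"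
          using flowD(2)[OF flow] unfolding compact_space_fip by (rule spec)
        have "\<Inter>\<F> \<noteq> {}" if F: "finite \<F>" "\<F> \<subseteq> z ` I" for \<F>
        proof -
          from finite_subset_image[OF F] obtain F where "F \<subseteq> I" "finite F" "\<F> = z ` F" by blast
          moreover from this obtain R where "R \<in> I" "z R \<subseteq> \<Inter>(z ` F)" using dir by blast
          moreover have "z R \<noteq> {}" using zne[OF \<open>R \<in> I\<close>] .
          ultimately show ?thesis by blast
        qed
        then have "\<Inter>(z ` I) \<noteq> {}" using zclosed by (intro *[THEN mp]) auto
        then obtain x where x: "\<And>R. R \<in> I \<Longrightarrow> x \<in> z R" by blast
        have xX: "x \<in> topspace X"
          using x zsub total_in_finite_ellis_congruences[OF flow] unfolding I_def by blast
        have "z R = h x R" if R: "R \<in> I" for R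
        proof -
          obtain y where y: "y \<in> topspace X" "z R = R `` {y}" using pt[OF zt[OF R]] by blast
          then have "(y, x) \<in> R" using x[OF R] by blast
          then show ?thesis using congruence_class_eq[OF flow cong[OF R] y(1) xX] y R by (simp add: h_def)
        qed
        moreover have "z \<in> extensional I" "h x \<in> extensional I"
          using z by (auto simp: topspace_inverse_limit PiE_iff h_def)
        ultimately have "z = h x" by (intro extensionalityI[where A = I]) auto
        then show "z \<in> h ` topspace X" using xX by blast
      qed
    qed
  qed
  moreover have "h (act g x) = inverse_limit_act I leq ?X ?act ?\<pi> g (h x)"
    if g: "g \<in> carrier G" and x: "x \<in> topspace X" for g x
  proof (rule ext)
    fix R
    show "h (act g x) R = inverse_limit_act I leq ?X ?act ?\<pi> g (h x) R"
      using hL[OF x] quot_act_class[OF flow cong g x] by (simp add: inverse_limit_act_def h_def restrict_def)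
  qed
  ultimately have "flow_isomorphic G X act ?L (inverse_limit_act I leq ?X ?act ?\<pi>)"
    unfolding flow_isomorphic_def by blast
  then show ?thesis
    unfolding inverse_limit_of_finite_ellis_def using sys fin by blast
qed

lemma profinite_ellis_group_if_finite_ellis_separated:
  assumes flow: "flow G \<tau> X act" and sep: "finite_ellis_separated G X act"
    and M: "minimal_left_ideal G X act M" "u \<in> M" "ellis_idempotent X u"
  shows "profinite_group (ellis_group X M u) (tau_topology G X act M u)"
proof (rule profinite_ellis_group[OF flow M])
  fix R assume R: "R \<in> finite_ellis_congruences G X act"
  then have cong: "flow_congruence G X act R" by (simp add: finite_ellis_congruences_def)
  show "flow G \<tau> (quot_space X R) (quot_act X R act)" by (rule flow_quot[OF flow cong])
  show "flow_epi G X act (quot_space X R) (quot_act X R act) (\<lambda>x. R `` {x})" by (rule flow_epi_quot[OF flow cong])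
  show "finite_ellis_group G (quot_space X R) (quot_act X R act)"
    using R by (simp add: finite_ellis_congruences_def)
next
  fix x y assume xy: "x \<in> topspace X" "y \<in> topspace X" "x \<noteq> y"
  then obtain R where R: "R \<in> finite_ellis_congruences G X act" "(x, y) \<notin> R"
    using sep unfolding finite_ellis_separated_def by blast
  have "R `` {x} \<noteq> R `` {y}"
    using congruence_class_eq[OF flow _ xy(1,2)] R by (simp add: finite_ellis_congruences_def)
  then show "\<exists>R\<in>finite_ellis_congruences G X act. R `` {x} \<noteq> R `` {y}" using R by blast
qed

text \<open>Since \<open>f\<close> is constant on the classes of \<open>R\<close>, the flow
  \<open>Z\<close> is a quotient of the quotient by \<open>R\<close>, and finiteness descends. For
  the same reason the representative chosen by \<open>SOME\<close> does not matter.\<close>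

lemma finite_ellis_group_factor:
  assumes flow: "flow G \<tau> X act" and Z: "flow G \<tau> Z actZ" and epi: "flow_epi G X act Z actZ f"
    and R: "R \<in> finite_ellis_congruences G X act" "\<And>x y. (x, y) \<in> R \<Longrightarrow> f x = f y"
  shows "finite_ellis_group G Z actZ"
proof -
  have cong: "flow_congruence G X act R" using R by (simp add: finite_ellis_congruences_def)
  have "flow_epi G (quot_space X R) (quot_act X R act) Z actZ (\<lambda>c. f (SOME x. x \<in> c))"
  proof (rule flow_epi_factor[OF flow cong epi])
    fix x assume "x \<in> topspace X"
    then have "x \<in> R `` {x}" using congruence_equiv[OF flow cong] by (auto simp: equiv_def refl_on_def)
    then have "(SOME y. y \<in> R `` {x}) \<in> R `` {x}" by (rule someI)
    then show "f (SOME y. y \<in> R `` {x}) = f x" using R(2)[of x "SOME y. y \<in> R `` {x}"] by simp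
  qed
  then show ?thesis
    using finite_ellis_group_epi[OF flow_quot[OF flow cong] Z] R by (simp add: finite_ellis_congruences_def)
qed

section \<open>Profinite groups\<close>

lemma profinite_group_iso:
  fixes \<Gamma> :: "('g, 'z) monoid_scheme" (structure)
  assumes pf: "profinite_group \<Gamma> \<tau>" and grp': "group \<Gamma>'"
    and bij: "\<phi> ` carrier \<Gamma> = carrier \<Gamma>'"
    and hom: "\<And>x y. \<lbrakk>x \<in> carrier \<Gamma>; y \<in> carrier \<Gamma>\<rbrakk> \<Longrightarrow> \<phi> (x \<otimes> y) = \<phi> x \<otimes>\<^bsub>\<Gamma>'\<^esub> \<phi> y"
    and homeo: "homeomorphic_map \<tau> \<tau>' \<phi>"
  shows "profinite_group \<Gamma>' \<tau>'"
proof -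
  have tg: "topological_group \<Gamma> \<tau>" and top: "topspace \<tau> = carrier \<Gamma>" and grp: "group \<Gamma>"
    using pf by (auto simp: profinite_group_def topological_group_def)
  interpret A: group \<Gamma> by fact
  interpret B: group \<Gamma>' by fact
  have top': "topspace \<tau>' = carrier \<Gamma>'" using homeomorphic_imp_surjective_map[OF homeo] top bij by simp
  obtain \<psi> where \<psi>: "homeomorphic_maps \<tau> \<tau>' \<phi> \<psi>" using homeo homeomorphic_map_maps by blast
  have \<psi>c: "continuous_map \<tau>' \<tau> \<psi>" and \<phi>c: "continuous_map \<tau> \<tau>' \<phi>"
    and \<phi>\<psi>: "\<And>y. y \<in> carrier \<Gamma>' \<Longrightarrow> \<phi> (\<psi> y) = y"
    using \<psi> top top' by (auto simp: homeomorphic_maps_def)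
  have \<psi>in: "\<psi> y \<in> carrier \<Gamma>" if "y \<in> carrier \<Gamma>'" for y
    using \<psi>c that top top' by (auto simp: continuous_map_def)
  have \<phi>in: "\<phi> x \<in> carrier \<Gamma>'" if "x \<in> carrier \<Gamma>" for x using that bij by blast
  have inv: "\<phi> (inv x) = inv\<^bsub>\<Gamma>'\<^esub> \<phi> x" if x: "x \<in> carrier \<Gamma>" for x
  proof -
    have "\<phi> \<one> \<otimes>\<^bsub>\<Gamma>'\<^esub> \<phi> \<one> = \<phi> \<one>" using hom[of \<one> \<one>] by simp
    then have "\<phi> \<one> = \<one>\<^bsub>\<Gamma>'\<^esub>" using \<phi>in B.l_cancel_one by simp
    then have "\<phi> (inv x) \<otimes>\<^bsub>\<Gamma>'\<^esub> \<phi> x = \<one>\<^bsub>\<Gamma>'\<^esub>" using hom[of "inv x" x] x by simp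
    then show ?thesis using B.inv_equality \<phi>in x by simp
  qed
  have "continuous_map (prod_topology \<tau>' \<tau>') \<tau>' (\<phi> \<circ> (\<lambda>(x, y). x \<otimes> y) \<circ> (\<lambda>(x, y). (\<psi> x, \<psi> y)))"
    using tg \<psi>c \<phi>c unfolding topological_group_def
    by (intro continuous_map_compose[OF _ continuous_map_compose[of _ \<tau>]]) (auto simp: continuous_map_prod_top)
  then have "continuous_map (prod_topology \<tau>' \<tau>') \<tau>' (\<lambda>(x, y). x \<otimes>\<^bsub>\<Gamma>'\<^esub> y)"
    by (rule continuous_map_eq) (auto simp: top' hom \<psi>in \<phi>\<psi>)
  moreover have "continuous_map \<tau>' \<tau>' (\<phi> \<circ> (\<lambda>x. inv x) \<circ> \<psi>)"
    using tg \<psi>c \<phi>c unfolding topological_group_def by (meson continuous_map_compose)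
  then have "continuous_map \<tau>' \<tau>' (\<lambda>x. inv\<^bsub>\<Gamma>'\<^esub> x)"
    by (rule continuous_map_eq) (auto simp: top' inv \<psi>in \<phi>\<psi>)
  moreover have "compact_space \<tau>'" "Hausdorff_space \<tau>'"
    using pf homeo homeomorphic_compact_space homeomorphic_Hausdorff_space homeomorphic_map_imp_homeomorphic_space
    unfolding profinite_group_def by blast+
  moreover have "totally_disconnected \<tau>'"
    unfolding totally_disconnected_def
  proof
    fix y assume "y \<in> topspace \<tau>'"
    then have "y \<in> \<phi> ` carrier \<Gamma>" using top' bij by simp
    then obtain x where x: "x \<in> topspace \<tau>" "y = \<phi> x" unfolding top by blast
    have "connected_component_of_set \<tau>' (\<phi> x) = \<phi> ` connected_component_of_set \<tau> x"
      using homeomorphic_map_connected_component_of[OF homeo x(1)] .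
    then show "connected_component_of_set \<tau>' y = {y}"
      using pf x by (simp add: profinite_group_def totally_disconnected_def)
  qed
  ultimately show ?thesis using top' grp' by (simp add: profinite_group_def topological_group_def)
qed

text \<open>Cosets of the trivial subgroup are singletons. The factor group is thus a copy of
  \<open>\<Gamma>\<close> with elements of another type, and profiniteness is carried along the
  isomorphism.\<close>

lemma profinite_group_Mod_trivial:
  fixes \<Gamma> :: "('g, 'z) monoid_scheme" (structure)
  assumes pf: "profinite_group \<Gamma> \<tau>"
  shows "profinite_group (\<Gamma> Mod {\<one>}) (quotient_topology \<tau> (\<lambda>x. {\<one>} #> x))"
proof -
  have top: "topspace \<tau> = carrier \<Gamma>" and grp: "group \<Gamma>"
    using pf by (auto simp: profinite_group_def topological_group_def)
  interpret group \<Gamma> by fact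
  interpret N: normal "{\<one>}" \<Gamma> by (rule one_is_normal)
  have coset: "{\<one>} #> x = {x}" if "x \<in> carrier \<Gamma>" for x using that by (auto simp: r_coset_def)
  show ?thesis
  proof (rule profinite_group_iso[OF pf N.factorgroup_is_group])
    show "(\<lambda>x. {\<one>} #> x) ` carrier \<Gamma> = carrier (\<Gamma> Mod {\<one>})" by (auto simp: FactGroup_def RCOSETS_def)
    show "{\<one>} #> (x \<otimes> y) = ({\<one>} #> x) \<otimes>\<^bsub>\<Gamma> Mod {\<one>}\<^esub> ({\<one>} #> y)" if "x \<in> carrier \<Gamma>" "y \<in> carrier \<Gamma>" for x y
      using that by (simp add: FactGroup_def N.rcos_sum)
    have "inj_on (\<lambda>x. {\<one>} #> x) (topspace \<tau>)" using coset by (auto simp: inj_on_def top)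
    then show "homeomorphic_map \<tau> (quotient_topology \<tau> (\<lambda>x. {\<one>} #> x)) (\<lambda>x. {\<one>} #> x)"
      unfolding homeomorphic_map_def by (simp add: quotient_map_quotient_topology)
  qed
qed

text \<open>A continuous epimorphism from a compact group onto a Hausdorff group is open and closed, hence it
  maps clopen sets to clopen sets.\<close>

lemma totally_disconnected_image:
  fixes \<Gamma> :: "('g, 'z) monoid_scheme" (structure) and \<Delta> :: "('h, 'w) monoid_scheme"
  assumes pf: "profinite_group \<Gamma> \<tau>" and tg': "topological_group \<Delta> \<tau>'" and haus': "Hausdorff_space \<tau>'"
    and cont: "continuous_map \<tau> \<tau>' \<theta>"
    and hom: "\<And>x y. \<lbrakk>x \<in> carrier \<Gamma>; y \<in> carrier \<Gamma>\<rbrakk> \<Longrightarrow> \<theta> (x \<otimes> y) = \<theta> x \<otimes>\<^bsub>\<Delta>\<^esub> \<theta> y"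
    and surj: "\<theta> ` carrier \<Gamma> = carrier \<Delta>"
  shows "totally_disconnected \<tau>'"
  unfolding totally_disconnected_def
proof (intro ballI equalityI subsetI)
  have top: "topspace \<tau> = carrier \<Gamma>" and grp: "group \<Gamma>" and comp: "compact_space \<tau>" and haus: "Hausdorff_space \<tau>"
    and mcont: "continuous_map (prod_topology \<tau> \<tau>) \<tau> (\<lambda>(x, y). x \<otimes> y)"
    using pf by (auto simp: profinite_group_def topological_group_def)
  have top': "topspace \<tau>' = carrier \<Delta>" and grp': "group \<Delta>"
    and mcont': "continuous_map (prod_topology \<tau>' \<tau>') \<tau>' (\<lambda>(x, y). x \<otimes>\<^bsub>\<Delta>\<^esub> y)"
    using tg' by (auto simp: topological_group_def)
  interpret A: group \<Gamma> by fact
  interpret B: group \<Delta> by fact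
  have \<theta>in: "\<theta> x \<in> carrier \<Delta>" if "x \<in> carrier \<Gamma>" for x using that surj by blast
  have \<theta>1: "\<theta> \<one> = \<one>\<^bsub>\<Delta>\<^esub>" using hom[of \<one> \<one>] \<theta>in[of \<one>] by (simp add: B.l_cancel_one)
  fix x y assume x: "x \<in> topspace \<tau>'" and y: "y \<in> connected_component_of_set \<tau>' x"
  have yc: "y \<in> carrier \<Delta>" using y connected_component_in_topspace top' by fastforce
  have xc: "x \<in> carrier \<Delta>" using x top' by simp
  have "quasi_component_of \<tau>' x y"
    using y connected_component_subset_quasi_component_of[of \<tau>' x] by auto
  then have q: "y \<in> T" if "x \<in> T" "closedin \<tau>' T" "openin \<tau>' T" for T
    using that by (auto simp: quasi_component_of)
  show "y \<in> {x}"
  proof (rule ccontr)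
    assume ne: "y \<notin> {x}"
    \<comment> \<open>By translation it suffices to separate \<open>w\<close> from the identity by a
      clopen set. It will be the image of a clopen neighbourhood \<open>V\<close> of
      \<open>\<one>\<close> that misses the compact fibre \<open>F\<close> over
      \<open>w\<close>.\<close>
    define w where "w = y \<otimes>\<^bsub>\<Delta>\<^esub> inv\<^bsub>\<Delta>\<^esub> x"
    have wc: "w \<in> carrier \<Delta>" using xc yc by (simp add: w_def)
    have w1: "w \<noteq> \<one>\<^bsub>\<Delta>\<^esub>"
      using ne xc yc B.inv_equality[of y "inv\<^bsub>\<Delta>\<^esub> x"] by (auto simp: w_def)
    define F where "F = {b \<in> topspace \<tau>. \<theta> b \<in> {w}}"
    have "closedin \<tau>' {w}" by (rule closedin_Hausdorff_singleton[OF haus']) (simp add: wc top')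
    then have "closedin \<tau> F" unfolding F_def by (rule closedin_continuous_map_preimage[OF cont])
    then have Fcomp: "compactin \<tau> F" by (rule closedin_compact_space[OF comp])
    \<comment> \<open>In a compact Hausdorff space quasi-components are connected components, here
      points. So each element of \<open>F\<close> is excluded by some member of \<open>\<V>\<close>,
      and compactness of \<open>F\<close> leaves finitely many.\<close>
    define \<V> where "\<V> = {V. closedin \<tau> V \<and> openin \<tau> V \<and> \<one> \<in> V}"
    have "F \<subseteq> \<Union>((\<lambda>V. topspace \<tau> - V) ` \<V>)"
    proof
      fix b assume b: "b \<in> F"
      then have bc: "b \<in> topspace \<tau>" "\<theta> b = w" by (auto simp: F_def)
      have "connected_component_of_set \<tau> \<one> = {\<one>}"
        using pf top by (simp add: profinite_group_def totally_disconnected_def)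
      moreover have "quasi_component_of \<tau> \<one> = connected_component_of \<tau> \<one>"
        using comp haus by (intro quasi_eq_connected_component_of) simp
      ultimately have "\<not> quasi_component_of \<tau> \<one> b" using bc \<theta>1 w1 by (metis mem_Collect_eq singletonD)
      then obtain V where "\<one> \<in> V" "closedin \<tau> V" "openin \<tau> V" "b \<notin> V"
        using bc top by (auto simp: quasi_component_of)
      then show "b \<in> \<Union>((\<lambda>V. topspace \<tau> - V) ` \<V>)" using bc by (auto simp: \<V>_def)
    qed
    moreover have "openin \<tau> U" if "U \<in> (\<lambda>V. topspace \<tau> - V) ` \<V>" for U
      using that by (auto simp: \<V>_def)
    ultimately obtain \<F> where \<F>: "finite \<F>" "\<F> \<subseteq> (\<lambda>V. topspace \<tau> - V) ` \<V>" "F \<subseteq> \<Union>\<F>"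
      using Fcomp unfolding compactin_def by meson
    from finite_subset_image[OF \<F>(1,2)] \<F>(3) obtain \<G> where \<G>: "finite \<G>" "\<G> \<subseteq> \<V>"
      and cov: "F \<subseteq> \<Union>((\<lambda>V. topspace \<tau> - V) ` \<G>)" by blast
    \<comment> \<open>Intersecting with the whole space makes \<open>V\<close> correct for empty
      \<open>\<G>\<close>, too.\<close>
    define V where "V = \<Inter>((\<lambda>V. V) ` \<G>) \<inter> topspace \<tau>"
    have Vop: "openin \<tau> V" unfolding V_def using \<G> by (intro openin_INT) (auto simp: \<V>_def)
    have "closedin \<tau> (\<Inter>(insert (topspace \<tau>) \<G>))" using \<G> by (intro closedin_Inter) (auto simp: \<V>_def)
    then have Vcl: "closedin \<tau> V" by (simp add: V_def Int_commute)
    have V1: "\<one> \<in> V" using \<G> top by (auto simp: V_def \<V>_def)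
    have VF: "V \<inter> F = {}" using cov by (auto simp: V_def)
    have VT: "V \<subseteq> carrier \<Gamma>" using top by (auto simp: V_def)
    have closed_image: "closedin \<tau>' (\<theta> ` K)" if "closedin \<tau> K" for K
      using closedin_compact_space[OF comp that] image_compactin[OF _ cont] compactin_imp_closedin[OF haus'] by blast
    have rtrans: "continuous_map \<tau> \<tau> (\<lambda>a. a \<otimes> b)" if b: "b \<in> carrier \<Gamma>" for b
    proof -
      have "continuous_map \<tau> (prod_topology \<tau> \<tau>) (\<lambda>a. (a, b))"
        using b top by (auto simp: continuous_map_pairwise o_def)
      from continuous_map_compose[OF this mcont] show ?thesis by (simp add: o_def)
    qed
    have rtrans': "continuous_map \<tau>' \<tau>' (\<lambda>a. a \<otimes>\<^bsub>\<Delta>\<^esub> b)" if b: "b \<in> carrier \<Delta>" for b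
    proof -
      have "continuous_map \<tau>' (prod_topology \<tau>' \<tau>') (\<lambda>a. (a, b))"
        using b top' by (auto simp: continuous_map_pairwise o_def)
      from continuous_map_compose[OF this mcont'] show ?thesis by (simp add: o_def)
    qed
    define S where "S = {b \<in> carrier \<Gamma>. \<theta> b \<in> \<theta> ` V}"
    \<comment> \<open>The saturation of \<open>V\<close> is the union of its translates by the
      kernel, hence open. Its complement is therefore compact, and the image of that complement is
      the complement of the image of \<open>V\<close>.\<close>
    have "S = (\<Union>k\<in>{k \<in> carrier \<Gamma>. \<theta> k = \<one>\<^bsub>\<Delta>\<^esub>}. {b \<in> topspace \<tau>. b \<otimes> k \<in> V})"
    proof (intro equalityI subsetI)
      fix b assume b: "b \<in> S"
      then obtain v where v: "v \<in> V" "\<theta> b = \<theta> v" by (auto simp: S_def)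
      have bc: "b \<in> carrier \<Gamma>" "v \<in> carrier \<Gamma>" using b v VT by (auto simp: S_def)
      have "\<theta> b \<otimes>\<^bsub>\<Delta>\<^esub> \<theta> (inv b \<otimes> v) = \<theta> v" using hom[of b "inv b \<otimes> v"] bc by (simp add: A.m_assoc[symmetric])
      then have "\<theta> (inv b \<otimes> v) = \<one>\<^bsub>\<Delta>\<^esub>" using v bc \<theta>in by (simp add: B.l_cancel_one)
      moreover have "b \<otimes> (inv b \<otimes> v) = v" using bc by (simp add: A.m_assoc[symmetric])
      ultimately show "b \<in> (\<Union>k\<in>{k \<in> carrier \<Gamma>. \<theta> k = \<one>\<^bsub>\<Delta>\<^esub>}. {b \<in> topspace \<tau>. b \<otimes> k \<in> V})"
        using bc v top by (intro UN_I[where a = "inv b \<otimes> v"]) auto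
    next
      fix b assume "b \<in> (\<Union>k\<in>{k \<in> carrier \<Gamma>. \<theta> k = \<one>\<^bsub>\<Delta>\<^esub>}. {b \<in> topspace \<tau>. b \<otimes> k \<in> V})"
      then obtain k where k: "k \<in> carrier \<Gamma>" "\<theta> k = \<one>\<^bsub>\<Delta>\<^esub>" "b \<in> carrier \<Gamma>" "b \<otimes> k \<in> V" using top by auto
      then have "\<theta> (b \<otimes> k) = \<theta> b" using hom \<theta>in by simp
      then have "\<theta> b \<in> \<theta> ` V" using k(4) by (metis imageI)
      then show "b \<in> S" using k by (simp add: S_def)
    qed
    moreover have "openin \<tau> (\<Union>k\<in>{k \<in> carrier \<Gamma>. \<theta> k = \<one>\<^bsub>\<Delta>\<^esub>}. {b \<in> topspace \<tau>. b \<otimes> k \<in> V})"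
      by (intro openin_Union) (auto intro!: openin_continuous_map_preimage[OF rtrans Vop])
    ultimately have "closedin \<tau> (topspace \<tau> - S)" by auto
    then have "closedin \<tau>' (\<theta> ` (topspace \<tau> - S))" by (rule closed_image)
    moreover have "\<theta> ` (topspace \<tau> - S) = topspace \<tau>' - \<theta> ` V"
    proof (intro equalityI subsetI)
      fix z assume z: "z \<in> topspace \<tau>' - \<theta> ` V"
      then have "z \<in> \<theta> ` carrier \<Gamma>" using surj top' by simp
      then obtain b where "b \<in> carrier \<Gamma>" "z = \<theta> b" by blast
      then show "z \<in> \<theta> ` (topspace \<tau> - S)" using z top by (auto simp: S_def)
    qed (use top top' \<theta>in in \<open>auto simp: S_def\<close>)
    ultimately have "closedin \<tau>' (topspace \<tau>' - \<theta> ` V)" by simp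
    moreover have "\<theta> ` V \<subseteq> topspace \<tau>'" using VT \<theta>in top' by auto
    ultimately have op': "openin \<tau>' (\<theta> ` V)" by (simp add: openin_closedin)
    have cl': "closedin \<tau>' (\<theta> ` V)" by (rule closed_image[OF Vcl])
    \<comment> \<open>The clopen image of \<open>V\<close>, translated by \<open>x\<close>: it
      contains \<open>x\<close>, hence also \<open>y\<close>, which puts \<open>w\<close> into the
      image of \<open>V\<close>, contrary to the choice of \<open>V\<close>.\<close>
    let ?T = "{z \<in> topspace \<tau>'. z \<otimes>\<^bsub>\<Delta>\<^esub> inv\<^bsub>\<Delta>\<^esub> x \<in> \<theta> ` V}"
    have "\<theta> \<one> \<in> \<theta> ` V" using V1 by blast
    then have "x \<in> ?T" using xc x \<theta>1 by simp
    moreover have "closedin \<tau>' ?T" "openin \<tau>' ?T"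
      using closedin_continuous_map_preimage[OF rtrans' cl'] openin_continuous_map_preimage[OF rtrans' op'] xc by simp_all
    ultimately have "y \<in> ?T" by (rule q)
    then have "w \<in> \<theta> ` V" by (simp add: w_def)
    then show False using VF VT top by (auto simp: F_def)
  qed
next
  fix x y assume "x \<in> topspace \<tau>'" "y \<in> {x}"
  then show "y \<in> connected_component_of_set \<tau>' x" by (simp add: connected_component_of_refl)
qed

section \<open>Formulas and definable conditions\<close>

lemma finite_fv_tm: "finite (fv_tm t)"
  by (induction t) auto

lemma finite_fv: "finite (fv \<phi>)"
  by (induction \<phi>) (auto simp: finite_fv_tm)

lemma eval_tm_cong: "(\<And>v. v \<in> fv_tm t \<Longrightarrow> e v = e' v) \<Longrightarrow> eval_tm C e t = eval_tm C e' t"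
proof (induction t)
  case (App f ts)
  then have "map (eval_tm C e) ts = map (eval_tm C e') ts" by auto
  then show ?case by (simp only: eval_tm.simps)
qed simp

lemma sat_in_cong: "(\<And>v. v \<in> fv \<phi> \<Longrightarrow> e v = e' v) \<Longrightarrow> sat_in C D e \<phi> \<longleftrightarrow> sat_in C D e' \<phi>"
proof (induction \<phi> arbitrary: e e')
  case (Equal s t)
  then have "eval_tm C e s = eval_tm C e' s" "eval_tm C e t = eval_tm C e' t"
    by (auto intro: eval_tm_cong)
  then show ?case by simp
next
  case (Rel r ts)
  then have "map (eval_tm C e) ts = map (eval_tm C e') ts" by (auto intro: eval_tm_cong)
  then show ?case by (simp only: sat_in.simps)
next
  case (Neg \<phi>)
  have "sat_in C D e \<phi> = sat_in C D e' \<phi>" by (rule Neg.IH) (use Neg.prems in simp)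
  then show ?case by simp
next
  case (Conj \<phi> \<psi>)
  have "sat_in C D e \<phi> = sat_in C D e' \<phi>" by (rule Conj.IH(1)) (use Conj.prems in simp)
  moreover have "sat_in C D e \<psi> = sat_in C D e' \<psi>" by (rule Conj.IH(2)) (use Conj.prems in simp)
  ultimately show ?case by simp
next
  case (Exi v \<phi>)
  have "sat_in C D (e(v := a)) \<phi> = sat_in C D (e'(v := a)) \<phi>" for a
    by (rule Exi.IH) (use Exi.prems in auto)
  then show ?case by simp
qed

lemma map_tm_id:
  "fv_tm (map_tm (\<lambda>f. f) h t) = h ` fv_tm t"
  "eval_tm C e (map_tm (\<lambda>f. f) h t) = eval_tm C (\<lambda>v. e (h v)) t"
  "wf_tm L t \<Longrightarrow> wf_tm L (map_tm (\<lambda>f. f) h t)"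
proof (induction t)
  case (App f ts)
  { case 1 show ?case using App(1) by (auto simp: image_UN) }
  { case 2
    have "map (eval_tm C e) (map (map_tm (\<lambda>f. f) h) ts) = map (eval_tm C (\<lambda>v. e (h v))) ts"
      using App(2) by simp
    then show ?case by (simp only: tm.map eval_tm.simps) }
  { case 3 then show ?case using App(3) by auto }
qed simp_all

text \<open>Bound variables are renamed to fresh ones, so \<open>h\<close> need not be injective.\<close>

lemma rename_ex:
  fixes \<phi> :: "('f, 'r, 'v) fm" and h :: "'v \<Rightarrow> 'w"
  assumes inf: "infinite (UNIV :: 'w set)" and "wf_fm L \<phi>"
  shows "\<exists>\<phi>'. wf_fm L \<phi>' \<and> fv \<phi>' \<subseteq> h ` fv \<phi> \<and> (\<forall>e. sat C e \<phi>' \<longleftrightarrow> sat C (\<lambda>v. e (h v)) \<phi>)"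
  using assms(2)
proof (induction \<phi> arbitrary: h)
  case (Equal s t)
  then show ?case
    by (intro exI[where x = "Equal (map_tm (\<lambda>f. f) h s) (map_tm (\<lambda>f. f) h t)"]) (simp add: map_tm_id o_def image_Un)
next
  case (Rel r ts)
  have "map (eval_tm C e) (map (map_tm (\<lambda>f. f) h) ts) = map (eval_tm C (\<lambda>v. e (h v))) ts" for e
    by (simp add: map_tm_id o_def)
  then have "sat C e (Rel r (map (map_tm (\<lambda>f. f) h) ts)) \<longleftrightarrow> sat C (\<lambda>v. e (h v)) (Rel r ts)" for e
    by (simp only: sat_in.simps)
  then show ?case using Rel
    by (intro exI[where x = "Rel r (map (map_tm (\<lambda>f. f) h) ts)"]) (auto simp del: sat_in.simps simp: map_tm_id o_def)
next
  case (Neg \<phi>)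
  obtain \<phi>' where "wf_fm L \<phi>'" "fv \<phi>' \<subseteq> h ` fv \<phi>" "\<forall>e. sat C e \<phi>' \<longleftrightarrow> sat C (\<lambda>v. e (h v)) \<phi>"
    using Neg.IH[of h] Neg.prems by auto
  then show ?case by (intro exI[where x = "Neg \<phi>'"]) simp
next
  case (Conj \<phi> \<psi>)
  obtain \<phi>' where "wf_fm L \<phi>'" "fv \<phi>' \<subseteq> h ` fv \<phi>" "\<forall>e. sat C e \<phi>' \<longleftrightarrow> sat C (\<lambda>v. e (h v)) \<phi>"
    using Conj.IH(1)[of h] Conj.prems by auto
  moreover obtain \<psi>' where "wf_fm L \<psi>'" "fv \<psi>' \<subseteq> h ` fv \<psi>" "\<forall>e. sat C e \<psi>' \<longleftrightarrow> sat C (\<lambda>v. e (h v)) \<psi>"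
    using Conj.IH(2)[of h] Conj.prems by auto
  ultimately show ?case by (intro exI[where x = "Conj \<phi>' \<psi>'"]) auto
next
  case (Exi v \<phi>)
  have "finite (h ` fv \<phi>)" using finite_fv by blast
  then obtain w where w: "w \<notin> h ` fv \<phi>" using inf ex_new_if_finite by blast
  obtain \<phi>' where \<phi>': "wf_fm L \<phi>'" "fv \<phi>' \<subseteq> h(v := w) ` fv \<phi>"
      "\<forall>e. sat C e \<phi>' \<longleftrightarrow> sat C (\<lambda>u. e ((h(v := w)) u)) \<phi>"
    using Exi.IH[of "h(v := w)"] Exi.prems by auto
  have "sat C (\<lambda>u. (e(w := a)) ((h(v := w)) u)) \<phi> \<longleftrightarrow> sat C ((\<lambda>u. e (h u))(v := a)) \<phi>" for e a
    by (rule sat_in_cong) (use w in auto)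
  moreover have "fv \<phi>' - {w} \<subseteq> h ` (fv \<phi> - {v})" using \<phi>'(2) by auto
  ultimately show ?case using \<phi>' by (intro exI[where x = "Exi w \<phi>'"]) simp
qed

text \<open>The variable \<open>Inl (Inr a)\<close> serves as a name for the parameter
  \<open>a\<close> and is interpreted by \<open>a\<close> itself. Inserting parameters thereby
  becomes a renaming of variables.\<close>

abbreviation asg :: "('v \<Rightarrow> 'm) \<Rightarrow> ('v + 'm) + nat \<Rightarrow> 'm" where
  "asg x \<equiv> case_sum (case_sum x id) (\<lambda>_. undefined)"

text \<open>The summand \<open>nat\<close> only provides infinitely many bound variables.\<close>

definition definable ::
  "('f, 'r) signature \<Rightarrow> ('f, 'r, 'm) fo_struct \<Rightarrow> 'v set \<Rightarrow> 'm set \<Rightarrow> (('v \<Rightarrow> 'm) \<Rightarrow> bool) set" where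
  "definable L C V A = {Q. \<exists>\<phi> :: ('f, 'r, ('v + 'm) + nat) fm.
     wf_fm L \<phi> \<and> fv \<phi> \<subseteq> Inl ` (Inl ` V \<union> Inr ` A) \<and> Q = (\<lambda>x. sat C (asg x) \<phi>)}"

text \<open>The general way into \<open>definable\<close>: the formula may use any type of
  variables, and \<open>s\<close> tells which type variable or parameter each of its variables
  becomes. Several variables may be identified by \<open>s\<close>, which is why
  \<open>rename_ex\<close> allows maps that are not injective.\<close>

lemma definableI:
  fixes \<phi> :: "('f, 'r, 'w) fm" and s :: "'w \<Rightarrow> 'v + 'm"
  assumes "wf_fm L \<phi>" "s ` fv \<phi> \<subseteq> Inl ` V \<union> Inr ` A"
  shows "(\<lambda>x. sat C (\<lambda>w. case_sum x id (s w)) \<phi>) \<in> definable L C V A"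
proof -
  have "infinite (UNIV :: (('v + 'm) + nat) set)" by (simp add: finite_Plus_UNIV_iff)
  from rename_ex[OF this assms(1)]
  obtain \<phi>' :: "('f, 'r, ('v + 'm) + nat) fm" where \<phi>': "wf_fm L \<phi>'" "fv \<phi>' \<subseteq> (\<lambda>w. Inl (s w)) ` fv \<phi>"
    "\<forall>e. sat C e \<phi>' \<longleftrightarrow> sat C (\<lambda>w. e (Inl (s w))) \<phi>" by blast
  have "(\<lambda>x. sat C (\<lambda>w. case_sum x id (s w)) \<phi>) = (\<lambda>x. sat C (asg x) \<phi>')" using \<phi>'(3) by simp
  moreover have "fv \<phi>' \<subseteq> Inl ` (Inl ` V \<union> Inr ` A)"
  proof
    fix z assume "z \<in> fv \<phi>'"
    then obtain w where w: "w \<in> fv \<phi>" "z = Inl (s w)" using \<phi>'(2) by blast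
    then have "s w \<in> Inl ` V \<union> Inr ` A" using assms(2) by blast
    then show "z \<in> Inl ` (Inl ` V \<union> Inr ` A)" using w by blast
  qed
  ultimately show ?thesis using \<phi>'(1) unfolding definable_def by (intro CollectI exI[where x = \<phi>']) simp
qed

lemma definableE:
  assumes "Q \<in> definable L C V A"
  obtains \<phi> :: "('f, 'r, ('v + 'm) + nat) fm" where "wf_fm L \<phi>" "fv \<phi> \<subseteq> Inl ` (Inl ` V \<union> Inr ` A)"
    "Q = (\<lambda>x :: 'v \<Rightarrow> 'm. sat C (asg x) \<phi>)"
  using assms unfolding definable_def by blast

lemma definable_mono: "\<lbrakk>Q \<in> definable L C V A; V \<subseteq> V'; A \<subseteq> A'\<rbrakk> \<Longrightarrow> Q \<in> definable L C V' A'"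
  unfolding definable_def by blast

lemma definable_Neg:
  assumes "Q \<in> definable L C V A"
  shows "(\<lambda>x. \<not> Q x) \<in> definable L C V A"
proof -
  obtain \<phi> where \<phi>: "wf_fm L \<phi>" "fv \<phi> \<subseteq> Inl ` (Inl ` V \<union> Inr ` A)" "Q = (\<lambda>x. sat C (asg x) \<phi>)"
    using assms by (rule definableE)
  then show ?thesis unfolding definable_def by (intro CollectI exI[where x = "Neg \<phi>"]) simp
qed

lemma definable_Conj:
  assumes "Q \<in> definable L C V A" "Q' \<in> definable L C V A"
  shows "(\<lambda>x. Q x \<and> Q' x) \<in> definable L C V A"
proof -
  obtain \<phi> where \<phi>: "wf_fm L \<phi>" "fv \<phi> \<subseteq> Inl ` (Inl ` V \<union> Inr ` A)" "Q = (\<lambda>x. sat C (asg x) \<phi>)"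
    using assms(1) by (rule definableE)
  obtain \<psi> where \<psi>: "wf_fm L \<psi>" "fv \<psi> \<subseteq> Inl ` (Inl ` V \<union> Inr ` A)" "Q' = (\<lambda>x. sat C (asg x) \<psi>)"
    using assms(2) by (rule definableE)
  show ?thesis unfolding definable_def
    using \<phi> \<psi> by (intro CollectI exI[where x = "Conj \<phi> \<psi>"]) simp
qed

lemma definable_True: "(\<lambda>x. True) \<in> definable L C V A"
  unfolding definable_def
  \<comment> \<open>Truth is expressed by the sentence saying that something equals itself; it has
    no free variables, so \<open>V\<close> and \<open>A\<close> may be empty.\<close>
  by (intro CollectI exI[where x = "Exi (Inr 0) (Equal (Var (Inr 0)) (Var (Inr 0)))"]) auto

lemma definable_Ball:
  assumes "finite I" "\<And>i. i \<in> I \<Longrightarrow> Q i \<in> definable L C V A"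
  shows "(\<lambda>x. \<forall>i\<in>I. Q i x) \<in> definable L C V A"
  using assms
proof (induction I rule: finite_induct)
  case (insert i I)
  have "(\<lambda>x. Q i x \<and> (\<forall>i\<in>I. Q i x)) \<in> definable L C V A" using insert by (intro definable_Conj) auto
  then show ?case by simp
qed (simp add: definable_True)

lemma definable_Ex:
  assumes "Q \<in> definable L C V A"
  shows "(\<lambda>x. \<exists>a. Q (x(v := a))) \<in> definable L C (V - {v}) A"
proof -
  obtain \<phi> where \<phi>: "wf_fm L \<phi>" "fv \<phi> \<subseteq> Inl ` (Inl ` V \<union> Inr ` A)" "Q = (\<lambda>x. sat C (asg x) \<phi>)"
    using assms by (rule definableE)
  have eq: "asg (x(v := a)) = (asg x)(Inl (Inl v) := a)" for x a by (auto simp: fun_eq_iff split: sum.splits)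
  have "(\<lambda>x. \<exists>a. Q (x(v := a))) = (\<lambda>x. sat C (asg x) (Exi (Inl (Inl v)) \<phi>))"
    unfolding \<phi>(3) sat_in.simps eq by simp
  moreover have "fv (Exi (Inl (Inl v)) \<phi>) \<subseteq> Inl ` (Inl ` (V - {v}) \<union> Inr ` A)" using \<phi>(2) by auto
  ultimately show ?thesis using \<phi>(1) unfolding definable_def
    by (intro CollectI exI[where x = "Exi (Inl (Inl v)) \<phi>"]) simp
qed

text \<open>A formula has finitely many free variables. This lets a predicate be transferred between
  assignments that agree only on \<open>V\<close>, or only on a finite part of it.\<close>

lemma definable_local:
  assumes "Q \<in> definable L C V A"
  shows "\<exists>V0. finite V0 \<and> V0 \<subseteq> V \<and> (\<forall>x y. (\<forall>v\<in>V0. x v = y v) \<longrightarrow> Q x = Q y)"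
proof -
  obtain \<phi> where \<phi>: "wf_fm L \<phi>" "fv \<phi> \<subseteq> Inl ` (Inl ` V \<union> Inr ` A)" "Q = (\<lambda>x. sat C (asg x) \<phi>)"
    using assms by (rule definableE)
  define V0 where "V0 = {v \<in> V. Inl (Inl v) \<in> fv \<phi>}"
  have "V0 \<subseteq> (\<lambda>w. case w of Inl (Inl v) \<Rightarrow> v) ` fv \<phi>" by (force simp: V0_def)
  then have "finite V0" using finite_fv finite_subset by blast
  moreover have "Q x = Q y" if xy: "\<forall>v\<in>V0. x v = y v" for x y
    unfolding \<phi>(3) by (rule sat_in_cong) (use \<phi>(2) xy in \<open>auto simp: V0_def\<close>)
  moreover have "V0 \<subseteq> V" by (auto simp: V0_def)
  ultimately show ?thesis by blast
qed

lemma definable_restrict: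
  assumes "Q \<in> definable L C V A"
  shows "\<exists>V0. finite V0 \<and> V0 \<subseteq> V \<and> Q \<in> definable L C V0 A"
proof -
  obtain \<phi> where \<phi>: "wf_fm L \<phi>" "fv \<phi> \<subseteq> Inl ` (Inl ` V \<union> Inr ` A)" "Q = (\<lambda>x. sat C (asg x) \<phi>)"
    using assms by (rule definableE)
  define V0 where "V0 = {v \<in> V. Inl (Inl v) \<in> fv \<phi>}"
  have "V0 \<subseteq> (\<lambda>w. case w of Inl (Inl v) \<Rightarrow> v) ` fv \<phi>" by (force simp: V0_def)
  then have "finite V0" using finite_fv finite_subset by blast
  moreover have "fv \<phi> \<subseteq> Inl ` (Inl ` V0 \<union> Inr ` A)" using \<phi>(2) by (auto simp: V0_def)
  ultimately show ?thesis using \<phi> unfolding definable_def V0_def by (intro exI[where x = V0]) (auto simp: V0_def)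
qed

lemma definable_subst:
  fixes f :: "'v \<Rightarrow> 'w + 'm"
  assumes Q: "Q \<in> definable L C V A" and f: "f ` V \<subseteq> Inl ` W \<union> Inr ` B" and "A \<subseteq> B"
  shows "(\<lambda>x. Q (\<lambda>v. case_sum x id (f v))) \<in> definable L C W B"
proof -
  obtain \<phi> where \<phi>: "wf_fm L \<phi>" "fv \<phi> \<subseteq> Inl ` (Inl ` V \<union> Inr ` A)" "Q = (\<lambda>x. sat C (asg x) \<phi>)"
    using Q by (rule definableE)
  define s :: "('v + 'm) + nat \<Rightarrow> 'w + 'm" where "s = case_sum (case_sum f Inr) (\<lambda>_. Inr undefined)"
  have "s ` fv \<phi> \<subseteq> Inl ` W \<union> Inr ` B"
  proof
    fix z assume "z \<in> s ` fv \<phi>"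
    then obtain w where w: "w \<in> Inl ` V \<union> Inr ` A" "z = s (Inl w)" using \<phi>(2) by blast
    then show "z \<in> Inl ` W \<union> Inr ` B" using f \<open>A \<subseteq> B\<close> by (auto simp: s_def)
  qed
  from definableI[OF \<phi>(1) this, of C]
  have "(\<lambda>x. sat C (\<lambda>w. case_sum x id (s w)) \<phi>) \<in> definable L C W B" .
  moreover have "sat C (\<lambda>w. case_sum x id (s w)) \<phi> \<longleftrightarrow> Q (\<lambda>v. case_sum x id (f v))" for x
    unfolding \<phi>(3) by (rule sat_in_cong) (use \<phi>(2) in \<open>auto simp: s_def\<close>)
  ultimately show ?thesis by simp
qed

lemma definable_rename:
  assumes "Q \<in> definable L C V A" "f ` V \<subseteq> W"
  shows "(\<lambda>x. Q (\<lambda>v. x (f v))) \<in> definable L C W A"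
  using definable_subst[OF assms(1), of "\<lambda>v. Inl (f v)" W A] assms(2) by auto

lemma definable_psat:
  fixes q :: "('f, 'r, 'x, 'm) pfm"
  assumes "q \<in> pfms L V A"
  shows "(\<lambda>x. psat C x q) \<in> definable L C V A"
proof -
  obtain \<phi> b where q: "q = (\<phi>, b)" by fastforce
  then have \<phi>: "wf_fm L \<phi>" "fv \<phi> \<subseteq> Inl ` V \<union> Inr ` {..<length b}" "set b \<subseteq> A"
    using assms by (auto simp: pfms_def fms_def)
  define s :: "'x + nat \<Rightarrow> 'x + 'm" where "s = case_sum Inl (\<lambda>k. Inr (b ! k))"
  have "s ` fv \<phi> \<subseteq> Inl ` V \<union> Inr ` A" using \<phi>(2,3) by (auto simp: s_def subset_iff)
  from definableI[OF \<phi>(1) this, of C] have "(\<lambda>x. sat C (\<lambda>w. case_sum x id (s w)) \<phi>) \<in> definable L C V A" .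
  moreover have "(\<lambda>w. case_sum x id (s w)) = case_sum x (nth b)" for x :: "'x \<Rightarrow> 'm"
    by (auto simp: s_def fun_eq_iff split: sum.splits)
  ultimately show ?thesis by (simp add: q psat_def)
qed

text \<open>The converse of \<open>definable_psat\<close>. The finitely many parameters of the
  formula are collected in a list \<open>b\<close>, and each of them is replaced by a variable
  numbered by a position in that list.\<close>

lemma definable_pfm:
  fixes Q :: "('v \<Rightarrow> 'm) \<Rightarrow> bool" and C :: "('f, 'r, 'm) fo_struct"
  assumes "Q \<in> definable L C V A"
  shows "\<exists>q\<in>pfms L V A. \<forall>x. psat C x q \<longleftrightarrow> Q x"
proof -
  obtain \<phi> :: "('f, 'r, ('v + 'm) + nat) fm" where
    \<phi>: "wf_fm L \<phi>" "fv \<phi> \<subseteq> Inl ` (Inl ` V \<union> Inr ` A)" "Q = (\<lambda>x. sat C (asg x) \<phi>)"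
    using assms by (rule definableE)
  define A0 where "A0 = {a \<in> A. Inl (Inr a) \<in> fv \<phi>}"
  have "A0 \<subseteq> (\<lambda>w. case w of Inl (Inr a) \<Rightarrow> a) ` fv \<phi>" by (force simp: A0_def)
  then have "finite A0" using finite_fv finite_subset by blast
  then obtain b where b: "set b = A0" using finite_list by blast
  define idx where "idx a = (SOME k. k < length b \<and> b ! k = a)" for a
  have idx: "idx a < length b" "b ! idx a = a" if "a \<in> A0" for a
    using someI_ex[of "\<lambda>k. k < length b \<and> b ! k = a"] that b unfolding idx_def by (auto simp: in_set_conv_nth)
  define h :: "('v + 'm) + nat \<Rightarrow> 'v + nat" where "h = case_sum (case_sum Inl (\<lambda>a. Inr (idx a))) Inr"
  have "infinite (UNIV :: ('v + nat) set)" by (simp add: finite_Plus_UNIV_iff)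
  from rename_ex[OF this \<phi>(1), of h C] obtain \<phi>' where \<phi>': "wf_fm L \<phi>'" "fv \<phi>' \<subseteq> h ` fv \<phi>"
    "\<forall>e. sat C e \<phi>' \<longleftrightarrow> sat C (\<lambda>v. e (h v)) \<phi>" by blast
  have "sat C (\<lambda>v. case_sum x (nth b) (h v)) \<phi> \<longleftrightarrow> Q x" for x
    unfolding \<phi>(3) by (rule sat_in_cong) (use \<phi>(2) idx in \<open>auto simp: h_def A0_def\<close>)
  then have "\<forall>x. psat C x (\<phi>', b) \<longleftrightarrow> Q x" using \<phi>'(3) by (simp add: psat_def)
  moreover have "fv \<phi>' \<subseteq> Inl ` V \<union> Inr ` {..<length b}"
  proof
    fix z assume "z \<in> fv \<phi>'"
    then obtain w' where w': "w' \<in> fv \<phi>" "z = h w'" using \<phi>'(2) by blast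
    moreover from this obtain w where "w' = Inl w" "w \<in> Inl ` V \<union> Inr ` A" using \<phi>(2) by blast
    ultimately have w: "Inl w \<in> fv \<phi>" "w \<in> Inl ` V \<union> Inr ` A" "z = h (Inl w)" by simp_all
    then show "z \<in> Inl ` V \<union> Inr ` {..<length b}" using idx(1) by (auto simp: h_def A0_def)
  qed
  then have "(\<phi>', b) \<in> pfms L V A" using \<phi>'(1) b by (auto simp: pfms_def fms_def A0_def)
  ultimately show ?thesis by blast
qed

section \<open>Automorphisms\<close>

lemma automorphismsD:
  assumes "\<sigma> \<in> automorphisms L C"
  shows "bij \<sigma>" "\<And>f xs. (f, length xs) \<in> funs L \<Longrightarrow> \<sigma> (fun_int C f xs) = fun_int C f (map \<sigma> xs)"
    "\<And>r xs. (r, length xs) \<in> rels L \<Longrightarrow> rel_int C r (map \<sigma> xs) \<longleftrightarrow> rel_int C r xs"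
  using assms by (auto simp: automorphisms_def)

lemma eval_tm_automorphism:
  assumes "\<sigma> \<in> automorphisms L C" "wf_tm L t"
  shows "eval_tm C (\<lambda>v. \<sigma> (e v)) t = \<sigma> (eval_tm C e t)"
  using assms(2)
proof (induction t)
  case (App f ts)
  then have "map (eval_tm C (\<lambda>v. \<sigma> (e v))) ts = map \<sigma> (map (eval_tm C e) ts)" by auto
  moreover have "\<sigma> (fun_int C f (map (eval_tm C e) ts)) = fun_int C f (map \<sigma> (map (eval_tm C e) ts))"
    using App.prems by (intro automorphismsD(2)[OF assms(1)]) simp
  ultimately show ?case by (simp only: eval_tm.simps)
qed simp

lemma sat_automorphism:
  assumes "\<sigma> \<in> automorphisms L C" "wf_fm L \<phi>"
  shows "sat C (\<lambda>v. \<sigma> (e v)) \<phi> \<longleftrightarrow> sat C e \<phi>"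
  using assms(2)
proof (induction \<phi> arbitrary: e)
  case (Equal s t)
  then show ?case using automorphismsD(1)[OF assms(1)]
    by (simp add: eval_tm_automorphism[OF assms(1)] bij_def inj_eq)
next
  case (Rel r ts)
  then have "map (eval_tm C (\<lambda>v. \<sigma> (e v))) ts = map \<sigma> (map (eval_tm C e) ts)"
    using eval_tm_automorphism[OF assms(1)] by auto
  moreover have "rel_int C r (map \<sigma> (map (eval_tm C e) ts)) \<longleftrightarrow> rel_int C r (map (eval_tm C e) ts)"
    using Rel by (intro automorphismsD(3)[OF assms(1)]) simp
  ultimately show ?case by (simp only: sat_in.simps)
next
  case (Exi v \<phi>)
  have "sat C ((\<lambda>u. \<sigma> (e u))(v := \<sigma> a)) \<phi> \<longleftrightarrow> sat C (e(v := a)) \<phi>" for a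
    
  proof -
    have "(\<lambda>u. \<sigma> (e u))(v := \<sigma> a) = (\<lambda>u. \<sigma> ((e(v := a)) u))" by auto
    moreover have "wf_fm L \<phi>" using Exi.prems by simp
    ultimately show ?thesis using Exi.IH[of "e(v := a)"] by (simp only:)
  qed
  moreover have "(\<exists>b. sat C ((\<lambda>u. \<sigma> (e u))(v := b)) \<phi>) \<longleftrightarrow> (\<exists>a. sat C ((\<lambda>u. \<sigma> (e u))(v := \<sigma> a)) \<phi>)"
    using bij_is_surj[OF automorphismsD(1)[OF assms(1)]] by (metis surjD)
  ultimately show ?case by simp
qed simp_all

lemma automorphisms_id: "id \<in> automorphisms L C"
  by (auto simp: automorphisms_def)

lemma automorphisms_comp:
  assumes "\<sigma> \<in> automorphisms L C" "\<rho> \<in> automorphisms L C"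
  shows "\<sigma> \<circ> \<rho> \<in> automorphisms L C"
  unfolding automorphisms_def
proof (intro CollectI conjI)
  show "bij (\<sigma> \<circ> \<rho>)" using automorphismsD(1) assms bij_comp by blast
  show "\<forall>(f, n)\<in>funs L. \<forall>xs. length xs = n \<longrightarrow> (\<sigma> \<circ> \<rho>) (fun_int C f xs) = fun_int C f (map (\<sigma> \<circ> \<rho>) xs)"
    using automorphismsD(2)[OF assms(1)] automorphismsD(2)[OF assms(2)] by (auto simp flip: map_map)
  show "\<forall>(r, n)\<in>rels L. \<forall>xs. length xs = n \<longrightarrow> rel_int C r (map (\<sigma> \<circ> \<rho>) xs) = rel_int C r xs"
    using automorphismsD(3)[OF assms(1)] automorphismsD(3)[OF assms(2)] by (auto simp flip: map_map)
qed

abbreviation finv :: "('a \<Rightarrow> 'b) \<Rightarrow> 'b \<Rightarrow> 'a" where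
  "finv \<equiv> inv_into UNIV"

lemma automorphisms_inv:
  fixes \<sigma> :: "'m \<Rightarrow> 'm"
  assumes "\<sigma> \<in> automorphisms L C"
  shows "finv \<sigma> \<in> automorphisms L C" "finv \<sigma> (\<sigma> a) = a" "\<sigma> (finv \<sigma> a) = a" "finv \<sigma> \<circ> \<sigma> = id" "\<sigma> \<circ> finv \<sigma> = id"
proof -
  have bij: "bij \<sigma>" using automorphismsD(1)[OF assms] .
  then show i1: "finv \<sigma> (\<sigma> a) = a" and i2: "\<sigma> (finv \<sigma> a) = a" for a
    by (simp_all add: bij_is_inj bij_is_surj surj_f_inv_f)
  then show c: "finv \<sigma> \<circ> \<sigma> = id" "\<sigma> \<circ> finv \<sigma> = id" by auto
  have m: "map \<sigma> (map (finv \<sigma>) xs) = xs" for xs by (simp add: c)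
  show "finv \<sigma> \<in> automorphisms L C"
    unfolding automorphisms_def
  proof (intro CollectI conjI)
    show "bij (finv \<sigma>)" using bij by (rule bij_imp_bij_inv)
    show "\<forall>(f, n)\<in>funs L. \<forall>xs. length xs = n \<longrightarrow> finv \<sigma> (fun_int C f xs) = fun_int C f (map (finv \<sigma>) xs)"
    proof clarify
      fix f and xs :: "'m list" assume "(f, length xs) \<in> funs L"
      then have "\<sigma> (fun_int C f (map (finv \<sigma>) xs)) = fun_int C f xs"
        using automorphismsD(2)[OF assms, of f "map (finv \<sigma>) xs"] m by simp
      then show "finv \<sigma> (fun_int C f xs) = fun_int C f (map (finv \<sigma>) xs)" by (metis i1)
    qed
    show "\<forall>(r, n)\<in>rels L. \<forall>xs. length xs = n \<longrightarrow> rel_int C r (map (finv \<sigma>) xs) = rel_int C r xs"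
    proof clarify
      fix r and xs :: "'m list" assume "(r, length xs) \<in> rels L"
      then show "rel_int C r (map (finv \<sigma>) xs) = rel_int C r xs"
        using automorphismsD(3)[OF assms, of r "map (finv \<sigma>) xs"] m by simp
    qed
  qed
qed

lemma group_Aut: "group (Aut L C)"
  unfolding Aut_def
  by (rule groupI) (auto simp: automorphisms_comp automorphisms_id o_assoc intro: automorphisms_inv)

lemma inv_Aut: "\<sigma> \<in> automorphisms L C \<Longrightarrow> inv\<^bsub>Aut L C\<^esub> \<sigma> = finv \<sigma>"
  by (rule group.inv_equality[OF group_Aut]) (auto simp: Aut_def automorphisms_inv)

lemma Aut_simps [simp]:
  "carrier (Aut L C) = automorphisms L C" "\<sigma> \<otimes>\<^bsub>Aut L C\<^esub> \<rho> = \<sigma> \<circ> \<rho>" "\<one>\<^bsub>Aut L C\<^esub> = id"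
  by (simp_all add: Aut_def)

lemma definable_automorphism:
  assumes "\<sigma> \<in> automorphisms L C" "Q \<in> definable L C V {}"
  shows "Q (\<lambda>v. \<sigma> (x v)) \<longleftrightarrow> Q x"
proof -
  obtain \<phi> where \<phi>: "wf_fm L \<phi>" "fv \<phi> \<subseteq> Inl ` (Inl ` V \<union> Inr ` {})" "Q = (\<lambda>x. sat C (asg x) \<phi>)"
    using assms(2) by (rule definableE)
  have "sat C (asg (\<lambda>v. \<sigma> (x v))) \<phi> \<longleftrightarrow> sat C (\<lambda>w. \<sigma> (asg x w)) \<phi>" by (rule sat_in_cong) (use \<phi>(2) in auto)
  then show ?thesis using sat_automorphism[OF assms(1) \<phi>(1)] \<phi>(3) by simp
qed

text \<open>Satisfaction is invariant under \<open>\<sigma>\<close>, so moving the variables by the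
  inverse of \<open>\<sigma>\<close> has the same effect as moving the parameters by
  \<open>\<sigma>\<close>.\<close>

lemma definable_translate:
  fixes Q :: "('v \<Rightarrow> 'm) \<Rightarrow> bool" and C :: "('f, 'r, 'm) fo_struct"
  assumes "\<sigma> \<in> automorphisms L C" "Q \<in> definable L C V A"
  shows "(\<lambda>x. Q (\<lambda>v. finv \<sigma> (x v))) \<in> definable L C V (\<sigma> ` A)"
proof -
  obtain \<phi> where \<phi>: "wf_fm L \<phi>" "fv \<phi> \<subseteq> Inl ` (Inl ` V \<union> Inr ` A)" "Q = (\<lambda>x. sat C (asg x) \<phi>)"
    using assms(2) by (rule definableE)
  define s :: "('v + 'm) + nat \<Rightarrow> 'v + 'm"
    where "s = case_sum (case_sum Inl (\<lambda>a. Inr (\<sigma> a))) (\<lambda>_. Inr undefined)"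
  have "s ` fv \<phi> \<subseteq> Inl ` V \<union> Inr ` \<sigma> ` A" using \<phi>(2) by (auto simp: s_def)
  from definableI[OF \<phi>(1) this, of C] have "(\<lambda>x. sat C (\<lambda>w. case_sum x id (s w)) \<phi>) \<in> definable L C V (\<sigma> ` A)" .
  moreover have "sat C (\<lambda>w. case_sum x id (s w)) \<phi> \<longleftrightarrow> Q (\<lambda>v. finv \<sigma> (x v))" for x
  proof -
    have "sat C (\<lambda>w. \<sigma> (asg (\<lambda>v. finv \<sigma> (x v)) w)) \<phi> \<longleftrightarrow> sat C (\<lambda>w. case_sum x id (s w)) \<phi>"
      by (rule sat_in_cong) (use \<phi>(2) in \<open>auto simp: s_def automorphisms_inv[OF assms(1)]\<close>)
    then show ?thesis using sat_automorphism[OF assms(1) \<phi>(1)] \<phi>(3) by simp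
  qed
  ultimately show ?thesis by simp
qed

text \<open>Preservation of truth in one direction suffices, because it can be applied to the
  negation as well.\<close>

lemma partial_elementaryI:
  fixes f :: "'m \<Rightarrow> 'm" and C :: "('f, 'r, 'm) fo_struct"
  assumes "\<And>Q. \<lbrakk>Q \<in> definable L C A {}; Q id\<rbrakk> \<Longrightarrow> Q f"
  shows "partial_elementary L C A f"
  unfolding partial_elementary_def
proof (intro allI impI, elim conjE)
  fix \<phi> :: "('f, 'r, nat) fm" and e assume \<phi>: "wf_fm L \<phi>" "e ` fv \<phi> \<subseteq> A"
  let ?Q = "\<lambda>x. sat C (\<lambda>k. x (e k)) \<phi>"
  have "(\<lambda>x. sat C (\<lambda>k. case_sum x id (Inl (e k))) \<phi>) \<in> definable L C A {}"
    using \<phi> by (intro definableI) auto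
  then have Q: "?Q \<in> definable L C A {}" by simp
  have "sat C e \<phi> \<Longrightarrow> sat C (f \<circ> e) \<phi>" using assms[OF Q] by (simp add: o_def)
  moreover have "\<not> sat C e \<phi> \<Longrightarrow> \<not> sat C (f \<circ> e) \<phi>" using assms[OF definable_Neg[OF Q]] by (simp add: o_def)
  ultimately show "sat C e \<phi> \<longleftrightarrow> sat C (f \<circ> e) \<phi>" by blast
qed

section \<open>Elementary submodels\<close>

lemma sat_in_foldr_Exi:
  "sat_in C D e (foldr Exi vs \<phi>) \<longleftrightarrow>
     (\<exists>e'. (\<forall>v. v \<notin> set vs \<longrightarrow> e' v = e v) \<and> (\<forall>v\<in>set vs. e' v \<in> D) \<and> sat_in C D e' \<phi>)"
proof (induction vs arbitrary: e)
  case Nil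
  show ?case
  proof
    assume "sat_in C D e (foldr Exi [] \<phi>)"
    then show "\<exists>e'. (\<forall>v. v \<notin> set [] \<longrightarrow> e' v = e v) \<and> (\<forall>v\<in>set []. e' v \<in> D) \<and> sat_in C D e' \<phi>" by auto
  next
    assume "\<exists>e'. (\<forall>v. v \<notin> set [] \<longrightarrow> e' v = e v) \<and> (\<forall>v\<in>set []. e' v \<in> D) \<and> sat_in C D e' \<phi>"
    then obtain e' where "\<And>v. e' v = e v" "sat_in C D e' \<phi>" by auto
    then show "sat_in C D e (foldr Exi [] \<phi>)" by (metis ext foldr_Nil id_apply)
  qed
next
  case (Cons w vs)
  show ?case
  proof
    assume "sat_in C D e (foldr Exi (w # vs) \<phi>)"
    then obtain a where "a \<in> D" "sat_in C D (e(w := a)) (foldr Exi vs \<phi>)" by auto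
    then obtain e' where "\<forall>v. v \<notin> set vs \<longrightarrow> e' v = (e(w := a)) v" "\<forall>v\<in>set vs. e' v \<in> D" "sat_in C D e' \<phi>"
      using Cons.IH by blast
    then show "\<exists>e'. (\<forall>v. v \<notin> set (w # vs) \<longrightarrow> e' v = e v) \<and> (\<forall>v\<in>set (w # vs). e' v \<in> D) \<and> sat_in C D e' \<phi>"
      using \<open>a \<in> D\<close> by (intro exI[where x = e']) (auto split: if_splits)
  next
    assume "\<exists>e'. (\<forall>v. v \<notin> set (w # vs) \<longrightarrow> e' v = e v) \<and> (\<forall>v\<in>set (w # vs). e' v \<in> D) \<and> sat_in C D e' \<phi>"
    then obtain e' where e': "\<forall>v. v \<notin> set (w # vs) \<longrightarrow> e' v = e v" "\<forall>v\<in>set (w # vs). e' v \<in> D" "sat_in C D e' \<phi>"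
      by blast
    then have "sat_in C D (e(w := e' w)) (foldr Exi vs \<phi>)"
      unfolding Cons.IH by (intro exI[where x = e']) auto
    then show "sat_in C D e (foldr Exi (w # vs) \<phi>)" using e'(2) by auto
  qed
qed

lemma fv_foldr_Exi: "fv (foldr Exi vs \<phi>) = fv \<phi> - set vs"
  by (induction vs) auto

lemma wf_foldr_Exi: "wf_fm L (foldr Exi vs \<phi>) = wf_fm L \<phi>"
  by (induction vs) auto

text \<open>\<open>elementary_submodel\<close> speaks about formulas with variables in
  \<open>nat\<close> only. The formula is renamed along an injection of its free variables into
  \<open>nat\<close> and closed existentially; the resulting sentence transfers to \<open>D\<close>
  and its witnesses are read back.\<close>

lemma definable_elementary:
  fixes C :: "('f, 'r, 'm) fo_struct" and Q :: "('v \<Rightarrow> 'm) \<Rightarrow> bool"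
  assumes D: "elementary_submodel L C D" and Q: "Q \<in> definable L C V {}" "Q x"
  shows "\<exists>y. range y \<subseteq> D \<and> Q y"
proof -
  obtain \<phi> where \<phi>: "wf_fm L \<phi>" "fv \<phi> \<subseteq> Inl ` (Inl ` V \<union> Inr ` {})" "Q = (\<lambda>x. sat C (asg x) \<phi>)"
    using Q(1) by (rule definableE)
  obtain h :: "('v + 'm) + nat \<Rightarrow> nat" where h: "inj_on h (fv \<phi>)"
    using finite_imp_inj_to_nat_seg[OF finite_fv[of \<phi>]] by (elim exE conjE) (rule that)
  from rename_ex[OF infinite_UNIV_nat \<phi>(1), of h C]
  obtain \<phi>' where "wf_fm L \<phi>' \<and> fv \<phi>' \<subseteq> h ` fv \<phi> \<and> (\<forall>e. sat C e \<phi>' \<longleftrightarrow> sat C (\<lambda>v. e (h v)) \<phi>)" by (rule exE)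
  then have \<phi>': "wf_fm L \<phi>'" "fv \<phi>' \<subseteq> h ` fv \<phi>" "\<And>e. sat C e \<phi>' \<longleftrightarrow> sat C (\<lambda>v. e (h v)) \<phi>" by blast+
  obtain vs where vs: "set vs = fv \<phi>'" using finite_list[OF finite_fv[of \<phi>']] by (rule exE)
  let ?\<psi> = "foldr Exi vs \<phi>'"
  have fv: "fv ?\<psi> = {}" by (simp add: fv_foldr_Exi vs)
  obtain d where d: "d \<in> D" using D by (auto simp: elementary_submodel_def)
  have "sat C (\<lambda>k. asg x (inv_into (fv \<phi>) h k)) \<phi>'"
    unfolding \<phi>'(3) by (rule sat_in_cong[THEN iffD1, rotated]) (use Q(2) \<phi>(3) h in auto)
  then have "sat C (\<lambda>k. asg x (inv_into (fv \<phi>) h k)) ?\<psi>"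
    unfolding sat_in_foldr_Exi by (intro exI[where x = "\<lambda>k. asg x (inv_into (fv \<phi>) h k)"]) auto
  then have "sat C (\<lambda>_. d) ?\<psi>" by (rule sat_in_cong[THEN iffD1, rotated]) (simp add: fv)
  then have "sat_in C D (\<lambda>_. d) ?\<psi>"
    using D \<phi>'(1) d unfolding elementary_submodel_def by (simp add: wf_foldr_Exi)
  then obtain e where e: "\<forall>v. v \<notin> set vs \<longrightarrow> e v = d" "\<forall>v\<in>set vs. e v \<in> D" "sat_in C D e \<phi>'"
    unfolding sat_in_foldr_Exi by blast
  have re: "range e \<subseteq> D" using e d by force
  then have "sat C e \<phi>'" using e(3) D \<phi>'(1) unfolding elementary_submodel_def by blast
  then have "sat C (\<lambda>v. e (h v)) \<phi>" using \<phi>'(3) by blast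
  then have "sat C (asg (\<lambda>v. e (h (Inl (Inl v))))) \<phi>"
    by (rule sat_in_cong[THEN iffD1, rotated]) (use \<phi>(2) in auto)
  then have "Q (\<lambda>v. e (h (Inl (Inl v))))" using \<phi>(3) by simp
  then show ?thesis using re by (intro exI[where x = "\<lambda>v. e (h (Inl (Inl v)))"]) auto
qed

section \<open>Type spaces\<close>

lemma psat_pneg [simp]: "psat C x (pneg q) \<longleftrightarrow> \<not> psat C x q"
  by (cases q) (simp add: psat_def pneg_def)

lemma pneg_pfms: "q \<in> pfms L V A \<Longrightarrow> pneg q \<in> pfms L V A"
  by (cases q) (simp add: pfms_def fms_def pneg_def)

lemma consistentD: "\<lbrakk>consistent C p; p0 \<subseteq> p; finite p0\<rbrakk> \<Longrightarrow> \<exists>x. \<forall>q\<in>p0. psat C x q"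
  by (simp add: consistent_def)

lemma consistent_subset: "\<lbrakk>consistent C p; p' \<subseteq> p\<rbrakk> \<Longrightarrow> consistent C p'"
  by (meson consistent_def subset_trans)

lemma consistent_not_both: "\<lbrakk>consistent C p; q \<in> p\<rbrakk> \<Longrightarrow> pneg q \<notin> p"
proof
  assume "consistent C p" "q \<in> p" "pneg q \<in> p"
  then have "\<exists>x. \<forall>r\<in>{q, pneg q}. psat C x r" by (intro consistentD) auto
  then show False by auto
qed

text \<open>Consistency means finite satisfiability in \<open>C\<close>, so the argument is purely
  semantic. If a maximal consistent set decided neither \<open>q\<close> nor \<open>pneg q\<close>,
  it would contain finite parts incompatible with each of them, and the union of these parts could
  not be satisfied.\<close>

lemma Lindenbaum:
  assumes "consistent C p0"
  shows "\<exists>P. p0 \<subseteq> P \<and> consistent C P \<and> (\<forall>q. q \<in> P \<or> pneg q \<in> P)"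
proof -
  let ?A = "{P. p0 \<subseteq> P \<and> consistent C P}"
  have "\<exists>P\<in>?A. \<forall>X\<in>?A. P \<subseteq> X \<longrightarrow> X = P"
  proof (rule subset_Zorn_nonempty)
    show "?A \<noteq> {}" using assms by blast
    fix \<C> assume ne: "\<C> \<noteq> {}" and ch: "subset.chain ?A \<C>"
    have "\<exists>x. \<forall>q\<in>f. psat C x q" if f: "f \<subseteq> \<Union>\<C>" "finite f" for f
    proof -
      obtain P where "P \<in> \<C>" "f \<subseteq> P" using finite_subset_Union_chain[OF f(2,1) ne ch] by blast
      then show ?thesis using ch f(2) by (auto simp: subset.chain_def intro: consistentD)
    qed
    moreover obtain P where "P \<in> \<C>" using ne by blast
    then have "p0 \<subseteq> \<Union>\<C>" using ch unfolding subset_chain_def by blast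
    ultimately show "\<Union>\<C> \<in> ?A" by (simp add: consistent_def)
  qed
  then obtain P where P: "P \<in> ?A" and max: "\<forall>X\<in>?A. P \<subseteq> X \<longrightarrow> X = P" by (rule bexE)
  have con: "consistent C P" using P by simp
  have ins: "\<exists>f. f \<subseteq> P \<and> finite f \<and> (\<nexists>x. psat C x r \<and> (\<forall>q\<in>f. psat C x q))" if r: "r \<notin> P" for r
  proof -
    have "\<not> consistent C (insert r P)"
    proof
      assume "consistent C (insert r P)"
      then have "insert r P = P" using max[THEN bspec, of "insert r P"] P by auto
      then show False using r by blast
    qed
    then obtain f where f: "f \<subseteq> insert r P" "finite f" "\<nexists>x. \<forall>q\<in>f. psat C x q" by (auto simp: consistent_def)
    then show ?thesis by (intro exI[where x = "f - {r}"]) auto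
  qed
  have "q \<in> P \<or> pneg q \<in> P" for q
  proof (rule ccontr)
    assume "\<not> (q \<in> P \<or> pneg q \<in> P)"
    then have nq: "q \<notin> P" and npq: "pneg q \<notin> P" by simp_all
    obtain f g where f: "f \<subseteq> P" "finite f" "\<nexists>x. psat C x q \<and> (\<forall>r\<in>f. psat C x r)"
      and g: "g \<subseteq> P" "finite g" "\<nexists>x. psat C x (pneg q) \<and> (\<forall>r\<in>g. psat C x r)"
      using ins[OF nq] ins[OF npq] by blast
    have "\<exists>x. \<forall>r\<in>f \<union> g. psat C x r" using f g by (intro consistentD[OF con]) auto
    then show False using f(3) g(3) by auto
  qed
  then show ?thesis using P by blast
qed

text \<open>A maximal consistent extension of \<open>p0\<close> is cut down to the instances in
  \<open>I\<close> and their negations. Consistency of the result with all of \<open>p0\<close> is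
  recorded separately because \<open>p0\<close> may contain formulas outside \<open>I\<close>, as
  tp(c) does in the case of \<Delta>-types.\<close>

lemma complete_types_extension:
  assumes "consistent C p0"
  shows "\<exists>p\<in>complete_types C I. consistent C (p \<union> p0) \<and> p0 \<inter> (I \<union> pneg ` I) \<subseteq> p"
proof -
  obtain P where P: "p0 \<subseteq> P" "consistent C P" "\<forall>q. q \<in> P \<or> pneg q \<in> P" using Lindenbaum[OF assms] by blast
  let ?p = "P \<inter> (I \<union> pneg ` I)"
  have "consistent C ?p" "consistent C (?p \<union> p0)" using P by (auto intro: consistent_subset)
  then show ?thesis using P by (intro bexI[where x = ?p]) (auto simp: complete_types_def)
qed

lemma complete_typesD:
  assumes "p \<in> complete_types C I"
  shows "consistent C p" "p \<subseteq> I \<union> pneg ` I" "\<And>q. q \<in> I \<Longrightarrow> pneg q \<in> p \<longleftrightarrow> q \<notin> p"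
  using assms consistent_not_both by (auto simp: complete_types_def)

lemma complete_types_eqI:
  assumes p: "p \<in> complete_types C I" and p': "p' \<in> complete_types C I" and eq: "\<And>q. q \<in> I \<Longrightarrow> q \<in> p \<longleftrightarrow> q \<in> p'"
  shows "p = p'"
proof -
  have "q \<in> p \<longleftrightarrow> q \<in> p'" if qI: "q \<in> I \<union> pneg ` I" for q
  proof (cases "q \<in> I")
    case True
    then show ?thesis by (rule eq)
  next
    case False
    then obtain r where "r \<in> I" "q = pneg r" using qI by blast
    then show ?thesis using eq[of r] complete_typesD(3)[OF p, of r] complete_typesD(3)[OF p', of r] by simp
  qed
  then show ?thesis using complete_typesD(2)[OF p] complete_typesD(2)[OF p'] by blast
qed

lemma complete_types_consequence:
  assumes p: "p \<in> complete_types C I" and f: "f \<subseteq> p" "finite f" and q: "q \<in> I"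
    and imp: "\<And>x. (\<forall>r\<in>f. psat C x r) \<Longrightarrow> psat C x q"
  shows "q \<in> p"
proof (rule ccontr)
  assume "q \<notin> p"
  then have "insert (pneg q) f \<subseteq> p" using complete_typesD(3)[OF p q] f by simp
  then obtain x where "\<forall>r\<in>insert (pneg q) f. psat C x r"
    using consistentD[OF complete_typesD(1)[OF p]] f by (metis finite_insert)
  then show False using imp[of x] by simp
qed

lemma topspace_type_topology: "topspace (type_topology I P) = P"
  unfolding type_topology_def topology_generated_by_topspace by auto

lemma openin_type_topology: "q \<in> I \<union> pneg ` I \<Longrightarrow> openin (type_topology I P) {p \<in> P. q \<in> p}"
  unfolding type_topology_def by (rule topology_generated_by_Basis) blast

lemma continuous_map_type_topology:
  assumes "f \<in> topspace Y \<rightarrow> P" "\<And>q. q \<in> I \<union> pneg ` I \<Longrightarrow> openin Y {y \<in> topspace Y. q \<in> f y}"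
  shows "continuous_map Y (type_topology I P) f"
  unfolding type_topology_def
proof (rule continuous_on_generated_topo)
  fix U assume "U \<in> insert P {{p \<in> P. q \<in> p} |q. q \<in> I \<union> pneg ` I}"
  then consider "U = P" | q where "q \<in> I \<union> pneg ` I" "U = {p \<in> P. q \<in> p}" by blast
  then show "openin Y (f -` U \<inter> topspace Y)"
  proof cases
    case 1
    then have "f -` U \<inter> topspace Y = topspace Y" using assms(1) by auto
    then show ?thesis by simp
  next
    case 2
    then have "f -` U \<inter> topspace Y = {y \<in> topspace Y. q \<in> f y}" using assms(1) by auto
    then show ?thesis using assms(2) 2 by simp
  qed
qed (use assms(1) in auto)

text \<open>Treats the spaces of complete types and of \<Delta>-types alike. For \<Delta>-types the
  condition is the defining one; for complete types \<open>type_space_eq\<close> converts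
  containment of the type of the tuple into joint consistency with it.\<close>

abbreviation types_over ::
  "('f, 'r, 'm) fo_struct \<Rightarrow> ('f, 'r, 'x, 'm) pfm set \<Rightarrow> ('f, 'r, 'x, 'm) pfm set \<Rightarrow> ('f, 'r, 'x, 'm) pfm set set" where
  "types_over C I p0 \<equiv> {p \<in> complete_types C I. consistent C (p \<union> p0)}"

lemma clopen_type_topology:
  assumes "q \<in> I"
  shows "openin (type_topology I (types_over C I p0)) {p \<in> types_over C I p0. q \<in> p}"
    "closedin (type_topology I (types_over C I p0)) {p \<in> types_over C I p0. q \<in> p}"
proof -
  let ?P = "types_over C I p0"
  show "openin (type_topology I ?P) {p \<in> ?P. q \<in> p}" using assms by (intro openin_type_topology) simp
  have "?P - {p \<in> ?P. q \<in> p} = {p \<in> ?P. pneg q \<in> p}"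
    using complete_typesD(3)[OF _ assms] by auto
  moreover have "openin (type_topology I ?P) {p \<in> ?P. pneg q \<in> p}" using assms by (intro openin_type_topology) simp
  ultimately show "closedin (type_topology I ?P) {p \<in> ?P. q \<in> p}"
    by (auto simp: closedin_def topspace_type_topology)
qed

text \<open>The Alexander subbase theorem for \<open>topology_generated_by\<close>. Having
  \<open>\<Union>B\<close> among the generators reconciles nonempty finite intersections with
  arbitrary finite intersections relative to the whole space.\<close>

lemma Alexander_subbase_generated:
  assumes top: "\<Union>B \<in> B"
    and fin: "\<And>\<C>. \<lbrakk>\<C> \<subseteq> B; \<Union>\<C> = \<Union>B\<rbrakk> \<Longrightarrow> \<exists>\<C>'. finite \<C>' \<and> \<C>' \<subseteq> \<C> \<and> \<Union>\<C>' = \<Union>B"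
  shows "compact_space (topology_generated_by B)"
proof (rule Alexander_subbase)
  have eq: "finite' intersection_of (\<lambda>x. x \<in> B) = (finite intersection_of (\<lambda>x. x \<in> B) relative_to \<Union>B)"
  proof (rule ext, rule iffI)
    fix A assume "(finite' intersection_of (\<lambda>x. x \<in> B)) A"
    then obtain \<F> where \<F>: "finite \<F>" "\<F> \<noteq> {}" "\<F> \<subseteq> B" "A = \<Inter>\<F>" unfolding intersection_of_def by auto
    then have "A = \<Union>B \<inter> \<Inter>\<F>" by blast
    moreover have "(finite intersection_of (\<lambda>x. x \<in> B)) (\<Inter>\<F>)"
      unfolding intersection_of_def using \<F> by (intro exI[where x = \<F>]) auto
    ultimately show "(finite intersection_of (\<lambda>x. x \<in> B) relative_to \<Union>B) A"
      unfolding relative_to_def by (intro exI[where x = "\<Inter>\<F>"]) simp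
  next
    fix A assume "(finite intersection_of (\<lambda>x. x \<in> B) relative_to \<Union>B) A"
    then obtain S where S: "(finite intersection_of (\<lambda>x. x \<in> B)) S" "A = \<Union>B \<inter> S" unfolding relative_to_def by auto
    then obtain \<F> where \<F>: "finite \<F>" "\<F> \<subseteq> B" "S = \<Inter>\<F>" unfolding intersection_of_def by auto
    have "A = \<Inter>(insert (\<Union>B) \<F>)" using S(2) \<F>(3) by simp
    then show "(finite' intersection_of (\<lambda>x. x \<in> B)) A"
      unfolding intersection_of_def using \<F> top by (intro exI[where x = "insert (\<Union>B) \<F>"]) auto
  qed
  show "topology (arbitrary union_of (finite intersection_of (\<lambda>x. x \<in> B) relative_to \<Union>B)) =
      topology_generated_by B"
    unfolding eq[symmetric] generate_topology_on_eq ..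
  show "\<exists>C'. finite C' \<and> C' \<subseteq> \<C> \<and> \<Union>C' = topspace (topology_generated_by B)"
    if "\<C> \<subseteq> B" "\<Union>\<C> = topspace (topology_generated_by B)" for \<C>
    using fin[of \<C>] that by (simp add: topology_generated_by_topspace)
qed

text \<open>A subbasic cover is indexed by a set \<open>Q\<close> of instances and negated
  instances. Without a finite subcover every finite part of \<open>Q\<close> is omitted by some
  type, so the negations of \<open>Q\<close> are consistent with \<open>p0\<close>; a complete type
  extending them lies in no member of the cover.\<close>

lemma compact_type_topology: "compact_space (type_topology I (types_over C I p0))"
proof -
  let ?P = "types_over C I p0"
  let ?B = "insert ?P {{p \<in> ?P. q \<in> p} | q. q \<in> I \<union> pneg ` I}"
  have UB: "\<Union>?B = ?P" by blast
  show ?thesis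
    unfolding type_topology_def
  proof (rule Alexander_subbase_generated, unfold UB)
    show "?P \<in> ?B" by simp
    fix \<C> assume \<C>: "\<C> \<subseteq> ?B" "\<Union>\<C> = ?P"
    show "\<exists>C'. finite C' \<and> C' \<subseteq> \<C> \<and> \<Union>C' = ?P"
    proof (cases "?P \<in> \<C>")
      case True
      then show ?thesis using \<C> by (intro exI[where x = "{?P}"]) (simp only: finite.intros empty_subsetI insert_subset cSup_singleton simp_thms)
    next
      case False
      define Q where "Q = {q \<in> I \<union> pneg ` I. {p \<in> ?P. q \<in> p} \<in> \<C>}"
      have CQ: "\<C> = (\<lambda>q. {p \<in> ?P. q \<in> p}) ` Q"
      proof (rule equalityI)
        show "\<C> \<subseteq> (\<lambda>q. {p \<in> ?P. q \<in> p}) ` Q"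
        proof
          fix U assume U: "U \<in> \<C>"
          then have "U \<in> ?B" "U \<noteq> ?P" using \<C>(1) False by auto
          then obtain q where "q \<in> I \<union> pneg ` I" "U = {p \<in> ?P. q \<in> p}" by blast
          then show "U \<in> (\<lambda>q. {p \<in> ?P. q \<in> p}) ` Q" using U by (auto simp: Q_def)
        qed
      qed (auto simp: Q_def)
      show ?thesis
      proof (rule ccontr)
        assume no: "\<nexists>C'. finite C' \<and> C' \<subseteq> \<C> \<and> \<Union>C' = ?P"
        have fin: "\<exists>p\<in>?P. \<forall>q\<in>F. q \<notin> p" if F: "finite F" "F \<subseteq> Q" for F
        proof (rule ccontr)
          assume "\<not> (\<exists>p\<in>?P. \<forall>q\<in>F. q \<notin> p)"
          then have "\<Union>((\<lambda>q. {p \<in> ?P. q \<in> p}) ` F) = ?P" by (intro equalityI subsetI) blast+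
          moreover have "finite ((\<lambda>q. {p \<in> ?P. q \<in> p}) ` F)" "(\<lambda>q. {p \<in> ?P. q \<in> p}) ` F \<subseteq> \<C>"
            using F CQ by auto
          ultimately have "\<exists>C'. finite C' \<and> C' \<subseteq> \<C> \<and> \<Union>C' = ?P"
            by (intro exI[where x = "(\<lambda>q. {p \<in> ?P. q \<in> p}) ` F"] conjI)
          then show False using no by (rule notE[rotated])
        qed
        have "consistent C (pneg ` Q \<union> p0)"
          unfolding consistent_def
        proof (intro allI impI)
          fix f assume f: "f \<subseteq> pneg ` Q \<union> p0" "finite f"
          then have "finite (f \<inter> pneg ` Q)" "f \<inter> pneg ` Q \<subseteq> pneg ` Q" by auto
          from finite_subset_image[OF this] obtain F where F: "F \<subseteq> Q" "finite F" "f \<inter> pneg ` Q = pneg ` F" by blast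
          obtain p where p: "p \<in> ?P" "\<forall>q\<in>F. q \<notin> p" using fin[OF F(2,1)] by blast
          have pc: "p \<in> complete_types C I" using p by simp
          \<comment> \<open>For \<open>q = pneg r\<close> the type \<open>p\<close> contains \<open>r\<close> but not \<open>pneg q\<close>, hence the case distinction.\<close>
          define n where "n q = (if q \<in> I then pneg q else (SOME r. r \<in> I \<and> q = pneg r))" for q
          have n: "n q \<in> p \<and> (\<forall>x. psat C x (n q) \<longleftrightarrow> \<not> psat C x q)" if q: "q \<in> F" for q
          proof (cases "q \<in> I")
            case True
            then show ?thesis using complete_typesD(3)[OF pc True] p(2) q by (simp add: n_def)
          next
            case False
            have "q \<in> pneg ` I" using q F(1) False by (auto simp: Q_def)
            then have "\<exists>r. r \<in> I \<and> q = pneg r" by blast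
            then have r: "n q \<in> I \<and> q = pneg (n q)" using someI_ex[of "\<lambda>r. r \<in> I \<and> q = pneg r"] False by (simp add: n_def)
            then have "n q \<in> p" using complete_typesD(3)[OF pc, of "n q"] p(2) q by metis
            then show ?thesis using r by (metis psat_pneg)
          qed
          have "\<exists>x. \<forall>r\<in>n ` F \<union> (f \<inter> p0). psat C x r"
            by (rule consistentD[where p = "p \<union> p0"]) (use p n F f in auto)
          then obtain x where x: "\<forall>r\<in>n ` F \<union> (f \<inter> p0). psat C x r" by blast
          have "psat C x r" if r: "r \<in> f" for r
          proof (cases "r \<in> p0")
            case False
            then obtain q where q: "q \<in> F" "r = pneg q" using r f(1) F(3) by blast
            then show ?thesis using x n[OF q(1)] by auto
          qed (use x r in auto)
          then show "\<exists>x. \<forall>q\<in>f. psat C x q" by blast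
        qed
        from complete_types_extension[OF this, of I] obtain p where
          p: "p \<in> complete_types C I" "consistent C (p \<union> (pneg ` Q \<union> p0))" by blast
        have "p \<in> ?P" using p by (auto intro: consistent_subset)
        then obtain q where "q \<in> Q" "q \<in> p" using \<C>(2) CQ by blast
        then show False using consistent_not_both[OF p(2), of q] by auto
      qed
    qed
  qed
qed

lemma Hausdorff_type_topology: "Hausdorff_space (type_topology I (types_over C I p0))"
  unfolding Hausdorff_space_def topspace_type_topology
proof (intro allI impI)
  let ?P = "types_over C I p0"
  fix p p' assume pp: "p \<in> ?P \<and> p' \<in> ?P \<and> p \<noteq> p'"
  then have c: "p \<in> complete_types C I" "p' \<in> complete_types C I" by auto
  then obtain q where q: "q \<in> I" "(q \<in> p) \<noteq> (q \<in> p')" using complete_types_eqI[OF c] pp by blast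
  let ?U = "{p \<in> ?P. q \<in> p}" and ?V = "{p \<in> ?P. pneg q \<in> p}"
  have op: "openin (type_topology I ?P) ?U" "openin (type_topology I ?P) ?V"
    by (rule openin_type_topology, simp add: q(1))+
  have dis: "disjnt ?U ?V" "disjnt ?V ?U" using complete_typesD(3)[OF _ q(1)] by (auto simp: disjnt_iff)
  have neg: "pneg q \<in> p \<longleftrightarrow> q \<notin> p" "pneg q \<in> p' \<longleftrightarrow> q \<notin> p'" using complete_typesD(3) c q(1) by blast+
  show "\<exists>U V. openin (type_topology I ?P) U \<and> openin (type_topology I ?P) V \<and> p \<in> U \<and> p' \<in> V \<and> disjnt U V"
  proof (cases "q \<in> p")
    case True
    then show ?thesis using q neg pp op dis by (intro exI[where x = ?U] exI[where x = ?V]) simp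
  next
    case False
    then show ?thesis using q neg pp op dis by (intro exI[where x = ?V] exI[where x = ?U]) simp
  qed
qed

lemma type_space_eq:
  "type_space L C V A a = type_topology (pfms L V A) (types_over C (pfms L V A) (tp L C V {} a))"
proof -
  have tpI: "tp L C V {} a \<subseteq> pfms L V A" by (auto simp: tp_def pfms_def fms_def)
  have "tp L C V {} a \<subseteq> p \<longleftrightarrow> consistent C (p \<union> tp L C V {} a)" if p: "p \<in> complete_types C (pfms L V A)" for p
  proof
    assume "tp L C V {} a \<subseteq> p"
    then show "consistent C (p \<union> tp L C V {} a)" using complete_typesD(1)[OF p] by (simp add: Un_absorb2)
  next
    assume c: "consistent C (p \<union> tp L C V {} a)"
    show "tp L C V {} a \<subseteq> p"
    proof
      fix q assume q: "q \<in> tp L C V {} a"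
      then have "pneg q \<notin> p" using consistent_not_both[OF c, of q] by auto
      then show "q \<in> p" using complete_typesD(3)[OF p, of q] q tpI by blast
    qed
  qed
  then show ?thesis unfolding type_space_def by (metis (mono_tags, lifting) Collect_cong)
qed

section \<open>The action of the automorphism group on types\<close>

definition ptrans :: "('m \<Rightarrow> 'm) \<Rightarrow> ('f, 'r, 'x, 'm) pfm \<Rightarrow> ('f, 'r, 'x, 'm) pfm" where
  "ptrans \<sigma> = (\<lambda>(\<phi>, b). (\<phi>, map \<sigma> b))"

lemma ptrans_simps: "ptrans \<sigma> (\<phi>, b) = (\<phi>, map \<sigma> b)" "ptrans \<sigma> (pneg q) = pneg (ptrans \<sigma> q)"
  "ptrans id q = q" "ptrans (\<sigma> \<circ> \<rho>) q = ptrans \<sigma> (ptrans \<rho> q)"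
  by (cases q, simp add: ptrans_def pneg_def)+

lemma ptrans_pfms: "q \<in> pfms L V A \<Longrightarrow> ptrans \<sigma> q \<in> pfms L V (\<sigma> ` A)"
  by (cases q) (auto simp: ptrans_def pfms_def)

lemma ptrans_pfms_empty: "q \<in> pfms L V {} \<Longrightarrow> ptrans \<sigma> q = q"
  by (cases q) (auto simp: ptrans_def pfms_def)

lemma psat_ptrans:
  assumes "\<sigma> \<in> automorphisms L C" "q \<in> pfms L V A"
  shows "psat C (\<lambda>v. \<sigma> (x v)) (ptrans \<sigma> q) \<longleftrightarrow> psat C x q"
proof -
  obtain \<phi> b where q: "q = (\<phi>, b)" by fastforce
  have \<phi>: "wf_fm L \<phi>" "fv \<phi> \<subseteq> Inl ` V \<union> Inr ` {..<length b}" using assms(2) q by (auto simp: pfms_def fms_def)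
  have "sat C (case_sum (\<lambda>v. \<sigma> (x v)) (nth (map \<sigma> b))) \<phi> \<longleftrightarrow> sat C (\<lambda>w. \<sigma> (case_sum x (nth b) w)) \<phi>"
    by (rule sat_in_cong) (use \<phi>(2) in auto)
  then show ?thesis using sat_automorphism[OF assms(1) \<phi>(1)] by (simp add: q psat_def ptrans_def)
qed

lemma consistent_ptrans:
  assumes \<sigma>: "\<sigma> \<in> automorphisms L C" and p: "p \<subseteq> pfms L V A" "consistent C p"
  shows "consistent C (ptrans \<sigma> ` p)"
  unfolding consistent_def
proof (intro allI impI)
  fix f assume f: "f \<subseteq> ptrans \<sigma> ` p" "finite f"
  from finite_subset_image[OF f(2,1)] obtain g where g: "g \<subseteq> p" "finite g" "f = ptrans \<sigma> ` g" by blast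
  obtain x where x: "\<forall>q\<in>g. psat C x q" using consistentD[OF p(2) g(1,2)] by blast
  have "psat C (\<lambda>v. \<sigma> (x v)) (ptrans \<sigma> q)" if "q \<in> g" for q
    using psat_ptrans[OF \<sigma>, of q V A x] that x g(1) p(1) by blast
  then show "\<exists>x. \<forall>q\<in>f. psat C x q" using g(3) by blast
qed

lemma ptrans_types_over:
  assumes \<sigma>: "\<sigma> \<in> automorphisms L C" and I: "I \<subseteq> pfms L V A" "ptrans \<sigma> ` I = I"
    and p0: "p0 \<subseteq> pfms L V A" "ptrans \<sigma> ` p0 = p0" and p: "p \<in> types_over C I p0"
  shows "ptrans \<sigma> ` p \<in> types_over C I p0"
proof -
  have c: "p \<in> complete_types C I" "consistent C (p \<union> p0)" using p by auto
  have sub: "p \<subseteq> I \<union> pneg ` I" using complete_typesD(2)[OF c(1)] .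
  then have pf: "p \<subseteq> pfms L V A" using I(1) pneg_pfms by blast
  have "consistent C (ptrans \<sigma> ` (p \<union> p0))" using consistent_ptrans[OF \<sigma> _ c(2)] pf p0(1) by blast
  then have con: "consistent C (ptrans \<sigma> ` p \<union> p0)" using p0(2) by (simp add: image_Un)
  have Ineg: "ptrans \<sigma> ` pneg ` I = pneg ` I"
  proof -
    have "ptrans \<sigma> ` pneg ` I = pneg ` ptrans \<sigma> ` I" by (simp add: image_image ptrans_simps)
    then show ?thesis using I(2) by simp
  qed
  have "ptrans \<sigma> ` p \<subseteq> I \<union> pneg ` I" using image_mono[OF sub, of "ptrans \<sigma>"] I(2) Ineg by (simp add: image_Un)
  moreover have "q \<in> ptrans \<sigma> ` p \<or> pneg q \<in> ptrans \<sigma> ` p" if "q \<in> I" for q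
  proof -
    have "q \<in> ptrans \<sigma> ` I" using that I(2) by simp
    then obtain q' where q': "q' \<in> I" "q = ptrans \<sigma> q'" by blast
    then have "q' \<in> p \<or> pneg q' \<in> p" using c(1) by (auto simp: complete_types_def)
    then show ?thesis using q' by (auto simp flip: ptrans_simps(2))
  qed
  ultimately show ?thesis using con by (auto simp: complete_types_def intro: consistent_subset)
qed

lemma openin_Aut_stabilizer:
  "openin (Aut_topology L C) {\<sigma> \<in> automorphisms L C. map \<sigma> b = b'}"
proof -
  let ?F = "product_topology (\<lambda>_. discrete_topology UNIV) UNIV :: ('a \<Rightarrow> 'a) topology"
  have 1: "openin ?F {\<sigma>. \<sigma> a = a'}" for a a' :: 'a
  proof -
    have "openin ?F {\<sigma> \<in> topspace ?F. \<sigma> a \<in> {a'}}"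
      by (rule openin_continuous_map_preimage[OF continuous_map_product_projection]) auto
    then show ?thesis by simp
  qed
  have "openin ?F {\<sigma>. map \<sigma> b = b'}"
  proof (cases "length b = length b'")
    case True
    have "openin ?F (\<Inter>((\<lambda>k. {\<sigma>. \<sigma> (b ! k) = b' ! k}) ` {..<length b}) \<inter> topspace ?F)"
      by (rule openin_INT) (auto simp: 1)
    moreover have "\<Inter>((\<lambda>k. {\<sigma>. \<sigma> (b ! k) = b' ! k}) ` {..<length b}) \<inter> topspace ?F = {\<sigma>. map \<sigma> b = b'}"
      using True by (auto simp: list_eq_iff_nth_eq)
    ultimately show ?thesis by simp
  next
    case False
    then have "{\<sigma>. map \<sigma> b = b'} = {}" by (auto dest: map_eq_imp_length_eq)
    then show ?thesis by simp
  qed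
  then show ?thesis unfolding Aut_topology_def openin_subtopology by (intro exI[where x = "{\<sigma>. map \<sigma> b = b'}"]) auto
qed

lemma topspace_Aut_topology: "topspace (Aut_topology L C) = automorphisms L C"
  by (simp add: Aut_topology_def)

lemma continuous_map_into_Aut:
  assumes "f \<in> topspace Y \<rightarrow> automorphisms L C" "\<And>a b. openin Y {y \<in> topspace Y. f y a = b}"
  shows "continuous_map Y (Aut_topology L C) f"
  unfolding Aut_topology_def continuous_map_in_subtopology continuous_map_componentwise_UNIV
proof (intro conjI allI)
  fix a
  have "openin Y {y \<in> topspace Y. f y a \<in> U}" for U
  proof -
    have "{y \<in> topspace Y. f y a \<in> U} = (\<Union>b\<in>U. {y \<in> topspace Y. f y a = b})" by blast
    then show ?thesis using assms(2) by auto
  qed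
  then show "continuous_map Y (discrete_topology UNIV) (\<lambda>y. f y a)" by (simp add: continuous_map_def)
qed (use assms(1) in auto)

lemma topological_group_Aut: "topological_group (Aut L C) (Aut_topology L C)"
proof -
  have st: "openin (Aut_topology L C) {\<sigma> \<in> automorphisms L C. \<sigma> a = b}" for a b
    using openin_Aut_stabilizer[of L C "[a]" "[b]"] by simp
  let ?P = "prod_topology (Aut_topology L C) (Aut_topology L C)"
  have "continuous_map ?P (Aut_topology L C) (\<lambda>(\<sigma>, \<rho>). \<sigma> \<circ> \<rho>)"
  proof (rule continuous_map_into_Aut)
    fix a b
    have "{y \<in> topspace ?P. (case y of (\<sigma>, \<rho>) \<Rightarrow> \<sigma> \<circ> \<rho>) a = b} =
      (\<Union>d. {\<sigma> \<in> automorphisms L C. \<sigma> d = b} \<times> {\<rho> \<in> automorphisms L C. \<rho> a = d})"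
      by (auto simp: topspace_Aut_topology)
    moreover have "openin ?P (\<Union>d. {\<sigma> \<in> automorphisms L C. \<sigma> d = b} \<times> {\<rho> \<in> automorphisms L C. \<rho> a = d})"
      using st by (intro openin_Union) (auto simp: openin_prod_Times_iff)
    ultimately show "openin ?P {y \<in> topspace ?P. (case y of (\<sigma>, \<rho>) \<Rightarrow> \<sigma> \<circ> \<rho>) a = b}" by simp
  qed (auto simp: topspace_Aut_topology automorphisms_comp)
  moreover have "continuous_map (Aut_topology L C) (Aut_topology L C) (\<lambda>\<sigma>. inv\<^bsub>Aut L C\<^esub> \<sigma>)"
  proof (rule continuous_map_into_Aut)
    show "(\<lambda>\<sigma>. inv\<^bsub>Aut L C\<^esub> \<sigma>) \<in> topspace (Aut_topology L C) \<rightarrow> automorphisms L C"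
      by (auto simp: topspace_Aut_topology inv_Aut automorphisms_inv)
    fix a b
    have "{\<sigma> \<in> topspace (Aut_topology L C). (inv\<^bsub>Aut L C\<^esub> \<sigma>) a = b} = {\<sigma> \<in> automorphisms L C. \<sigma> b = a}"
      using automorphisms_inv(2,3) by (fastforce simp: topspace_Aut_topology inv_Aut)
    then show "openin (Aut_topology L C) {\<sigma> \<in> topspace (Aut_topology L C). (inv\<^bsub>Aut L C\<^esub> \<sigma>) a = b}" using st by simp
  qed
  ultimately show ?thesis by (simp add: topological_group_def group_Aut topspace_Aut_topology)
qed

text \<open>For joint continuity, \<open>q\<close> belongs to the translate of \<open>p\<close> by
  \<open>\<sigma>\<close> exactly if some \<open>r\<close> in \<open>p\<close> is moved to
  \<open>q\<close>. For fixed \<open>r\<close> this is an open condition on \<open>\<sigma>\<close>,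
  which involves only finitely many parameters, and an open condition on \<open>p\<close>.\<close>

lemma flow_type_topology:
  fixes C :: "('f, 'r, 'm) fo_struct" and I p0 :: "('f, 'r, 'x, 'm) pfm set"
  assumes I: "I \<subseteq> pfms L V A" "\<And>\<sigma>. \<sigma> \<in> automorphisms L C \<Longrightarrow> ptrans \<sigma> ` I = I"
    and p0: "p0 \<subseteq> pfms L V A" "\<And>\<sigma>. \<sigma> \<in> automorphisms L C \<Longrightarrow> ptrans \<sigma> ` p0 = p0"
  shows "flow (Aut L C) (Aut_topology L C) (type_topology I (types_over C I p0))
           (type_act (type_topology I (types_over C I p0)))" (is "flow _ _ ?X _")
proof (rule flowI)
  let ?P = "types_over C I p0"
  have act: "type_act ?X \<sigma> p = ptrans \<sigma> ` p" if "p \<in> ?P" for \<sigma> p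
    using that by (simp add: type_act_def topspace_type_topology ptrans_def)
  have cl: "ptrans \<sigma> ` p \<in> ?P" if "\<sigma> \<in> automorphisms L C" "p \<in> ?P" for \<sigma> p
    using ptrans_types_over[OF that(1) I(1) I(2)[OF that(1)] p0(1) p0(2)[OF that(1)] that(2)] .
  show "topological_group (Aut L C) (Aut_topology L C)" by (rule topological_group_Aut)
  show "compact_space ?X" by (rule compact_type_topology)
  show "Hausdorff_space ?X" by (rule Hausdorff_type_topology)
  show "type_act ?X \<sigma> \<in> topspace ?X \<rightarrow>\<^sub>E topspace ?X" if "\<sigma> \<in> carrier (Aut L C)" for \<sigma>
    using that cl act by (intro PiE_I) (auto simp: topspace_type_topology type_act_def[of _ \<sigma>] ptrans_def)
  show "type_act ?X \<one>\<^bsub>Aut L C\<^esub> p = p" if "p \<in> topspace ?X" for p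
    using that act by (simp add: topspace_type_topology ptrans_simps)
  show "type_act ?X (\<sigma> \<otimes>\<^bsub>Aut L C\<^esub> \<rho>) p = type_act ?X \<sigma> (type_act ?X \<rho> p)"
    if "\<sigma> \<in> carrier (Aut L C)" "\<rho> \<in> carrier (Aut L C)" "p \<in> topspace ?X" for \<sigma> \<rho> p
  proof -
    have p: "p \<in> ?P" "ptrans \<rho> ` p \<in> ?P" using that cl by (auto simp: topspace_type_topology)
    show ?thesis unfolding Aut_simps act[OF p(1)] act[OF p(2)] by (simp add: image_image ptrans_simps)
  qed
  show "continuous_map (prod_topology (Aut_topology L C) ?X) ?X (\<lambda>(\<sigma>, p). type_act ?X \<sigma> p)"
  proof (rule continuous_map_type_topology)
    let ?Y = "prod_topology (Aut_topology L C) ?X"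
    show "(\<lambda>(\<sigma>, p). type_act ?X \<sigma> p) \<in> topspace ?Y \<rightarrow> ?P"
      using cl act by (auto simp: topspace_type_topology topspace_Aut_topology)
    fix q assume q: "q \<in> I \<union> pneg ` I"
    have st: "openin (Aut_topology L C) {\<sigma> \<in> automorphisms L C. ptrans \<sigma> r = q}" for r :: "('f, 'r, 'x, 'm) pfm"
    proof (cases "fst r = fst q")
      case True
      then have "{\<sigma> \<in> automorphisms L C. ptrans \<sigma> r = q} = {\<sigma> \<in> automorphisms L C. map \<sigma> (snd r) = snd q}"
        by (auto simp: ptrans_def case_prod_unfold prod_eq_iff)
      then show ?thesis using openin_Aut_stabilizer by simp
    next
      case False
      then have "{\<sigma> \<in> automorphisms L C. ptrans \<sigma> r = q} = {}" by (auto simp: ptrans_def case_prod_unfold)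
      then show ?thesis by (simp only: openin_empty)
    qed
    have "{y \<in> topspace ?Y. q \<in> (case y of (\<sigma>, p) \<Rightarrow> type_act ?X \<sigma> p)} =
       (\<Union>r\<in>I \<union> pneg ` I. {\<sigma> \<in> automorphisms L C. ptrans \<sigma> r = q} \<times> {p \<in> ?P. r \<in> p})" (is "?l = ?r")
    proof (intro equalityI subsetI)
      fix y assume "y \<in> ?l"
      then obtain \<sigma> p where y: "y = (\<sigma>, p)" "\<sigma> \<in> automorphisms L C" "p \<in> ?P" "q \<in> ptrans \<sigma> ` p"
        using act by (auto simp: topspace_type_topology topspace_Aut_topology)
      then obtain r where r: "r \<in> p" "q = ptrans \<sigma> r" by blast
      moreover have "r \<in> I \<union> pneg ` I" using r(1) y(3) complete_typesD(2)[of p C I] by blast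
      ultimately show "y \<in> ?r" using y by blast
    next
      fix y assume "y \<in> ?r"
      then obtain r \<sigma> p where "y = (\<sigma>, p)" "\<sigma> \<in> automorphisms L C" "ptrans \<sigma> r = q" "p \<in> ?P" "r \<in> p" by blast
      then show "y \<in> ?l" using act by (auto simp: topspace_type_topology topspace_Aut_topology)
    qed
    moreover have "openin ?Y ({\<sigma> \<in> automorphisms L C. ptrans \<sigma> r = q} \<times> {p \<in> ?P. r \<in> p})"
      if "r \<in> I \<union> pneg ` I" for r
      using st[of r] openin_type_topology[OF that, of ?P] by (simp only: openin_prod_Times_iff simp_thms)
    then have "openin ?Y ?r" by (intro openin_Union) blast
    ultimately show "openin ?Y {y \<in> topspace ?Y. q \<in> (case y of (\<sigma>, p) \<Rightarrow> type_act ?X \<sigma> p)}" by simp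
  qed
qed

lemma tp_subset_pfms: "tp L C V A a \<subseteq> pfms L V A"
  by (auto simp: tp_def)

lemma pfms_mono: "\<lbrakk>V \<subseteq> V'; A \<subseteq> A'\<rbrakk> \<Longrightarrow> pfms L V A \<subseteq> pfms L V' A'"
  by (force simp: pfms_def fms_def)

lemma ptrans_image_invariant:
  assumes "\<And>\<sigma> q. \<lbrakk>\<sigma> \<in> automorphisms L C; q \<in> I\<rbrakk> \<Longrightarrow> ptrans \<sigma> q \<in> I" "\<sigma> \<in> automorphisms L C"
  shows "ptrans \<sigma> ` I = I"
proof (intro equalityI subsetI)
  fix q assume q: "q \<in> I"
  have "ptrans (finv \<sigma>) q \<in> I" using assms(1)[OF automorphisms_inv(1)[OF assms(2)] q] .
  moreover have "ptrans \<sigma> (ptrans (finv \<sigma>) q) = q"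
    using ptrans_simps(4)[of \<sigma> "finv \<sigma>" q] automorphisms_inv(5)[OF assms(2)] by (simp add: ptrans_simps(3))
  ultimately show "q \<in> ptrans \<sigma> ` I" by (metis image_eqI)
qed (use assms in auto)

lemma ptrans_tp_empty: "ptrans \<sigma> ` tp L C V {} a = tp L C V {} a"
proof -
  have "ptrans \<sigma> q = q" if "q \<in> tp L C V {} a" for q
    using that ptrans_pfms_empty tp_subset_pfms by blast
  then show ?thesis by simp
qed

lemma topspace_global: "topspace (global_type_space L C c) = types_over C (pfms L UNIV UNIV) (tp L C UNIV {} c)"
  by (simp add: type_space_eq topspace_type_topology)

lemma flow_global: "flow (Aut L C) (Aut_topology L C) (global_type_space L C c) (global_type_act L C c)"
proof -
  have inv: "ptrans \<sigma> ` pfms L UNIV UNIV = pfms L UNIV UNIV" if \<sigma>: "\<sigma> \<in> automorphisms L C" for \<sigma>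
  proof (rule ptrans_image_invariant[OF _ \<sigma>])
    show "ptrans \<rho> q \<in> pfms L UNIV UNIV" if "q \<in> pfms L UNIV UNIV" for \<rho> q
      using ptrans_pfms[OF that, of \<rho>] pfms_mono[of UNIV UNIV "\<rho> ` UNIV" UNIV L] by auto
  qed
  have sub: "tp L C UNIV {} c \<subseteq> pfms L UNIV UNIV"
    by (rule subset_trans[OF tp_subset_pfms pfms_mono]) simp_all
  show ?thesis
    unfolding type_space_eq by (rule flow_type_topology[OF subset_refl inv sub ptrans_tp_empty])
qed

lemma realizations_automorphism:
  assumes \<sigma>: "\<sigma> \<in> automorphisms L C" and p: "p \<in> n_types L C n" and b: "b \<in> realizations C n p"
  shows "map \<sigma> b \<in> realizations C n p"
proof -
  have pf: "p \<subseteq> pfms L {..<n} {}"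
    using p complete_typesD(2)[of p C "pfms L {..<n} {}"] pneg_pfms unfolding n_types_def by blast
  have len: "length b = n" using b by (simp add: realizations_def)
  have "psat C (nth (map \<sigma> b)) q \<longleftrightarrow> psat C (nth b) q" if q: "q \<in> p" for q
  proof -
    obtain \<phi> d where qq: "q = (\<phi>, d)" by fastforce
    have "(\<phi>, d) \<in> pfms L {..<n} {}" using q pf qq by blast
    then have \<phi>: "d = []" "wf_fm L \<phi>" "fv \<phi> \<subseteq> Inl ` {..<n}" by (auto simp: pfms_def fms_def)
    have "sat C (case_sum (nth (map \<sigma> b)) (nth d)) \<phi> \<longleftrightarrow> sat C (\<lambda>w. \<sigma> (case_sum (nth b) (nth d) w)) \<phi>"
      by (rule sat_in_cong) (use \<phi>(3) len in auto)
    then show ?thesis using sat_automorphism[OF \<sigma> \<phi>(2)] by (simp add: qq psat_def)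
  qed
  then show ?thesis using b by (simp add: realizations_def)
qed

lemma Delta_instances_subset:
  assumes "\<Delta> \<subseteq> fms L UNIV n"
  shows "Delta_instances C n \<Delta> P \<subseteq> pfms L UNIV UNIV"
  using assms by (auto simp: Delta_instances_def pfms_def realizations_def)

lemma ptrans_Delta_instances:
  assumes "P \<subseteq> n_types L C n" "\<sigma> \<in> automorphisms L C"
  shows "ptrans \<sigma> ` Delta_instances C n \<Delta> P = Delta_instances C n \<Delta> P"
proof (rule ptrans_image_invariant[OF _ assms(2)])
  fix \<rho> q assume \<rho>: "\<rho> \<in> automorphisms L C" and q: "q \<in> Delta_instances C n \<Delta> P"
  obtain \<phi> b p where "q = (\<phi>, b)" "\<phi> \<in> \<Delta>" "p \<in> P" "b \<in> realizations C n p"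
    using q by (auto simp: Delta_instances_def)
  then show "ptrans \<rho> q \<in> Delta_instances C n \<Delta> P"
    using realizations_automorphism[OF \<rho>, of p n b] assms(1) by (auto simp: Delta_instances_def ptrans_def)
qed

context
  fixes L :: "('f, 'r) signature" and C :: "('f, 'r, 'm) fo_struct" and c :: "'i \<Rightarrow> 'm" and n
    and \<Delta> :: "('f, 'r, 'i + nat) fm set" and P :: "('f, 'r, nat, 'm) pfm set set"
  assumes data: "finite_Delta_data L C n \<Delta> P"
begin

lemma flow_Delta:
  "flow (Aut L C) (Aut_topology L C) (Delta_type_space L C c n \<Delta> P) (Delta_type_act L C c n \<Delta> P)"
proof -
  have sub: "Delta_instances C n \<Delta> P \<subseteq> pfms L UNIV UNIV"
    using data by (intro Delta_instances_subset) (simp add: finite_Delta_data_def)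
  have inv: "ptrans \<sigma> ` Delta_instances C n \<Delta> P = Delta_instances C n \<Delta> P" if "\<sigma> \<in> automorphisms L C" for \<sigma>
    using data by (intro ptrans_Delta_instances[OF _ that]) (simp add: finite_Delta_data_def)
  have "tp L C UNIV {} c \<subseteq> pfms L UNIV UNIV"
    by (rule subset_trans[OF tp_subset_pfms pfms_mono]) simp_all
  from flow_type_topology[OF sub inv this ptrans_tp_empty] show ?thesis by (simp add: Delta_type_space_def)
qed

text \<open>Restriction is onto because a \<Delta>-type of the space is by definition consistent
  with tp(c), and the union of the two extends to a complete global type.\<close>

lemma flow_epi_Delta:
  "flow_epi (Aut L C) (global_type_space L C c) (global_type_act L C c)
     (Delta_type_space L C c n \<Delta> P) (Delta_type_act L C c n \<Delta> P)
     (\<lambda>p. p \<inter> (Delta_instances C n \<Delta> P \<union> pneg ` Delta_instances C n \<Delta> P))"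
proof -
  let ?J = "Delta_instances C n \<Delta> P" and ?I = "pfms L UNIV UNIV :: ('f, 'r, 'i, 'm) pfm set" and ?t = "tp L C UNIV {} c"
  let ?X = "global_type_space L C c" and ?Z = "Delta_type_space L C c n \<Delta> P"
  let ?f = "\<lambda>p. p \<inter> (?J \<union> pneg ` ?J)"
  have X: "?X = type_topology ?I (types_over C ?I ?t)" by (rule type_space_eq)
  have Z: "?Z = type_topology ?J (types_over C ?J ?t)" by (rule Delta_type_space_def)
  have JI: "?J \<subseteq> ?I" using data by (intro Delta_instances_subset) (simp add: finite_Delta_data_def)
  have fin: "?f p \<in> types_over C ?J ?t" if p: "p \<in> types_over C ?I ?t" for p
  proof -
    have "consistent C (?f p)" "consistent C (?f p \<union> ?t)" using p by (auto intro: consistent_subset)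
    then show ?thesis using p JI by (auto simp: complete_types_def)
  qed
  show ?thesis
    unfolding flow_epi_def
  proof (intro conjI ballI)
    show "continuous_map ?X ?Z ?f"
      unfolding Z
    proof (rule continuous_map_type_topology)
      show "?f \<in> topspace ?X \<rightarrow> types_over C ?J ?t" using fin unfolding X topspace_type_topology by blast
      fix q assume q: "q \<in> ?J \<union> pneg ` ?J"
      then have "q \<in> ?I \<union> pneg ` ?I" using JI by blast
      from openin_type_topology[OF this, of "types_over C ?I ?t"] q
      show "openin ?X {p \<in> topspace ?X. q \<in> ?f p}" unfolding X topspace_type_topology by simp
    qed
    show "?f ` topspace ?X = topspace ?Z"
    proof (rule equalityI)
      show "?f ` topspace ?X \<subseteq> topspace ?Z" using fin unfolding X Z topspace_type_topology by blast
      show "topspace ?Z \<subseteq> ?f ` topspace ?X"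
      proof
        fix z assume "z \<in> topspace ?Z"
        then have z: "z \<in> complete_types C ?J" "consistent C (z \<union> ?t)" unfolding Z topspace_type_topology by auto
        from complete_types_extension[OF z(2), of ?I] obtain p where
          p: "p \<in> complete_types C ?I" "consistent C (p \<union> (z \<union> ?t))" "(z \<union> ?t) \<inter> (?I \<union> pneg ` ?I) \<subseteq> p" by blast
        have pX: "p \<in> types_over C ?I ?t" using p by (auto intro: consistent_subset)
        have "z \<subseteq> ?J \<union> pneg ` ?J" using complete_typesD(2)[OF z(1)] .
        then have "z \<subseteq> ?f p" using p(3) JI by blast
        moreover have "?f p \<in> complete_types C ?J" using fin[OF pX] by simp
        ultimately have "z = ?f p"
          using complete_types_eqI[OF z(1), of "?f p"] complete_typesD(3)[OF z(1)] complete_typesD(3)[of "?f p" C ?J] by blast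
        then show "z \<in> ?f ` topspace ?X" using pX unfolding X topspace_type_topology by blast
      qed
    qed
    fix \<sigma> p assume \<sigma>: "\<sigma> \<in> carrier (Aut L C)" and p: "p \<in> topspace ?X"
    then have \<sigma>': "\<sigma> \<in> automorphisms L C" by simp
    have fp: "?f p \<in> topspace ?Z" using fin p unfolding X Z topspace_type_topology by blast
    have Jinv: "ptrans \<sigma> ` ?J = ?J" 
      using data by (intro ptrans_Delta_instances[OF _ \<sigma>']) (simp add: finite_Delta_data_def)
    have inj: "inj (ptrans \<sigma> :: ('f, 'r, 'i, 'm) pfm \<Rightarrow> _)"
      using automorphismsD(1)[OF \<sigma>'] by (auto simp: inj_def ptrans_def bij_def inj_map_eq_map)
    have "ptrans \<sigma> ` pneg ` ?J = pneg ` ptrans \<sigma> ` ?J" by (simp add: image_image ptrans_simps)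
    then have "ptrans \<sigma> ` (?J \<union> pneg ` ?J) = ?J \<union> pneg ` ?J" using Jinv by (simp add: image_Un)
    then have "ptrans \<sigma> ` (?f p) = ptrans \<sigma> ` p \<inter> (?J \<union> pneg ` ?J)" by (simp add: image_Int[OF inj])
    then show "?f (global_type_act L C c \<sigma> p) = Delta_type_act L C c n \<Delta> P \<sigma> (?f p)"
      using p fp by (simp add: type_act_def flip: ptrans_def)
  qed
qed

end

section \<open>\<Delta>-types with finite Ellis groups and separation of global types\<close>

lemma tuple_type:
  assumes "length b = n"
  shows "tp L C {..<n} {} (nth b) \<in> n_types L C n" "b \<in> realizations C n (tp L C {..<n} {} (nth b))"
proof -
  have "consistent C (tp L C {..<n} {} (nth b))" by (auto simp: consistent_def tp_def)
  then show "tp L C {..<n} {} (nth b) \<in> n_types L C n"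
    unfolding n_types_def complete_types_def by (auto simp: tp_def pneg_pfms)
  show "b \<in> realizations C n (tp L C {..<n} {} (nth b))" using assms by (auto simp: realizations_def tp_def)
qed

text \<open>Two distinct global types differ at one instance \<phi>(x,b). The kernel of restriction
  to \<Delta> = {\<phi>} and to the single type tp(b) separates them.\<close>

lemma finite_ellis_separated_if_Delta:
  fixes c :: "'i \<Rightarrow> 'm" and C :: "('f, 'r, 'm) fo_struct"
  assumes "\<And>n (\<Delta> :: ('f, 'r, 'i + nat) fm set) P. finite_Delta_data L C n \<Delta> P \<Longrightarrow>
      finite_ellis_group (Aut L C) (Delta_type_space L C c n \<Delta> P) (Delta_type_act L C c n \<Delta> P)"
  shows "finite_ellis_separated (Aut L C) (global_type_space L C c) (global_type_act L C c)"
  unfolding finite_ellis_separated_def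
proof (intro ballI impI)
  let ?X = "global_type_space L C c" and ?I = "pfms L UNIV UNIV :: ('f, 'r, 'i, 'm) pfm set"
  fix x y assume xy: "x \<in> topspace ?X" "y \<in> topspace ?X" "x \<noteq> y"
  then have c: "x \<in> complete_types C ?I" "y \<in> complete_types C ?I" by (auto simp: topspace_global)
  then obtain q where q: "q \<in> ?I" "(q \<in> x) \<noteq> (q \<in> y)" using complete_types_eqI[OF c] xy by blast
  obtain \<phi> b where qq: "q = (\<phi>, b)" by fastforce
  let ?n = "length b" and ?P = "{tp L C {..<length b} {} (nth b)}"
  have data: "finite_Delta_data L C ?n {\<phi>} ?P"
    using q(1) qq tuple_type(1)[of b ?n L C] by (auto simp: finite_Delta_data_def pfms_def)
  have qJ: "q \<in> Delta_instances C ?n {\<phi>} ?P" using tuple_type(2)[of b ?n C L] by (simp add: qq Delta_instances_def)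
  let ?f = "\<lambda>p. p \<inter> (Delta_instances C ?n {\<phi>} ?P \<union> pneg ` Delta_instances C ?n {\<phi>} ?P)"
  have "{(x, y). x \<in> topspace ?X \<and> y \<in> topspace ?X \<and> ?f x = ?f y} \<in> finite_ellis_congruences (Aut L C) ?X (global_type_act L C c)"
    by (rule kernel_in_finite_ellis_congruences[OF flow_global flow_Delta[OF data] flow_epi_Delta[OF data] assms[OF data]])
  moreover have "?f x \<noteq> ?f y" using q(2) qJ by blast
  ultimately show "\<exists>R\<in>finite_ellis_congruences (Aut L C) ?X (global_type_act L C c). (x, y) \<notin> R"
    by (intro bexI[rotated]) auto
qed

lemma finite_ordLess_Cinfinite:
  assumes "finite A" "Cinfinite \<kappa>"
  shows "|A| <o \<kappa>"
  using assms by (intro finite_ordLess_infinite)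
    (auto simp: cinfinite_def card_order_on_well_order_on card_of_well_order_on Field_card_of)

text \<open>A complete type over the empty set determines the elementary properties of its
  realizations, so the entrywise map from \<open>b\<close> to \<open>b'\<close> is partial
  elementary, and strong homogeneity extends it.\<close>

lemma realizations_conjugate:
  assumes hom: "strongly_homogeneous \<kappa> L C" and \<kappa>: "Cinfinite \<kappa>" and p: "p \<in> n_types L C n"
    and b: "b \<in> realizations C n p" and b': "b' \<in> realizations C n p"
  shows "\<exists>\<sigma>\<in>automorphisms L C. map \<sigma> b = b'"
proof -
  have len: "length b = n" "length b' = n" using b b' by (auto simp: realizations_def)
  have transfer: "Q (nth b')" if Q: "Q \<in> definable L C {..<n} {}" "Q (nth b)" for Q
  proof -
    obtain q where q: "q \<in> pfms L {..<n} {}" "\<forall>x. psat C x q \<longleftrightarrow> Q x" using definable_pfm[OF Q(1)] by blast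
    have "q \<in> p \<or> pneg q \<in> p" using p q(1) by (auto simp: n_types_def complete_types_def)
    moreover have "\<not> psat C (nth b) (pneg q)" using q(2) Q(2) by simp
    then have "pneg q \<notin> p" using b by (auto simp: realizations_def)
    ultimately have "psat C (nth b') q" using b' by (auto simp: realizations_def)
    then show ?thesis using q(2) by blast
  qed
  define idx where "idx a = (SOME k. k < n \<and> b ! k = a)" for a
  have idx: "idx a < n \<and> b ! idx a = a" if "a \<in> set b" for a
    unfolding idx_def by (rule someI_ex) (use that len in \<open>auto simp: in_set_conv_nth\<close>)
  define f where "f a = b' ! idx a" for a
  have fb: "f (b ! i) = b' ! i" if i: "i < n" for i
  proof -
    \<comment> \<open>\<open>b\<close> may have repetitions. An equation between two of its entries
      belongs to \<open>p\<close> and thus holds in \<open>b'\<close> too, so the choice of the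
      position \<open>idx\<close> is harmless.\<close>
    let ?\<phi> = "Equal (Var i) (Var (idx (b ! i))) :: ('b, 'c, nat) fm"
    have id: "idx (b ! i) < n" "b ! idx (b ! i) = b ! i" using idx[of "b ! i"] i len by auto
    have "(\<lambda>x. sat C (\<lambda>w. case_sum x id (Inl w)) ?\<phi>) \<in> definable L C {..<n} {}"
      by (rule definableI) (use i id in auto)
    then have "(\<lambda>x. x i = x (idx (b ! i))) \<in> definable L C {..<n} {}" by simp
    from transfer[OF this] show ?thesis using id by (simp add: f_def)
  qed
  have "partial_elementary L C (set b) f"
  proof (rule partial_elementaryI)
    fix Q assume Q: "Q \<in> definable L C (set b) {}" "Q id"
    obtain V0 where V0: "V0 \<subseteq> set b" "\<forall>x y. (\<forall>v\<in>V0. x v = y v) \<longrightarrow> Q x = Q y"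
      using definable_local[OF Q(1)] by blast
    have "(\<lambda>x. Q (\<lambda>v. x (idx v))) \<in> definable L C {..<n} {}"
      using idx by (intro definable_rename[OF Q(1)]) auto
    moreover have "Q (\<lambda>v. b ! idx v) = Q id" using V0(1) idx by (intro V0(2)[rule_format]) auto
    ultimately have "Q (\<lambda>v. b' ! idx v)" using transfer Q(2) by blast
    moreover have "f = (\<lambda>v. b' ! idx v)" by (rule ext) (simp add: f_def)
    ultimately show "Q f" by simp
  qed
  moreover have "|set b| <o \<kappa>" using finite_ordLess_Cinfinite \<kappa> by blast
  ultimately obtain \<sigma> where \<sigma>: "\<sigma> \<in> automorphisms L C" "\<forall>a\<in>set b. \<sigma> a = f a"
    using hom unfolding strongly_homogeneous_def by blast
  have "map \<sigma> b = b'" using \<sigma>(2) fb len by (intro nth_equalityI) auto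
  then show ?thesis using \<sigma>(1) by blast
qed

text \<open>For a single instance, \<open>clopen_saturated\<close> yields a congruence
  \<open>R\<close> that decides it. As \<open>R\<close> is invariant and all realizations of
  \<open>p\<close> are conjugate, \<open>R\<close> decides \<phi>(x,b') for every such b'.
  Intersecting over the finitely many formulas and types gives one congruence through which
  restriction to \<Delta>-types factors.\<close>

lemma Delta_if_finite_ellis_separated:
  fixes c :: "'i \<Rightarrow> 'm" and C :: "('f, 'r, 'm) fo_struct"
  assumes hom: "strongly_homogeneous \<kappa> L C" and \<kappa>: "Cinfinite \<kappa>"
    and sep: "finite_ellis_separated (Aut L C) (global_type_space L C c) (global_type_act L C c)"
    and data: "finite_Delta_data L C n (\<Delta> :: ('f, 'r, 'i + nat) fm set) P"
  shows "finite_ellis_group (Aut L C) (Delta_type_space L C c n \<Delta> P) (Delta_type_act L C c n \<Delta> P)"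
proof -
  let ?X = "global_type_space L C c" and ?I = "pfms L UNIV UNIV :: ('f, 'r, 'i, 'm) pfm set"
  let ?R = "finite_ellis_congruences (Aut L C) ?X (global_type_act L C c)"
  let ?J = "Delta_instances C n \<Delta> P"
  have JI: "?J \<subseteq> ?I" using data by (intro Delta_instances_subset) (simp add: finite_Delta_data_def)
  have sat1: "\<exists>R\<in>?R. \<forall>b\<in>realizations C n p. \<forall>x y. (x, y) \<in> R \<longrightarrow> ((\<phi>, b) \<in> x \<longleftrightarrow> (\<phi>, b) \<in> y)"
    if \<phi>: "\<phi> \<in> \<Delta>" and p: "p \<in> P" for \<phi> p
  proof (cases "realizations C n p = {}")
    case True
    then show ?thesis using total_in_finite_ellis_congruences[OF flow_global[of L C c]] by blast
  next
    case False
    then obtain b where b: "b \<in> realizations C n p" by blast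
    have pn: "p \<in> n_types L C n" using data p by (auto simp: finite_Delta_data_def)
    have qI: "(\<phi>, b) \<in> ?I" using JI \<phi> p b by (auto simp: Delta_instances_def)
    let ?K = "{x \<in> types_over C ?I (tp L C UNIV {} c). (\<phi>, b) \<in> x}"
    have K: "openin ?X ?K" "closedin ?X ?K" unfolding type_space_eq using clopen_type_topology[OF qI] by blast+
    obtain R where R: "R \<in> ?R" "\<forall>x y. (x, y) \<in> R \<longrightarrow> (x \<in> ?K \<longleftrightarrow> y \<in> ?K)"
      using clopen_saturated[OF flow_global sep K(2,1)] by blast
    have cong: "flow_congruence (Aut L C) ?X (global_type_act L C c) R" using R(1) by (simp add: finite_ellis_congruences_def)
    have "(\<phi>, b') \<in> x \<longleftrightarrow> (\<phi>, b') \<in> y" if b': "b' \<in> realizations C n p" and xy: "(x, y) \<in> R" for b' x y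
    proof -
      obtain \<sigma> where \<sigma>: "\<sigma> \<in> automorphisms L C" "map \<sigma> b' = b" using realizations_conjugate[OF hom \<kappa> pn b' b] by blast
      let ?a = "global_type_act L C c \<sigma>"
      have xyX: "x \<in> topspace ?X" "y \<in> topspace ?X" using congruence_subset[OF flow_global cong] xy by blast+
      have "(?a x, ?a y) \<in> R" using cong xy \<sigma>(1) unfolding flow_congruence_def by simp
      then have "?a x \<in> ?K \<longleftrightarrow> ?a y \<in> ?K" using R(2) by blast
      moreover have inj: "inj (ptrans \<sigma> :: ('f, 'r, 'i, 'm) pfm \<Rightarrow> _)"
        using automorphismsD(1)[OF \<sigma>(1)] by (auto simp: inj_def ptrans_def bij_def inj_map_eq_map)
      have "?a z \<in> ?K \<longleftrightarrow> (\<phi>, b') \<in> z" if z: "z \<in> topspace ?X" for z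
      proof -
        have "?a z = ptrans \<sigma> ` z" using z by (simp add: type_act_def ptrans_def)
        moreover have "?a z \<in> topspace ?X" using flow_act(3)[OF flow_global _ z] \<sigma>(1) by simp
        moreover have "(\<phi>, b) = ptrans \<sigma> (\<phi>, b')" using \<sigma>(2) by (simp add: ptrans_def)
        ultimately show ?thesis using inj_image_mem_iff[OF inj, of "(\<phi>, b')" z] unfolding topspace_global by simp
      qed
      ultimately show ?thesis using xyX by blast
    qed
    then show ?thesis using R(1) by blast
  qed
  then obtain Rf where Rf: "\<And>\<phi> p. \<phi> \<in> \<Delta> \<Longrightarrow> p \<in> P \<Longrightarrow> Rf \<phi> p \<in> ?R"
    "\<And>\<phi> p b x y. \<phi> \<in> \<Delta> \<Longrightarrow> p \<in> P \<Longrightarrow> b \<in> realizations C n p \<Longrightarrow> (x, y) \<in> Rf \<phi> p \<Longrightarrow> ((\<phi>, b) \<in> x \<longleftrightarrow> (\<phi>, b) \<in> y)"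
    by metis
  define R where "R = topspace ?X \<times> topspace ?X \<inter> \<Inter>((\<lambda>(\<phi>, p). Rf \<phi> p) ` (\<Delta> \<times> P))"
  have "R \<in> ?R"
    unfolding R_def
  proof (rule Inter_in_finite_ellis_congruences[OF flow_global])
    show "finite ((\<lambda>(\<phi>, p). Rf \<phi> p) ` (\<Delta> \<times> P))" using data by (simp add: finite_Delta_data_def)
    show "(\<lambda>(\<phi>, p). Rf \<phi> p) ` (\<Delta> \<times> P) \<subseteq> ?R" using Rf(1) by auto
  qed
  moreover have "x \<inter> (?J \<union> pneg ` ?J) = y \<inter> (?J \<union> pneg ` ?J)" if xy: "(x, y) \<in> R" for x y
  proof -
    have xyX: "x \<in> complete_types C ?I" "y \<in> complete_types C ?I" using xy by (auto simp: R_def topspace_global)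
    have J: "q \<in> x \<longleftrightarrow> q \<in> y" if q: "q \<in> ?J" for q
    proof -
      obtain \<phi> b p where qq: "q = (\<phi>, b)" "\<phi> \<in> \<Delta>" "p \<in> P" "b \<in> realizations C n p"
        using q by (auto simp: Delta_instances_def)
      then have "(x, y) \<in> Rf \<phi> p" using xy by (auto simp: R_def)
      then show ?thesis using Rf(2)[OF qq(2,3,4)] qq(1) by blast
    qed
    moreover have "pneg q \<in> x \<longleftrightarrow> pneg q \<in> y" if q: "q \<in> ?J" for q
      using J[OF q] complete_typesD(3)[OF xyX(1), of q] complete_typesD(3)[OF xyX(2), of q] q JI by blast
    ultimately show ?thesis by blast
  qed
  ultimately show ?thesis
    by (rule finite_ellis_group_factor[OF flow_global flow_Delta[OF data] flow_epi_Delta[OF data]])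
qed

section \<open>Saturation\<close>

lemma definable_Ex_finite:
  assumes "finite E" "Q \<in> definable L C V A"
  shows "(\<lambda>x. \<exists>y. (\<forall>w. w \<notin> E \<longrightarrow> y w = x w) \<and> Q y) \<in> definable L C (V - E) A"
  using assms
proof (induction E arbitrary: Q V rule: finite_induct)
  case empty
  have "(\<lambda>x. \<exists>y. (\<forall>w. w \<notin> {} \<longrightarrow> y w = x w) \<and> Q y) = Q"
  proof (rule ext, rule iffI)
    fix x assume "\<exists>y. (\<forall>w. w \<notin> {} \<longrightarrow> y w = x w) \<and> Q y"
    then obtain y where "\<And>w. y w = x w" "Q y" by auto
    then show "Q x" by (metis ext)
  qed auto
  then show ?case using empty by simp
next
  case (insert e E)
  have "(\<lambda>x. \<exists>a. \<exists>y. (\<forall>w. w \<notin> E \<longrightarrow> y w = (x(e := a)) w) \<and> Q y) \<in> definable L C (V - E - {e}) A"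
    by (rule definable_Ex[OF insert.IH[OF insert.prems]])
  moreover have "(\<exists>a. \<exists>y. (\<forall>w. w \<notin> E \<longrightarrow> y w = (x(e := a)) w) \<and> Q y) \<longleftrightarrow>
      (\<exists>y. (\<forall>w. w \<notin> insert e E \<longrightarrow> y w = x w) \<and> Q y)" for x
  proof
    assume "\<exists>y. (\<forall>w. w \<notin> insert e E \<longrightarrow> y w = x w) \<and> Q y"
    then obtain y where "\<forall>w. w \<notin> insert e E \<longrightarrow> y w = x w" "Q y" by blast
    then have "(\<forall>w. w \<notin> E \<longrightarrow> y w = (x(e := y e)) w) \<and> Q y" by auto
    then show "\<exists>a. \<exists>y. (\<forall>w. w \<notin> E \<longrightarrow> y w = (x(e := a)) w) \<and> Q y" by blast
  next
    assume "\<exists>a. \<exists>y. (\<forall>w. w \<notin> E \<longrightarrow> y w = (x(e := a)) w) \<and> Q y"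
    then obtain a y where "\<forall>w. w \<notin> E \<longrightarrow> y w = (x(e := a)) w" "Q y" by blast
    then have "(\<forall>w. w \<notin> insert e E \<longrightarrow> y w = x w) \<and> Q y" by auto
    then show "\<exists>y. (\<forall>w. w \<notin> insert e E \<longrightarrow> y w = x w) \<and> Q y" by blast
  qed
  moreover have "V - E - {e} = V - insert e E" by blast
  ultimately show ?case by simp
qed

definition finitely_satisfiable :: "(('v \<Rightarrow> 'm) \<Rightarrow> bool) set \<Rightarrow> bool" where
  "finitely_satisfiable \<Gamma> \<longleftrightarrow> (\<forall>\<Gamma>0 \<subseteq> \<Gamma>. finite \<Gamma>0 \<longrightarrow> (\<exists>x. \<forall>Q\<in>\<Gamma>0. Q x))"

text \<open>\<open>saturated\<close> is about complete types in one variable;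
  \<open>\<Gamma>\<close> is turned into a set of formulas and completed.\<close>

lemma saturated_partial_1_type:
  fixes C :: "('f, 'r, 'm) fo_struct" and \<Gamma> :: "((unit \<Rightarrow> 'm) \<Rightarrow> bool) set"
  assumes sat: "saturated \<kappa> L C" and A: "|A| <o \<kappa>"
    and \<Gamma>: "\<Gamma> \<subseteq> definable L C UNIV A" and fs: "finitely_satisfiable \<Gamma>"
  shows "\<exists>a. \<forall>Q\<in>\<Gamma>. Q (\<lambda>_. a)"
proof -
  let ?I = "pfms L (UNIV :: unit set) A :: ('f, 'r, unit, 'm) pfm set"
  define p0 where "p0 = {q \<in> ?I. (\<lambda>x. psat C x q) \<in> \<Gamma>}"
  have "consistent C p0"
    unfolding consistent_def
  proof (intro allI impI)
    fix f assume f: "f \<subseteq> p0" "finite f"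
    have "(\<lambda>q x. psat C x q) ` f \<subseteq> \<Gamma>" using f(1) by (auto simp: p0_def)
    then obtain x where "\<forall>Q\<in>(\<lambda>q x. psat C x q) ` f. Q x"
      using fs f(2) unfolding finitely_satisfiable_def by (meson finite_imageI)
    then show "\<exists>x. \<forall>q\<in>f. psat C x q" by auto
  qed
  from complete_types_extension[OF this, of ?I] obtain p where
    p: "p \<in> complete_types C ?I" "p0 \<inter> (?I \<union> pneg ` ?I) \<subseteq> p" by blast
  obtain x where x: "\<forall>q\<in>p. psat C x q" using sat A p(1) unfolding saturated_def by blast
  have "Q (\<lambda>_. x ())" if Q: "Q \<in> \<Gamma>" for Q
  proof -
    obtain q where q: "q \<in> ?I" "\<forall>x. psat C x q \<longleftrightarrow> Q x" using definable_pfm[of Q L C UNIV A] Q \<Gamma> by blast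
    have "(\<lambda>x. psat C x q) = Q" using q(2) by blast
    then have "q \<in> p0" using q(1) Q by (simp add: p0_def)
    then have "q \<in> p" using p(2) q(1) by blast
    then have "Q x" using x q(2) by blast
    moreover have "x = (\<lambda>_. x ())" by (rule ext) simp
    ultimately show ?thesis by simp
  qed
  then show ?thesis by blast
qed

text \<open>The variables are assigned one by one: a partial assignment (given by its graph) under which
  all finite subsets of \<open>\<Gamma>\<close> stay satisfiable can be extended, and Zorn's lemma applies.\<close>

lemma saturated_realize:
  fixes C :: "('f, 'r, 'm) fo_struct" and \<Gamma> :: "(('v \<Rightarrow> 'm) \<Rightarrow> bool) set"
  assumes sat: "saturated \<kappa> L C" and \<kappa>: "Cinfinite \<kappa>" and V: "|V| <o \<kappa>" and A: "|A| <o \<kappa>"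
    and \<Gamma>: "\<Gamma> \<subseteq> definable L C V A" and fs: "finitely_satisfiable \<Gamma>"
  shows "\<exists>x. \<forall>Q\<in>\<Gamma>. Q x"
proof -
  define ok where "ok g \<longleftrightarrow> (\<forall>\<Gamma>0 \<subseteq> \<Gamma>. finite \<Gamma>0 \<longrightarrow> (\<exists>x. (\<forall>v a. (v, a) \<in> g \<longrightarrow> x v = a) \<and> (\<forall>Q\<in>\<Gamma>0. Q x)))" for g
  define \<A> where "\<A> = {g. g \<subseteq> V \<times> UNIV \<and> ok g}"
  have okD: "\<exists>x. (\<forall>v a. (v, a) \<in> g \<longrightarrow> x v = a) \<and> (\<forall>Q\<in>\<Gamma>0. Q x)"
    if "ok g" "\<Gamma>0 \<subseteq> \<Gamma>" "finite \<Gamma>0" for g \<Gamma>0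
    using that unfolding ok_def by simp
  have func: "a = a'" if g: "ok g" "(v, a) \<in> g" "(v, a') \<in> g" for g v a a'
  proof -
    obtain x where "\<forall>v a. (v, a) \<in> g \<longrightarrow> x v = a" using okD[OF g(1), of "{}"] by auto
    then show ?thesis using g(2,3) by metis
  qed
  have supp: "\<exists>V0. finite V0 \<and> V0 \<subseteq> V \<and> (\<forall>x y. (\<forall>v\<in>V0. x v = y v) \<longrightarrow> (\<forall>Q\<in>\<Gamma>0. Q x) = (\<forall>Q\<in>\<Gamma>0. Q y))"
    and conj: "(\<lambda>x. \<forall>Q\<in>\<Gamma>0. Q x) \<in> definable L C V A" if "\<Gamma>0 \<subseteq> \<Gamma>" "finite \<Gamma>0" for \<Gamma>0
  proof -
    show c: "(\<lambda>x. \<forall>Q\<in>\<Gamma>0. Q x) \<in> definable L C V A"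
      using definable_Ball[OF that(2), of "\<lambda>Q. Q" L C V A] that(1) \<Gamma> by blast
    show "\<exists>V0. finite V0 \<and> V0 \<subseteq> V \<and> (\<forall>x y. (\<forall>v\<in>V0. x v = y v) \<longrightarrow> (\<forall>Q\<in>\<Gamma>0. Q x) = (\<forall>Q\<in>\<Gamma>0. Q y))"
      by (rule definable_local[OF c])
  qed
  have "\<exists>g\<in>\<A>. \<forall>h\<in>\<A>. g \<subseteq> h \<longrightarrow> h = g"
  proof (rule subset_Zorn_nonempty)
    have "{} \<in> \<A>" using fs by (simp add: \<A>_def ok_def finitely_satisfiable_def)
    then show "\<A> \<noteq> {}" by blast
    fix \<C> assume ne: "\<C> \<noteq> {}" and ch: "subset.chain \<A> \<C>"
    have \<C>ok: "ok g" "g \<subseteq> V \<times> UNIV" if "g \<in> \<C>" for g using ch that by (auto simp: subset_chain_def \<A>_def)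
    let ?G = "\<Union>\<C>"
    have Gfun: "a = a'" if "(v, a) \<in> ?G" "(v, a') \<in> ?G" for v a a'
    proof -
      have "{(v, a), (v, a')} \<subseteq> ?G" using that by blast
      then obtain g where "g \<in> \<C>" "{(v, a), (v, a')} \<subseteq> g"
        using finite_subset_Union_chain[of "{(v, a), (v, a')}" \<C>, OF _ _ ne ch] by blast
      then show ?thesis using func[OF \<C>ok(1)[of g], of v a a'] by blast
    qed
    have "ok ?G"
      unfolding ok_def
    proof (intro allI impI)
      fix \<Gamma>0 assume \<Gamma>0: "\<Gamma>0 \<subseteq> \<Gamma>" "finite \<Gamma>0"
      obtain V0 where V0: "finite V0" "\<forall>x y. (\<forall>v\<in>V0. x v = y v) \<longrightarrow> (\<forall>Q\<in>\<Gamma>0. Q x) = (\<forall>Q\<in>\<Gamma>0. Q y)"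
        using supp[OF \<Gamma>0] by (elim exE conjE) (rule that)
      \<comment> \<open>Only the part of the union over the finite support \<open>V0\<close>
        matters. It is finite, hence contained in one member \<open>g\<close> of the chain; a
        solution for \<open>g\<close> is then overwritten by the union outside \<open>V0\<close>
        without affecting \<open>\<Gamma>0\<close>.\<close>
      let ?H = "{p \<in> ?G. fst p \<in> V0}"
      have "inj_on fst ?H" using Gfun by (auto simp: inj_on_def)
      moreover have "finite (fst ` ?H)" by (rule finite_subset[OF _ V0(1)]) auto
      ultimately have "finite ?H" using finite_imageD by blast
      moreover have "?H \<subseteq> ?G" by (rule Collect_restrict)
      ultimately obtain g where g: "g \<in> \<C>" "?H \<subseteq> g"
        using finite_subset_Union_chain[of ?H \<C>, OF _ _ ne ch] by metis
      obtain x where x: "\<forall>v a. (v, a) \<in> g \<longrightarrow> x v = a" "\<forall>Q\<in>\<Gamma>0. Q x"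
        using okD[OF \<C>ok(1)[OF g(1)] \<Gamma>0] by (elim exE conjE) (rule that)
      define y where "y v = (if \<exists>a. (v, a) \<in> ?G then THE a. (v, a) \<in> ?G else x v)" for v
      have yG: "y v = a" if va: "(v, a) \<in> ?G" for v a
      proof -
        have "(THE a. (v, a) \<in> ?G) = a" 
          by (rule the_equality) (use Gfun va in blast)+
        then show ?thesis using va by (auto simp: y_def)
      qed
      have "\<forall>v\<in>V0. x v = y v"
      proof
        fix v assume v: "v \<in> V0"
        show "x v = y v"
        proof (cases "\<exists>a. (v, a) \<in> ?G")
          case True
          then obtain a where a: "(v, a) \<in> ?G" by blast
          then have "(v, a) \<in> g" using g(2) v by auto
          then show ?thesis using x(1) yG[OF a] by simp
        qed (simp add: y_def)
      qed
      then have "\<forall>Q\<in>\<Gamma>0. Q y" using V0(2) x(2) by blast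
      then show "\<exists>x. (\<forall>v a. (v, a) \<in> ?G \<longrightarrow> x v = a) \<and> (\<forall>Q\<in>\<Gamma>0. Q x)" using yG by blast
    qed
    moreover have "?G \<subseteq> V \<times> UNIV" using \<C>ok(2) by blast
    ultimately show "?G \<in> \<A>" by (simp add: \<A>_def)
  qed
  then obtain g where g: "g \<in> \<A>" and max: "\<forall>h\<in>\<A>. g \<subseteq> h \<longrightarrow> h = g" by (rule bexE)
  have gok: "ok g" and gV: "g \<subseteq> V \<times> UNIV" using g by (auto simp: \<A>_def)
  define G where "G v = (THE a. (v, a) \<in> g)" for v
  have G: "G v = a" if "(v, a) \<in> g" for v a
    unfolding G_def by (rule the_equality) (use func[OF gok] that in blast)+
  have "Domain g = V"
  proof (rule ccontr)
    assume "Domain g \<noteq> V"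
    then obtain v where v: "v \<in> V" "v \<notin> Domain g" using gV by blast
    \<comment> \<open>The values assigned so far become parameters. They lie in the image of
      \<open>V\<close>, so there are fewer than \<kappa> of them.\<close>
    define B where "B = A \<union> G ` V"
    have "|G ` V| <o \<kappa>" using ordLeq_ordLess_trans[OF card_of_image V] .
    then have B: "|B| <o \<kappa>" unfolding B_def using Un_Cinfinite_bound_strict A \<kappa> by blast
    \<comment> \<open>\<open>R \<Gamma>0\<close> is the condition on a value for \<open>v\<close>
      that \<open>\<Gamma>0\<close> remain satisfiable. These conditions make up the partial type in
      one variable to which saturation is applied.\<close>
    define R where "R \<Gamma>0 z \<longleftrightarrow> (\<exists>x. (\<forall>v a. (v, a) \<in> g \<longrightarrow> x v = a) \<and> x v = z () \<and> (\<forall>Q\<in>\<Gamma>0. Q x))"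
      for \<Gamma>0 and z :: "unit \<Rightarrow> 'm"
    have R: "R \<Gamma>0 \<in> definable L C UNIV B" if \<Gamma>0: "\<Gamma>0 \<subseteq> \<Gamma>" "finite \<Gamma>0" for \<Gamma>0
    proof -
      let ?Qc = "\<lambda>x. \<forall>Q\<in>\<Gamma>0. Q x"
      obtain V0 where V0: "finite V0" "V0 \<subseteq> V" "?Qc \<in> definable L C V0 A"
        using definable_restrict[OF conj[OF \<Gamma>0]] by blast
      obtain V1 where V1: "V1 \<subseteq> V0" "\<forall>x y. (\<forall>v\<in>V1. x v = y v) \<longrightarrow> ?Qc x = ?Qc y"
        using definable_local[OF V0(3)] by (elim exE conjE) (rule that)
      define f :: "'v \<Rightarrow> 'v + 'm" where "f w = (if w \<in> Domain g then Inr (G w) else Inl w)" for w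
      \<comment> \<open>The variables of the support that are neither assigned nor equal to
        \<open>v\<close> are quantified existentially.\<close>
      define E where "E = V0 - Domain g - {v}"
      let ?Q1 = "\<lambda>x. ?Qc (\<lambda>w. case_sum x id (f w))"
      have "?Q1 \<in> definable L C (V0 - Domain g) B"
        using V0(2) by (intro definable_subst[OF V0(3)]) (auto simp: f_def B_def)
      then have "(\<lambda>x. \<exists>y. (\<forall>w. w \<notin> E \<longrightarrow> y w = x w) \<and> ?Q1 y) \<in> definable L C (V0 - Domain g - E) B"
        using V0(1) by (intro definable_Ex_finite) (auto simp: E_def)
      \<comment> \<open>At most the variable \<open>v\<close> is left, so all free variables may be
        identified with the single variable of a 1-type.\<close>
      then have "(\<lambda>z. \<exists>y. (\<forall>w. w \<notin> E \<longrightarrow> y w = z ()) \<and> ?Q1 y) \<in> definable L C UNIV B"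
        by (rule definable_rename[where f = "\<lambda>_. ()"]) simp
      moreover have "(\<exists>y. (\<forall>w. w \<notin> E \<longrightarrow> y w = z ()) \<and> ?Q1 y) \<longleftrightarrow> R \<Gamma>0 z" for z
      proof
        assume "\<exists>y. (\<forall>w. w \<notin> E \<longrightarrow> y w = z ()) \<and> ?Q1 y"
        then obtain y where y: "\<forall>w. w \<notin> E \<longrightarrow> y w = z ()" "?Q1 y" by blast
        let ?x = "\<lambda>w. case_sum y id (f w)"
        have "?x w = a" if "(w, a) \<in> g" for w a using that G[OF that] by (auto simp: f_def)
        moreover have "?x v = z ()" using y(1) v by (simp add: f_def E_def)
        ultimately show "R \<Gamma>0 z" unfolding R_def using y(2) by (intro exI[where x = ?x] conjI) simp_all
      next
        assume "R \<Gamma>0 z"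
        then obtain x where x: "\<forall>v a. (v, a) \<in> g \<longrightarrow> x v = a" "x v = z ()" "?Qc x"
          unfolding R_def by (elim exE conjE) (rule that)
        let ?y = "\<lambda>w. if w \<in> E then x w else z ()"
        have "\<forall>w\<in>V1. x w = case_sum ?y id (f w)"
        proof
          fix w assume w: "w \<in> V1"
          show "x w = case_sum ?y id (f w)"
          proof (cases "w \<in> Domain g")
            case True
            then obtain a where "(w, a) \<in> g" by blast
            then show ?thesis using x(1) G True by (simp add: f_def)
          next
            case False
            then have "w \<in> E \<or> w = v" using w V1(1) by (auto simp: E_def)
            then show ?thesis using False x(2) by (auto simp: f_def)
          qed
        qed
        then have "?Qc x = ?Q1 ?y" by (rule V1(2)[THEN spec, THEN spec, THEN mp])
        then have "?Q1 ?y" using x(3) by (rule iffD1)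
        then show "\<exists>y. (\<forall>w. w \<notin> E \<longrightarrow> y w = z ()) \<and> ?Q1 y" by (intro exI[where x = ?y]) simp
      qed
      ultimately show ?thesis by simp
    qed
    let ?\<Gamma>' = "{R \<Gamma>0 | \<Gamma>0. \<Gamma>0 \<subseteq> \<Gamma> \<and> finite \<Gamma>0}"
    have "finitely_satisfiable ?\<Gamma>'"
      unfolding finitely_satisfiable_def
    proof (intro allI impI)
      fix \<Delta> assume \<Delta>: "\<Delta> \<subseteq> ?\<Gamma>'" "finite \<Delta>"
      then have "\<Delta> \<subseteq> R ` {\<Gamma>0. \<Gamma>0 \<subseteq> \<Gamma> \<and> finite \<Gamma>0}" by blast
      from finite_subset_image[OF \<Delta>(2) this] obtain S where
        S: "S \<subseteq> {\<Gamma>0. \<Gamma>0 \<subseteq> \<Gamma> \<and> finite \<Gamma>0}" "finite S" "\<Delta> = R ` S" by blast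
      have "\<Union>S \<subseteq> \<Gamma>" "finite (\<Union>S)" using S by auto
      then obtain x where x: "\<forall>v a. (v, a) \<in> g \<longrightarrow> x v = a" "\<forall>Q\<in>\<Union>S. Q x"
        using okD[OF gok] by metis
      have "R \<Gamma>0 (\<lambda>_. x v)" if "\<Gamma>0 \<in> S" for \<Gamma>0
        unfolding R_def using x that by (intro exI[where x = x]) auto
      then have "\<forall>Q\<in>\<Delta>. Q (\<lambda>_. x v)" using S(3) by blast
      then show "\<exists>x. \<forall>Q\<in>\<Delta>. Q x" by blast
    qed
    moreover have "?\<Gamma>' \<subseteq> definable L C UNIV B" using R by blast
    ultimately obtain a where a: "\<forall>Q\<in>?\<Gamma>'. Q (\<lambda>_. a)" using saturated_partial_1_type[OF sat B] by blast
    have "ok (insert (v, a) g)"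
      unfolding ok_def
    proof (intro allI impI)
      fix \<Gamma>0 assume "\<Gamma>0 \<subseteq> \<Gamma>" "finite \<Gamma>0"
      then have "R \<Gamma>0 (\<lambda>_. a)" using a by blast
      then obtain x where "\<forall>v a. (v, a) \<in> g \<longrightarrow> x v = a" "x v = a" "\<forall>Q\<in>\<Gamma>0. Q x" unfolding R_def by blast
      then show "\<exists>x. (\<forall>w b. (w, b) \<in> insert (v, a) g \<longrightarrow> x w = b) \<and> (\<forall>Q\<in>\<Gamma>0. Q x)" by blast
    qed
    then have "insert (v, a) g \<in> \<A>" using gV v by (auto simp: \<A>_def)
    then have "insert (v, a) g = g" using max by blast
    then show False using v by blast
  qed
  have "Q G" if Q: "Q \<in> \<Gamma>" for Q
  proof -
    obtain x where x: "\<forall>v a. (v, a) \<in> g \<longrightarrow> x v = a" "Q x"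
      using okD[OF gok, of "{Q}"] Q by auto
    obtain V0 where V0: "V0 \<subseteq> V" "\<forall>x y. (\<forall>v\<in>V0. x v = y v) \<longrightarrow> Q x = Q y"
      using definable_local[of Q L C V A] Q \<Gamma> by blast
    have "\<forall>v\<in>V0. x v = G v"
    proof
      fix v assume "v \<in> V0"
      then have "v \<in> Domain g" using V0(1) \<open>Domain g = V\<close> by blast
      then obtain a where "(v, a) \<in> g" by blast
      then show "x v = G v" using x(1) G by simp
    qed
    then show ?thesis using V0(2) x(2) by blast
  qed
  then show ?thesis by blast
qed

lemma Times_Cinfinite_bound_strict:
  assumes "|A| <o \<kappa>" "|B| <o \<kappa>" "Cinfinite \<kappa>"
  shows "|A \<times> B| <o \<kappa>"
proof (cases "finite (A <+> B)")
  case True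
  then have "finite (A \<times> B)" by (simp add: finite_Plus_iff)
  then show ?thesis by (rule finite_ordLess_Cinfinite[OF _ assms(3)])
next
  case False
  have "|A <+> B| <o \<kappa>"
    using assms by (intro card_of_Plus_ordLess_infinite_Field) (auto simp: cinfinite_def)
  moreover have "|A \<times> B| \<le>o |A <+> B|"
    using False by (intro card_of_Times_ordLeq_infinite_Field)
      (simp_all add: Field_card_of card_of_Plus1 card_of_Plus2 card_of_card_order_on)
  ultimately show ?thesis by (rule ordLeq_ordLess_trans[rotated])
qed

text \<open>The variables form a family of copies of \<open>D\<close>. By \<open>elem\<close>,
  \<open>\<Gamma>\<close> contains the elementary diagram of \<open>D\<close> on each copy, so a
  solution is partial elementary there and extends to an automorphism by homogeneity. One copy
  serves for realizing types, two copies for limits of pairs of automorphisms.\<close>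

theorem realize_by_automorphisms:
  fixes C :: "('f, 'r, 'm) fo_struct" and \<Gamma> :: "(('b::finite \<times> 'm \<Rightarrow> 'm) \<Rightarrow> bool) set"
  assumes sat: "saturated \<kappa> L C" and hom: "strongly_homogeneous \<kappa> L C" and \<kappa>: "Cinfinite \<kappa>"
    and D: "|D| <o \<kappa>" and A: "|A| <o \<kappa>"
    and \<Gamma>: "\<Gamma> \<subseteq> definable L C (UNIV \<times> D) A" and fs: "finitely_satisfiable \<Gamma>"
    and elem: "\<And>b Q. \<lbrakk>Q \<in> definable L C D {}; Q id\<rbrakk> \<Longrightarrow> (\<lambda>x. Q (\<lambda>d. x (b, d))) \<in> \<Gamma>"
  shows "\<exists>\<sigma>. (\<forall>b. \<sigma> b \<in> automorphisms L C) \<and> (\<forall>Q\<in>\<Gamma>. Q (\<lambda>(b, d). \<sigma> b d))"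
proof -
  have "|UNIV \<times> D :: ('b \<times> 'm) set| <o \<kappa>"
    by (rule Times_Cinfinite_bound_strict[OF finite_ordLess_Cinfinite[OF _ \<kappa>] D \<kappa>]) simp
  from saturated_realize[OF sat \<kappa> this A \<Gamma> fs] obtain x where x: "\<forall>Q\<in>\<Gamma>. Q x" by blast
  have "\<exists>\<sigma>\<in>automorphisms L C. \<forall>d\<in>D. \<sigma> d = x (b, d)" for b
  proof -
    have "partial_elementary L C D (\<lambda>d. x (b, d))"
    proof (rule partial_elementaryI)
      fix Q assume "Q \<in> definable L C D {}" "Q id"
      then have "(\<lambda>x. Q (\<lambda>d. x (b, d))) \<in> \<Gamma>" by (rule elem)
      from bspec[OF x this] show "Q (\<lambda>d. x (b, d))" .
    qed
    then show ?thesis using hom D unfolding strongly_homogeneous_def by blast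
  qed
  then obtain \<sigma> where \<sigma>: "\<And>b. \<sigma> b \<in> automorphisms L C" "\<And>b d. d \<in> D \<Longrightarrow> \<sigma> b d = x (b, d)" by metis
  have "Q (\<lambda>(b, d). \<sigma> b d)" if Q: "Q \<in> \<Gamma>" for Q
  proof -
    obtain V0 where V0: "V0 \<subseteq> UNIV \<times> D" "\<forall>x y. (\<forall>v\<in>V0. x v = y v) \<longrightarrow> Q x = Q y"
      using definable_local[of Q L C "UNIV \<times> D" A] Q \<Gamma> by blast
    have "Q x = Q (\<lambda>(b, d). \<sigma> b d)" using V0(1) \<sigma>(2) by (intro V0(2)[rule_format]) auto
    then show ?thesis using x Q by blast
  qed
  then show ?thesis using \<sigma>(1) by blast
qed

section \<open>Conditions holding in a type\<close>

text \<open>Membership in a type up to equivalence of formulas, so that changes of variables and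
  parameters can be made on predicates and not on syntax.\<close>

definition holds ::
  "('f, 'r, 'm) fo_struct \<Rightarrow> ('f, 'r, 'x, 'm) pfm set \<Rightarrow> (('x \<Rightarrow> 'm) \<Rightarrow> bool) \<Rightarrow> bool" where
  "holds C p Q \<longleftrightarrow> (\<exists>q\<in>p. \<forall>x. psat C x q \<longleftrightarrow> Q x)"

context
  fixes C :: "('f, 'r, 'm) fo_struct" and L V A p
  assumes p: "p \<in> complete_types C (pfms L V A)"
begin

lemma holds_psat: "q \<in> pfms L V A \<Longrightarrow> holds C p (\<lambda>x. psat C x q) \<longleftrightarrow> q \<in> p"
proof
  assume q: "q \<in> pfms L V A" and "holds C p (\<lambda>x. psat C x q)"
  then obtain r where "r \<in> p" "\<forall>x. psat C x r \<longleftrightarrow> psat C x q" by (auto simp: holds_def)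
  then show "q \<in> p" using complete_types_consequence[OF p _ _ q, of "{r}"] by auto
qed (auto simp: holds_def)

lemma holds_Neg:
  assumes "Q \<in> definable L C V A"
  shows "holds C p (\<lambda>x. \<not> Q x) \<longleftrightarrow> \<not> holds C p Q"
proof -
  obtain q where q: "q \<in> pfms L V A" "\<forall>x. psat C x q \<longleftrightarrow> Q x" using definable_pfm[OF assms] by blast
  have "Q = (\<lambda>x. psat C x q)" using q(2) by blast
  moreover have "(\<lambda>x. \<not> Q x) = (\<lambda>x. psat C x (pneg q))" using q(2) by auto
  ultimately show ?thesis
    using holds_psat[OF q(1)] holds_psat[OF pneg_pfms[OF q(1)]] complete_typesD(3)[OF p q(1)] by simp
qed

lemma holds_satisfiable:
  assumes "finite \<Gamma>" "\<And>Q. Q \<in> \<Gamma> \<Longrightarrow> holds C p Q"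
  shows "\<exists>x. \<forall>Q\<in>\<Gamma>. Q x"
proof -
  have "\<forall>Q\<in>\<Gamma>. \<exists>q. q \<in> p \<and> (\<forall>x. psat C x q \<longleftrightarrow> Q x)" using assms(2) unfolding holds_def by blast
  from bchoice[OF this] obtain f where f: "\<forall>Q\<in>\<Gamma>. f Q \<in> p \<and> (\<forall>x. psat C x (f Q) \<longleftrightarrow> Q x)" by blast
  have "f ` \<Gamma> \<subseteq> p" "finite (f ` \<Gamma>)" using f assms(1) by auto
  then have "\<exists>x. \<forall>q\<in>f ` \<Gamma>. psat C x q" by (rule consistentD[OF complete_typesD(1)[OF p]])
  then obtain x where "\<forall>q\<in>f ` \<Gamma>. psat C x q" by (rule exE)
  then have "\<forall>Q\<in>\<Gamma>. Q x" using f by auto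
  then show ?thesis by (intro exI[where x = x])
qed

end

text \<open>One inclusion is enough, as both types are complete.\<close>

lemma complete_types_holds_eqI:
  assumes p: "p \<in> complete_types C (pfms L V A)" and p': "p' \<in> complete_types C (pfms L V A)"
    and eq: "\<And>Q. \<lbrakk>Q \<in> definable L C V A; holds C p Q\<rbrakk> \<Longrightarrow> holds C p' Q"
  shows "p = p'"
proof (rule complete_types_eqI[OF p p'])
  fix q assume q: "q \<in> pfms L V A"
  have "q \<in> p \<Longrightarrow> q \<in> p'" using eq[OF definable_psat[OF q]] holds_psat[OF p q] holds_psat[OF p' q] by simp
  moreover have "q \<notin> p \<Longrightarrow> q \<notin> p'"
    using eq[OF definable_psat[OF pneg_pfms[OF q]]] holds_psat[OF p pneg_pfms[OF q]] holds_psat[OF p' pneg_pfms[OF q]]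
      complete_typesD(3)[OF p q] complete_typesD(3)[OF p' q] by simp
  ultimately show "q \<in> p \<longleftrightarrow> q \<in> p'" by blast
qed

lemma clopen_holds:
  assumes "Q \<in> definable L C V A"
  shows "openin (type_space L C V A a) {p \<in> topspace (type_space L C V A a). holds C p Q}"
proof -
  obtain q where q: "q \<in> pfms L V A" "\<forall>x. psat C x q \<longleftrightarrow> Q x" using definable_pfm[OF assms] by blast
  have "Q = (\<lambda>x. psat C x q)" using q(2) by blast
  then have "{p \<in> topspace (type_space L C V A a). holds C p Q} =
      {p \<in> types_over C (pfms L V A) (tp L C V {} a). q \<in> p}"
    unfolding type_space_eq topspace_type_topology using holds_psat[OF _ q(1)] by auto
  then show ?thesis unfolding type_space_eq using clopen_type_topology(1)[OF q(1)] by simp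
qed

section \<open>The Kim--Pillay strong automorphisms\<close>

locale monster =
  fixes \<kappa> :: "'k rel" and L :: "('f, 'r) signature" and C :: "('f, 'r, 'm) fo_struct"
  assumes limit: "strong_limit \<kappa>" and saturated: "saturated \<kappa> L C"
    and homogeneous: "strongly_homogeneous \<kappa> L C"
begin

lemma Cinfinite: "Cinfinite \<kappa>"
  using limit by (simp add: strong_limit_def)

lemma pair_definable:
  fixes \<psi> :: "('f, 'r, 'j + 'j) fm" and f h :: "'j \<Rightarrow> 'w"
  assumes "wf_fm L \<psi>" "fv \<psi> \<subseteq> Inl ` J \<union> Inr ` J" "f ` J \<subseteq> W" "h ` J \<subseteq> W"
  shows "(\<lambda>w. sat C (case_sum (\<lambda>j. w (f j)) (\<lambda>j. w (h j))) \<psi>) \<in> definable L C W {}"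
proof -
  define s :: "'j + 'j \<Rightarrow> 'w + 'm" where "s = case_sum (\<lambda>j. Inl (f j)) (\<lambda>j. Inl (h j))"
  have "s ` fv \<psi> \<subseteq> Inl ` W \<union> Inr ` {}"
  proof
    fix z assume "z \<in> s ` fv \<psi>"
    then obtain v where "v \<in> Inl ` J \<union> Inr ` J" "z = s v" using assms(2) by blast
    then show "z \<in> Inl ` W \<union> Inr ` {}" using assms(3,4) by (auto simp: s_def)
  qed
  from definableI[OF assms(1) this, of C]
  have "(\<lambda>w. sat C (\<lambda>v. case_sum w id (s v)) \<psi>) \<in> definable L C W {}" .
  moreover have "(\<lambda>v. case_sum w id (s v)) = case_sum (\<lambda>j. w (f j)) (\<lambda>j. w (h j))" for w :: "'w \<Rightarrow> 'm"
    by (auto simp: s_def fun_eq_iff split: sum.splits)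
  ultimately show ?thesis by simp
qed

text \<open>By compactness, \<open>\<Phi>\<close> may be replaced by finite subsets \<open>\<Psi>\<close>. Boundedness bounds the size of families
  of pairwise \<open>\<Psi>\<close>-unrelated tuples, and a family of maximal size exists in every elementary submodel.\<close>

lemma fixes_model_bounded_equiv:
  fixes \<Phi> :: "('f, 'r, 'k + 'k) fm set" and a :: "'k \<Rightarrow> 'm"
  assumes \<Phi>: "\<Phi> \<subseteq> {\<phi>. wf_fm L \<phi> \<and> fv \<phi> \<subseteq> Inl ` J \<union> Inr ` J}" and E: "E = type_definable_rel C J \<Phi>"
    and equiv: "equiv (J \<rightarrow>\<^sub>E UNIV) E" and bdd: "|(J \<rightarrow>\<^sub>E UNIV) // E| <o \<kappa>" and J: "|J| <o \<kappa>"
    and N: "elementary_submodel L C N" and \<sigma>: "\<sigma> \<in> automorphisms L C" "\<And>n. n \<in> N \<Longrightarrow> \<sigma> n = n"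
    and \<phi>: "\<phi> \<in> \<Phi>"
  shows "sat C (case_sum a (\<lambda>j. \<sigma> (a j))) \<phi>"
proof -
  \<comment> \<open>\<open>S\<close> is the relation \<open>E\<close> for assignments that are not
    restricted to \<open>J\<close>, and \<open>B \<Psi>\<close> its approximation by a part of
    \<open>\<Phi>\<close>. In general \<open>B \<Psi>\<close> is neither symmetric nor
    transitive.\<close>
  define S where "S x y \<longleftrightarrow> (\<forall>\<psi>\<in>\<Phi>. sat C (case_sum x y) \<psi>)" for x y :: "'k \<Rightarrow> 'm"
  define B where "B \<Psi> x y \<longleftrightarrow> (\<forall>\<psi>\<in>\<Psi>. sat C (case_sum x y) \<psi>)" for \<Psi> and x y :: "'k \<Rightarrow> 'm"
  have wf: "wf_fm L \<psi>" and fv: "fv \<psi> \<subseteq> Inl ` J \<union> Inr ` J" if "\<psi> \<in> \<Phi>" for \<psi> using \<Phi> that by auto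
  have S_iff: "S x y \<longleftrightarrow> (restrict x J, restrict y J) \<in> E" for x y
  proof -
    have "sat C (case_sum x y) \<psi> \<longleftrightarrow> sat C (case_sum (restrict x J) (restrict y J)) \<psi>" if "\<psi> \<in> \<Phi>" for \<psi>
      by (rule sat_in_cong) (use fv[OF that] in auto)
    then show ?thesis by (simp add: S_def E type_definable_rel_def)
  qed
  have S_sym: "S x y \<Longrightarrow> S y x" and S_trans: "S x y \<Longrightarrow> S y z \<Longrightarrow> S x z" for x y z
    using equiv unfolding S_iff equiv_def by (meson symD transD)+
  let ?V3 = "{0, 1, 2 :: nat} \<times> J"
  have V3: "|?V3| <o \<kappa>"
    by (rule Times_Cinfinite_bound_strict[OF finite_ordLess_Cinfinite[OF _ Cinfinite] J Cinfinite]) simp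
  \<comment> \<open>Indices 0, 1, 2 name three tuples. If two relations among them force
    \<open>\<phi>\<close> between the outer tuples, a finite part of \<open>\<Phi>\<close> does so
    already; otherwise saturation would realize all of \<open>\<Phi>\<close> on both pairs together
    with the negation of \<open>\<phi>\<close>.\<close>
  have compact: "\<exists>\<Psi>\<subseteq>\<Phi>. finite \<Psi> \<and> (\<forall>w :: nat \<times> 'k \<Rightarrow> 'm. B \<Psi> (\<lambda>l. w (i1, l)) (\<lambda>l. w (i2, l)) \<longrightarrow>
        B \<Psi> (\<lambda>l. w (i3, l)) (\<lambda>l. w (i4, l)) \<longrightarrow> sat C (case_sum (\<lambda>l. w (0, l)) (\<lambda>l. w (2, l))) \<phi>)"
    if i: "{i1, i2, i3, i4} \<subseteq> {0, 1, 2}"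
      and imp: "\<And>w :: nat \<times> 'k \<Rightarrow> 'm. S (\<lambda>l. w (i1, l)) (\<lambda>l. w (i2, l)) \<Longrightarrow> S (\<lambda>l. w (i3, l)) (\<lambda>l. w (i4, l)) \<Longrightarrow>
         S (\<lambda>l. w (0, l)) (\<lambda>l. w (2, l))" for i1 i2 i3 i4
  proof (rule ccontr)
    define P where "P \<Psi> \<longleftrightarrow> (\<forall>w :: nat \<times> 'k \<Rightarrow> 'm. B \<Psi> (\<lambda>l. w (i1, l)) (\<lambda>l. w (i2, l)) \<longrightarrow>
        B \<Psi> (\<lambda>l. w (i3, l)) (\<lambda>l. w (i4, l)) \<longrightarrow> sat C (case_sum (\<lambda>l. w (0, l)) (\<lambda>l. w (2, l))) \<phi>)" for \<Psi>
    assume "\<not> ?thesis"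
    then have no: "\<not> (\<exists>\<Psi>\<subseteq>\<Phi>. finite \<Psi> \<and> P \<Psi>)" unfolding P_def .
    define G where "G \<psi> w \<longleftrightarrow> sat C (case_sum (\<lambda>l. w (i1, l)) (\<lambda>l. w (i2, l))) \<psi> \<and>
       sat C (case_sum (\<lambda>l. w (i3, l)) (\<lambda>l. w (i4, l))) \<psi> \<and>
       \<not> sat C (case_sum (\<lambda>l. w (0, l)) (\<lambda>l. w (2, l))) \<phi>" for \<psi> and w :: "nat \<times> 'k \<Rightarrow> 'm"
    have G: "G \<psi> \<in> definable L C ?V3 {}" if \<psi>: "\<psi> \<in> \<Phi>" for \<psi>
    proof -
      have "(\<lambda>w. sat C (case_sum (\<lambda>l. w (i, l)) (\<lambda>l. w (j, l))) \<theta>) \<in> definable L C ?V3 {}"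
        if "\<theta> \<in> \<Phi>" "{i, j} \<subseteq> {0, 1, 2}" for \<theta> and i j :: nat
        by (rule pair_definable[OF wf[OF that(1)] fv[OF that(1)]]) (use that(2) in auto)
      note d = this
      have "(\<lambda>w. sat C (case_sum (\<lambda>l. w (i1, l)) (\<lambda>l. w (i2, l))) \<psi> \<and>
         (sat C (case_sum (\<lambda>l. w (i3, l)) (\<lambda>l. w (i4, l))) \<psi> \<and>
         \<not> sat C (case_sum (\<lambda>l. w (0, l)) (\<lambda>l. w (2, l))) \<phi>)) \<in> definable L C ?V3 {}"
        using i by (intro definable_Conj[OF d[OF \<psi>] definable_Conj[OF d[OF \<psi>] definable_Neg[OF d[OF \<phi>]]]]) auto
      moreover have "G \<psi> = (\<lambda>w. sat C (case_sum (\<lambda>l. w (i1, l)) (\<lambda>l. w (i2, l))) \<psi> \<and>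
         (sat C (case_sum (\<lambda>l. w (i3, l)) (\<lambda>l. w (i4, l))) \<psi> \<and>
         \<not> sat C (case_sum (\<lambda>l. w (0, l)) (\<lambda>l. w (2, l))) \<phi>))" by (rule ext) (simp add: G_def)
      ultimately show ?thesis by simp
    qed
    then have "G ` \<Phi> \<subseteq> definable L C ?V3 {}" by blast
    moreover have "finitely_satisfiable (G ` \<Phi>)"
      unfolding finitely_satisfiable_def
    proof (intro allI impI)
      fix \<Gamma>0 assume "\<Gamma>0 \<subseteq> G ` \<Phi>" "finite \<Gamma>0"
      from finite_subset_image[OF this(2,1)] obtain \<Psi> where \<Psi>: "\<Psi> \<subseteq> \<Phi>" "finite \<Psi>" "\<Gamma>0 = G ` \<Psi>" by blast
      obtain w where "B \<Psi> (\<lambda>l. w (i1, l)) (\<lambda>l. w (i2, l))" "B \<Psi> (\<lambda>l. w (i3, l)) (\<lambda>l. w (i4, l))"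
        "\<not> sat C (case_sum (\<lambda>l. w (0, l)) (\<lambda>l. w (2, l))) \<phi>"
      proof -
        have "\<not> P \<Psi>" using no \<Psi>(1,2) by blast
        then show ?thesis unfolding P_def not_all not_imp by (elim exE conjE) (rule that)
      qed
      then have "\<forall>Q\<in>\<Gamma>0. Q w" using \<Psi>(3) by (simp add: B_def G_def)
      then show "\<exists>w. \<forall>Q\<in>\<Gamma>0. Q w" by (intro exI[where x = w])
    qed
    moreover have "|{} :: 'm set| <o \<kappa>" by (rule finite_ordLess_Cinfinite[OF _ Cinfinite]) simp
    ultimately have "\<exists>w. \<forall>Q\<in>G ` \<Phi>. Q w" by (intro saturated_realize[OF saturated Cinfinite V3])
    then obtain w where "\<forall>\<psi>\<in>\<Phi>. G \<psi> w" by auto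
    then have "S (\<lambda>l. w (i1, l)) (\<lambda>l. w (i2, l))" "S (\<lambda>l. w (i3, l)) (\<lambda>l. w (i4, l))"
      "\<not> sat C (case_sum (\<lambda>l. w (0, l)) (\<lambda>l. w (2, l))) \<phi>" using \<phi> by (auto simp: S_def G_def)
    then show False using imp[of w] \<phi> unfolding S_def by blast
  qed
  \<comment> \<open>As \<open>B \<Psi>\<close> need not be symmetric, two configurations are
    treated: both outer tuples related to the middle one in \<Psi>1, the middle one related to both
    in \<Psi>2.\<close>
  obtain \<Psi>1 where \<Psi>1: "\<Psi>1 \<subseteq> \<Phi>" "finite \<Psi>1"
    "\<forall>w :: nat \<times> 'k \<Rightarrow> 'm. B \<Psi>1 (\<lambda>l. w (0, l)) (\<lambda>l. w (1, l)) \<longrightarrow> B \<Psi>1 (\<lambda>l. w (2, l)) (\<lambda>l. w (1, l)) \<longrightarrow>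
        sat C (case_sum (\<lambda>l. w (0, l)) (\<lambda>l. w (2, l))) \<phi>"
  proof -
    have "\<exists>\<Psi>\<subseteq>\<Phi>. finite \<Psi> \<and> (\<forall>w :: nat \<times> 'k \<Rightarrow> 'm. B \<Psi> (\<lambda>l. w (0, l)) (\<lambda>l. w (1, l)) \<longrightarrow>
        B \<Psi> (\<lambda>l. w (2, l)) (\<lambda>l. w (1, l)) \<longrightarrow> sat C (case_sum (\<lambda>l. w (0, l)) (\<lambda>l. w (2, l))) \<phi>)"
      by (rule compact, simp) (rule S_trans[OF _ S_sym])
    then show ?thesis by (elim exE conjE) (rule that)
  qed
  obtain \<Psi>2 where \<Psi>2: "\<Psi>2 \<subseteq> \<Phi>" "finite \<Psi>2"
    "\<forall>w :: nat \<times> 'k \<Rightarrow> 'm. B \<Psi>2 (\<lambda>l. w (1, l)) (\<lambda>l. w (0, l)) \<longrightarrow> B \<Psi>2 (\<lambda>l. w (1, l)) (\<lambda>l. w (2, l)) \<longrightarrow>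
        sat C (case_sum (\<lambda>l. w (0, l)) (\<lambda>l. w (2, l))) \<phi>"
  proof -
    have "\<exists>\<Psi>\<subseteq>\<Phi>. finite \<Psi> \<and> (\<forall>w :: nat \<times> 'k \<Rightarrow> 'm. B \<Psi> (\<lambda>l. w (1, l)) (\<lambda>l. w (0, l)) \<longrightarrow>
        B \<Psi> (\<lambda>l. w (1, l)) (\<lambda>l. w (2, l)) \<longrightarrow> sat C (case_sum (\<lambda>l. w (0, l)) (\<lambda>l. w (2, l))) \<phi>)"
      by (rule compact, simp) (rule S_trans[OF S_sym])
    then show ?thesis by (elim exE conjE) (rule that)
  qed
  define \<Psi> where "\<Psi> = \<Psi>1 \<union> \<Psi>2"
  have \<Psi>: "\<Psi> \<subseteq> \<Phi>" "finite \<Psi>" using \<Psi>1 \<Psi>2 by (auto simp: \<Psi>_def)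
  have BB: "sat C (case_sum x z) \<phi>" if "B \<Psi> x y \<and> B \<Psi> z y \<or> B \<Psi> y x \<and> B \<Psi> y z" for x y z
  proof -
    define w :: "nat \<times> 'k \<Rightarrow> 'm" where "w = (\<lambda>(i, l). if i = 0 then x l else if i = 1 then y l else z l)"
    have "B \<Psi>1 x y \<and> B \<Psi>1 z y \<or> B \<Psi>2 y x \<and> B \<Psi>2 y z" using that by (auto simp: B_def \<Psi>_def)
    then show ?thesis using \<Psi>1(3)[THEN spec, of w] \<Psi>2(3)[THEN spec, of w] by (auto simp: w_def)
  qed
  have nB_def: "(\<lambda>w. \<not> B \<Psi> (\<lambda>l. w (i, l)) (\<lambda>l. w (j, l))) \<in> definable L C (I \<times> J) {}"
    if "i \<in> I" "j \<in> I" for i j :: 'idx and I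
    unfolding B_def
  proof (rule definable_Neg[OF definable_Ball[OF \<Psi>(2)]])
    fix \<psi> assume "\<psi> \<in> \<Psi>"
    then have "wf_fm L \<psi>" "fv \<psi> \<subseteq> Inl ` J \<union> Inr ` J" using \<Psi>(1) wf fv by blast+
    then show "(\<lambda>w. sat C (case_sum (\<lambda>l. w (i, l)) (\<lambda>l. w (j, l))) \<psi>) \<in> definable L C (I \<times> J) {}"
      by (rule pair_definable) (use that in auto)
  qed
  define chain where "chain m \<longleftrightarrow> (\<exists>w :: nat \<times> 'k \<Rightarrow> 'm. \<forall>i<m. \<forall>j<m. i \<noteq> j \<longrightarrow>
      \<not> B \<Psi> (\<lambda>l. w (i, l)) (\<lambda>l. w (j, l)))" for m
  have "\<exists>m. \<not> chain m"
  proof (rule ccontr)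
    assume "\<nexists>m. \<not> chain m"
    then have chain: "chain m" for m by blast
    \<comment> \<open>\<open>A\<close> has as many elements as there are classes of
      \<open>E\<close>. Since \<kappa> is a strong limit, \<open>Pow A\<close> is still small, so
      arbitrarily long finite chains give by saturation a family of pairwise unrelated tuples
      indexed by \<open>Pow A\<close>. Its members are in distinct classes, against Cantor's
      theorem.\<close>
    obtain A :: "'k set" where A: "|(J \<rightarrow>\<^sub>E UNIV) // E| =o |A|" "|A| <o \<kappa>"
      using internalize_card_of_ordLess[THEN iffD1, OF bdd] by blast
    define I where "I = Pow A"
    have I: "|I| <o \<kappa>" using limit A(2) by (simp add: strong_limit_def I_def)
    define P where "P = {(i, j). i \<in> I \<and> j \<in> I \<and> i \<noteq> j}"
    define g where "g p w \<longleftrightarrow> \<not> B \<Psi> (\<lambda>l. w (fst p, l)) (\<lambda>l. w (snd p, l))" for p and w :: "'k set \<times> 'k \<Rightarrow> 'm"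
    have "g p \<in> definable L C (I \<times> J) {}" if "p \<in> P" for p
    proof -
      have "(\<lambda>w. \<not> B \<Psi> (\<lambda>l. w (fst p, l)) (\<lambda>l. w (snd p, l))) \<in> definable L C (I \<times> J) {}"
        by (rule nB_def) (use that in \<open>auto simp: P_def\<close>)
      moreover have "g p = (\<lambda>w. \<not> B \<Psi> (\<lambda>l. w (fst p, l)) (\<lambda>l. w (snd p, l)))" by (rule ext) (simp add: g_def)
      ultimately show ?thesis by simp
    qed
    then have "g ` P \<subseteq> definable L C (I \<times> J) {}" by blast
    moreover have "finitely_satisfiable (g ` P)"
      unfolding finitely_satisfiable_def
    proof (intro allI impI)
      fix \<Gamma>0 assume "\<Gamma>0 \<subseteq> g ` P" "finite \<Gamma>0"
      from finite_subset_image[OF this(2,1)] obtain P0 where P0: "P0 \<subseteq> P" "finite P0" "\<Gamma>0 = g ` P0" by blast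
      define F where "F = fst ` P0 \<union> snd ` P0"
      have "finite F" using P0(2) by (simp add: F_def)
      then obtain h where h: "bij_betw h F {0..<card F}" using ex_bij_betw_finite_nat by blast
      obtain w :: "nat \<times> 'k \<Rightarrow> 'm" where w: "\<forall>i<card F. \<forall>j<card F. i \<noteq> j \<longrightarrow> \<not> B \<Psi> (\<lambda>l. w (i, l)) (\<lambda>l. w (j, l))"
        using chain[of "card F"] unfolding chain_def by (rule exE)
      have "g p (\<lambda>(i, l). w (h i, l))" if p: "p \<in> P0" for p
      proof -
        have "fst p \<in> F" "snd p \<in> F" "fst p \<noteq> snd p" using p P0(1) by (auto simp: F_def P_def)
        then have "h (fst p) < card F" "h (snd p) < card F" "h (fst p) \<noteq> h (snd p)"
          using h by (auto simp: bij_betw_def inj_on_def)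
        then show ?thesis using w by (simp add: g_def)
      qed
      then have "\<forall>Q\<in>\<Gamma>0. Q (\<lambda>(i, l). w (h i, l))" using P0(3) by auto
      then show "\<exists>w. \<forall>Q\<in>\<Gamma>0. Q w" by (intro exI[where x = "\<lambda>(i, l). w (h i, l)"])
    qed
    moreover have "|{} :: 'm set| <o \<kappa>" by (rule finite_ordLess_Cinfinite[OF _ Cinfinite]) simp
    ultimately have "\<exists>w. \<forall>Q\<in>g ` P. Q w"
      by (intro saturated_realize[OF saturated Cinfinite Times_Cinfinite_bound_strict[OF I J Cinfinite]])
    then obtain w where w: "\<forall>p\<in>P. g p w" by auto
    define cls where "cls i = E `` {restrict (\<lambda>l. w (i, l)) J}" for i
    have "inj_on cls I"
    proof (rule inj_onI, rule ccontr)
      fix i j assume ij: "i \<in> I" "j \<in> I" "cls i = cls j" "i \<noteq> j"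
      then have "\<not> B \<Psi> (\<lambda>l. w (i, l)) (\<lambda>l. w (j, l))" using w by (auto simp: P_def g_def)
      then have "\<not> S (\<lambda>l. w (i, l)) (\<lambda>l. w (j, l))" using \<Psi>(1) by (auto simp: B_def S_def)
      then have "(restrict (\<lambda>l. w (i, l)) J, restrict (\<lambda>l. w (j, l)) J) \<notin> E" by (simp add: S_iff)
      moreover have "restrict (\<lambda>l. w (i, l)) J \<in> J \<rightarrow>\<^sub>E UNIV" "restrict (\<lambda>l. w (j, l)) J \<in> J \<rightarrow>\<^sub>E UNIV" by auto
      ultimately show False using ij(3) eq_equiv_class_iff[OF equiv] unfolding cls_def by blast
    qed
    moreover have "cls i \<in> (J \<rightarrow>\<^sub>E UNIV) // E" for i unfolding cls_def by (rule quotientI) auto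
    ultimately have "|I| \<le>o |(J \<rightarrow>\<^sub>E UNIV) // E|" by (intro card_of_ordLeqI)
    then have "|Pow A| \<le>o |A|" using A(1) ordLeq_ordIso_trans unfolding I_def by blast
    then show False using card_of_Pow[of A] not_ordLess_ordLeq by blast
  qed
  moreover have "chain 0" by (simp add: chain_def)
  ultimately obtain m where m: "chain m" "\<not> chain (Suc m)" by (metis nat_induct)
  let ?Q = "\<lambda>w :: nat \<times> 'k \<Rightarrow> 'm. \<forall>p\<in>{p \<in> {..<m} \<times> {..<m}. fst p \<noteq> snd p}.
      \<not> B \<Psi> (\<lambda>l. w (fst p, l)) (\<lambda>l. w (snd p, l))"
  obtain w0 :: "nat \<times> 'k \<Rightarrow> 'm" where "?Q w0" using m(1) unfolding chain_def by auto
  moreover have "?Q \<in> definable L C ({..<m} \<times> J) {}"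
  proof (rule definable_Ball)
    fix p assume "p \<in> {p \<in> {..<m} \<times> {..<m}. fst p \<noteq> snd p}"
    then show "(\<lambda>w. \<not> B \<Psi> (\<lambda>l. w (fst p, l)) (\<lambda>l. w (snd p, l))) \<in> definable L C ({..<m} \<times> J) {}"
      by (intro nB_def) auto
  qed simp
  ultimately have "\<exists>w. range w \<subseteq> N \<and> ?Q w" by (intro definable_elementary[OF N])
  then obtain w where w: "range w \<subseteq> N" "?Q w" by (elim exE conjE)
  \<comment> \<open>The longest chain, taken inside \<open>N\<close>, is prolonged by
    \<open>a\<close> at position \<open>m\<close>. The prolongation cannot be a chain, so
    \<open>a\<close> is related to some tuple in \<open>N\<close>; this tuple is fixed by
    \<open>\<sigma>\<close>, so the image of \<open>a\<close> is related to it as well, and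
    \<open>BB\<close> applies.\<close>
  define w' where "w' = (\<lambda>(i, l). if i < m then w (i, l) else a l)"
  obtain i j where ij: "i < Suc m" "j < Suc m" "i \<noteq> j" "B \<Psi> (\<lambda>l. w' (i, l)) (\<lambda>l. w' (j, l))"
    using m(2) unfolding chain_def by blast
  have inv: "B \<Psi> (\<lambda>l. \<sigma> (x l)) (\<lambda>l. \<sigma> (y l)) \<longleftrightarrow> B \<Psi> x y" for x y
  proof -
    have "sat C (case_sum (\<lambda>l. \<sigma> (x l)) (\<lambda>l. \<sigma> (y l))) \<psi> \<longleftrightarrow> sat C (case_sum x y) \<psi>" if "\<psi> \<in> \<Psi>" for \<psi>
    proof -
      have "case_sum (\<lambda>l. \<sigma> (x l)) (\<lambda>l. \<sigma> (y l)) = (\<lambda>v. \<sigma> (case_sum x y v))" by (auto simp: fun_eq_iff split: sum.splits)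
      then show ?thesis using sat_automorphism[OF \<sigma>(1), of \<psi> "case_sum x y"] wf[of \<psi>] \<Psi>(1) that by auto
    qed
    then show ?thesis by (simp add: B_def)
  qed
  have fix_w: "(\<lambda>l. \<sigma> (w (i, l))) = (\<lambda>l. w (i, l))" for i using w(1) \<sigma>(2) by (auto simp: fun_eq_iff)
  have "\<not> (i < m \<and> j < m)" using w(2) ij(3,4) by (auto simp: w'_def)
  then consider "i = m" "j < m" | "j = m" "i < m" using ij by linarith
  then show ?thesis
  proof cases
    case 1
    then have b: "B \<Psi> a (\<lambda>l. w (j, l))" using ij(4) by (simp add: w'_def)
    then have "B \<Psi> (\<lambda>l. \<sigma> (a l)) (\<lambda>l. w (j, l))" using inv[of a "\<lambda>l. w (j, l)"] fix_w by simp
    then show ?thesis using BB b by blast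
  next
    case 2
    then have b: "B \<Psi> (\<lambda>l. w (i, l)) a" using ij(4) by (simp add: w'_def)
    then have "B \<Psi> (\<lambda>l. w (i, l)) (\<lambda>l. \<sigma> (a l))" using inv[of "\<lambda>l. w (i, l)" a] fix_w by simp
    then show ?thesis using BB b by blast
  qed
qed

abbreviation KP :: "('m \<Rightarrow> 'm) set" where "KP \<equiv> Autf_KP \<kappa> L C"

lemma KP_automorphism: "\<sigma> \<in> KP \<Longrightarrow> \<sigma> \<in> automorphisms L C"
  by (simp add: Autf_KP_def)

lemma fixes_model_in_KP:
  assumes N: "elementary_submodel L C N" and \<sigma>: "\<sigma> \<in> automorphisms L C" "\<And>n. n \<in> N \<Longrightarrow> \<sigma> n = n"
  shows "\<sigma> \<in> KP"
  unfolding Autf_KP_def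
proof (intro CollectI conjI \<sigma> allI impI ballI)
  fix J E and a :: "'k \<Rightarrow> 'm"
  assume J: "|J| <o \<kappa>" and E: "E \<in> bounded_type_definable_equivs \<kappa> L C J" and a: "a \<in> J \<rightarrow>\<^sub>E UNIV"
  obtain \<Phi> where \<Phi>: "\<Phi> \<subseteq> {\<phi>. wf_fm L \<phi> \<and> fv \<phi> \<subseteq> Inl ` J \<union> Inr ` J}" "E = type_definable_rel C J \<Phi>"
      "equiv (J \<rightarrow>\<^sub>E UNIV) E" "|(J \<rightarrow>\<^sub>E UNIV :: ('k \<Rightarrow> 'm) set) // E| <o \<kappa>"
    using E unfolding bounded_type_definable_equivs_def by blast
  have "sat C (case_sum a (restrict (\<sigma> \<circ> a) J)) \<phi>" if \<phi>: "\<phi> \<in> \<Phi>" for \<phi>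
  proof -
    have "sat C (case_sum a (restrict (\<sigma> \<circ> a) J)) \<phi> \<longleftrightarrow> sat C (case_sum a (\<lambda>j. \<sigma> (a j))) \<phi>"
      by (rule sat_in_cong) (use \<Phi>(1) \<phi> in \<open>auto split: sum.splits\<close>)
    then show ?thesis using fixes_model_bounded_equiv[OF \<Phi> J N \<sigma> \<phi>] by blast
  qed
  then show "(a, restrict (\<sigma> \<circ> a) J) \<in> E" using a by (auto simp: \<Phi>(2) type_definable_rel_def)
qed

lemma bounded_equiv_automorphism:
  assumes E: "E \<in> bounded_type_definable_equivs \<kappa> L C J" and \<sigma>: "\<sigma> \<in> automorphisms L C" and ab: "(a, b) \<in> E"
  shows "(restrict (\<sigma> \<circ> a) J, restrict (\<sigma> \<circ> b) J) \<in> E"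
proof -
  obtain \<Phi> where \<Phi>: "\<Phi> \<subseteq> {\<phi>. wf_fm L \<phi> \<and> fv \<phi> \<subseteq> Inl ` J \<union> Inr ` J}" "E = type_definable_rel C J \<Phi>"
    using E unfolding bounded_type_definable_equivs_def by blast
  have "sat C (case_sum (restrict (\<sigma> \<circ> a) J) (restrict (\<sigma> \<circ> b) J)) \<phi>" if \<phi>: "\<phi> \<in> \<Phi>" for \<phi>
  proof -
    have "sat C (case_sum (restrict (\<sigma> \<circ> a) J) (restrict (\<sigma> \<circ> b) J)) \<phi> \<longleftrightarrow> sat C (\<lambda>v. \<sigma> (case_sum a b v)) \<phi>"
      by (rule sat_in_cong) (use \<Phi>(1) \<phi> in \<open>auto split: sum.splits\<close>)
    also have "\<dots> \<longleftrightarrow> sat C (case_sum a b) \<phi>" using sat_automorphism[OF \<sigma>] \<Phi>(1) \<phi> by blast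
    finally show ?thesis using ab \<phi> by (auto simp: \<Phi>(2) type_definable_rel_def)
  qed
  then show ?thesis by (auto simp: \<Phi>(2) type_definable_rel_def)
qed

lemma KP_D:
  "\<lbrakk>\<sigma> \<in> KP; |J| <o \<kappa>; E \<in> bounded_type_definable_equivs \<kappa> L C J; a \<in> J \<rightarrow>\<^sub>E UNIV\<rbrakk> \<Longrightarrow> (a, restrict (\<sigma> \<circ> a) J) \<in> E"
  by (simp add: Autf_KP_def)

lemma bounded_equivD: "E \<in> bounded_type_definable_equivs \<kappa> L C J \<Longrightarrow> equiv (J \<rightarrow>\<^sub>E UNIV) E"
  by (simp add: bounded_type_definable_equivs_def)

lemma restrict_comp: "restrict (\<sigma> \<circ> restrict (\<rho> \<circ> a) J) J = restrict (\<sigma> \<circ> \<rho> \<circ> a) J"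
  by (auto simp: fun_eq_iff)

lemma KP_comp:
  assumes "\<sigma> \<in> KP" "\<rho> \<in> KP"
  shows "\<sigma> \<circ> \<rho> \<in> KP"
  unfolding Autf_KP_def
proof (intro CollectI conjI allI impI ballI)
  show "\<sigma> \<circ> \<rho> \<in> automorphisms L C" using assms automorphisms_comp KP_automorphism by blast
  fix J E and a :: "'k \<Rightarrow> 'm"
  assume J: "|J| <o \<kappa>" and E: "E \<in> bounded_type_definable_equivs \<kappa> L C J" and a: "a \<in> J \<rightarrow>\<^sub>E UNIV"
  have "(a, restrict (\<rho> \<circ> a) J) \<in> E" by (rule KP_D[OF assms(2) J E a])
  moreover have "(restrict (\<rho> \<circ> a) J, restrict (\<sigma> \<circ> restrict (\<rho> \<circ> a) J) J) \<in> E" by (rule KP_D[OF assms(1) J E]) simp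
  ultimately show "(a, restrict (\<sigma> \<circ> \<rho> \<circ> a) J) \<in> E"
    using bounded_equivD[OF E] unfolding restrict_comp equiv_def by (meson transD)
qed

text \<open>\<open>E\<close> is defined without parameters and thus invariant under
  \<open>\<rho>\<close>. The condition on \<open>\<sigma>\<close> is used at the tuple
  \<open>a\<close> pulled back by \<open>\<rho>\<close> and the result is pushed forward.\<close>

lemma KP_conj:
  assumes "\<sigma> \<in> KP" "\<rho> \<in> automorphisms L C"
  shows "\<rho> \<circ> \<sigma> \<circ> finv \<rho> \<in> KP"
  unfolding Autf_KP_def
proof (intro CollectI conjI allI impI ballI)
  show "\<rho> \<circ> \<sigma> \<circ> finv \<rho> \<in> automorphisms L C"
    using assms automorphisms_comp KP_automorphism automorphisms_inv(1) by blast
  fix J E and a :: "'k \<Rightarrow> 'm"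
  assume J: "|J| <o \<kappa>" and E: "E \<in> bounded_type_definable_equivs \<kappa> L C J" and a: "a \<in> J \<rightarrow>\<^sub>E UNIV"
  let ?b = "restrict (finv \<rho> \<circ> a) J"
  have "(?b, restrict (\<sigma> \<circ> ?b) J) \<in> E" by (rule KP_D[OF assms(1) J E]) simp
  from bounded_equiv_automorphism[OF E assms(2) this]
  have "(restrict (\<rho> \<circ> finv \<rho> \<circ> a) J, restrict (\<rho> \<circ> \<sigma> \<circ> finv \<rho> \<circ> a) J) \<in> E" by (simp add: restrict_comp o_assoc)
  moreover have "restrict (\<rho> \<circ> finv \<rho> \<circ> a) J = a" using automorphisms_inv(5)[OF assms(2)] a by (simp add: PiE_restrict)
  ultimately show "(a, restrict (\<rho> \<circ> \<sigma> \<circ> finv \<rho> \<circ> a) J) \<in> E" by simp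
qed

lemma KP_inv:
  assumes "\<sigma> \<in> KP"
  shows "finv \<sigma> \<in> KP"
  unfolding Autf_KP_def
proof (intro CollectI conjI allI impI ballI)
  have \<sigma>: "\<sigma> \<in> automorphisms L C" using KP_automorphism[OF assms] .
  show "finv \<sigma> \<in> automorphisms L C" using automorphisms_inv(1)[OF \<sigma>] .
  fix J E and a :: "'k \<Rightarrow> 'm"
  assume J: "|J| <o \<kappa>" and E: "E \<in> bounded_type_definable_equivs \<kappa> L C J" and a: "a \<in> J \<rightarrow>\<^sub>E UNIV"
  let ?b = "restrict (finv \<sigma> \<circ> a) J"
  have "(?b, restrict (\<sigma> \<circ> ?b) J) \<in> E" by (rule KP_D[OF assms J E]) simp
  moreover have "restrict (\<sigma> \<circ> ?b) J = a" using automorphisms_inv(5)[OF \<sigma>] a by (simp add: restrict_comp PiE_restrict)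
  ultimately show "(a, ?b) \<in> E" using bounded_equivD[OF E] by (auto simp: equiv_def dest: symD)
qed

lemma id_in_KP: "id \<in> KP"
  unfolding Autf_KP_def
proof (intro CollectI conjI automorphisms_id allI impI ballI)
  fix J E and a :: "'k \<Rightarrow> 'm"
  assume E: "E \<in> bounded_type_definable_equivs \<kappa> L C J" and a: "a \<in> J \<rightarrow>\<^sub>E UNIV"
  then show "(a, restrict (id \<circ> a) J) \<in> E" using bounded_equivD[OF E] by (auto simp: equiv_def refl_on_def PiE_restrict)
qed

lemma normal_KP: "KP \<lhd> Aut L C"
proof -
  interpret group "Aut L C" by (rule group_Aut)
  have "subgroup KP (Aut L C)"
  proof (rule subgroupI)
    show "inv\<^bsub>Aut L C\<^esub> \<sigma> \<in> KP" if "\<sigma> \<in> KP" for \<sigma>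
      using KP_inv[OF that] inv_Aut[OF KP_automorphism[OF that]] by simp
  qed (use KP_automorphism id_in_KP KP_comp in auto)
  then show ?thesis
    using KP_conj by (auto simp: normal_inv_iff inv_Aut)
qed

lemma KP_coset_eq:
  assumes "\<sigma> \<in> automorphisms L C" "\<rho> \<in> automorphisms L C"
  shows "KP #>\<^bsub>Aut L C\<^esub> \<sigma> = KP #>\<^bsub>Aut L C\<^esub> \<rho> \<longleftrightarrow> \<rho> \<circ> finv \<sigma> \<in> KP"
proof -
  interpret group "Aut L C" by (rule group_Aut)
  interpret N: normal KP "Aut L C" by (rule normal_KP)
  show ?thesis
  proof
    assume "KP #>\<^bsub>Aut L C\<^esub> \<sigma> = KP #>\<^bsub>Aut L C\<^esub> \<rho>"
    moreover have "\<rho> \<in> KP #>\<^bsub>Aut L C\<^esub> \<rho>" 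
      using rcos_self[OF _ N.subgroup_axioms, of \<rho>] assms(2) by simp
    ultimately obtain k where "k \<in> KP" "\<rho> = k \<circ> \<sigma>" by (auto simp: r_coset_def)
    then show "\<rho> \<circ> finv \<sigma> \<in> KP" using automorphisms_inv(5)[OF assms(1)] by (simp add: comp_assoc)
  next
    assume k: "\<rho> \<circ> finv \<sigma> \<in> KP"
    have "\<rho> = (\<rho> \<circ> finv \<sigma>) \<circ> \<sigma>" using automorphisms_inv(4)[OF assms(1)] by (simp add: comp_assoc)
    then have "\<rho> \<in> KP #>\<^bsub>Aut L C\<^esub> \<sigma>" using k unfolding r_coset_def by auto
    then show "KP #>\<^bsub>Aut L C\<^esub> \<sigma> = KP #>\<^bsub>Aut L C\<^esub> \<rho>"
      using repr_independence[OF _ _ N.subgroup_axioms, of \<rho> \<sigma>] assms by simp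
  qed
qed

end

section \<open>The Kim--Pillay group as a compact topological group\<close>

text \<open>Checking division alone means that a single closed relation on the type space has to be
  controlled; see \<open>closedin_division\<close>.\<close>

lemma topological_groupI_division:
  fixes G :: "('g, 'b) monoid_scheme" (structure)
  assumes grp: "group G" and top: "topspace \<tau> = carrier G"
    and div: "continuous_map (prod_topology \<tau> \<tau>) \<tau> (\<lambda>(x, y). inv x \<otimes> y)"
  shows "topological_group G \<tau>"
proof -
  interpret group G by fact
  have "continuous_map \<tau> (prod_topology \<tau> \<tau>) (\<lambda>x. (x, \<one>))"
    using top by (auto simp: continuous_map_pairwise o_def)
  from continuous_map_compose[OF this div] have "continuous_map \<tau> \<tau> (\<lambda>x. inv x \<otimes> \<one>)" by (simp add: o_def)
  then have inv: "continuous_map \<tau> \<tau> (\<lambda>x. inv x)" by (rule continuous_map_eq) (simp add: top)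
  have "continuous_map (prod_topology \<tau> \<tau>) (prod_topology \<tau> \<tau>) (\<lambda>(x, y). (inv x, y))"
    using inv by (simp add: continuous_map_prod_top)
  from continuous_map_compose[OF this div]
  have "continuous_map (prod_topology \<tau> \<tau>) \<tau> ((\<lambda>(x, y). inv x \<otimes> y) \<circ> (\<lambda>(x, y). (inv x, y)))" .
  then have "continuous_map (prod_topology \<tau> \<tau>) \<tau> (\<lambda>(x, y). x \<otimes> y)" by (rule continuous_map_eq) (auto simp: top)
  then show ?thesis using grp top inv by (simp add: topological_group_def)
qed

text \<open>Each point of \<open>D\<close> violates some formula of \<open>p\<close>. By compactness
  of \<open>D\<close> finitely many formulas suffice, and their conjunction separates.\<close>

lemma closedin_type_space_separate:
  assumes D: "closedin (type_space L C V A a) D" and p: "p \<in> topspace (type_space L C V A a)" "p \<notin> D"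
  shows "\<exists>Q\<in>definable L C V A. holds C p Q \<and> (\<forall>p'\<in>D. \<not> holds C p' Q)"
proof -
  let ?X = "type_space L C V A a"
  have top: "topspace ?X = types_over C (pfms L V A) (tp L C V {} a)" by (simp add: type_space_eq topspace_type_topology)
  have comp: "compactin ?X D"
    by (rule closedin_compact_space[OF _ D]) (simp add: type_space_eq compact_type_topology)
  have DX: "D \<subseteq> topspace ?X" using D by (rule closedin_subset)
  define \<Q> where "\<Q> = {Q \<in> definable L C V A. holds C p Q}"
  define U where "U Q = {p' \<in> topspace ?X. holds C p' (\<lambda>x. \<not> Q x)}" for Q
  have "D \<subseteq> \<Union>(U ` \<Q>)"
  proof
    fix p' assume p': "p' \<in> D"
    then have c: "p \<in> complete_types C (pfms L V A)" "p' \<in> complete_types C (pfms L V A)" using p(1) DX top by auto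
    have "p \<noteq> p'" using p' p(2) by blast
    then obtain Q where Q: "Q \<in> definable L C V A" "holds C p Q" "\<not> holds C p' Q" using complete_types_holds_eqI[OF c] by blast
    then show "p' \<in> \<Union>(U ` \<Q>)" using holds_Neg[OF c(2) Q(1)] p' DX by (auto simp: U_def \<Q>_def)
  qed
  moreover have "openin ?X W" if "W \<in> U ` \<Q>" for W
    using that clopen_holds[OF definable_Neg] by (auto simp: U_def \<Q>_def)
  ultimately obtain \<F> where \<F>: "finite \<F>" "\<F> \<subseteq> U ` \<Q>" "D \<subseteq> \<Union>\<F>" using comp unfolding compactin_def by meson
  from finite_subset_image[OF \<F>(1,2)] obtain F where F: "F \<subseteq> \<Q>" "finite F" "\<F> = U ` F" by blast
  let ?Q = "\<lambda>x. \<forall>Q\<in>F. Q x"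
  have pc: "p \<in> complete_types C (pfms L V A)" using p(1) top by simp
  have Fd: "Q \<in> definable L C V A" if "Q \<in> F" for Q using that F(1) by (auto simp: \<Q>_def)
  have Qd: "?Q \<in> definable L C V A" by (rule definable_Ball[OF F(2) Fd])
  have "holds C p ?Q"
  proof (rule ccontr)
    assume "\<not> holds C p ?Q"
    then have "holds C p (\<lambda>x. \<not> ?Q x)" using holds_Neg[OF pc Qd] by blast
    then have "\<exists>x. \<forall>Q\<in>insert (\<lambda>x. \<not> ?Q x) F. Q x"
      using F(1,2) by (intro holds_satisfiable[OF pc]) (auto simp: \<Q>_def)
    then show False by auto
  qed
  moreover have "\<not> holds C p' ?Q" if p': "p' \<in> D" for p'
  proof
    assume h: "holds C p' ?Q"
    obtain Q where Q: "Q \<in> F" "p' \<in> U Q" using p' \<F>(3) F(3) by blast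
    have "p' \<in> complete_types C (pfms L V A)" using p' DX top by auto
    then have "\<exists>x. \<forall>R\<in>{?Q, \<lambda>x. \<not> Q x}. R x" by (rule holds_satisfiable) (use h Q(2) in \<open>auto simp: U_def\<close>)
    then show False using Q(1) by auto
  qed
  ultimately show ?thesis using Qd by blast
qed

text \<open>Turns parameters into further variables. Invariance under automorphisms, available for
  predicates without parameters, then applies with the former parameters being moved along.\<close>

lemma definable_params:
  fixes Q :: "('v \<Rightarrow> 'm) \<Rightarrow> bool" and C :: "('f, 'r, 'm) fo_struct"
  assumes "Q \<in> definable L C V A"
  shows "\<exists>Q'\<in>definable L C (Inl ` V \<union> Inr ` A) {}. \<forall>x. Q x \<longleftrightarrow> Q' (case_sum x id)"
proof -
  obtain \<phi> where \<phi>: "wf_fm L \<phi>" "fv \<phi> \<subseteq> Inl ` (Inl ` V \<union> Inr ` A)" "Q = (\<lambda>x. sat C (asg x) \<phi>)"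
    using assms by (rule definableE)
  define s :: "('v + 'm) + nat \<Rightarrow> ('v + 'm) + 'm" where "s = case_sum Inl (\<lambda>_. Inr undefined)"
  have "s ` fv \<phi> \<subseteq> Inl ` (Inl ` V \<union> Inr ` A) \<union> Inr ` {}"
  proof
    fix z assume "z \<in> s ` fv \<phi>"
    then obtain v where "v \<in> Inl ` V \<union> Inr ` A" "z = s (Inl v)" using \<phi>(2) by blast
    then show "z \<in> Inl ` (Inl ` V \<union> Inr ` A) \<union> Inr ` {}" by (auto simp: s_def)
  qed
  from definableI[OF \<phi>(1) this, of C]
  have "(\<lambda>y. sat C (\<lambda>w. case_sum y id (s w)) \<phi>) \<in> definable L C (Inl ` V \<union> Inr ` A) {}" .
  moreover have "Q x \<longleftrightarrow> sat C (\<lambda>w. case_sum (case_sum x id) id (s w)) \<phi>" for x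
    unfolding \<phi>(3) by (rule sat_in_cong) (use \<phi>(2) in \<open>auto simp: s_def\<close>)
  ultimately show ?thesis by (intro bexI[where x = "\<lambda>y. sat C (\<lambda>w. case_sum y id (s w)) \<phi>"]) simp_all
qed

context monster
begin

lemma realize_by_automorphism:
  fixes \<Gamma> :: "(('m \<Rightarrow> 'm) \<Rightarrow> bool) set"
  assumes D: "|D| <o \<kappa>" and A: "|A| <o \<kappa>"
    and \<Gamma>: "\<Gamma> \<subseteq> definable L C D A" and fs: "finitely_satisfiable \<Gamma>"
    and elem: "\<And>Q. \<lbrakk>Q \<in> definable L C D {}; Q id\<rbrakk> \<Longrightarrow> Q \<in> \<Gamma>"
  shows "\<exists>\<sigma>\<in>automorphisms L C. \<forall>Q\<in>\<Gamma>. Q \<sigma>"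
proof -
  define g :: "(('m \<Rightarrow> 'm) \<Rightarrow> bool) \<Rightarrow> (unit \<times> 'm \<Rightarrow> 'm) \<Rightarrow> bool" where "g Q = (\<lambda>x. Q (\<lambda>d. x ((), d)))" for Q
  have "\<exists>\<sigma>. (\<forall>b. \<sigma> b \<in> automorphisms L C) \<and> (\<forall>Q\<in>g ` \<Gamma>. Q (\<lambda>(b, d). \<sigma> b d))"
  proof (rule realize_by_automorphisms[OF saturated homogeneous Cinfinite D A])
    show "g ` \<Gamma> \<subseteq> definable L C (UNIV \<times> D) A"
    proof
      fix R assume "R \<in> g ` \<Gamma>"
      then obtain Q where "Q \<in> \<Gamma>" "R = (\<lambda>x. Q (\<lambda>d. x ((), d)))" by (auto simp: g_def)
      then show "R \<in> definable L C (UNIV \<times> D) A" using definable_rename[of Q L C D A "\<lambda>d. ((), d)" "UNIV \<times> D"] \<Gamma> by auto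
    qed
    show "finitely_satisfiable (g ` \<Gamma>)"
      unfolding finitely_satisfiable_def
    proof (intro allI impI)
      fix \<Gamma>0 assume "\<Gamma>0 \<subseteq> g ` \<Gamma>" "finite \<Gamma>0"
      from finite_subset_image[OF this(2,1)] obtain \<Gamma>1 where \<Gamma>1: "\<Gamma>1 \<subseteq> \<Gamma>" "finite \<Gamma>1" "\<Gamma>0 = g ` \<Gamma>1" by blast
      obtain x where "\<forall>Q\<in>\<Gamma>1. Q x" using fs \<Gamma>1(1,2) unfolding finitely_satisfiable_def by meson
      then have "\<forall>Q\<in>\<Gamma>0. Q (\<lambda>(b, d). x d)" using \<Gamma>1(3) by (simp add: g_def)
      then show "\<exists>x. \<forall>Q\<in>\<Gamma>0. Q x" by (intro exI[where x = "\<lambda>(b, d). x d"])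
    qed
    show "(\<lambda>x. Q (\<lambda>d. x (b, d))) \<in> g ` \<Gamma>" if "Q \<in> definable L C D {}" "Q id" for b :: unit and Q
      using elem[OF that] by (auto simp: g_def image_iff)
  qed
  then obtain \<sigma> where \<sigma>: "\<forall>b. \<sigma> b \<in> automorphisms L C" "\<forall>Q\<in>g ` \<Gamma>. Q (\<lambda>(b, d). \<sigma> b d)" by (elim exE conjE)
  have "\<forall>Q\<in>\<Gamma>. Q (\<sigma> ())" using \<sigma>(2) by (simp add: g_def)
  then show ?thesis using \<sigma>(1) by (intro bexI[where x = "\<sigma> ()"]) simp_all
qed

end

section \<open>Types over a small model and the automorphisms realizing them\<close>

locale small_model = monster \<kappa> L C
  for \<kappa> :: "'k rel" and L :: "('f, 'r) signature" and C :: "('f, 'r, 'm) fo_struct" +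
  fixes N assumes model: "elementary_submodel L C N" and small: "|N| <o \<kappa>"
begin

abbreviation Sp where "Sp \<equiv> type_space L C N N id"
abbreviation r where "r \<equiv> tp L C N N"

lemma topspace_Sp: "topspace Sp = types_over C (pfms L N N) (tp L C N {} id)"
  by (simp add: type_space_eq topspace_type_topology)

lemma Sp_complete: "p \<in> topspace Sp \<Longrightarrow> p \<in> complete_types C (pfms L N N)"
  by (simp add: topspace_Sp)

lemma holds_r: "Q \<in> definable L C N N \<Longrightarrow> holds C (r \<sigma>) Q \<longleftrightarrow> Q \<sigma>"
proof
  assume "holds C (r \<sigma>) Q"
  then show "Q \<sigma>" by (auto simp: holds_def tp_def)
next
  assume Q: "Q \<in> definable L C N N" "Q \<sigma>"
  obtain q where "q \<in> pfms L N N" "\<forall>x. psat C x q \<longleftrightarrow> Q x" using definable_pfm[OF Q(1)] by blast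
  then show "holds C (r \<sigma>) Q" unfolding holds_def using Q(2) by (intro bexI[where x = q]) (simp_all add: tp_def)
qed

lemma r_in_Sp: "\<sigma> \<in> automorphisms L C \<Longrightarrow> r \<sigma> \<in> topspace Sp"
proof -
  assume \<sigma>: "\<sigma> \<in> automorphisms L C"
  have "psat C \<sigma> q" if "q \<in> tp L C N {} id" for q
    using that definable_automorphism[OF \<sigma> definable_psat[of q L N "{}" C], of id] by (simp add: tp_def)
  moreover have "psat C \<sigma> q" if "q \<in> r \<sigma>" for q using that by (simp add: tp_def)
  ultimately have "consistent C (r \<sigma> \<union> tp L C N {} id)"
    unfolding consistent_def by (intro allI impI exI[where x = \<sigma>]) blast
  moreover from this have "consistent C (r \<sigma>)" by (auto intro: consistent_subset)
  ultimately show ?thesis by (auto simp: topspace_Sp complete_types_def tp_def pneg_pfms)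
qed

lemma Sp_elementary:
  assumes "p \<in> topspace Sp" "Q \<in> definable L C N {}" "Q id"
  shows "holds C p Q"
proof -
  obtain q where q: "q \<in> pfms L N {}" "\<forall>x. psat C x q \<longleftrightarrow> Q x" using definable_pfm[OF assms(2)] by blast
  then have qt: "q \<in> tp L C N {} id" using assms(3) by (simp add: tp_def)
  have "pneg q \<notin> p" using consistent_not_both[of C "p \<union> tp L C N {} id" q] assms(1) qt by (auto simp: topspace_Sp)
  moreover have "q \<in> pfms L N N" using q(1) pfms_mono[of N N "{}" N L] by blast
  ultimately have "q \<in> p" using complete_typesD(3)[OF Sp_complete[OF assms(1)]] by blast
  then show ?thesis using q(2) by (auto simp: holds_def)
qed

text \<open>\<open>p\<close> contains the elementary diagram of \<open>N\<close>, so a realization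
  defines a partial elementary map on \<open>N\<close>, which extends to an automorphism.\<close>

lemma Sp_realized:
  assumes "p \<in> topspace Sp"
  shows "\<exists>\<sigma>\<in>automorphisms L C. p = r \<sigma>"
proof -
  let ?\<Gamma> = "{Q \<in> definable L C N N. holds C p Q}"
  have "\<exists>\<sigma>\<in>automorphisms L C. \<forall>Q\<in>?\<Gamma>. Q \<sigma>"
  proof (rule realize_by_automorphism[OF small small])
    show "finitely_satisfiable ?\<Gamma>"
      unfolding finitely_satisfiable_def using holds_satisfiable[OF Sp_complete[OF assms]] by blast
    show "Q \<in> ?\<Gamma>" if "Q \<in> definable L C N {}" "Q id" for Q
      using Sp_elementary[OF assms that] definable_mono[OF that(1), of N N] by simp
  qed blast
  then obtain \<sigma> where \<sigma>: "\<sigma> \<in> automorphisms L C" "\<forall>Q\<in>?\<Gamma>. Q \<sigma>" by blast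
  have "p = r \<sigma>"
    by (rule complete_types_holds_eqI[OF Sp_complete[OF assms] Sp_complete[OF r_in_Sp[OF \<sigma>(1)]]])
      (use \<sigma>(2) holds_r in auto)
  then show ?thesis using \<sigma>(1) by blast
qed

lemma r_eq_imp_KP:
  assumes \<sigma>: "\<sigma> \<in> automorphisms L C" and \<rho>: "\<rho> \<in> automorphisms L C" and eq: "r \<sigma> = r \<rho>"
  shows "\<rho> \<circ> finv \<sigma> \<in> KP"
proof -
  have transfer: "Q \<rho>" if "Q \<in> definable L C N N" "Q \<sigma>" for Q using holds_r[OF that(1)] that(2) eq by metis
  define f where "f a = (if a \<in> N then a else \<rho> (finv \<sigma> a))" for a
  define D where "D = N \<union> \<sigma> ` N"
  have "partial_elementary L C D f"
  proof (rule partial_elementaryI)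
    fix Q assume Q: "Q \<in> definable L C D {}" "Q id"
    define h :: "'m \<Rightarrow> 'm + 'm" where "h a = (if a \<in> N then Inr a else Inl (finv \<sigma> a))" for a
    obtain V0 where V0: "V0 \<subseteq> D" "\<forall>x y. (\<forall>v\<in>V0. x v = y v) \<longrightarrow> Q x = Q y" using definable_local[OF Q(1)] by blast
    have "(\<lambda>x. Q (\<lambda>v. case_sum x id (h v))) \<in> definable L C N N"
      by (rule definable_subst[OF Q(1)]) (auto simp: h_def D_def automorphisms_inv[OF \<sigma>])
    moreover have "(\<lambda>v. case_sum \<sigma> id (h v)) = id" by (rule ext) (simp add: h_def automorphisms_inv[OF \<sigma>])
    ultimately have "Q (\<lambda>v. case_sum \<rho> id (h v))" using transfer[of "\<lambda>x. Q (\<lambda>v. case_sum x id (h v))"] Q(2) by simp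
    moreover have "(\<lambda>v. case_sum \<rho> id (h v)) = f" by (rule ext) (simp add: h_def f_def)
    ultimately show "Q f" by simp
  qed
  moreover have "|D| <o \<kappa>"
    unfolding D_def using Un_Cinfinite_bound_strict[OF small ordLeq_ordLess_trans[OF card_of_image small] Cinfinite] .
  ultimately obtain \<alpha> where \<alpha>: "\<alpha> \<in> automorphisms L C" "\<forall>a\<in>D. \<alpha> a = f a"
    using homogeneous unfolding strongly_homogeneous_def by blast
  have \<alpha>K: "\<alpha> \<in> KP" by (rule fixes_model_in_KP[OF model \<alpha>(1)]) (use \<alpha>(2) in \<open>auto simp: D_def f_def\<close>)
  have a\<sigma>: "\<alpha> (\<sigma> n) = \<rho> n" if n: "n \<in> N" for n
  proof (cases "\<sigma> n \<in> N")
    case True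
    \<comment> \<open>Here \<open>f\<close> is the identity at \<open>\<sigma> n\<close>. The
      equation of the variable \<open>n\<close> with the parameter \<open>\<sigma> n\<close> belongs
      to the common type, so \<open>\<rho> n\<close> is \<open>\<sigma> n\<close> too.\<close>
    let ?\<phi> = "Equal (Var (Inl n)) (Var (Inr (\<sigma> n))) :: ('f, 'r, 'm + 'm) fm"
    have "(\<lambda>x. sat C (\<lambda>w. case_sum x id (id w)) ?\<phi>) \<in> definable L C N N"
      by (rule definableI) (use n True in auto)
    then have "(\<lambda>x. x n = \<sigma> n) \<in> definable L C N N" by simp
    from transfer[OF this] have "\<rho> n = \<sigma> n" by simp
    then show ?thesis using \<alpha>(2) True n by (simp add: D_def f_def)
  next
    case False
    then show ?thesis using \<alpha>(2) n by (simp add: D_def f_def automorphisms_inv[OF \<sigma>])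
  qed
  have as: "\<alpha> \<circ> \<sigma> \<in> automorphisms L C" using automorphisms_comp \<alpha>(1) \<sigma> by blast
  have "finv (\<alpha> \<circ> \<sigma>) \<circ> \<rho> \<in> KP"
  proof (rule fixes_model_in_KP[OF model])
    show "finv (\<alpha> \<circ> \<sigma>) \<circ> \<rho> \<in> automorphisms L C" using automorphisms_comp automorphisms_inv(1)[OF as] \<rho> by blast
    show "(finv (\<alpha> \<circ> \<sigma>) \<circ> \<rho>) n = n" if "n \<in> N" for n
      using automorphisms_inv(2)[OF as, of n] a\<sigma>[OF that] by simp
  qed
  from KP_conj[OF this as] have "\<rho> \<circ> finv (\<alpha> \<circ> \<sigma>) \<in> KP"
    using automorphisms_inv(5)[OF as] by (simp add: o_assoc)
  moreover have "finv (\<alpha> \<circ> \<sigma>) = finv \<sigma> \<circ> finv \<alpha>"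
    using automorphismsD(1)[OF \<alpha>(1)] automorphismsD(1)[OF \<sigma>] by (simp add: o_inv_distrib)
  ultimately have "\<rho> \<circ> finv \<sigma> \<circ> finv \<alpha> \<in> KP" by (simp add: o_assoc)
  from KP_comp[OF this \<alpha>K] show ?thesis using automorphisms_inv(4)[OF \<alpha>(1)] by (simp add: comp_assoc)
qed

lemma KP_map_r: "\<sigma> \<in> automorphisms L C \<Longrightarrow> KP_map \<kappa> L C N (r \<sigma>) = KP #>\<^bsub>Aut L C\<^esub> \<sigma>"
proof -
  assume \<sigma>: "\<sigma> \<in> automorphisms L C"
  let ?\<rho> = "SOME \<rho>. \<rho> \<in> automorphisms L C \<and> tp L C N N \<rho> = r \<sigma>"
  have "?\<rho> \<in> automorphisms L C \<and> tp L C N N ?\<rho> = r \<sigma>" by (rule someI[where x = \<sigma>]) (simp add: \<sigma>)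
  then show ?thesis unfolding KP_map_def using KP_coset_eq[of ?\<rho> \<sigma>] r_eq_imp_KP[of ?\<rho> \<sigma>] \<sigma> by simp
qed

text \<open>Applying \<open>\<sigma>\<close> turns the type of
  \<open>finv \<sigma> \<circ> \<rho>\<close> on \<open>N\<close> over \<open>N\<close> into that of
  \<open>\<rho>\<close> on \<open>N\<close> over the image of \<open>N\<close> under
  \<open>\<sigma>\<close>. So it is described by formulas without parameters about the pair, and
  such formulas survive in the limit. The lemma serves for the Hausdorff property, with
  \<open>D\<close> the types of strong automorphisms, and for continuity of division, with
  \<open>D\<close> the preimage of a closed set.\<close>

lemma closedin_division:
  assumes D: "closedin Sp D"
  shows "closedin (prod_topology Sp Sp)
     {(r \<sigma>, r \<rho>) | \<sigma> \<rho>. \<sigma> \<in> automorphisms L C \<and> \<rho> \<in> automorphisms L C \<and> r (finv \<sigma> \<circ> \<rho>) \<in> D}" (is "closedin _ ?T")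
proof -
  have TX: "?T \<subseteq> topspace (prod_topology Sp Sp)" using r_in_Sp by auto
  have "prod_topology Sp Sp closure_of ?T \<subseteq> ?T"
  proof
    fix z assume z: "z \<in> prod_topology Sp Sp closure_of ?T"
    obtain p q where pq: "z = (p, q)" by fastforce
    have pX: "p \<in> topspace Sp" "q \<in> topspace Sp" using z closure_of_subset_topspace[of "prod_topology Sp Sp" ?T] pq by auto
    define gF :: "(('m \<Rightarrow> 'm) \<Rightarrow> bool) \<Rightarrow> (bool \<times> 'm \<Rightarrow> 'm) \<Rightarrow> bool" where "gF Q = (\<lambda>x. Q (\<lambda>d. x (False, d)))" for Q
    define gT :: "(('m \<Rightarrow> 'm) \<Rightarrow> bool) \<Rightarrow> (bool \<times> 'm \<Rightarrow> 'm) \<Rightarrow> bool" where "gT Q = (\<lambda>x. Q (\<lambda>d. x (True, d)))" for Q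
    define pair :: "('m \<Rightarrow> 'm) \<Rightarrow> ('m \<Rightarrow> 'm) \<Rightarrow> bool \<times> 'm \<Rightarrow> 'm" where "pair \<sigma> \<rho> = (\<lambda>(b, d). if b then \<rho> d else \<sigma> d)" for \<sigma> \<rho>
    define good where "good \<sigma> \<rho> \<longleftrightarrow> \<sigma> \<in> automorphisms L C \<and> \<rho> \<in> automorphisms L C \<and> r (finv \<sigma> \<circ> \<rho>) \<in> D" for \<sigma> \<rho>
    let ?P = "{Q \<in> definable L C N N. holds C p Q}" and ?Q = "{Q \<in> definable L C N N. holds C q Q}"
    \<comment> \<open>All conditions without parameters that hold for every admissible pair. They
      are consistent with the limit types \<open>p\<close> and \<open>q\<close>, since admissible
      pairs come arbitrarily close to \<open>z\<close>.\<close>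
    define Cs where "Cs = {R \<in> definable L C (UNIV \<times> N) {}. \<forall>\<sigma> \<rho>. good \<sigma> \<rho> \<longrightarrow> R (pair \<sigma> \<rho>)}"
    let ?\<Gamma> = "gF ` ?P \<union> gT ` ?Q \<union> Cs"
    have "\<exists>\<sigma>. (\<forall>b. \<sigma> b \<in> automorphisms L C) \<and> (\<forall>Q\<in>?\<Gamma>. Q (\<lambda>(b, d). \<sigma> b d))"
    proof (rule realize_by_automorphisms[OF saturated homogeneous Cinfinite small small])
      have "gF Q \<in> definable L C (UNIV \<times> N) N" "gT Q \<in> definable L C (UNIV \<times> N) N" if "Q \<in> definable L C N N" for Q
        unfolding gF_def gT_def by (rule definable_rename[OF that]; auto)+
      moreover have "Cs \<subseteq> definable L C (UNIV \<times> N) N"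
        unfolding Cs_def using definable_mono[of _ L C "UNIV \<times> N" "{}" "UNIV \<times> N" N] by blast
      ultimately show "?\<Gamma> \<subseteq> definable L C (UNIV \<times> N) N" by blast
      show "(\<lambda>x. Q (\<lambda>d. x (b, d))) \<in> ?\<Gamma>" if Q: "Q \<in> definable L C N {}" "Q id" for b :: bool and Q
      proof -
        have "(\<lambda>x. Q (\<lambda>d. x (b, d))) \<in> definable L C (UNIV \<times> N) {}" by (rule definable_rename[OF Q(1)]) auto
        moreover have "Q (\<lambda>d. pair \<sigma> \<rho> (b, d))" if "good \<sigma> \<rho>" for \<sigma> \<rho>
        proof -
          have "(\<lambda>d. pair \<sigma> \<rho> (b, d)) = (\<lambda>d. (if b then \<rho> else \<sigma>) (id d))" by (auto simp: pair_def)
          moreover have "(if b then \<rho> else \<sigma>) \<in> automorphisms L C" using that by (simp add: good_def)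
          ultimately show ?thesis using definable_automorphism[of "if b then \<rho> else \<sigma>" L C Q N id] Q by simp
        qed
        ultimately show ?thesis by (simp add: Cs_def)
      qed
      show "finitely_satisfiable ?\<Gamma>"
        unfolding finitely_satisfiable_def
      proof (intro allI impI)
        fix \<Gamma>0 assume \<Gamma>0: "\<Gamma>0 \<subseteq> ?\<Gamma>" "finite \<Gamma>0"
        have "finite (\<Gamma>0 \<inter> gF ` ?P)" "\<Gamma>0 \<inter> gF ` ?P \<subseteq> gF ` ?P" using \<Gamma>0(2) by auto
        from finite_subset_image[OF this] obtain F1 where F1: "F1 \<subseteq> ?P" "finite F1" "\<Gamma>0 \<inter> gF ` ?P = gF ` F1" by blast
        have "finite (\<Gamma>0 \<inter> gT ` ?Q)" "\<Gamma>0 \<inter> gT ` ?Q \<subseteq> gT ` ?Q" using \<Gamma>0(2) by auto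
        from finite_subset_image[OF this] obtain F2 where F2: "F2 \<subseteq> ?Q" "finite F2" "\<Gamma>0 \<inter> gT ` ?Q = gT ` F2" by blast
        define U where "U F = \<Inter>((\<lambda>Q. {p \<in> topspace Sp. holds C p Q}) ` F) \<inter> topspace Sp" for F
        have Uop: "openin Sp (U F)" if "finite F" "F \<subseteq> definable L C N N" for F
          unfolding U_def using that clopen_holds by (intro openin_INT) blast+
        have "openin (prod_topology Sp Sp) (U F1 \<times> U F2)"
          using Uop[OF F1(2)] Uop[OF F2(2)] F1(1) F2(1) by (auto simp: openin_prod_Times_iff)
        moreover have "z \<in> U F1 \<times> U F2" using pq pX F1(1) F2(1) by (auto simp: U_def)
        ultimately have "\<exists>y\<in>?T. y \<in> U F1 \<times> U F2" by (rule closure_of_meets[OF z])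
        then obtain \<sigma> \<rho> where sr: "good \<sigma> \<rho>" "r \<sigma> \<in> U F1" "r \<rho> \<in> U F2" by (auto simp: good_def)
        have "Q (pair \<sigma> \<rho>)" if Q: "Q \<in> \<Gamma>0" for Q
        proof -
          consider "Q \<in> gF ` F1" | "Q \<in> gT ` F2" | "Q \<in> Cs" using Q \<Gamma>0(1) F1(3) F2(3) by blast
          then show ?thesis
          proof cases
            case 1
            then obtain Q' where Q': "Q' \<in> F1" "Q = gF Q'" by blast
            then have "holds C (r \<sigma>) Q'" "Q' \<in> definable L C N N" using sr(2) F1(1) by (auto simp: U_def)
            then show ?thesis using holds_r Q'(2) by (simp add: gF_def pair_def)
          next
            case 2
            then obtain Q' where Q': "Q' \<in> F2" "Q = gT Q'" by blast
            then have "holds C (r \<rho>) Q'" "Q' \<in> definable L C N N" using sr(3) F2(1) by (auto simp: U_def)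
            then show ?thesis using holds_r Q'(2) by (simp add: gT_def pair_def)
          next
            case 3
            then show ?thesis using sr(1) by (simp add: Cs_def)
          qed
        qed
        then show "\<exists>x. \<forall>Q\<in>\<Gamma>0. Q x" by (intro exI[where x = "pair \<sigma> \<rho>"]) blast
      qed
    qed
    then obtain s where s: "\<forall>b. s b \<in> automorphisms L C" "\<forall>Q\<in>?\<Gamma>. Q (\<lambda>(b, d). s b d)" by (elim exE conjE)
    let ?\<sigma> = "s False" and ?\<rho> = "s True"
    have aut: "?\<sigma> \<in> automorphisms L C" "?\<rho> \<in> automorphisms L C" using s(1) by auto
    have pairs: "(\<lambda>(b, d). s b d) = pair ?\<sigma> ?\<rho>" by (auto simp: pair_def fun_eq_iff)
    have "p = r ?\<sigma>"
    proof (rule complete_types_holds_eqI[OF Sp_complete[OF pX(1)] Sp_complete[OF r_in_Sp[OF aut(1)]]])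
      fix Q assume Q: "Q \<in> definable L C N N" "holds C p Q"
      then have "gF Q (pair ?\<sigma> ?\<rho>)" using s(2) pairs by auto
      then show "holds C (r ?\<sigma>) Q" using holds_r[OF Q(1)] by (simp add: gF_def pair_def)
    qed
    moreover have "q = r ?\<rho>"
    proof (rule complete_types_holds_eqI[OF Sp_complete[OF pX(2)] Sp_complete[OF r_in_Sp[OF aut(2)]]])
      fix Q assume Q: "Q \<in> definable L C N N" "holds C q Q"
      then have "gT Q (pair ?\<sigma> ?\<rho>)" using s(2) pairs by auto
      then show "holds C (r ?\<rho>) Q" using holds_r[OF Q(1)] by (simp add: gT_def pair_def)
    qed
    moreover have "r (finv ?\<sigma> \<circ> ?\<rho>) \<in> D"
    proof (rule ccontr)
      assume no: "r (finv ?\<sigma> \<circ> ?\<rho>) \<notin> D"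
      have "finv ?\<sigma> \<circ> ?\<rho> \<in> automorphisms L C" using automorphisms_comp automorphisms_inv(1) aut by blast
      from closedin_type_space_separate[OF D r_in_Sp[OF this] no]
      obtain Q where Q: "Q \<in> definable L C N N" "holds C (r (finv ?\<sigma> \<circ> ?\<rho>)) Q" "\<forall>p'\<in>D. \<not> holds C p' Q" by blast
      obtain Q' where Q': "Q' \<in> definable L C (Inl ` N \<union> Inr ` N) {}" "\<forall>x. Q x \<longleftrightarrow> Q' (case_sum x id)"
        using definable_params[OF Q(1)] by blast
      \<comment> \<open>The variables of \<open>Q\<close> are read in the copy \<open>True\<close>,
        which belongs to \<open>\<rho>\<close>, and its parameters in the copy \<open>False\<close>,
        where they are moved by \<open>\<sigma>\<close>.\<close>
      define t :: "'m + 'm \<Rightarrow> bool \<times> 'm" where "t = case_sum (Pair True) (Pair False)"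
      let ?R = "\<lambda>x. \<not> Q' (\<lambda>v. x (t v))"
      have Rd: "?R \<in> definable L C (UNIV \<times> N) {}"
        by (rule definable_Neg[OF definable_rename[OF Q'(1)]]) (auto simp: t_def)
      have R: "?R (pair \<sigma> \<rho>) \<longleftrightarrow> \<not> Q (finv \<sigma> \<circ> \<rho>)" if \<sigma>: "\<sigma> \<in> automorphisms L C" for \<sigma> \<rho>
      proof -
        have "(\<lambda>v. pair \<sigma> \<rho> (t v)) = (\<lambda>v. \<sigma> (case_sum (finv \<sigma> \<circ> \<rho>) id v))"
          by (auto simp: fun_eq_iff pair_def t_def automorphisms_inv[OF \<sigma>] split: sum.splits)
        then show ?thesis using definable_automorphism[OF \<sigma> Q'(1), of "case_sum (finv \<sigma> \<circ> \<rho>) id"] Q'(2) by simp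
      qed
      have "?R (pair \<sigma> \<rho>)" if "good \<sigma> \<rho>" for \<sigma> \<rho>
        using that Q(3) holds_r[OF Q(1), of "finv \<sigma> \<circ> \<rho>"] R[of \<sigma> \<rho>] by (auto simp: good_def)
      then have "?R \<in> Cs" using Rd by (simp add: Cs_def)
      then have "?R (pair ?\<sigma> ?\<rho>)" using s(2) pairs by auto
      then show False using R[OF aut(1), of ?\<rho>] Q(2) holds_r[OF Q(1)] by simp
    qed
    ultimately show "z \<in> ?T" using aut pq by blast
  qed
  then show ?thesis using TX closure_of_subset_eq[of ?T "prod_topology Sp Sp"] by blast
qed

text \<open>Given a limit type \<open>p\<close> realized by \<open>\<sigma>\<close>, a relation
  \<open>E\<close> and a tuple \<open>a\<close>, the model is enlarged by the entries of
  \<open>a\<close>. Some \<open>\<rho>\<close> realizes \<open>p\<close> together with every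
  condition over this set that all strong automorphisms satisfy; in particular it moves
  \<open>a\<close> inside its class. As \<open>\<sigma>\<close> and \<open>\<rho>\<close> have the
  same type, they differ by a strong automorphism, so \<open>\<sigma>\<close> moves \<open>a\<close>
  inside its class too.\<close>

lemma closedin_r_KP: "closedin Sp (r ` KP)"
proof -
  have "r ` KP \<subseteq> topspace Sp" using r_in_Sp KP_automorphism by blast
  moreover have "Sp closure_of (r ` KP) \<subseteq> r ` KP"
  proof
    fix p assume p: "p \<in> Sp closure_of (r ` KP)"
    then have pX: "p \<in> topspace Sp" using closure_of_subset_topspace[of Sp] by blast
    then obtain \<sigma> where \<sigma>: "\<sigma> \<in> automorphisms L C" "p = r \<sigma>" using Sp_realized by blast
    have "\<sigma> \<in> KP"
      unfolding Autf_KP_def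
    proof (intro CollectI conjI \<sigma>(1) allI impI ballI)
      fix J E and a :: "'k \<Rightarrow> 'm"
      assume J: "|J| <o \<kappa>" and E: "E \<in> bounded_type_definable_equivs \<kappa> L C J" and a: "a \<in> J \<rightarrow>\<^sub>E UNIV"
      define D where "D = N \<union> a ` J"
      have Dsmall: "|D| <o \<kappa>"
        unfolding D_def using Un_Cinfinite_bound_strict[OF small ordLeq_ordLess_trans[OF card_of_image J] Cinfinite] .
      obtain \<Phi> where \<Phi>: "\<Phi> \<subseteq> {\<phi>. wf_fm L \<phi> \<and> fv \<phi> \<subseteq> Inl ` J \<union> Inr ` J}" "E = type_definable_rel C J \<Phi>"
        using E unfolding bounded_type_definable_equivs_def by blast
      let ?P = "{Q \<in> definable L C N N. holds C p Q}"
      define Cs where "Cs = {R \<in> definable L C D D. \<forall>k\<in>KP. R k}"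
      let ?\<Gamma> = "?P \<union> Cs"
      have "\<exists>\<rho>\<in>automorphisms L C. \<forall>Q\<in>?\<Gamma>. Q \<rho>"
      proof (rule realize_by_automorphism[OF Dsmall Dsmall])
        show "?\<Gamma> \<subseteq> definable L C D D" unfolding Cs_def D_def using definable_mono[of _ L C N N "N \<union> a ` J" "N \<union> a ` J"] by blast
        show "Q \<in> ?\<Gamma>" if "Q \<in> definable L C D {}" "Q id" for Q
        proof -
          have "Q k" if "k \<in> KP" for k
            using definable_automorphism[OF KP_automorphism[OF that] \<open>Q \<in> definable L C D {}\<close>, of id] \<open>Q id\<close> by simp
          then show ?thesis using definable_mono[OF that(1), of D D] by (simp add: Cs_def)
        qed
        show "finitely_satisfiable ?\<Gamma>"
          unfolding finitely_satisfiable_def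
        proof (intro allI impI)
          fix \<Gamma>0 assume \<Gamma>0: "\<Gamma>0 \<subseteq> ?\<Gamma>" "finite \<Gamma>0"
          let ?F = "\<Gamma>0 \<inter> ?P"
          define U where "U = \<Inter>((\<lambda>Q. {p \<in> topspace Sp. holds C p Q}) ` ?F) \<inter> topspace Sp"
          have "openin Sp U" unfolding U_def using \<Gamma>0(2) clopen_holds by (intro openin_INT) auto
          moreover have "p \<in> U" using pX by (auto simp: U_def)
          ultimately have "\<exists>y\<in>r ` KP. y \<in> U" by (rule closure_of_meets[OF p])
          then obtain k where k: "k \<in> KP" "r k \<in> U" by blast
          have "Q k" if "Q \<in> \<Gamma>0" for Q
          proof (cases "Q \<in> ?P")
            case True
            then have "holds C (r k) Q" using k(2) that by (auto simp: U_def)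
            then show ?thesis using holds_r True by simp
          next
            case False
            then have "Q \<in> Cs" using that \<Gamma>0(1) by blast
            then show ?thesis using k(1) by (simp add: Cs_def)
          qed
          then show "\<exists>x. \<forall>Q\<in>\<Gamma>0. Q x" by (intro exI[where x = k]) blast
        qed
      qed
      then obtain \<rho> where \<rho>: "\<rho> \<in> automorphisms L C" "\<forall>Q\<in>?\<Gamma>. Q \<rho>" by blast
      have "p = r \<rho>"
        by (rule complete_types_holds_eqI[OF Sp_complete[OF pX] Sp_complete[OF r_in_Sp[OF \<rho>(1)]]])
          (use \<rho>(2) holds_r in auto)
      then have k: "\<sigma> \<circ> finv \<rho> \<in> KP" using r_eq_imp_KP[OF \<rho>(1) \<sigma>(1)] \<sigma>(2) by simp
      have "(a, restrict (\<rho> \<circ> a) J) \<in> E"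
      proof -
        have "sat C (case_sum a (restrict (\<rho> \<circ> a) J)) \<phi>" if \<phi>: "\<phi> \<in> \<Phi>" for \<phi>
        proof -
          have wf: "wf_fm L \<phi>" "fv \<phi> \<subseteq> Inl ` J \<union> Inr ` J" using \<Phi>(1) \<phi> by auto
          define t :: "'k + 'k \<Rightarrow> 'm + 'm" where "t = case_sum (\<lambda>j. Inr (a j)) (\<lambda>j. Inl (a j))"
          let ?R = "\<lambda>x. sat C (\<lambda>w. case_sum x id (t w)) \<phi>"
          have "?R \<in> definable L C D D" by (rule definableI[OF wf(1)]) (use wf(2) in \<open>auto simp: t_def D_def\<close>)
          moreover have R: "?R x \<longleftrightarrow> sat C (case_sum a (restrict (x \<circ> a) J)) \<phi>" for x
            by (rule sat_in_cong) (use wf(2) in \<open>auto simp: t_def\<close>)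
          moreover have "sat C (case_sum a (restrict (k \<circ> a) J)) \<phi>" if "k \<in> KP" for k
            using KP_D[OF that J E a] \<phi> by (auto simp: \<Phi>(2) type_definable_rel_def)
          ultimately have "?R \<in> Cs" by (simp add: Cs_def)
          then show ?thesis using \<rho>(2) R by auto
        qed
        then show ?thesis using a by (auto simp: \<Phi>(2) type_definable_rel_def)
      qed
      moreover have "(restrict (\<rho> \<circ> a) J, restrict ((\<sigma> \<circ> finv \<rho>) \<circ> restrict (\<rho> \<circ> a) J) J) \<in> E"
        by (rule KP_D[OF k J E]) simp
      moreover have "\<sigma> \<circ> finv \<rho> \<circ> \<rho> = \<sigma>" using automorphisms_inv(4)[OF \<rho>(1)] by (simp add: comp_assoc)
      ultimately show "(a, restrict (\<sigma> \<circ> a) J) \<in> E"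
        using bounded_equivD[OF E] unfolding restrict_comp equiv_def by (metis transD)
    qed
    then show "p \<in> r ` KP" using \<sigma>(2) by blast
  qed
  ultimately show ?thesis using closure_of_subset_eq[of "r ` KP" Sp] by blast
qed

end

context small_model
begin

abbreviation Gal where "Gal \<equiv> Gal_KP \<kappa> L C"
abbreviation GT where "GT \<equiv> Gal_KP_topology \<kappa> L C N"
abbreviation \<rho> where "\<rho> \<equiv> KP_map \<kappa> L C N"
abbreviation cs where "cs \<sigma> \<equiv> KP #>\<^bsub>Aut L C\<^esub> \<sigma>"

lemma compact_Sp: "compact_space Sp" and Hausdorff_Sp: "Hausdorff_space Sp"
  by (simp_all add: type_space_eq compact_type_topology Hausdorff_type_topology)

lemma carrier_Gal: "carrier Gal = cs ` automorphisms L C"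
  by (auto simp: Gal_KP_def FactGroup_def RCOSETS_def)

lemma group_Gal: "group Gal"
  unfolding Gal_KP_def by (rule normal.factorgroup_is_group[OF normal_KP])

lemma Gal_mult: "\<lbrakk>\<sigma> \<in> automorphisms L C; \<tau> \<in> automorphisms L C\<rbrakk> \<Longrightarrow> cs \<sigma> \<otimes>\<^bsub>Gal\<^esub> cs \<tau> = cs (\<sigma> \<circ> \<tau>)"
  using normal.rcos_sum[OF normal_KP, of \<sigma> \<tau>] by (simp add: Gal_KP_def FactGroup_def)

lemma Gal_one: "\<one>\<^bsub>Gal\<^esub> = cs id"
proof -
  interpret group Gal by (rule group_Gal)
  have "cs id \<in> carrier Gal" using automorphisms_id by (auto simp: carrier_Gal)
  moreover have "cs id \<otimes>\<^bsub>Gal\<^esub> cs id = cs id" using Gal_mult[OF automorphisms_id automorphisms_id] by simp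
  ultimately show ?thesis using l_cancel_one by metis
qed

lemma Gal_inv: "\<sigma> \<in> automorphisms L C \<Longrightarrow> inv\<^bsub>Gal\<^esub> (cs \<sigma>) = cs (finv \<sigma>)"
  by (rule group.inv_equality[OF group_Gal])
    (auto simp: Gal_mult automorphisms_inv Gal_one carrier_Gal)

lemma topspace_GT: "topspace GT = carrier Gal"
proof -
  have "topspace GT = \<rho> ` topspace Sp" by (simp add: Gal_KP_topology_def topspace_quotient_topology)
  also have "\<dots> = cs ` automorphisms L C"
  proof (intro equalityI subsetI)
    fix x assume "x \<in> \<rho> ` topspace Sp"
    then obtain \<sigma> where "\<sigma> \<in> automorphisms L C" "x = \<rho> (r \<sigma>)" using Sp_realized by blast
    then show "x \<in> cs ` automorphisms L C" using KP_map_r by blast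
  next
    fix x assume "x \<in> cs ` automorphisms L C"
    then obtain \<sigma> where \<sigma>: "\<sigma> \<in> automorphisms L C" "x = cs \<sigma>" by blast
    then show "x \<in> \<rho> ` topspace Sp" using KP_map_r[OF \<sigma>(1)] r_in_Sp[OF \<sigma>(1)] by (metis imageI)
  qed
  finally show ?thesis by (simp add: carrier_Gal)
qed

lemma continuous_\<rho>: "continuous_map Sp GT \<rho>"
  unfolding Gal_KP_topology_def by (rule quotient_imp_continuous_map[OF quotient_map_quotient_topology])

text \<open>Equality of right cosets produces the quotient on the right,
  \<open>closedin_division\<close> uses the one on the left; normality of \<open>KP\<close>
  identifies the two conditions.\<close>

lemma KP_comm:
  assumes "\<sigma> \<in> automorphisms L C" "\<tau> \<in> automorphisms L C"
  shows "finv \<sigma> \<circ> \<tau> \<in> KP \<longleftrightarrow> \<tau> \<circ> finv \<sigma> \<in> KP"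
proof
  assume "finv \<sigma> \<circ> \<tau> \<in> KP"
  from KP_conj[OF this assms(1)] show "\<tau> \<circ> finv \<sigma> \<in> KP" using automorphisms_inv(5)[OF assms(1)] by (simp add: o_assoc)
next
  assume "\<tau> \<circ> finv \<sigma> \<in> KP"
  from KP_conj[OF this automorphisms_inv(1)[OF assms(1)]]
  have "finv \<sigma> \<circ> \<tau> \<circ> (finv \<sigma> \<circ> finv (finv \<sigma>)) \<in> KP" by (simp add: o_assoc)
  then show "finv \<sigma> \<circ> \<tau> \<in> KP" using automorphisms_inv(5)[OF automorphisms_inv(1)[OF assms(1)]] by simp
qed

lemma r_in_r_KP:
  assumes "\<tau> \<in> automorphisms L C"
  shows "r \<tau> \<in> r ` KP \<longleftrightarrow> \<tau> \<in> KP"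
proof
  assume "r \<tau> \<in> r ` KP"
  then obtain k where k: "k \<in> KP" "r k = r \<tau>" by auto
  have "\<tau> \<circ> finv k \<in> KP" using r_eq_imp_KP[OF KP_automorphism[OF k(1)] assms k(2)] .
  from KP_comp[OF this k(1)] show "\<tau> \<in> KP" using automorphisms_inv(4)[OF KP_automorphism[OF k(1)]] by (simp add: comp_assoc)
qed blast

lemma Hausdorff_GT: "Hausdorff_space GT"
  unfolding Gal_KP_topology_def
proof (rule Hausdorff_quotient_topology[OF compact_Sp Hausdorff_Sp])
  have "{(p, q). p \<in> topspace Sp \<and> q \<in> topspace Sp \<and> \<rho> p = \<rho> q} =
      {(r \<sigma>, r \<tau>) | \<sigma> \<tau>. \<sigma> \<in> automorphisms L C \<and> \<tau> \<in> automorphisms L C \<and> r (finv \<sigma> \<circ> \<tau>) \<in> r ` KP}" (is "?A = ?B")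
  proof -
    have key: "\<rho> (r \<sigma>) = \<rho> (r \<tau>) \<longleftrightarrow> r (finv \<sigma> \<circ> \<tau>) \<in> r ` KP"
      if "\<sigma> \<in> automorphisms L C" "\<tau> \<in> automorphisms L C" for \<sigma> \<tau>
      using KP_map_r[OF that(1)] KP_map_r[OF that(2)] KP_coset_eq[OF that] KP_comm[OF that]
        r_in_r_KP[OF automorphisms_comp[OF automorphisms_inv(1)[OF that(1)] that(2)]] by simp
    show ?thesis
    proof (intro equalityI subsetI)
      fix z assume "z \<in> ?A"
      then obtain p q where z: "z = (p, q)" "p \<in> topspace Sp" "q \<in> topspace Sp" "\<rho> p = \<rho> q" by auto
      obtain \<sigma> where \<sigma>: "\<sigma> \<in> automorphisms L C" "p = r \<sigma>" using Sp_realized[OF z(2)] by blast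
      obtain \<tau> where \<tau>: "\<tau> \<in> automorphisms L C" "q = r \<tau>" using Sp_realized[OF z(3)] by blast
      show "z \<in> ?B" using z \<sigma> \<tau> key[OF \<sigma>(1) \<tau>(1)] by blast
    next
      fix z assume "z \<in> ?B"
      then obtain \<sigma> \<tau> where "z = (r \<sigma>, r \<tau>)" "\<sigma> \<in> automorphisms L C" "\<tau> \<in> automorphisms L C" "r (finv \<sigma> \<circ> \<tau>) \<in> r ` KP" by blast
      then show "z \<in> ?A" using key r_in_Sp by simp
    qed
  qed
  then show "closedin (prod_topology Sp Sp) {(p, q). p \<in> topspace Sp \<and> q \<in> topspace Sp \<and> \<rho> p = \<rho> q}"
    using closedin_division[OF closedin_r_KP] by simp
qed

text \<open>The preimage of a closed set under division is the image of a closed relation on the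
  compact space of pairs of types, hence compact and so closed in the Hausdorff product.\<close>

lemma topological_group_Gal: "topological_group Gal GT"
proof (rule topological_groupI_division[OF group_Gal topspace_GT])
  interpret group Gal by (rule group_Gal)
  let ?d = "\<lambda>(x, y). inv\<^bsub>Gal\<^esub> x \<otimes>\<^bsub>Gal\<^esub> y"
  show "continuous_map (prod_topology GT GT) GT ?d"
    unfolding continuous_map_closedin
  proof (intro conjI allI impI)
    show "?d \<in> topspace (prod_topology GT GT) \<rightarrow> topspace GT" by (auto simp: topspace_GT)
    fix F assume F: "closedin GT F"
    define D where "D = {p \<in> topspace Sp. \<rho> p \<in> F}"
    have D: "closedin Sp D" unfolding D_def by (rule closedin_continuous_map_preimage[OF continuous_\<rho> F])
    let ?T = "{(r \<sigma>, r \<tau>) | \<sigma> \<tau>. \<sigma> \<in> automorphisms L C \<and> \<tau> \<in> automorphisms L C \<and> r (finv \<sigma> \<circ> \<tau>) \<in> D}"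
    have "compact_space (prod_topology Sp Sp)" using compact_Sp by (simp add: compact_space_prod_topology)
    then have "compactin (prod_topology Sp Sp) ?T" by (rule closedin_compact_space[OF _ closedin_division[OF D]])
    moreover have "continuous_map (prod_topology Sp Sp) (prod_topology GT GT) (\<lambda>(p, q). (\<rho> p, \<rho> q))"
      using continuous_\<rho> by (simp add: continuous_map_prod_top)
    ultimately have "compactin (prod_topology GT GT) ((\<lambda>(p, q). (\<rho> p, \<rho> q)) ` ?T)" by (rule image_compactin)
    then have "closedin (prod_topology GT GT) ((\<lambda>(p, q). (\<rho> p, \<rho> q)) ` ?T)"
      by (rule compactin_imp_closedin[rotated]) (simp add: Hausdorff_space_prod_topology Hausdorff_GT)
    moreover have "(\<lambda>(p, q). (\<rho> p, \<rho> q)) ` ?T = {z \<in> topspace (prod_topology GT GT). ?d z \<in> F}"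
    proof (intro equalityI subsetI)
      fix z assume "z \<in> (\<lambda>(p, q). (\<rho> p, \<rho> q)) ` ?T"
      then obtain \<sigma> \<tau> where st: "\<sigma> \<in> automorphisms L C" "\<tau> \<in> automorphisms L C" "r (finv \<sigma> \<circ> \<tau>) \<in> D" "z = (\<rho> (r \<sigma>), \<rho> (r \<tau>))" by auto
      have c: "finv \<sigma> \<circ> \<tau> \<in> automorphisms L C" using automorphisms_comp automorphisms_inv(1) st(1,2) by blast
      have z: "z = (cs \<sigma>, cs \<tau>)" using st KP_map_r by simp
      have "?d z = cs (finv \<sigma> \<circ> \<tau>)" unfolding z using Gal_inv[OF st(1)] Gal_mult[OF automorphisms_inv(1)[OF st(1)] st(2)] by simp
      also have "\<dots> = \<rho> (r (finv \<sigma> \<circ> \<tau>))" using KP_map_r[OF c] by simp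
      finally show "z \<in> {z \<in> topspace (prod_topology GT GT). ?d z \<in> F}"
        using st z by (auto simp: D_def topspace_GT carrier_Gal)
    next
      fix z assume "z \<in> {z \<in> topspace (prod_topology GT GT). ?d z \<in> F}"
      then obtain \<sigma> \<tau> where st: "\<sigma> \<in> automorphisms L C" "\<tau> \<in> automorphisms L C" "z = (cs \<sigma>, cs \<tau>)" "?d z \<in> F"
        by (auto simp: topspace_GT carrier_Gal)
      have c: "finv \<sigma> \<circ> \<tau> \<in> automorphisms L C" using automorphisms_comp automorphisms_inv(1) st(1,2) by blast
      have "?d z = cs (finv \<sigma> \<circ> \<tau>)" unfolding st(3) using Gal_inv[OF st(1)] Gal_mult[OF automorphisms_inv(1)[OF st(1)] st(2)] by simp
      then have "\<rho> (r (finv \<sigma> \<circ> \<tau>)) \<in> F" using st(4) KP_map_r[OF c] by simp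
      then have "r (finv \<sigma> \<circ> \<tau>) \<in> D" using r_in_Sp[OF c] by (simp add: D_def)
      then have "(r \<sigma>, r \<tau>) \<in> ?T" using st by blast
      moreover have "z = (\<lambda>(p, q). (\<rho> p, \<rho> q)) (r \<sigma>, r \<tau>)" using st KP_map_r by simp
      ultimately show "z \<in> (\<lambda>(p, q). (\<rho> p, \<rho> q)) ` ?T" by (rule image_eqI[rotated])
    qed
    ultimately show "closedin (prod_topology GT GT) {z \<in> topspace (prod_topology GT GT). ?d z \<in> F}" by simp
  qed
qed

lemma compact_GT: "compact_space GT"
  using image_compactin[OF _ continuous_\<rho>, of "topspace Sp"] compact_Sp
  by (simp add: compact_space_def Gal_KP_topology_def topspace_quotient_topology)

end

section \<open>From the Ellis semigroup to the Kim--Pillay group\<close>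

locale enumerated_small_model = small_model \<kappa> L C N
  for \<kappa> :: "'k rel" and L :: "('f, 'r) signature" and C :: "('f, 'r, 'm) fo_struct" and N +
  fixes c :: "'i \<Rightarrow> 'm" assumes c: "surj c"
begin

abbreviation X where "X \<equiv> global_type_space L C c"
abbreviation act where "act \<equiv> global_type_act L C c"
abbreviation \<I> :: "('f, 'r, 'i, 'm) pfm set" where "\<I> \<equiv> pfms L UNIV UNIV"

text \<open>A chosen index at which the enumeration takes a given value; \<open>c\<close> may repeat
  values.\<close>

abbreviation s where "s \<equiv> finv c"

lemma c_inv: "c (s m) = m"
  using c by (simp add: surj_f_inv_f)

text \<open>The restriction map from the global types of \<open>c\<close> to the types of
  \<open>N\<close> over \<open>N\<close>: the variable with index \<open>s m\<close> is read as the
  variable \<open>m\<close>.\<close>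

definition rN :: "('f, 'r, 'i, 'm) pfm set \<Rightarrow> ('f, 'r, 'm, 'm) pfm set" where
  "rN p = {q \<in> pfms L N N. holds C p (\<lambda>x. psat C (\<lambda>m. x (s m)) q)}"

lemma definable_s: "Q \<in> definable L C N A \<Longrightarrow> (\<lambda>x. Q (\<lambda>m. x (s m))) \<in> definable L C UNIV A"
  by (rule definable_rename) auto

lemma definable_s_UNIV: "Q \<in> definable L C N A \<Longrightarrow> (\<lambda>x. Q (\<lambda>m. x (s m))) \<in> definable L C UNIV UNIV"
  by (rule definable_mono[OF definable_s]) auto

lemma X_complete: "p \<in> topspace X \<Longrightarrow> p \<in> complete_types C \<I>"
  by (simp add: topspace_global)

lemma X_elementary:
  assumes "p \<in> topspace X" "Q \<in> definable L C UNIV {}" "Q c"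
  shows "holds C p Q"
proof -
  obtain q where q: "q \<in> pfms L UNIV {}" "\<forall>x. psat C x q \<longleftrightarrow> Q x" using definable_pfm[OF assms(2)] by blast
  then have qt: "q \<in> tp L C UNIV {} c" using assms(3) by (simp add: tp_def)
  have "pneg q \<notin> p" using consistent_not_both[of C "p \<union> tp L C UNIV {} c" q] assms(1) qt by (auto simp: topspace_global)
  moreover have "q \<in> \<I>" by (rule subsetD[OF pfms_mono q(1)]) simp_all
  ultimately have "q \<in> p" using complete_typesD(3)[OF X_complete[OF assms(1)]] by blast
  then show ?thesis using q(2) by (auto simp: holds_def)
qed

lemma holds_rN: "Q \<in> definable L C N N \<Longrightarrow> holds C (rN p) Q \<longleftrightarrow> holds C p (\<lambda>x. Q (\<lambda>m. x (s m)))"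
proof
  assume "holds C (rN p) Q"
  then obtain q where "q \<in> rN p" "\<forall>x. psat C x q \<longleftrightarrow> Q x" unfolding holds_def by blast
  then show "holds C p (\<lambda>x. Q (\<lambda>m. x (s m)))" by (simp add: rN_def)
next
  assume Q: "Q \<in> definable L C N N" and h: "holds C p (\<lambda>x. Q (\<lambda>m. x (s m)))"
  obtain q where q: "q \<in> pfms L N N" "\<forall>x. psat C x q \<longleftrightarrow> Q x" using definable_pfm[OF Q] by blast
  then have "q \<in> rN p" using h by (simp add: rN_def)
  then show "holds C (rN p) Q" using q(2) unfolding holds_def by blast
qed

lemma rN_in_Sp:
  assumes p: "p \<in> topspace X"
  shows "rN p \<in> topspace Sp"
proof -
  have el: "q \<in> rN p" if "q \<in> tp L C N {} id" for q
  proof -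
    have q: "q \<in> pfms L N {}" "psat C id q" using that by (auto simp: tp_def)
    have "holds C p (\<lambda>x. psat C (\<lambda>m. x (s m)) q)"
      by (rule X_elementary[OF p definable_s[OF definable_psat[OF q(1)]]]) (use q(2) in \<open>simp add: c_inv id_def\<close>)
    moreover have "q \<in> pfms L N N" using q(1) pfms_mono[of N N "{}" N L] by blast
    ultimately show ?thesis by (simp add: rN_def)
  qed
  have con: "consistent C (rN p)"
    unfolding consistent_def
  proof (intro allI impI)
    fix f assume f: "f \<subseteq> rN p" "finite f"
    have "\<exists>x. \<forall>Q\<in>(\<lambda>q x. psat C (\<lambda>m. x (s m)) q) ` f. Q x"
      by (rule holds_satisfiable[OF X_complete[OF p]]) (use f in \<open>auto simp: rN_def\<close>)
    then obtain x where "\<forall>q\<in>f. psat C (\<lambda>m. x (s m)) q" by auto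
    then show "\<exists>x. \<forall>q\<in>f. psat C x q" by (intro exI[where x = "\<lambda>m. x (s m)"])
  qed
  have "q \<in> rN p \<or> pneg q \<in> rN p" if q: "q \<in> pfms L N N" for q
    using holds_Neg[OF X_complete[OF p] definable_s_UNIV[OF definable_psat[OF q]]] q pneg_pfms[OF q] by (auto simp: rN_def)
  moreover have "rN p \<subseteq> pfms L N N" by (auto simp: rN_def)
  moreover have "rN p \<union> tp L C N {} id = rN p" using el by blast
  ultimately show ?thesis using con by (auto simp: topspace_Sp complete_types_def)
qed

lemma continuous_rN: "continuous_map X Sp rN"
  unfolding type_space_eq[of L C N N id]
proof (rule continuous_map_type_topology)
  show "rN \<in> topspace X \<rightarrow> types_over C (pfms L N N) (tp L C N {} id)" using rN_in_Sp topspace_Sp by blast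
  fix q assume "q \<in> pfms L N N \<union> pneg ` pfms L N N"
  then have q: "q \<in> pfms L N N" using pneg_pfms by blast
  have "{p \<in> topspace X. q \<in> rN p} = {p \<in> topspace X. holds C p (\<lambda>x. psat C (\<lambda>m. x (s m)) q)}"
    using q by (simp add: rN_def)
  then show "openin X {p \<in> topspace X. q \<in> rN p}"
    using clopen_holds[OF definable_s_UNIV[OF definable_psat[OF q]], of c] by simp
qed

lemma holds_act:
  assumes p: "p \<in> topspace X" and g: "g \<in> automorphisms L C" and Q: "Q \<in> definable L C UNIV UNIV"
  shows "holds C (act g p) Q \<longleftrightarrow> holds C p (\<lambda>x. Q (\<lambda>v. g (x v)))"
proof -
  have a: "act g p = ptrans g ` p" using p by (simp add: type_act_def ptrans_def)
  have pI: "p \<subseteq> \<I>" using complete_typesD(2)[OF X_complete[OF p]] pneg_pfms by blast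
  have t: "psat C (\<lambda>v. g (x v)) (ptrans g q) \<longleftrightarrow> psat C x q" if "q \<in> p" for q x
    by (rule psat_ptrans[OF g]) (use that pI in blast)
  show ?thesis
  proof
    assume "holds C (act g p) Q"
    then obtain q where q: "q \<in> p" "\<forall>x. psat C x (ptrans g q) \<longleftrightarrow> Q x" unfolding holds_def a by blast
    then show "holds C p (\<lambda>x. Q (\<lambda>v. g (x v)))" unfolding holds_def using t[OF q(1)] by (intro bexI[where x = q]) simp_all
  next
    assume "holds C p (\<lambda>x. Q (\<lambda>v. g (x v)))"
    then obtain q where q: "q \<in> p" "\<forall>x. psat C x q \<longleftrightarrow> Q (\<lambda>v. g (x v))" unfolding holds_def by blast
    have "psat C x (ptrans g q) \<longleftrightarrow> Q x" for x
      using t[OF q(1), of "\<lambda>v. finv g (x v)"] q(2) by (simp add: automorphisms_inv[OF g])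
    then show "holds C (act g p) Q" unfolding holds_def a using q(1) by (intro bexI[where x = "ptrans g q"]) auto
  qed
qed

text \<open>Restricting the translate of \<open>p\<close> by \<open>g\<close> to \<open>N\<close>
  involves \<open>p\<close> over the preimage of \<open>N\<close> under \<open>g\<close>. A single
  \<open>\<tau>\<close> therefore has to realize \<open>p\<close> over both \<open>N\<close> and
  this preimage, that is over the small set \<open>A\<close>.\<close>

lemma rN_act:
  assumes p: "p \<in> topspace X" and g: "g \<in> automorphisms L C"
  shows "\<exists>\<tau>\<in>automorphisms L C. rN p = r \<tau> \<and> rN (act g p) = r (g \<circ> \<tau>)"
proof -
  define A where "A = N \<union> finv g ` N"
  have A: "|A| <o \<kappa>"
    unfolding A_def using Un_Cinfinite_bound_strict[OF small ordLeq_ordLess_trans[OF card_of_image small] Cinfinite] .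
  let ?\<Gamma> = "{Q \<in> definable L C N A. holds C p (\<lambda>x. Q (\<lambda>m. x (s m)))}"
  have "\<exists>\<tau>\<in>automorphisms L C. \<forall>Q\<in>?\<Gamma>. Q \<tau>"
  proof (rule realize_by_automorphism[OF small A])
    show "finitely_satisfiable ?\<Gamma>"
      unfolding finitely_satisfiable_def
    proof (intro allI impI)
      fix \<Gamma>0 assume \<Gamma>0: "\<Gamma>0 \<subseteq> ?\<Gamma>" "finite \<Gamma>0"
      have "\<exists>x. \<forall>Q\<in>(\<lambda>Q x. Q (\<lambda>m. x (s m))) ` \<Gamma>0. Q x"
        by (rule holds_satisfiable[OF X_complete[OF p]]) (use \<Gamma>0 in auto)
      then obtain x where "\<forall>Q\<in>\<Gamma>0. Q (\<lambda>m. x (s m))" by auto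
      then show "\<exists>x. \<forall>Q\<in>\<Gamma>0. Q x" by (intro exI[where x = "\<lambda>m. x (s m)"])
    qed
    show "Q \<in> ?\<Gamma>" if Q: "Q \<in> definable L C N {}" "Q id" for Q
    proof -
      have "holds C p (\<lambda>x. Q (\<lambda>m. x (s m)))"
        by (rule X_elementary[OF p definable_s[OF Q(1)]]) (use Q(2) in \<open>simp add: c_inv id_def\<close>)
      then show ?thesis using definable_mono[OF Q(1), of N A] by simp
    qed
  qed blast
  then obtain \<tau> where \<tau>: "\<tau> \<in> automorphisms L C" "\<forall>Q\<in>?\<Gamma>. Q \<tau>" by (elim bexE)
  have gp: "act g p \<in> topspace X" using flow_act(3)[OF flow_global _ p] g by simp
  have g\<tau>: "g \<circ> \<tau> \<in> automorphisms L C" using automorphisms_comp g \<tau>(1) by blast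
  have "rN p = r \<tau>"
  proof (rule complete_types_holds_eqI[OF Sp_complete[OF rN_in_Sp[OF p]] Sp_complete[OF r_in_Sp[OF \<tau>(1)]]])
    fix Q assume Q: "Q \<in> definable L C N N" "holds C (rN p) Q"
    then have "Q \<in> ?\<Gamma>" using holds_rN[OF Q(1)] definable_mono[OF Q(1), of N A] by (simp add: A_def)
    then show "holds C (r \<tau>) Q" using bspec[OF \<tau>(2)] holds_r[OF Q(1)] by blast
  qed
  moreover have "rN (act g p) = r (g \<circ> \<tau>)"
  proof (rule complete_types_holds_eqI[OF Sp_complete[OF rN_in_Sp[OF gp]] Sp_complete[OF r_in_Sp[OF g\<tau>]]])
    fix Q assume Q: "Q \<in> definable L C N N" "holds C (rN (act g p)) Q"
    have gg: "finv (finv g) = g" using automorphismsD(1)[OF g] by (rule inv_inv_eq)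
    have "(\<lambda>y. Q (\<lambda>m. finv (finv g) (y m))) \<in> definable L C N (finv g ` N)"
      by (rule definable_translate[OF automorphisms_inv(1)[OF g] Q(1)])
    then have "(\<lambda>y. Q (\<lambda>m. g (y m))) \<in> definable L C N A"
      unfolding gg by (rule definable_mono) (auto simp: A_def)
    moreover have "holds C p (\<lambda>x. Q (\<lambda>m. g (x (s m))))"
      using Q(2) holds_rN[OF Q(1)] holds_act[OF p g definable_s_UNIV[OF Q(1)]] by simp
    ultimately have "(\<lambda>y. Q (\<lambda>m. g (y m))) \<in> ?\<Gamma>" by simp
    from bspec[OF \<tau>(2) this] have "Q (g \<circ> \<tau>)" by (simp add: o_def)
    then show "holds C (r (g \<circ> \<tau>)) Q" using holds_r[OF Q(1)] by simp
  qed
  ultimately show ?thesis using \<tau>(1) by blast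
qed

definition cls where "cls p = \<rho> (rN p)"

lemma cls_in: "p \<in> topspace X \<Longrightarrow> cls p \<in> carrier Gal"
  using continuous_\<rho> rN_in_Sp topspace_GT unfolding cls_def continuous_map_def by blast

lemma continuous_cls: "continuous_map X GT cls"
  using continuous_map_compose[OF continuous_rN continuous_\<rho>] by (simp add: cls_def[abs_def] o_def)

lemma cls_act: "\<lbrakk>p \<in> topspace X; g \<in> automorphisms L C\<rbrakk> \<Longrightarrow> cls (act g p) = cs g \<otimes>\<^bsub>Gal\<^esub> cls p"
proof -
  assume p: "p \<in> topspace X" and g: "g \<in> automorphisms L C"
  obtain \<tau> where \<tau>: "\<tau> \<in> automorphisms L C" "rN p = r \<tau>" "rN (act g p) = r (g \<circ> \<tau>)" using rN_act[OF p g] by blast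
  then show ?thesis
    using KP_map_r[OF \<tau>(1)] KP_map_r[OF automorphisms_comp[OF g \<tau>(1)]] Gal_mult[OF g \<tau>(1)] by (simp add: cls_def)
qed

definition pc where "pc = tp L C UNIV UNIV c"

lemma pc_in: "pc \<in> topspace X"
proof -
  have "psat C c q" if "q \<in> pc \<union> tp L C UNIV {} c" for q using that by (auto simp: pc_def tp_def)
  then have "consistent C (pc \<union> tp L C UNIV {} c)" unfolding consistent_def by (intro allI impI exI[where x = c]) blast
  moreover from this have "consistent C pc" by (auto intro: consistent_subset)
  ultimately show ?thesis by (auto simp: topspace_global complete_types_def pc_def tp_def pneg_pfms)
qed

lemma cls_pc: "cls pc = \<one>\<^bsub>Gal\<^esub>"
proof -
  have "rN pc = r id"
  proof (rule complete_types_holds_eqI[OF Sp_complete[OF rN_in_Sp[OF pc_in]] Sp_complete[OF r_in_Sp[OF automorphisms_id]]])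
    fix Q assume Q: "Q \<in> definable L C N N" "holds C (rN pc) Q"
    then have "holds C pc (\<lambda>x. Q (\<lambda>m. x (s m)))" using holds_rN by blast
    then have "Q (\<lambda>m. c (s m))" by (auto simp: holds_def pc_def tp_def)
    then have "Q id" by (simp add: c_inv id_def)
    then show "holds C (r id) Q" using holds_r[OF Q(1)] by simp
  qed
  then show ?thesis using KP_map_r[OF automorphisms_id] by (simp add: cls_def Gal_one)
qed

definition \<Theta> where "\<Theta> \<eta> = cls (\<eta> pc)"

lemma continuous_eval_cls: "p \<in> topspace X \<Longrightarrow> continuous_map (self_maps X) GT (\<lambda>\<eta>. cls (\<eta> p))"
  using continuous_map_compose[OF continuous_map_product_projection[of p "topspace X" "\<lambda>_. X"] continuous_cls] by (simp add: o_def)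

lemma continuous_\<Theta>: "continuous_map (self_maps X) GT \<Theta>"
  using continuous_eval_cls[OF pc_in] by (simp add: \<Theta>_def[abs_def])

lemma \<Theta>_act: "g \<in> automorphisms L C \<Longrightarrow> \<Theta> (act g) = cs g"
proof -
  assume g: "g \<in> automorphisms L C"
  interpret group Gal by (rule group_Gal)
  have "cs g \<in> carrier Gal" using g by (auto simp: carrier_Gal)
  then show ?thesis using cls_act[OF pc_in g] cls_pc by (simp add: \<Theta>_def)
qed

lemma \<Theta>_in: "\<eta> \<in> EL (Aut L C) X act \<Longrightarrow> \<Theta> \<eta> \<in> carrier Gal"
  unfolding \<Theta>_def by (rule cls_in, rule PiE_mem[OF EL_in_PiE[OF flow_global] pc_in])

text \<open>Both sides depend continuously on \<open>\<eta>\<close>, take values in a Hausdorff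
  group and agree for group elements. The case where \<open>p\<close> is the image of
  \<open>pc\<close> under another element of \<open>EL\<close> is the multiplicativity of
  \<open>\<Theta>\<close>.\<close>

lemma cls_EL:
  assumes "\<eta> \<in> EL (Aut L C) X act" "p \<in> topspace X"
  shows "cls (\<eta> p) = \<Theta> \<eta> \<otimes>\<^bsub>Gal\<^esub> cls p"
proof -
  have mc: "continuous_map (prod_topology GT GT) GT (\<lambda>(x, y). x \<otimes>\<^bsub>Gal\<^esub> y)"
    using topological_group_Gal by (simp add: topological_group_def)
  have "continuous_map GT (prod_topology GT GT) (\<lambda>x. (x, cls p))"
    using cls_in[OF assms(2)] topspace_GT by (auto simp: continuous_map_pairwise o_def)
  from continuous_map_compose[OF this mc] have "continuous_map GT GT (\<lambda>x. x \<otimes>\<^bsub>Gal\<^esub> cls p)" by (simp add: o_def)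
  from continuous_map_compose[OF continuous_\<Theta> this]
  have "continuous_map (self_maps X) GT (\<lambda>\<eta>. \<Theta> \<eta> \<otimes>\<^bsub>Gal\<^esub> cls p)" by (simp add: o_def)
  moreover have "cls (h p) = \<Theta> h \<otimes>\<^bsub>Gal\<^esub> cls p" if "h \<in> act ` carrier (Aut L C)" for h
    using that cls_act[OF assms(2)] \<Theta>_act by auto
  moreover have "\<eta> \<in> self_maps X closure_of (act ` carrier (Aut L C))" using assms(1) by (simp add: EL_def)
  ultimately show ?thesis
    using forall_in_closure_of_eq[of \<eta> "self_maps X" "act ` carrier (Aut L C)" GT "\<lambda>\<eta>. cls (\<eta> p)" "\<lambda>\<eta>. \<Theta> \<eta> \<otimes>\<^bsub>Gal\<^esub> cls p"]
      Hausdorff_GT continuous_eval_cls[OF assms(2)] by blast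
qed

lemma \<Theta>_compose:
  assumes "\<eta> \<in> EL (Aut L C) X act" "\<eta>' \<in> EL (Aut L C) X act"
  shows "\<Theta> (compose (topspace X) \<eta> \<eta>') = \<Theta> \<eta> \<otimes>\<^bsub>Gal\<^esub> \<Theta> \<eta>'"
proof -
  have "\<eta>' pc \<in> topspace X" by (rule PiE_mem[OF EL_in_PiE[OF flow_global assms(2)] pc_in])
  from cls_EL[OF assms(1) this] show ?thesis using compose_eq[OF pc_in, of \<eta> \<eta>'] by (simp only: \<Theta>_def)
qed

section \<open>From the Ellis group onto the Kim-Pillay group\<close>

context
  fixes M u
  assumes min: "minimal_left_ideal (Aut L C) X act M" and u: "u \<in> M" and idem: "ellis_idempotent X u"
begin

abbreviation UM where "UM \<equiv> carrier (ellis_group X M u)"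
abbreviation \<tau>top where "\<tau>top \<equiv> tau_topology (Aut L C) X act M u"
abbreviation H where "H \<equiv> tau_H (Aut L C) X act M u"

lemmas flX = flow_global[of L C c]
lemmas UM_EL = uM_in_EL[OF flX min u idem]

lemma \<Theta>_u: "\<Theta> u = \<one>\<^bsub>Gal\<^esub>"
proof -
  interpret group Gal by (rule group_Gal)
  have uE: "u \<in> EL (Aut L C) X act" using UM_EL[OF u_in_uM[OF flX min u idem]] .
  have "\<Theta> u \<otimes>\<^bsub>Gal\<^esub> \<Theta> u = \<Theta> u" using \<Theta>_compose[OF uE uE] idem by (simp add: ellis_idempotent_def)
  then show ?thesis using l_cancel_one[OF \<Theta>_in[OF uE] \<Theta>_in[OF uE]] by simp
qed

text \<open>For \<open>g\<close> close to \<open>u\<close> the value \<open>\<Theta> (act g)\<close>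
  is close to the identity, and if \<open>g b\<close> is close to \<open>f\<close>, then
  \<open>\<Theta> b\<close>, the quotient of the values at \<open>g b\<close> and \<open>g\<close>,
  is close to \<open>\<Theta> f\<close>. Joint continuity of division in the Galois group makes this
  precise.\<close>

lemma tau_closed_preimage:
  assumes F: "closedin GT F"
  shows "closedin \<tau>top {f \<in> UM. \<Theta> f \<in> F}" (is "closedin _ ?B")
  unfolding closedin_tau[OF flX min u idem]
proof (intro conjI equalityI)
  show "?B \<subseteq> tau_closure (Aut L C) X act M u ?B" by (rule tau_closure_extensive[OF flX min u idem]) blast
  show "tau_closure (Aut L C) X act M u ?B \<subseteq> ?B"
  proof
    fix f assume f: "f \<in> tau_closure (Aut L C) X act M u ?B"
    then have fM: "f \<in> UM" by (simp add: tau_closure_def)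
    interpret group Gal by (rule group_Gal)
    have "\<Theta> f \<in> F"
    proof (rule ccontr)
      assume no: "\<Theta> f \<notin> F"
      let ?V = "topspace GT - F"
      let ?d = "\<lambda>(x, y). inv\<^bsub>Gal\<^esub> x \<otimes>\<^bsub>Gal\<^esub> y"
      have fc: "\<Theta> f \<in> carrier Gal" using \<Theta>_in[OF UM_EL[OF fM]] .
      have "continuous_map (prod_topology GT GT) (prod_topology GT GT) (\<lambda>(x, y). (inv\<^bsub>Gal\<^esub> x, y))"
        using topological_group_Gal by (simp add: continuous_map_prod_top topological_group_def)
      moreover have "continuous_map (prod_topology GT GT) GT (\<lambda>(x, y). x \<otimes>\<^bsub>Gal\<^esub> y)"
        using topological_group_Gal by (simp add: topological_group_def)
      ultimately have "continuous_map (prod_topology GT GT) GT ((\<lambda>(x, y). x \<otimes>\<^bsub>Gal\<^esub> y) \<circ> (\<lambda>(x, y). (inv\<^bsub>Gal\<^esub> x, y)))"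
        by (rule continuous_map_compose)
      then have dc: "continuous_map (prod_topology GT GT) GT ?d" by (rule continuous_map_eq) auto
      have "openin GT ?V" using F by blast
      then have "openin (prod_topology GT GT) {z \<in> topspace (prod_topology GT GT). ?d z \<in> ?V}"
        by (rule openin_continuous_map_preimage[OF dc])
      moreover have "(\<one>\<^bsub>Gal\<^esub>, \<Theta> f) \<in> {z \<in> topspace (prod_topology GT GT). ?d z \<in> ?V}"
        using fc no by (simp add: topspace_GT)
      ultimately obtain U1 U2 where U: "openin GT U1" "openin GT U2" "\<one>\<^bsub>Gal\<^esub> \<in> U1" "\<Theta> f \<in> U2"
        "U1 \<times> U2 \<subseteq> {z \<in> topspace (prod_topology GT GT). ?d z \<in> ?V}"
        unfolding openin_prod_topology_alt by meson
      let ?U = "{\<eta> \<in> topspace (self_maps X). \<Theta> \<eta> \<in> U1}" and ?W = "{\<eta> \<in> topspace (self_maps X). \<Theta> \<eta> \<in> U2}"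
      have op: "openin (self_maps X) ?U" "openin (self_maps X) ?W"
        by (rule openin_continuous_map_preimage[OF continuous_\<Theta>], rule U)+
      have "u \<in> ?U" "f \<in> ?W"
        using U(3,4) \<Theta>_u subsetD[OF EL_subset[OF flX] UM_EL[OF u_in_uM[OF flX min u idem]]]
          subsetD[OF EL_subset[OF flX] UM_EL[OF fM]] by simp_all
      from tau_closureD[OF flX min u idem f op(1) this(1) op(2) this(2)]
      obtain g b where gb: "g \<in> carrier (Aut L C)" "b \<in> ?B" "act g \<in> ?U" "compose (topspace X) (act g) b \<in> ?W" by (elim bexE conjE)
      have gE: "act g \<in> EL (Aut L C) X act" "b \<in> EL (Aut L C) X act" using act_in_EL[OF flX gb(1)] UM_EL gb(2) by auto
      have "(\<Theta> (act g), \<Theta> (compose (topspace X) (act g) b)) \<in> U1 \<times> U2" using gb by simp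
      then have "?d (\<Theta> (act g), \<Theta> (compose (topspace X) (act g) b)) \<in> ?V" using U(5) by blast
      then have "inv\<^bsub>Gal\<^esub> \<Theta> (act g) \<otimes>\<^bsub>Gal\<^esub> (\<Theta> (act g) \<otimes>\<^bsub>Gal\<^esub> \<Theta> b) \<in> ?V" using \<Theta>_compose[OF gE] by simp
      then have "\<Theta> b \<in> ?V" using \<Theta>_in gE by (simp add: m_assoc[symmetric])
      then show False using gb(2) by simp
    qed
    then show "f \<in> ?B" using fM by simp
  qed
qed blast

lemma continuous_\<Theta>_tau: "continuous_map \<tau>top GT \<Theta>"
  unfolding continuous_map_closedin
proof (intro conjI allI impI)
  show "\<Theta> \<in> topspace \<tau>top \<rightarrow> topspace GT" using \<Theta>_in UM_EL by (auto simp: topspace_tau[OF flX min u idem] topspace_GT)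
  show "closedin \<tau>top {x \<in> topspace \<tau>top. \<Theta> x \<in> F}" if "closedin GT F" for F
    using tau_closed_preimage[OF that] by (simp add: topspace_tau[OF flX min u idem])
qed

lemma H_subset: "H \<subseteq> UM" and u_in_H: "u \<in> H"
proof -
  have "openin \<tau>top UM" using openin_topspace[of \<tau>top] by (simp add: topspace_tau[OF flX min u idem])
  then show "H \<subseteq> UM" using u_in_uM[OF flX min u idem] unfolding tau_H_def tau_closure_def by blast
  show "u \<in> H" unfolding tau_H_def using tau_closure_extensive[OF flX min u idem] openin_tau[OF flX min u idem] by blast
qed

text \<open>If \<open>\<Theta> v\<close> differed from the identity, disjoint neighbourhoods would
  place the preimage of a neighbourhood of the identity inside a \<tau>-closed preimage that misses
  \<open>v\<close>.\<close>

lemma H_kernel: "v \<in> H \<Longrightarrow> \<Theta> v = \<one>\<^bsub>Gal\<^esub>"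
proof (rule ccontr)
  assume v: "v \<in> H" and ne: "\<Theta> v \<noteq> \<one>\<^bsub>Gal\<^esub>"
  interpret group Gal by (rule group_Gal)
  have "\<Theta> v \<in> topspace GT" "\<one>\<^bsub>Gal\<^esub> \<in> topspace GT" using \<Theta>_in UM_EL v H_subset by (auto simp: topspace_GT)
  then obtain V1 V2 where V: "openin GT V1" "openin GT V2" "\<one>\<^bsub>Gal\<^esub> \<in> V1" "\<Theta> v \<in> V2" "disjnt V1 V2"
    using Hausdorff_GT ne unfolding Hausdorff_space_def by metis
  let ?U = "{f \<in> UM. \<Theta> f \<in> V1}" and ?F = "{f \<in> UM. \<Theta> f \<in> topspace GT - V2}"
  have "openin \<tau>top ?U"
    using openin_continuous_map_preimage[OF continuous_\<Theta>_tau V(1)] by (simp add: topspace_tau[OF flX min u idem])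
  moreover have "u \<in> ?U" using u_in_uM[OF flX min u idem] \<Theta>_u V(3) by simp
  ultimately have "v \<in> tau_closure (Aut L C) X act M u ?U" using v unfolding tau_H_def by blast
  moreover have "?U \<subseteq> ?F" using V(1,5) openin_subset by (fastforce simp: disjnt_iff)
  ultimately have "v \<in> tau_closure (Aut L C) X act M u ?F" using tau_closure_mono[OF flX min u idem] by blast
  moreover have "closedin \<tau>top ?F" using V(2) by (intro tau_closed_preimage) blast
  ultimately have "v \<in> ?F" using closedin_tau[OF flX min u idem] by simp
  then show False using V(4) by simp
qed

lemma Gal_profinite:
  assumes pf: "profinite_group (ellis_group X M u Mod H) (ellis_quotient_topology (Aut L C) X act M u)"
  shows "profinite_group Gal GT"
proof -
  let ?E = "ellis_group X M u" and ?Q = "ellis_quotient_topology (Aut L C) X act M u"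
  interpret Gal: group Gal by (rule group_Gal)
  interpret E: group ?E by (rule group_ellis_group[OF flX min u idem])
  have mult: "f \<otimes>\<^bsub>?E\<^esub> h = compose (topspace X) f h" and one: "\<one>\<^bsub>?E\<^esub> = u" for f h by (simp_all add: ellis_group_def)
  have \<Theta>_mult: "\<Theta> (f \<otimes>\<^bsub>?E\<^esub> h) = \<Theta> f \<otimes>\<^bsub>Gal\<^esub> \<Theta> h" if "f \<in> UM" "h \<in> UM" for f h
    unfolding mult by (rule \<Theta>_compose) (use that UM_EL in auto)
  \<comment> \<open>\<open>\<Theta>\<close> is constant on each coset of \<open>H\<close>, as
    \<open>H\<close> lies in its kernel.\<close>
  define \<theta> where "\<theta> c = the_elem (\<Theta> ` c)" for c
  have const: "\<Theta> x = \<Theta> f" if f: "f \<in> UM" and x: "x \<in> H #>\<^bsub>?E\<^esub> f" for f x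
  proof -
    obtain h where h: "h \<in> H" "x = h \<otimes>\<^bsub>?E\<^esub> f" using x by (auto simp: r_coset_def)
    show ?thesis using \<Theta>_mult[OF subsetD[OF H_subset h(1)] f] H_kernel[OF h(1)] \<Theta>_in[OF UM_EL[OF f]] h(2) by simp
  qed
  have self: "f \<in> H #>\<^bsub>?E\<^esub> f" if "f \<in> UM" for f
  proof -
    have "f = u \<otimes>\<^bsub>?E\<^esub> f" using E.l_one[OF that] by (simp add: one)
    then show ?thesis using u_in_H unfolding r_coset_def by blast
  qed
  have \<theta>: "\<theta> (H #>\<^bsub>?E\<^esub> f) = \<Theta> f" if f: "f \<in> UM" for f
  proof -
    have "\<Theta> ` (H #>\<^bsub>?E\<^esub> f) = {\<Theta> f}" using const[OF f] self[OF f] by blast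
    then show ?thesis by (simp add: \<theta>_def)
  qed
  have carr: "carrier (?E Mod H) = (\<lambda>f. H #>\<^bsub>?E\<^esub> f) ` UM" by (auto simp: FactGroup_def RCOSETS_def)
  interpret Q: group "?E Mod H" using pf by (simp add: profinite_group_def topological_group_def)
  have td: "totally_disconnected GT"
  proof (rule totally_disconnected_image[OF pf topological_group_Gal Hausdorff_GT])
    show "continuous_map ?Q GT \<theta>"
      unfolding ellis_quotient_topology_def
    proof (rule continuous_compose_quotient_map[OF quotient_map_quotient_topology])
      show "continuous_map \<tau>top GT (\<theta> \<circ> (\<lambda>f. H #>\<^bsub>?E\<^esub> f))"
        by (rule continuous_map_eq[OF continuous_\<Theta>_tau]) (simp add: \<theta> topspace_tau[OF flX min u idem])
    qed
    show "\<theta> ` carrier (?E Mod H) = carrier Gal"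
    proof (intro equalityI subsetI)
      fix y assume "y \<in> \<theta> ` carrier (?E Mod H)"
      then show "y \<in> carrier Gal" using \<theta> \<Theta>_in UM_EL unfolding carr by auto
    next
      fix y assume "y \<in> carrier Gal"
      then obtain \<sigma> where \<sigma>: "\<sigma> \<in> automorphisms L C" "y = cs \<sigma>" by (auto simp: carrier_Gal)
      have uE: "u \<in> EL (Aut L C) X act" using UM_EL[OF u_in_uM[OF flX min u idem]] .
      have aE: "act \<sigma> \<in> EL (Aut L C) X act" using act_in_EL[OF flX] \<sigma>(1) by simp
      \<comment> \<open>The class of \<open>\<sigma>\<close> is attained at the product of
        \<open>u\<close>, \<open>act \<sigma>\<close> and \<open>u\<close>: it lies in
        \<open>u M\<close>, and \<open>\<Theta> u\<close> is the identity.\<close>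
      let ?m = "compose (topspace X) (act \<sigma>) u"
      have mM: "?m \<in> M" using min aE u by (simp add: minimal_left_ideal_def left_ideal_def)
      have mE: "?m \<in> EL (Aut L C) X act" using EL_compose[OF flX aE uE] .
      let ?f = "compose (topspace X) u ?m"
      have f: "?f \<in> UM" using u_compose_M[OF flX min u idem mM] .
      have "cs \<sigma> \<in> carrier Gal" using \<sigma>(1) by (auto simp: carrier_Gal)
      then have "\<Theta> ?f = y" using \<Theta>_compose[OF uE mE] \<Theta>_compose[OF aE uE] \<Theta>_u \<Theta>_act[OF \<sigma>(1)] \<sigma>(2) by simp
      then show "y \<in> \<theta> ` carrier (?E Mod H)" using \<theta>[OF f] f unfolding carr by (metis imageI)
    qed
    fix x y assume xy: "x \<in> carrier (?E Mod H)" "y \<in> carrier (?E Mod H)"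
    obtain f where f: "f \<in> UM" "x = H #>\<^bsub>?E\<^esub> f" using xy(1) unfolding carr by blast
    obtain h where h: "h \<in> UM" "y = H #>\<^bsub>?E\<^esub> h" using xy(2) unfolding carr by blast
    \<comment> \<open>The product of two elements of the factor group is again one of its cosets. It
      contains \<open>f \<otimes> h\<close>, and so this element determines the value of
      \<open>\<theta>\<close> on it.\<close>
    obtain k where k: "k \<in> UM" "x \<otimes>\<^bsub>?E Mod H\<^esub> y = H #>\<^bsub>?E\<^esub> k" using Q.m_closed[OF xy] unfolding carr by blast
    have "f \<otimes>\<^bsub>?E\<^esub> h \<in> x \<otimes>\<^bsub>?E Mod H\<^esub> y"
      using self[OF f(1)] self[OF h(1)] f(2) h(2) by (auto simp: FactGroup_def set_mult_def)
    then have "\<Theta> (f \<otimes>\<^bsub>?E\<^esub> h) = \<Theta> k" using const[OF k(1)] k(2) by simp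
    then show "\<theta> (x \<otimes>\<^bsub>?E Mod H\<^esub> y) = \<theta> x \<otimes>\<^bsub>Gal\<^esub> \<theta> y"
      using \<Theta>_mult[OF f(1) h(1)] \<theta>[OF k(1)] \<theta>[OF f(1)] \<theta>[OF h(1)] k(2) f(2) h(2) by simp
  qed
  then show ?thesis using topological_group_Gal compact_GT Hausdorff_GT by (simp add: profinite_group_def)
qed

end

end

text \<open>An existential statement over index and point types has to name these types:
  \<open>cond_B\<close> uses sets of pairs of global types and sets of global types. The conjunct
  \<open>cond_B_any \<longrightarrow> cond_B\<close>, with free types \<open>'j\<close> and
  \<open>'x\<close>, shows that this choice loses nothing.\<close>

theorem theorem1p3:
  fixes \<kappa> :: "'k rel"
    and L :: "('f, 'r) signature"
    and T :: "('f, 'r, nat) fm set"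
    and C :: "('f, 'r, 'm) fo_struct"
    and c :: "'i \<Rightarrow> 'm"
    and M :: "(('f, 'r, 'i, 'm) pfm set \<Rightarrow> ('f, 'r, 'i, 'm) pfm set) set"
    and u :: "('f, 'r, 'i, 'm) pfm set \<Rightarrow> ('f, 'r, 'i, 'm) pfm set"
  defines "G \<equiv> Aut L C"
    and "X \<equiv> global_type_space L C c"
    and "act \<equiv> global_type_act L C c"
  defines "cond_A'' \<equiv> Gal_KP_profinite \<kappa> L C"
    and "cond_A' \<equiv> profinite_group (ellis_group X M u Mod tau_H G X act M u)
                (ellis_quotient_topology G X act M u)"
    and "cond_A \<equiv> profinite_group (ellis_group X M u) (tau_topology G X act M u)"
    and "cond_B \<equiv> inverse_limit_of_finite_ellis
                TYPE((('f, 'r, 'i, 'm) pfm set \<times> ('f, 'r, 'i, 'm) pfm set) set)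
                TYPE(('f, 'r, 'i, 'm) pfm set set)
                G (Aut_topology L C) X act"
    and "cond_B_any \<equiv> inverse_limit_of_finite_ellis TYPE('j) TYPE('x) G (Aut_topology L C) X act"
    and "cond_C \<equiv> (\<forall>n (\<Delta> :: ('f, 'r, 'i + nat) fm set) P. finite_Delta_data L C n \<Delta> P \<longrightarrow>
                finite_ellis_group G (Delta_type_space L C c n \<Delta> P) (Delta_type_act L C c n \<Delta> P))"
    and "cond_D \<equiv> (\<forall>n (\<Delta> :: ('f, 'r, 'i + nat) fm set) P. finite_Delta_data L C n \<Delta> P \<longrightarrow>
                (\<exists>\<eta> \<in> EL G (Delta_type_space L C c n \<Delta> P) (Delta_type_act L C c n \<Delta> P).
                   finite (\<eta> ` topspace (Delta_type_space L C c n \<Delta> P))))"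
  assumes "complete_theory L T"
    and "monster_model \<kappa> L T C"
    and "surj c"
    and "minimal_left_ideal G X act M"
    and "u \<in> M"
    and "ellis_idempotent X u"
  shows "(cond_D \<longrightarrow> cond_C) \<and> (cond_C \<longleftrightarrow> cond_B) \<and> (cond_B_any \<longrightarrow> cond_B) \<and>
    (cond_B \<longrightarrow> cond_A) \<and> (cond_A \<longrightarrow> cond_A') \<and> (cond_A' \<longrightarrow> cond_A'')"
proof -
  have mon: "strong_limit \<kappa>" "saturated \<kappa> L C" "strongly_homogeneous \<kappa> L C"
    using \<open>monster_model \<kappa> L T C\<close> by (simp_all add: monster_model_def)
  have inf: "Cinfinite \<kappa>" using mon(1) by (simp add: strong_limit_def)
  note fl = flow_global[of L C c]
  note min = \<open>minimal_left_ideal G X act M\<close>[unfolded G_def X_def act_def] \<open>u \<in> M\<close>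
    \<open>ellis_idempotent X u\<close>[unfolded X_def]
  let ?sep = "finite_ellis_separated (Aut L C) (global_type_space L C c) (global_type_act L C c)"
  have BS: "cond_B \<longleftrightarrow> ?sep"
    unfolding cond_B_def G_def X_def act_def
    using finite_ellis_separated_if_inverse_limit[OF fl] inverse_limit_if_finite_ellis_separated[OF fl] by (rule iffI)
  have CS: "cond_C \<longleftrightarrow> ?sep"
  proof
    assume C: cond_C
    show ?sep
      by (rule finite_ellis_separated_if_Delta) (rule C[unfolded cond_C_def G_def, rule_format])
  next
    assume ?sep
    then show cond_C
      unfolding cond_C_def G_def by (intro allI impI) (rule Delta_if_finite_ellis_separated[OF mon(3) inf])
  qed
  have DC: "cond_D \<longrightarrow> cond_C"
    unfolding cond_D_def cond_C_def G_def
  proof (intro impI allI)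
    fix n P and \<Delta> :: "('f, 'r, 'i + nat) fm set"
    let ?Y = "Delta_type_space L C c n \<Delta> P" and ?act = "Delta_type_act L C c n \<Delta> P"
    assume D: "\<forall>n (\<Delta> :: ('f, 'r, 'i + nat) fm set) P. finite_Delta_data L C n \<Delta> P \<longrightarrow>
        (\<exists>\<eta> \<in> EL (Aut L C) (Delta_type_space L C c n \<Delta> P) (Delta_type_act L C c n \<Delta> P).
           finite (\<eta> ` topspace (Delta_type_space L C c n \<Delta> P)))"
      and data: "finite_Delta_data L C n \<Delta> P"
    from D[rule_format, OF data] obtain \<eta> where "\<eta> \<in> EL (Aut L C) ?Y ?act" "finite (\<eta> ` topspace ?Y)" by (elim bexE)
    then show "finite_ellis_group (Aut L C) ?Y ?act" by (rule finite_ellis_group_if_finite_image[OF flow_Delta[OF data]])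
  qed
  have B_any: "cond_B_any \<longrightarrow> cond_B"
    unfolding BS cond_B_any_def G_def X_def act_def using finite_ellis_separated_if_inverse_limit[OF fl] by (rule impI)
  have BA: "cond_B \<longrightarrow> cond_A"
    unfolding BS cond_A_def G_def X_def act_def
    using profinite_ellis_group_if_finite_ellis_separated[OF fl _ min] by (rule impI)
  have AA': "cond_A \<longrightarrow> cond_A'"
  proof
    assume cond_A
    then have A: "profinite_group (ellis_group X M u) (tau_topology G X act M u)" by (simp add: cond_A_def)
    then have "Hausdorff_space (tau_topology G X act M u)" by (simp add: profinite_group_def)
    then have "tau_H G X act M u = {u}"
      unfolding G_def X_def act_def by (rule tau_H_trivial[OF fl min])
    moreover have "\<one>\<^bsub>ellis_group X M u\<^esub> = u" by (simp add: ellis_group_def)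
    ultimately show cond_A'
      using profinite_group_Mod_trivial[OF A] by (simp add: cond_A'_def ellis_quotient_topology_def)
  qed
  have A'A'': "cond_A' \<longrightarrow> cond_A''"
    unfolding cond_A''_def Gal_KP_profinite_def
  proof (intro impI allI, elim conjE)
    fix N assume A': cond_A' and N: "elementary_submodel L C N" "|N| <o \<kappa>"
    \<comment> \<open>The topology on the Galois group is defined through a small model, so the
      argument is carried out for each such \<open>N\<close>.\<close>
    interpret enumerated_small_model \<kappa> L C N c
      by unfold_locales (rule mon N \<open>surj c\<close>)+
    show "profinite_group (Gal_KP \<kappa> L C) (Gal_KP_topology \<kappa> L C N)"
      by (rule Gal_profinite[OF min A'[unfolded cond_A'_def G_def X_def act_def]])
  qed
  show ?thesis using DC CS BS B_any BA AA' A'A'' by blast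
qed

end
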